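(* Let $\mathcal{A}$ be a finite von Neumann algebra and $\mathcal{U}$ its algebra of affiliated operators. There is a one-to-one correspondence between Goldie closed ideals of $\mathcal{A}$ and direct summands of $\mathcal{U}$ given by $I\mapsto\mathcal{U}\otimes_{\mathcal{A}}I=E(I)$. The inverse map is given by $L\mapsto L\cap\mathcal{A}$. This correspondence induces an isomorphism of monoids $\mu:\mathrm{Proj}(\mathcal{A})\to\mathrm{Proj}(\mathcal{U})$ and an isomorphism $\mu:K_0(\mathcal{A})\to K_0(\mathcal{U})$ given by $[P]\mapsto[\mathcal{U}\otimes_{\mathcal{A}}P]$, with the inverse $[Q]\mapsto[Q\cap\mathcal{A}^n]$ if $Q$ is a direct summand of $\mathcal{U}^n$.
   Context: A von Neumann algebra is finite if it has a normal faithful trace $\mathrm{tr}_{\mathcal{A}}$; such a trace is fixed. $\mathcal{U}$ is the algebra of operators affiliated to $\mathcal{A}$, i.e. the closed densely defined operators on $l^2(\mathcal{A})$ (the Hilbert space completion of $\mathcal{A}$ for $\langle a,b\rangle=\mathrm{tr}_{\mathcal{A}}(ab^* )$) commuting with the commutant of $\mathcal{A}$; it contains $\mathcal{A}$ and equals the classical ring of quotients of the Ore ring $\mathcal{A}$, and also the injective envelope $E(\mathcal{A})$ of $\mathcal{A}$. Modules and ideals are left modules and left ideals. The Goldie torsion theory is the torsion theory whose torsion-free modules are the nonsingular modules; an ideal $I$ of $\mathcal{A}$ is Goldie closed if it equals its Goldie closure in $\mathcal{A}$, i.e. if the Goldie torsion submodule of $\mathcal{A}/I$ is zero (equivalently $\mathcal{A}/I$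 is nonsingular). $E(I)$ denotes the injective envelope of $I$, and $\mathcal{U}\otimes_{\mathcal{A}}I$ is identified with its copy in $\mathcal{U}=\mathcal{U}\otimes_{\mathcal{A}}\mathcal{A}$ ($\mathcal{U}$ is $\mathcal{A}$-flat). Direct summands of $\mathcal{U}=E(\mathcal{A})$ are taken as left modules. $\mathrm{Proj}(R)$ is the monoid (under direct sum) of isomorphism classes of finitely generated projective $R$-modules, and $\mathcal{A}^n\subseteq\mathcal{U}^n$ via $\mathcal{A}\subseteq\mathcal{U}$. *)

theory Defs
  imports
    "HOL-Analysis.Elementary_Topology"
    "HOL-Analysis.Inner_Product"
    "HOL-Analysis.Product_Vector"
    "HOL-Library.Nonpos_Ints"
    "HOL-Algebra.AbelCoset"
    "HOL-Algebra.Module"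
    "HOL-Algebra.Free_Abelian_Groups"
    "HOL-Algebra.Generated_Groups"
begin

section \<open>Complex Hilbert spaces and bounded operators\<close>

text \<open>The complex inner product is linear in its first argument; its real part is the real
  inner product of the library, so norm, topology and completeness are the library notions.\<close>

class complex_hilbert_space = real_inner + complete_space +
  fixes scaleC :: "complex \<Rightarrow> 'a \<Rightarrow> 'a"
    and cinner :: "'a \<Rightarrow> 'a \<Rightarrow> complex"
  assumes scaleC_add_right: "scaleC c (x + y) = scaleC c x + scaleC c y"
    and scaleC_add_left: "scaleC (c + d) x = scaleC c x + scaleC d x"
    and scaleC_scaleC: "scaleC c (scaleC d x) = scaleC (c * d) x"
    and scaleR_scaleC: "scaleR r x = scaleC (complex_of_real r) x"
    and cinner_commute: "cinner x y = cnj (cinner y x)"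
    and cinner_add_left: "cinner (x + y) z = cinner x z + cinner y z"
    and cinner_scaleC_left: "cinner (scaleC c x) y = c * cinner x y"
    and inner_cinner: "inner x y = Re (cinner x y)"

definition bounded_clinear :: "('h::complex_hilbert_space \<Rightarrow> 'h) \<Rightarrow> bool" where
  "bounded_clinear T \<longleftrightarrow> bounded_linear T \<and> (\<forall>c x. T (scaleC c x) = scaleC c (T x))"

definition cadjoint :: "('h::complex_hilbert_space \<Rightarrow> 'h) \<Rightarrow> 'h \<Rightarrow> 'h" where
  "cadjoint T = (THE S. bounded_clinear S \<and> (\<forall>x y. cinner (T x) y = cinner x (S y)))"

definition commutant :: "('h::complex_hilbert_space \<Rightarrow> 'h) set \<Rightarrow> ('h \<Rightarrow> 'h) set" where
  "commutant X = {T. bounded_clinear T \<and> (\<forall>S\<in>X. T \<circ> S = S \<circ> T)}"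

definition self_adjoint :: "('h::complex_hilbert_space \<Rightarrow> 'h) \<Rightarrow> bool" where
  "self_adjoint T \<longleftrightarrow> cadjoint T = T"

definition op_le :: "('h::complex_hilbert_space \<Rightarrow> 'h) \<Rightarrow> ('h \<Rightarrow> 'h) \<Rightarrow> bool" where
  "op_le S T \<longleftrightarrow> (\<forall>x. cinner (T x - S x) x \<in> \<real>\<^sub>\<ge>\<^sub>0)"


section \<open>Finite von Neumann algebras\<close>

text \<open>A von Neumann algebra is a *-closed set of bounded operators equal to its double
  commutant; being a commutant it is automatically a unital complex subalgebra.\<close>

definition von_neumann_algebra :: "('h::complex_hilbert_space \<Rightarrow> 'h) set \<Rightarrow> bool" where
  "von_neumann_algebra A \<longleftrightarrow>
     (\<forall>a\<in>A. bounded_clinear a \<and> cadjoint a \<in> A) \<and> commutant (commutant A) = A"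

definition trace_on :: "('h::complex_hilbert_space \<Rightarrow> 'h) set \<Rightarrow> (('h \<Rightarrow> 'h) \<Rightarrow> complex) \<Rightarrow> bool" where
  "trace_on A tr \<longleftrightarrow>
     (\<forall>a\<in>A. \<forall>b\<in>A. tr (\<lambda>x. a x + b x) = tr a + tr b) \<and>
     (\<forall>c. \<forall>a\<in>A. tr (\<lambda>x. scaleC c (a x)) = c * tr a) \<and>
     (\<forall>a\<in>A. tr (cadjoint a \<circ> a) \<in> \<real>\<^sub>\<ge>\<^sub>0) \<and>
     (\<forall>a\<in>A. \<forall>b\<in>A. tr (a \<circ> b) = tr (b \<circ> a))"

definition faithful_on :: "('h::complex_hilbert_space \<Rightarrow> 'h) set \<Rightarrow> (('h \<Rightarrow> 'h) \<Rightarrow> complex) \<Rightarrow> bool" where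
  "faithful_on A tr \<longleftrightarrow> (\<forall>a\<in>A. tr (cadjoint a \<circ> a) = 0 \<longrightarrow> a = (\<lambda>_. 0))"

text \<open>Normality: the functional preserves suprema of upward directed sets of self-adjoint
  elements (for the operator order).\<close>

definition is_sa_sup ::
    "('h::complex_hilbert_space \<Rightarrow> 'h) set \<Rightarrow> ('h \<Rightarrow> 'h) set \<Rightarrow> ('h \<Rightarrow> 'h) \<Rightarrow> bool" where
  "is_sa_sup A D s \<longleftrightarrow> s \<in> A \<and> self_adjoint s \<and> (\<forall>d\<in>D. op_le d s) \<and>
     (\<forall>t\<in>A. self_adjoint t \<and> (\<forall>d\<in>D. op_le d t) \<longrightarrow> op_le s t)"

definition normal_on :: "('h::complex_hilbert_space \<Rightarrow> 'h) set \<Rightarrow> (('h \<Rightarrow> 'h) \<Rightarrow> complex) \<Rightarrow> bool" where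
  "normal_on A tr \<longleftrightarrow>
     (\<forall>D s. D \<noteq> {} \<and> D \<subseteq> A \<and> (\<forall>d\<in>D. self_adjoint d) \<and>
        (\<forall>d\<in>D. \<forall>e\<in>D. \<exists>f\<in>D. op_le d f \<and> op_le e f) \<and> is_sa_sup A D s \<longrightarrow>
        Re (tr s) = (SUP d\<in>D. Re (tr d)))"

definition finite_von_neumann_algebra ::
    "('h::complex_hilbert_space \<Rightarrow> 'h) set \<Rightarrow> (('h \<Rightarrow> 'h) \<Rightarrow> complex) \<Rightarrow> bool" where
  "finite_von_neumann_algebra A tr \<longleftrightarrow>
     von_neumann_algebra A \<and> trace_on A tr \<and> normal_on A tr \<and> faithful_on A tr"

definition vn_ring :: "('h::complex_hilbert_space \<Rightarrow> 'h) set \<Rightarrow> ('h \<Rightarrow> 'h) ring" where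
  "vn_ring A = \<lparr>carrier = A, monoid.mult = (\<circ>), one = id,
     ring.zero = (\<lambda>_. 0), ring.add = (\<lambda>a b x. a x + b x)\<rparr>"


section \<open>The space of square-integrable elements and the affiliated operators\<close>

text \<open>A Hilbert space 'k together with \<open>\<Lambda>\<close> is a completion of A for
  \<open>\<langle>a, b\<rangle> = tr (a b*)\<close>; it is unique up to unitary equivalence.\<close>

definition l2_completion ::
    "('h::complex_hilbert_space \<Rightarrow> 'h) set \<Rightarrow> (('h \<Rightarrow> 'h) \<Rightarrow> complex) \<Rightarrow>
     (('h \<Rightarrow> 'h) \<Rightarrow> 'k::complex_hilbert_space) \<Rightarrow> bool" where
  "l2_completion A tr \<Lambda> \<longleftrightarrow>
     (\<forall>a\<in>A. \<forall>b\<in>A. \<Lambda> (\<lambda>x. a x + b x) = \<Lambda> a + \<Lambda> b) \<and>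
     (\<forall>c. \<forall>a\<in>A. \<Lambda> (\<lambda>x. scaleC c (a x)) = scaleC c (\<Lambda> a)) \<and>
     (\<forall>a\<in>A. \<forall>b\<in>A. cinner (\<Lambda> a) (\<Lambda> b) = tr (a \<circ> cadjoint b)) \<and>
     closure (\<Lambda> ` A) = UNIV"

text \<open>The action of A on its completion extending left multiplication.\<close>

definition left_mult ::
    "('h::complex_hilbert_space \<Rightarrow> 'h) set \<Rightarrow> (('h \<Rightarrow> 'h) \<Rightarrow> 'k::complex_hilbert_space) \<Rightarrow>
     ('h \<Rightarrow> 'h) \<Rightarrow> 'k \<Rightarrow> 'k" where
  "left_mult A \<Lambda> a = (THE T. bounded_clinear T \<and> (\<forall>b\<in>A. T (\<Lambda> b) = \<Lambda> (a \<circ> b)))"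

text \<open>An unbounded operator is represented by its graph.\<close>

definition op_graph :: "('k \<Rightarrow> 'k) \<Rightarrow> ('k \<times> 'k) set" where
  "op_graph T = {(x, T x) | x. True}"

definition closed_densely_defined :: "('k::complex_hilbert_space \<times> 'k) set \<Rightarrow> bool" where
  "closed_densely_defined T \<longleftrightarrow>
     (0, 0) \<in> T \<and>
     (\<forall>x y x' y'. (x, y) \<in> T \<and> (x', y') \<in> T \<longrightarrow> (x + x', y + y') \<in> T) \<and>
     (\<forall>c x y. (x, y) \<in> T \<longrightarrow> (scaleC c x, scaleC c y) \<in> T) \<and>
     single_valued T \<and> closed T \<and> closure (Domain T) = UNIV"

text \<open>An unbounded operator T commutes with a bounded S if \<open>S T\<close> is a restriction of \<open>T S\<close>.\<close>

definition affiliated ::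
    "('h::complex_hilbert_space \<Rightarrow> 'h) set \<Rightarrow> (('h \<Rightarrow> 'h) \<Rightarrow> 'k::complex_hilbert_space) \<Rightarrow>
     ('k \<times> 'k) set set" where
  "affiliated A \<Lambda> = {T. closed_densely_defined T \<and>
     (\<forall>S\<in>commutant (left_mult A \<Lambda> ` A). \<forall>(x, y)\<in>T. (S x, S y) \<in> T)}"

text \<open>Sum and product are the closures of the sum and the composition on the natural domains.\<close>

definition affiliated_ring ::
    "('h::complex_hilbert_space \<Rightarrow> 'h) set \<Rightarrow> (('h \<Rightarrow> 'h) \<Rightarrow> 'k::complex_hilbert_space) \<Rightarrow>
     ('k \<times> 'k) set ring" where
  "affiliated_ring A \<Lambda> = \<lparr>carrier = affiliated A \<Lambda>,
     monoid.mult = (\<lambda>S T. closure {(x, z). \<exists>y. (x, y) \<in> T \<and> (y, z) \<in> S}),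
     one = op_graph id,
     ring.zero = op_graph (\<lambda>_. 0),
     ring.add = (\<lambda>S T. closure {(x, y + z) | x y z. (x, y) \<in> S \<and> (x, z) \<in> T})\<rparr>"

definition vn_incl ::
    "('h::complex_hilbert_space \<Rightarrow> 'h) set \<Rightarrow> (('h \<Rightarrow> 'h) \<Rightarrow> 'k::complex_hilbert_space) \<Rightarrow>
     ('h \<Rightarrow> 'h) \<Rightarrow> ('k \<times> 'k) set" where
  "vn_incl A \<Lambda> a = op_graph (left_mult A \<Lambda> a)"


section \<open>Left modules over a ring\<close>

text \<open>\<^locale>\<open>module\<close> requires a commutative ring; the record type and \<^locale>\<open>submodule\<close> do not.\<close>

locale left_module = R?: ring R + M?: abelian_group M
  for R (structure) and M (structure) +
  assumes smult_closed:
      "\<lbrakk>r \<in> carrier R; x \<in> carrier M\<rbrakk> \<Longrightarrow> r \<odot>\<^bsub>M\<^esub> x \<in> carrier M"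
    and smult_l_distr:
      "\<lbrakk>r \<in> carrier R; s \<in> carrier R; x \<in> carrier M\<rbrakk> \<Longrightarrow>
         (r \<oplus>\<^bsub>R\<^esub> s) \<odot>\<^bsub>M\<^esub> x = r \<odot>\<^bsub>M\<^esub> x \<oplus>\<^bsub>M\<^esub> s \<odot>\<^bsub>M\<^esub> x"
    and smult_r_distr:
      "\<lbrakk>r \<in> carrier R; x \<in> carrier M; y \<in> carrier M\<rbrakk> \<Longrightarrow>
         r \<odot>\<^bsub>M\<^esub> (x \<oplus>\<^bsub>M\<^esub> y) = r \<odot>\<^bsub>M\<^esub> x \<oplus>\<^bsub>M\<^esub> r \<odot>\<^bsub>M\<^esub> y"
    and smult_assoc:
      "\<lbrakk>r \<in> carrier R; s \<in> carrier R; x \<in> carrier M\<rbrakk> \<Longrightarrow>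
         (r \<otimes>\<^bsub>R\<^esub> s) \<odot>\<^bsub>M\<^esub> x = r \<odot>\<^bsub>M\<^esub> (s \<odot>\<^bsub>M\<^esub> x)"
    and smult_one: "x \<in> carrier M \<Longrightarrow> \<one>\<^bsub>R\<^esub> \<odot>\<^bsub>M\<^esub> x = x"

text \<open>The multiplicative fields of a module record play no role.\<close>

definition regular_module :: "('r, 'b) ring_scheme \<Rightarrow> ('r, 'r) module" where
  "regular_module R = \<lparr>carrier = carrier R, monoid.mult = undefined, one = undefined,
     ring.zero = \<zero>\<^bsub>R\<^esub>, ring.add = ring.add R, module.smult = monoid.mult R\<rparr>"

abbreviation left_ideal :: "('r, 'b) ring_scheme \<Rightarrow> 'r set \<Rightarrow> bool" where
  "left_ideal R I \<equiv> submodule I R (regular_module R)"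

abbreviation restr :: "('r, 'm, 'c) module_scheme \<Rightarrow> 'm set \<Rightarrow> ('r, 'm, 'c) module_scheme" where
  "restr M N \<equiv> M\<lparr>carrier := N\<rparr>"

definition restrict_scalars ::
    "('r \<Rightarrow> 's) \<Rightarrow> ('s, 'm) module \<Rightarrow> ('r, 'm) module" where
  "restrict_scalars \<phi> M = \<lparr>carrier = carrier M, monoid.mult = undefined, one = undefined,
     ring.zero = \<zero>\<^bsub>M\<^esub>, ring.add = ring.add M, module.smult = (\<lambda>r x. \<phi> r \<odot>\<^bsub>M\<^esub> x)\<rparr>"

definition left_module_hom ::
    "('r, 'b) ring_scheme \<Rightarrow> ('r, 'm, 'c) module_scheme \<Rightarrow> ('r, 'n, 'd) module_scheme \<Rightarrow>
     ('m \<Rightarrow> 'n) set" where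
  "left_module_hom R M N = {f \<in> carrier M \<rightarrow> carrier N.
     (\<forall>x\<in>carrier M. \<forall>y\<in>carrier M. f (x \<oplus>\<^bsub>M\<^esub> y) = f x \<oplus>\<^bsub>N\<^esub> f y) \<and>
     (\<forall>r\<in>carrier R. \<forall>x\<in>carrier M. f (r \<odot>\<^bsub>M\<^esub> x) = r \<odot>\<^bsub>N\<^esub> f x)}"

definition module_isomorphic ::
    "('r, 'b) ring_scheme \<Rightarrow> ('r, 'm, 'c) module_scheme \<Rightarrow> ('r, 'n, 'd) module_scheme \<Rightarrow> bool" where
  "module_isomorphic R M N \<longleftrightarrow>
     (\<exists>f\<in>left_module_hom R M N. bij_betw f (carrier M) (carrier N))"

definition quotient_module :: "('r, 'm, 'c) module_scheme \<Rightarrow> 'm set \<Rightarrow> ('r, 'm set) module" where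
  "quotient_module M N = \<lparr>carrier = a_rcosets\<^bsub>M\<^esub> N, monoid.mult = undefined, one = undefined,
     ring.zero = N, ring.add = set_add M, module.smult = (\<lambda>r X. \<Union>x\<in>X. N +>\<^bsub>M\<^esub> (r \<odot>\<^bsub>M\<^esub> x))\<rparr>"

definition direct_sum ::
    "('r, 'm, 'c) module_scheme \<Rightarrow> ('r, 'n, 'd) module_scheme \<Rightarrow> ('r, 'm \<times> 'n) module" where
  "direct_sum M N = \<lparr>carrier = carrier M \<times> carrier N, monoid.mult = undefined, one = undefined,
     ring.zero = (\<zero>\<^bsub>M\<^esub>, \<zero>\<^bsub>N\<^esub>),
     ring.add = (\<lambda>(x, y) (x', y'). (x \<oplus>\<^bsub>M\<^esub> x', y \<oplus>\<^bsub>N\<^esub> y')),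
     module.smult = (\<lambda>r (x, y). (r \<odot>\<^bsub>M\<^esub> x, r \<odot>\<^bsub>N\<^esub> y))\<rparr>"

definition free_module :: "('r, 'b) ring_scheme \<Rightarrow> nat \<Rightarrow> ('r, nat \<Rightarrow> 'r) module" where
  "free_module R n = \<lparr>carrier = {..<n} \<rightarrow>\<^sub>E carrier R, monoid.mult = undefined, one = undefined,
     ring.zero = (\<lambda>i\<in>{..<n}. \<zero>\<^bsub>R\<^esub>),
     ring.add = (\<lambda>v w. \<lambda>i\<in>{..<n}. v i \<oplus>\<^bsub>R\<^esub> w i),
     module.smult = (\<lambda>r v. \<lambda>i\<in>{..<n}. r \<otimes>\<^bsub>R\<^esub> v i)\<rparr>"

definition direct_summand ::
    "('r, 'b) ring_scheme \<Rightarrow> ('r, 'm, 'c) module_scheme \<Rightarrow> 'm set \<Rightarrow> bool" where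
  "direct_summand R M L \<longleftrightarrow> submodule L R M \<and>
     (\<exists>L'. submodule L' R M \<and> L \<inter> L' = {\<zero>\<^bsub>M\<^esub>} \<and> L <+>\<^bsub>M\<^esub> L' = carrier M)"

definition essential_submodule ::
    "('r, 'b) ring_scheme \<Rightarrow> ('r, 'm, 'c) module_scheme \<Rightarrow> 'm set \<Rightarrow> bool" where
  "essential_submodule R M N \<longleftrightarrow> submodule N R M \<and>
     (\<forall>K. submodule K R M \<and> K \<noteq> {\<zero>\<^bsub>M\<^esub>} \<longrightarrow> N \<inter> K \<noteq> {\<zero>\<^bsub>M\<^esub>})"


section \<open>The Goldie torsion theory\<close>

definition annihilator ::
    "('r, 'b) ring_scheme \<Rightarrow> ('r, 'm, 'c) module_scheme \<Rightarrow> 'm \<Rightarrow> 'r set" where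
  "annihilator R M x = {r \<in> carrier R. r \<odot>\<^bsub>M\<^esub> x = \<zero>\<^bsub>M\<^esub>}"

definition singular_submodule ::
    "('r, 'b) ring_scheme \<Rightarrow> ('r, 'm, 'c) module_scheme \<Rightarrow> 'm set" where
  "singular_submodule R M =
     {x \<in> carrier M. essential_submodule R (regular_module R) (annihilator R M x)}"

definition nonsingular_module ::
    "('r, 'b) ring_scheme \<Rightarrow> ('r, 'm, 'c) module_scheme \<Rightarrow> bool" where
  "nonsingular_module R M \<longleftrightarrow> left_module R M \<and> singular_submodule R M = {\<zero>\<^bsub>M\<^esub>}"

text \<open>Torsion modules are those without nonzero homomorphisms to a torsion-free module. It is
  enough to test on modules F carried by the type 'm set: submodules of torsion-free modules are
  torsion-free, and the image of T in any module is isomorphic to a quotient of T.\<close>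

definition goldie_torsion ::
    "('r, 'b) ring_scheme \<Rightarrow> ('r, 'm, 'c) module_scheme \<Rightarrow> bool" where
  "goldie_torsion R T \<longleftrightarrow> left_module R T \<and>
     (\<forall>F :: ('r, 'm set) module. nonsingular_module R F \<longrightarrow>
        (\<forall>f\<in>left_module_hom R T F. \<forall>x\<in>carrier T. f x = \<zero>\<^bsub>F\<^esub>))"

text \<open>The union is the largest torsion submodule, since a sum of torsion submodules is torsion.\<close>

definition goldie_torsion_submodule ::
    "('r, 'b) ring_scheme \<Rightarrow> ('r, 'm, 'c) module_scheme \<Rightarrow> 'm set" where
  "goldie_torsion_submodule R M = \<Union>{T. submodule T R M \<and> goldie_torsion R (restr M T)}"

definition goldie_closure ::
    "('r, 'b) ring_scheme \<Rightarrow> ('r, 'm, 'c) module_scheme \<Rightarrow> 'm set \<Rightarrow> 'm set" where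
  "goldie_closure R M N =
     {x \<in> carrier M. N +>\<^bsub>M\<^esub> x \<in> goldie_torsion_submodule R (quotient_module M N)}"

definition goldie_closed_ideals :: "('r, 'b) ring_scheme \<Rightarrow> 'r set set" where
  "goldie_closed_ideals R = {I. left_ideal R I \<and> goldie_closure R (regular_module R) I = I}"


section \<open>Injective envelopes\<close>

text \<open>Injectivity is relative to the modules carried by an arbitrary type 'p; a statement in which
  'p is a free type variable expresses injectivity without restriction.\<close>

definition injective_module ::
    "'p itself \<Rightarrow> ('r, 'b) ring_scheme \<Rightarrow> ('r, 'm, 'c) module_scheme \<Rightarrow> bool" where
  "injective_module TYPE('p) R E \<longleftrightarrow> left_module R E \<and>
     (\<forall>(P :: ('r, 'p) module) N. left_module R P \<and> submodule N R P \<longrightarrow>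
        (\<forall>f\<in>left_module_hom R (restr P N) E. \<exists>g\<in>left_module_hom R P E. \<forall>x\<in>N. g x = f x))"

text \<open>E, with the embedding j, is an injective envelope of M.\<close>

definition injective_envelope ::
    "'p itself \<Rightarrow> ('r, 'b) ring_scheme \<Rightarrow> ('r, 'm, 'c) module_scheme \<Rightarrow> ('m \<Rightarrow> 'e) \<Rightarrow>
     ('r, 'e, 'd) module_scheme \<Rightarrow> bool" where
  "injective_envelope TYPE('p) R M j E \<longleftrightarrow> left_module R M \<and> injective_module TYPE('p) R E \<and>
     j \<in> left_module_hom R M E \<and> inj_on j (carrier M) \<and>
     essential_submodule R E (j ` carrier M)"


section \<open>Tensor products\<close>

text \<open>For a ring homomorphism \<open>\<phi>\<close> from R to S and a left R-module M, the left S-module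
  \<open>S \<otimes>\<^sub>R M\<close> is the free abelian group on \<open>S \<times> M\<close> modulo the usual relations.\<close>

abbreviation tensor_free ::
    "('s, 'b) ring_scheme \<Rightarrow> ('r, 'm, 'c) module_scheme \<Rightarrow> ('s \<times> 'm \<Rightarrow>\<^sub>0 int) monoid" where
  "tensor_free S M \<equiv> free_Abelian_group (carrier S \<times> carrier M)"

definition tensor_relations ::
    "('r, 'a) ring_scheme \<Rightarrow> ('s, 'b) ring_scheme \<Rightarrow> ('r \<Rightarrow> 's) \<Rightarrow>
     ('r, 'm, 'c) module_scheme \<Rightarrow> ('s \<times> 'm \<Rightarrow>\<^sub>0 int) set" where
  "tensor_relations R S \<phi> M =
     {frag_of (s \<oplus>\<^bsub>S\<^esub> t, x) - frag_of (s, x) - frag_of (t, x) | s t x.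
        s \<in> carrier S \<and> t \<in> carrier S \<and> x \<in> carrier M} \<union>
     {frag_of (s, x \<oplus>\<^bsub>M\<^esub> y) - frag_of (s, x) - frag_of (s, y) | s x y.
        s \<in> carrier S \<and> x \<in> carrier M \<and> y \<in> carrier M} \<union>
     {frag_of (s \<otimes>\<^bsub>S\<^esub> \<phi> r, x) - frag_of (s, r \<odot>\<^bsub>M\<^esub> x) | s r x.
        s \<in> carrier S \<and> r \<in> carrier R \<and> x \<in> carrier M}"

definition tensor_kernel ::
    "('r, 'a) ring_scheme \<Rightarrow> ('s, 'b) ring_scheme \<Rightarrow> ('r \<Rightarrow> 's) \<Rightarrow>
     ('r, 'm, 'c) module_scheme \<Rightarrow> ('s \<times> 'm \<Rightarrow>\<^sub>0 int) set" where
  "tensor_kernel R S \<phi> M = generate (tensor_free S M) (tensor_relations R S \<phi> M)"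

definition base_change ::
    "('r, 'a) ring_scheme \<Rightarrow> ('s, 'b) ring_scheme \<Rightarrow> ('r \<Rightarrow> 's) \<Rightarrow>
     ('r, 'm, 'c) module_scheme \<Rightarrow> ('s, ('s \<times> 'm \<Rightarrow>\<^sub>0 int) set) module" where
  "base_change R S \<phi> M = \<lparr>
     carrier = rcosets\<^bsub>tensor_free S M\<^esub> (tensor_kernel R S \<phi> M),
     monoid.mult = undefined, one = undefined,
     ring.zero = tensor_kernel R S \<phi> M,
     ring.add = set_mult (tensor_free S M),
     module.smult = (\<lambda>s X. \<Union>c\<in>X. tensor_kernel R S \<phi> M
        #>\<^bsub>tensor_free S M\<^esub> frag_extend (\<lambda>(t, x). frag_of (s \<otimes>\<^bsub>S\<^esub> t, x)) c)\<rparr>"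

text \<open>The canonical map \<open>S \<otimes>\<^sub>R I \<rightarrow> S \<otimes>\<^sub>R R = S\<close>, \<open>s \<otimes> x \<mapsto> s \<phi>(x)\<close>, and its image.\<close>

definition tensor_to_ring ::
    "('s, 'b) ring_scheme \<Rightarrow> ('r \<Rightarrow> 's) \<Rightarrow> ('s \<times> 'r \<Rightarrow>\<^sub>0 int) set \<Rightarrow> 's" where
  "tensor_to_ring S \<phi> X = the_elem ((\<lambda>c. finsum S
      (\<lambda>(s, x). add_pow S (Poly_Mapping.lookup c (s, x)) (s \<otimes>\<^bsub>S\<^esub> \<phi> x))
      (Poly_Mapping.keys c)) ` X)"

abbreviation ideal_tensor ::
    "('r, 'a) ring_scheme \<Rightarrow> ('s, 'b) ring_scheme \<Rightarrow> ('r \<Rightarrow> 's) \<Rightarrow> 'r set \<Rightarrow>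
     ('s, ('s \<times> 'r \<Rightarrow>\<^sub>0 int) set) module" where
  "ideal_tensor R S \<phi> I \<equiv> base_change R S \<phi> (restr (regular_module R) I)"

definition extended_ideal ::
    "('r, 'a) ring_scheme \<Rightarrow> ('s, 'b) ring_scheme \<Rightarrow> ('r \<Rightarrow> 's) \<Rightarrow> 'r set \<Rightarrow> 's set" where
  "extended_ideal R S \<phi> I = tensor_to_ring S \<phi> ` carrier (ideal_tensor R S \<phi> I)"


section \<open>Finitely generated projective modules and \<open>K\<^sub>0\<close>\<close>

definition finitely_generated ::
    "('r, 'b) ring_scheme \<Rightarrow> ('r, 'm, 'c) module_scheme \<Rightarrow> bool" where
  "finitely_generated R M \<longleftrightarrow> (\<exists>X. finite X \<and> X \<subseteq> carrier M \<and>
     (\<forall>N. submodule N R M \<and> X \<subseteq> N \<longrightarrow> N = carrier M))"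

text \<open>The type \<^typ>\<open>nat \<Rightarrow> 'r\<close> carries a copy of every finitely generated R-module (a quotient of
  some \<open>R\<^sup>n\<close>), so for a finitely generated P it suffices to test the lifting property on
  modules carried by this type.\<close>

definition fg_projective ::
    "('r, 'b) ring_scheme \<Rightarrow> ('r, 'm, 'c) module_scheme \<Rightarrow> bool" where
  "fg_projective R P \<longleftrightarrow> left_module R P \<and> finitely_generated R P \<and>
     (\<forall>(M :: ('r, nat \<Rightarrow> 'r) module) (N :: ('r, nat \<Rightarrow> 'r) module) g f.
        left_module R M \<and> left_module R N \<and>
        g \<in> left_module_hom R M N \<and> g ` carrier M = carrier N \<and> f \<in> left_module_hom R P N \<longrightarrow>
        (\<exists>h\<in>left_module_hom R P M. \<forall>x\<in>carrier P. g (h x) = f x))"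

text \<open>Isomorphism classes are formed within the modules carried by \<^typ>\<open>nat \<Rightarrow> 'r\<close>; the class of a
  finitely generated projective module on any other type is nonempty.\<close>

definition iso_class ::
    "('r, 'b) ring_scheme \<Rightarrow> ('r, 'm, 'c) module_scheme \<Rightarrow> ('r, nat \<Rightarrow> 'r) module set" where
  "iso_class R P = {P'. fg_projective R P' \<and> module_isomorphic R P P'}"

definition Proj :: "('r, 'b) ring_scheme \<Rightarrow> ('r, nat \<Rightarrow> 'r) module set monoid" where
  "Proj R = \<lparr>carrier = {iso_class R P | P :: ('r, nat \<Rightarrow> 'r) module. fg_projective R P},
     monoid.mult = (\<lambda>X Y. \<Union>P\<in>X. \<Union>Q\<in>Y. iso_class R (direct_sum P Q)),
     one = iso_class R (free_module R 0)\<rparr>"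

definition groth_rel :: "('a, 'b) monoid_scheme \<Rightarrow> (('a \<times> 'a) \<times> ('a \<times> 'a)) set" where
  "groth_rel G = {((a, b), (c, d)). a \<in> carrier G \<and> b \<in> carrier G \<and> c \<in> carrier G \<and> d \<in> carrier G \<and>
     (\<exists>e\<in>carrier G. a \<otimes>\<^bsub>G\<^esub> d \<otimes>\<^bsub>G\<^esub> e = c \<otimes>\<^bsub>G\<^esub> b \<otimes>\<^bsub>G\<^esub> e)}"

text \<open>The Grothendieck group of a commutative monoid; the class of \<open>(a, b)\<close> is \<open>[a] - [b]\<close>.\<close>

definition grothendieck_group :: "('a, 'b) monoid_scheme \<Rightarrow> ('a \<times> 'a) set monoid" where
  "grothendieck_group G = \<lparr>carrier = (carrier G \<times> carrier G) // groth_rel G,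
     monoid.mult = (\<lambda>X Y. \<Union>(a, b)\<in>X. \<Union>(c, d)\<in>Y. groth_rel G `` {(a \<otimes>\<^bsub>G\<^esub> c, b \<otimes>\<^bsub>G\<^esub> d)}),
     one = groth_rel G `` {(\<one>\<^bsub>G\<^esub>, \<one>\<^bsub>G\<^esub>)}\<rparr>"

definition groth_map ::
    "('b, 'd) monoid_scheme \<Rightarrow> ('a \<Rightarrow> 'b) \<Rightarrow> ('a \<times> 'a) set \<Rightarrow> ('b \<times> 'b) set" where
  "groth_map H f X = (\<Union>(a, b)\<in>X. groth_rel H `` {(f a, f b)})"

definition K0 :: "('r, 'b) ring_scheme \<Rightarrow> (('r, nat \<Rightarrow> 'r) module set \<times> ('r, nat \<Rightarrow> 'r) module set) set monoid"
  where "K0 R = grothendieck_group (Proj R)"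

definition K0_class ::
    "('r, 'b) ring_scheme \<Rightarrow> ('r, 'm, 'c) module_scheme \<Rightarrow>
     (('r, nat \<Rightarrow> 'r) module set \<times> ('r, nat \<Rightarrow> 'r) module set) set" where
  "K0_class R P = groth_rel (Proj R) `` {(iso_class R P, \<one>\<^bsub>Proj R\<^esub>)}"

definition Proj_map ::
    "('r, 'a) ring_scheme \<Rightarrow> ('s, 'b) ring_scheme \<Rightarrow> ('r \<Rightarrow> 's) \<Rightarrow>
     ('r, nat \<Rightarrow> 'r) module set \<Rightarrow> ('s, nat \<Rightarrow> 's) module set" where
  "Proj_map R S \<phi> X = (\<Union>P\<in>X. iso_class S (base_change R S \<phi> P))"

definition K0_map ::
    "('r, 'a) ring_scheme \<Rightarrow> ('s, 'b) ring_scheme \<Rightarrow> ('r \<Rightarrow> 's) \<Rightarrow>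
     (('r, nat \<Rightarrow> 'r) module set \<times> ('r, nat \<Rightarrow> 'r) module set) set \<Rightarrow>
     (('s, nat \<Rightarrow> 's) module set \<times> ('s, nat \<Rightarrow> 's) module set) set" where
  "K0_map R S \<phi> = groth_map (Proj S) (Proj_map R S \<phi>)"

text \<open>\<open>Q \<inter> R\<^sup>n\<close> for a submodule Q of \<open>S\<^sup>n\<close>, where \<open>R\<^sup>n\<close> is embedded in \<open>S\<^sup>n\<close> by \<open>\<phi>\<close> on each
  coordinate.\<close>

definition contract ::
    "('r, 'a) ring_scheme \<Rightarrow> ('r \<Rightarrow> 's) \<Rightarrow> nat \<Rightarrow> (nat \<Rightarrow> 's) set \<Rightarrow> ('r, nat \<Rightarrow> 'r) module" where
  "contract R \<phi> n Q = restr (free_module R n)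
     {v \<in> carrier (free_module R n). (\<lambda>i\<in>{..<n}. \<phi> (v i)) \<in> Q}"

end

theory Submission
  imports Defs "HOL-Analysis.Elementary_Normed_Spaces"
begin

text \<open>The faithful normal trace gives a dimension function on the projections of \<open>A\<close>. It makes the
 regular representation on the completion a von Neumann algebra isomorphic to \<open>A\<close>, and lets domains of
 affiliated operators intersect densely, so that these form a ring \<open>U\<close>. Polar decomposition shows that
 \<open>U\<close> is an Ore localization of \<open>A\<close>, that finitely generated left ideals of \<open>A\<close> are principal, and that every
 annihilator is generated by an idempotent. Approximating a left ideal by its projections, with normality of
 the trace, shows that its Goldie closure is generated by an idempotent and that its homomorphisms to \<open>U\<close> are
 right multiplications, whence \<open>U\<close> is injective. The correspondences are then pure algebra: a summand of
 \<open>U\<close> is generated by an idempotent of \<open>A\<close>, and a finitely generated submodule of \<open>A\<^sup>n\<close> is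
 determined up to isomorphism by the submodule of \<open>U\<^sup>n\<close> it generates.\<close>

text \<open>No spectral theorem is assumed: the spectral subspace of \<open>a\<close> above a
  threshold \<open>\<delta>\<close> is the closed range of \<open>m + k\<close> with
  \<open>k = adj a a - \<delta>\<^sup>2\<close> and \<open>m\<close> the absolute value of
  \<open>k\<close>; all absolute values come from one iteration for square roots. On the analytic
  side the obstacle is that two Hilbert spaces occur. \<open>A\<close> acts on an arbitrary space,
  while \<open>affiliated\<close> refers to the commutant of the left multiplications on the
  completion; the dimension theory is needed on both, once to prove that the left multiplications
  equal their bicommutant and once for the operators affiliated with them. Hence the locale
  \<open>tracial\<close> with an abstract trace. On the algebraic side, left ideals of
  \<open>A\<close> need not be finitely generated, so a homomorphism from one is glued from its
  values on countably many projections of the ideal, normality controlling the error. For the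
  monoids the difficulty is to descend an isomorphism from \<open>U\<close> to \<open>A\<close>: of
  two finitely generated modules with the same span neither need contain the other; they are
  compared through right annihilators of cyclic generators, coordinate by coordinate.\<close>

abbreviation (input) "Hom \<equiv> left_module_hom"
abbreviation (input) "Reg \<equiv> regular_module"
abbreviation (input) "RS \<equiv> restrict_scalars"
abbreviation (input) "Free \<equiv> free_module"
abbreviation (input) "Isom \<equiv> module_isomorphic"
abbreviation (input) "Groth \<equiv> grothendieck_group"
abbreviation (input) "fgp \<equiv> fg_projective"
abbreviation (input) "BC \<equiv> base_change"
abbreviation (input) "DSum \<equiv> direct_sum"
abbreviation (input) "adj \<equiv> cadjoint"
abbreviation (input) "bclin \<equiv> bounded_clinear"
abbreviation (input) "gr \<equiv> op_graph"
abbreviation (input) "keys \<equiv> Poly_Mapping.keys"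
abbreviation (input) "lookup \<equiv> Poly_Mapping.lookup"
abbreviation (input) "lmod \<equiv> left_module"
abbreviation (input) "fin_gen \<equiv> finitely_generated"
abbreviation (input) "summand \<equiv> direct_summand"
abbreviation (input) converges ("(_)/ \<leadsto> (_)" [60, 60] 60)
 where "f \<leadsto> l \<equiv> f \<longlonglongrightarrow> l"

section \<open>Orthogonal projections and adjoints\<close>

abbreviation csub :: "'a::real_normed_vector set => bool" where "csub G \<equiv> closed G \<and> subspace G"

lemma convergent_if_dist_le:
 fixes X :: "nat => 'a::complete_space"
 assumes d: "\<And>m n. n \<le> m ==> dist (X m) (X n) \<le> f n" and f: "f \<leadsto> 0" shows "\<exists>l. X \<leadsto> l"
proof -
 have "Cauchy X"
 proof (rule metric_CauchyI)
  fix e :: real assume "0 < e"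
  then obtain M where "\<And>n. n \<ge> M ==> f n < e" using order_tendstoD(2)[OF f] unfolding eventually_sequentially by blast
  then have "dist (X m) (X n) < e" if "M \<le> n" "n \<le> m" for m n using d[OF that(2)] that(1) by (meson order_le_less_trans)
  then show "\<exists>M. \<forall>m\<ge>M. \<forall>n\<ge>M. dist (X m) (X n) < e" by (metis dist_commute nle_le)
 qed
 then show ?thesis by (simp add: convergent_eq_Cauchy)
qed

text \<open>The midpoint of two members of \<open>G\<close> is again in \<open>G\<close>, so the
  parallelogram law bounds the distance of two almost minimizing points by their defects; hence a
  minimizing sequence is Cauchy.\<close>

lemma nearest_point_exists:
 fixes G :: "'a::{real_inner,complete_space} set"
 assumes cG: "closed G" and sG: "subspace G" shows "\<exists>g\<in>G. \<forall>h\<in>G. (norm (x - g))\<^sup>2 \<le> (norm (x - h))\<^sup>2"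
proof -
 define d where "d = (INF g\<in>G. (norm (x - g))\<^sup>2)"
 have G0: "G \<noteq> {}" using sG by (auto dest: subspace_0)
 have bdd: "bdd_below ((\<lambda>g. (norm (x - g))\<^sup>2) ` G)" by (rule bdd_belowI[of _ 0]) auto
 have dle: "d \<le> (norm (x - h))\<^sup>2" if "h \<in> G" for h unfolding d_def by (rule cINF_lower[OF bdd that])
 have "\<exists>g\<in>G. (norm (x - g))\<^sup>2 < d + 1 / Suc n" for n using cINF_less_iff[OF G0 bdd, of "d + 1 / Suc n"] by (simp add: d_def)
 then obtain g where g: "\<And>n. g n \<in> G" "\<And>n. (norm (x - g n))\<^sup>2 < d + 1 / Suc n" by metis
 have par: "(norm (g m - g n))\<^sup>2 \<le> 2 / Suc m + 2 / Suc n" for m n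
 proof -
  have *: "(norm (g m - g n))\<^sup>2 = 2 * (norm (x - g m))\<^sup>2 + 2 * (norm (x - g n))\<^sup>2
    - 4 * (norm (x - (1/2) *\<^sub>R (g m + g n)))\<^sup>2"
   by (simp add: power2_norm_eq_inner inner_diff_right inner_add_left inner_add_right
     inner_commute field_simps)
  have "(1/2) *\<^sub>R (g m + g n) \<in> G" using sG g by (simp add: subspace_add subspace_scale)
  from dle[OF this] have "d \<le> (norm (x - (1/2) *\<^sub>R (g m + g n)))\<^sup>2" .
  moreover have "2 / Suc k = 2 * (1 / Suc k)" for k by simp
  ultimately show ?thesis using g(2)[of m] g(2)[of n] * by linarith
 qed
 have "\<exists>l. g \<leadsto> l"
 proof (rule convergent_if_dist_le)
  show "dist (g m) (g n) \<le> sqrt (4 * (1 / Suc n))" if "n \<le> m" for m n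
  proof -
   have "2 / Suc m \<le> 2 / Suc n" using that by (simp add: frac_le)
   then show ?thesis using par[of m n] by (intro real_le_rsqrt) (simp add: dist_norm)
  qed
  have "(\<lambda>n. sqrt (4 * (1 / Suc n))) \<leadsto> sqrt (4 * 0)" by (intro tendsto_intros LIMSEQ_Suc[OF lim_1_over_n])
  then show "(\<lambda>n. sqrt (4 * (1 / Suc n))) \<leadsto> 0" by simp
 qed
 then obtain l where l: "g \<leadsto> l" ..
 have "l \<in> G" using closed_sequentially[OF cG _ l] g by auto
 moreover have "(norm (x - l))\<^sup>2 \<le> d"
 proof (rule LIMSEQ_le)
  show "(\<lambda>n. (norm (x - g n))\<^sup>2) \<leadsto> (norm (x - l))\<^sup>2" by (intro tendsto_intros l)
  show "(\<lambda>n. d + 1 / Suc n) \<leadsto> d" using LIMSEQ_Suc[OF lim_1_over_n] by (auto intro: tendsto_eq_intros)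
  show "\<exists>N. \<forall>n\<ge>N. (norm (x - g n))\<^sup>2 \<le> d + 1 / Suc n" using g(2) less_imp_le by blast
 qed
 ultimately show ?thesis using dle by (meson order_trans)
qed

lemma projection_exists:
 fixes G :: "'a::{real_inner,complete_space} set"
 assumes "csub G" shows "\<exists>g\<in>G. \<forall>h\<in>G. inner (x - g) h = 0"
proof -
 from nearest_point_exists[of G x] assms obtain g
  where g: "g \<in> G" "\<And>h. h \<in> G ==> (norm (x - g))\<^sup>2 \<le> (norm (x - h))\<^sup>2" by metis
 have "inner (x - g) h = 0" if h: "h \<in> G" for h
 proof (cases "h = 0")
  case False
  \<comment> \<open>\<open>t\<close> minimizes the quadratic polynomial
    \<open>s \<mapsto> (norm (y - s *\<^sub>R h))\<^sup>2\<close>; if \<open>inner y h\<close> were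
    nonzero, \<open>g + t *\<^sub>R h\<close> would be closer to \<open>x\<close> than
    \<open>g\<close>.\<close>
  define y t where "y = x - g" and "t = inner y h / inner h h"
  have n: "inner h h > 0" using False by simp
  have "g + t *\<^sub>R h \<in> G" using assms g(1) h by (simp add: subspace_add subspace_scale)
  from g(2)[OF this] have "(norm y)\<^sup>2 \<le> (norm (y - t *\<^sub>R h))\<^sup>2" by (simp add: y_def algebra_simps)
  also have "\<dots> = (norm y)\<^sup>2 - 2 * t * inner y h + t * t * inner h h"
   by (simp add: power2_norm_eq_inner inner_diff_left inner_commute algebra_simps)
  also have "\<dots> = (norm y)\<^sup>2 - (inner y h)\<^sup>2 / inner h h" using n by (simp add: t_def power2_eq_square)
  finally have "(inner (x - g) h)\<^sup>2 \<le> 0" using n by (simp add: y_def divide_le_0_iff)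
  then show ?thesis by simp
 qed simp
 with g show ?thesis by blast
qed

text \<open>Orthogonality is meant for the real inner product. On subspaces closed under complex
  scalars this is the usual projection: its complex linearity is obtained by applying
  \<open>pr_commute\<close> to \<open>scaleC\<close>.\<close>

definition pr :: "'a::{real_inner,complete_space} set => 'a => 'a" where
 "pr G x = (SOME g. g \<in> G \<and> (\<forall>h\<in>G. inner (x - g) h = 0))"

lemma pr_in: "csub G ==> pr G x \<in> G" and pr_orth: "csub G ==> h \<in> G ==> inner (x - pr G x) h = 0"
 using someI_ex[OF projection_exists[of G x, unfolded Bex_def]] unfolding pr_def by auto

lemma pr_unique:
 assumes "csub G" "g \<in> G" "\<And>h. h \<in> G ==> inner (x - g) h = 0" shows "pr G x = g"
proof -
 have "pr G x - g \<in> G" using assms pr_in[of G x] by (simp add: subspace_diff)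
 then have "inner (x - g) (pr G x - g) - inner (x - pr G x) (pr G x - g) = 0" using assms(3) pr_orth[OF assms(1)] by simp
 then have "inner (pr G x - g) (pr G x - g) = 0" by (simp add: inner_diff_left)
 then show ?thesis by simp
qed

lemma pr_id: "csub G ==> x \<in> G ==> pr G x = x" by (rule pr_unique) auto

lemma pr_pr: "csub G ==> pr G (pr G x) = pr G x" by (simp add: pr_id pr_in)

lemma pr_id_iff: "csub G ==> pr G x = x \<longleftrightarrow> x \<in> G" using pr_id pr_in by metis

lemma pr_add: "csub G ==> pr G (x + y) = pr G x + pr G y"
proof (rule pr_unique)
 fix h assume G: "csub G" and h: "h \<in> G"
 show "inner (x + y - (pr G x + pr G y)) h = 0" using pr_orth[OF G h, of x] pr_orth[OF G h, of y] by (simp add: inner_diff_left inner_add_left)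
qed (auto simp: pr_in subspace_add)

lemma pr_scale: "csub G ==> pr G (r *\<^sub>R x) = r *\<^sub>R pr G x"
proof (rule pr_unique)
 fix h assume G: "csub G" and h: "h \<in> G"
 show "inner (r *\<^sub>R x - r *\<^sub>R pr G x) h = 0" using pr_orth[OF G h, of x] by (simp add: inner_diff_left)
qed (auto simp: pr_in subspace_scale)

lemma pr_inner_self: "csub G ==> inner (pr G x) x = (norm (pr G x))\<^sup>2" using pr_orth[of G "pr G x" x] pr_in[of G x]
 by (simp add: inner_diff_right power2_norm_eq_inner inner_commute)

lemma norm_pr_Pythagoras: "csub G ==> (norm x)\<^sup>2 = (norm (pr G x))\<^sup>2 + (norm (x - pr G x))\<^sup>2" using pr_inner_self[of G x]
 by (simp add: power2_norm_eq_inner inner_diff_right inner_commute)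

lemma norm_pr_le: "csub G ==> norm (pr G x) \<le> norm x"
 using norm_pr_Pythagoras[of G x] by (metis le_add_same_cancel1 norm_ge_zero power2_le_imp_le zero_le_power2)

lemma bounded_linear_pr: "csub G ==> bounded_linear (pr G)" by (rule bounded_linear_intro[where K=1]) (auto simp: pr_add pr_scale norm_pr_le)

lemma pr_diff: "csub G ==> pr G (x - y) = pr G x - pr G y" by (rule linear_simps(2)[OF bounded_linear_pr])

lemma pr_sym: "csub G ==> inner (pr G x) y = inner x (pr G y)" using pr_orth[of G "pr G x" y] pr_orth[of G "pr G y" x] pr_in[of G x] pr_in[of G y]
 by (simp add: inner_diff_right inner_commute)

lemma pr_zero_iff: "csub G ==> pr G x = 0 \<longleftrightarrow> (\<forall>g\<in>G. inner x g = 0)"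
 using pr_unique[of G 0 x] pr_orth[of G _ x] by (auto simp: subspace_0)

text \<open>\<open>S (x - pr G x)\<close> is orthogonal to \<open>G\<close> because
  \<open>S'\<close> maps \<open>G\<close> into itself. The hypotheses on \<open>S\<close> are kept
  this weak so that the lemma covers elements of a commutant, complex scalars, and diagonal maps on
  a product of Hilbert spaces alike.\<close>

lemma pr_commute:
 assumes G: "csub G" and add: "\<And>x y. S (x + y) = S x + S y" and adj: "\<And>x y. inner (S x) y = inner x (S' y)"
  and inv: "\<And>x. x \<in> G ==> S x \<in> G" "\<And>x. x \<in> G ==> S' x \<in> G" shows "pr G (S x) = S (pr G x)"
proof (rule pr_unique[OF G])
 show "S (pr G x) \<in> G" by (simp add: inv pr_in G)
 fix h assume h: "h \<in> G"
 have "S x - S (pr G x) = S (x - pr G x)" using add[of "x - pr G x" "pr G x"] by simp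
 then show "inner (S x - S (pr G x)) h = 0" using adj pr_orth[OF G inv(2)[OF h]] by simp
qed

section \<open>Orthogonal complements and density\<close>

definition ortho :: "'a::real_inner set => 'a set" where "ortho X = {x. \<forall>g\<in>X. inner x g = 0}"

lemma csub_ortho: "csub (ortho X)"
proof
 have "ortho X = (\<Inter>g\<in>X. {x. inner x g = 0})" by (auto simp: ortho_def)
 then show "closed (ortho X)" by (auto intro!: closed_INT closed_Collect_eq linear_continuous_on bounded_linear_inner_left)
 show "subspace (ortho X)" by (auto simp: subspace_def ortho_def inner_add_left)
qed

lemma pr_ortho: "csub G ==> pr (ortho G) x = x - pr G x"
proof (rule pr_unique[OF csub_ortho])
 assume G: "csub G"
 show "x - pr G x \<in> ortho G" using pr_orth[OF G] by (simp add: ortho_def)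
 fix h assume "h \<in> ortho G"
 then show "inner (x - (x - pr G x)) h = 0" using pr_in[OF G] by (auto simp: ortho_def inner_commute)
qed

lemma ortho_ortho:
 fixes G :: "'a::{real_inner,complete_space} set"
 assumes G: "csub G" shows "ortho (ortho G) = G"
proof -
 have "pr (ortho (ortho G)) x = pr G x" for x by (simp add: pr_ortho csub_ortho G)
 then show ?thesis using pr_id_iff[OF G] pr_id_iff[OF csub_ortho] by (metis subsetI subset_antisym)
qed

lemma ortho_closure: "ortho (closure X) = ortho X"
proof
 show "ortho X \<subseteq> ortho (closure X)"
 proof
  fix x assume "x \<in> ortho X"
  then have "X \<subseteq> {y. inner x y = 0}" by (auto simp: ortho_def)
  then have "closure X \<subseteq> {y. inner x y = 0}"
   by (intro closure_minimal) (auto intro!: closed_Collect_eq linear_continuous_on bounded_linear_inner_right)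
  then show "x \<in> ortho (closure X)" by (auto simp: ortho_def)
 qed
qed (use closure_subset in \<open>auto simp: ortho_def\<close>)

lemma subspace_closure: "subspace (G :: 'a::real_normed_vector set) ==> subspace (closure G)"
proof (rule subspaceI)
 assume G: "subspace G"
 show "0 \<in> closure G" using subspace_0[OF G] closure_subset by blast
 fix x y assume "x \<in> closure G" "y \<in> closure G"
 then obtain a b where a: "\<And>n. a n \<in> G" "a \<leadsto> x" and b: "\<And>n. b n \<in> G" "b \<leadsto> y" by (auto simp: closure_sequential)
 show "x + y \<in> closure G" unfolding closure_sequential
  by (rule exI[of _ "\<lambda>n. a n + b n"]) (auto intro: tendsto_add a b subspace_add[OF G])
next
 assume G: "subspace G"
 fix c x assume "x \<in> closure G"
 then obtain a where a: "\<And>n. a n \<in> G" "a \<leadsto> x" by (auto simp: closure_sequential)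
 show "c *\<^sub>R x \<in> closure G" unfolding closure_sequential
  by (rule exI[of _ "\<lambda>n. c *\<^sub>R a n"]) (auto intro: tendsto_intros a subspace_scale[OF G])
qed

lemma dense_if_ortho_trivial:
 fixes D :: "'a::{real_inner,complete_space} set"
 assumes "subspace D" "\<And>x. x \<in> ortho D ==> x = 0" shows "closure D = UNIV"
proof -
 have c: "csub (closure D)" using assms(1) by (simp add: subspace_closure)
 have "x - pr (closure D) x \<in> ortho (closure D)" for x using pr_orth[OF c] by (auto simp: ortho_def)
 then have "x = pr (closure D) x" for x using assms(2)[of "x - pr (closure D) x"] ortho_closure[of D] by auto
 then show ?thesis using pr_in[OF c] by (metis UNIV_eq_I)
qed

lemma orth_dense_zero:
 assumes "closure D = UNIV" "\<And>g. g \<in> D ==> inner x g = 0" shows "x = 0" using assms ortho_closure[of D] by (fastforce simp: ortho_def)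

section \<open>Riesz representation and adjoints\<close>

lemma Riesz_representation:
 fixes f :: "'a::{real_inner,complete_space} => real"
 assumes f: "bounded_linear f" shows "\<exists>z. \<forall>x. f x = inner x z"
proof (cases "\<forall>x. f x = 0")
 case False
 then obtain x0 where x0: "f x0 \<noteq> 0" by blast
 let ?G = "{x. f x = 0}"
 have "subspace ?G" using f by (auto simp: subspace_def linear_simps)
 then have G: "csub ?G" by (auto intro!: closed_Collect_eq linear_continuous_on[OF f])
 define w where "w = x0 - pr ?G x0"
 have fw: "f w = f x0" using pr_in[OF G, of x0] f by (simp add: w_def linear_simps)
 have w0: "w \<noteq> 0" using fw x0 f by (auto simp: linear_simps)
 have "f x = inner x ((f w / inner w w) *\<^sub>R w)" for x
 proof -
  have "x - (f x / f w) *\<^sub>R w \<in> ?G" using f fw x0 by (simp add: linear_simps)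
  then have "inner w (x - (f x / f w) *\<^sub>R w) = 0" unfolding w_def using pr_orth[OF G] by blast
  then show ?thesis using fw x0 w0 by (simp add: inner_diff_right inner_commute)
 qed
 then show ?thesis by blast
qed (auto intro: exI[of _ 0])

lemma inner_eqI_left: "(\<And>y. inner x y = inner x' y) ==> x = (x' :: 'a::real_inner)" by (metis inner_diff_left inner_eq_zero_iff right_minus_eq)

lemma inner_eqI_right: "(\<And>y. inner y x = inner y x') ==> x = (x' :: 'a::real_inner)" using inner_eqI_left by (metis inner_commute)

lemma real_adjoint_exists:
 fixes T :: "'a::{real_inner,complete_space} => 'a"
 assumes T: "bounded_linear T" shows "\<exists>S. bounded_linear S \<and> (\<forall>x y. inner (T x) y = inner x (S y))"
proof -
 have "\<exists>z. \<forall>x. inner (T x) y = inner x z" for y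
  by (rule Riesz_representation) (rule bounded_linear_compose[OF bounded_linear_inner_left T])
 then obtain S where S: "\<And>x y. inner (T x) y = inner x (S y)" by metis
 obtain K where K: "\<And>x. norm (T x) \<le> norm x * K" using bounded_linear.bounded[OF T] by blast
 have "bounded_linear S"
 proof (rule bounded_linear_intro[where K=K])
  show "S (x + y) = S x + S y" for x y by (rule inner_eqI_right) (simp add: S[symmetric] inner_add_right)
  show "S (r *\<^sub>R x) = r *\<^sub>R S x" for r x by (rule inner_eqI_right) (simp add: S[symmetric])
  show "norm (S x) \<le> norm x * K" for x
  proof (cases "S x = 0")
   case False
   have "norm (S x) * norm (S x) = inner (T (S x)) x" by (simp add: S power2_norm_eq_inner flip: power2_eq_square)
   also have "\<dots> \<le> norm (S x) * K * norm x"
    using norm_cauchy_schwarz[of "T (S x)" x] K[of "S x"] mult_right_mono norm_ge_zero order_trans by blast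
   finally show ?thesis using False by (simp add: mult.commute)
  next
   case True
   have "0 \<le> norm x * K" using K[of x] norm_ge_zero order_trans by blast
   then show ?thesis using True by simp
  qed
 qed
 then show ?thesis using S by blast
qed

section \<open>Bounded complex-linear operators\<close>

lemma cinner_scaleC_right: "cinner x (scaleC c y) = cnj c * cinner (x :: 'a::complex_hilbert_space) y"
 by (metis cinner_commute cinner_scaleC_left complex_cnj_mult)

text \<open>The imaginary part is seen by rotating the second argument by \<open>\<i>\<close>. So
  identities between real inner products, in which nearly all later computations are done, imply the
  complex ones.\<close>

lemma cinner_conv: "cinner x y = Complex (inner x y) (inner (x :: 'a::complex_hilbert_space) (scaleC \<i> y))"
 by (simp add: inner_cinner cinner_scaleC_right)

lemma scaleC_adj: "inner (scaleC c x) y = inner (x :: 'a::complex_hilbert_space) (scaleC (cnj c) y)"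
 by (simp add: inner_cinner cinner_scaleC_right cinner_scaleC_left)

lemma norm_scaleC: "norm (scaleC c x) = cmod c * norm (x :: 'a::complex_hilbert_space)"
proof -
 have "cnj c * c = complex_of_real ((cmod c)\<^sup>2)" by (simp only: complex_norm_square mult.commute)
 then have "(norm (scaleC c x))\<^sup>2 = (cmod c * norm x)\<^sup>2" by (simp add: power2_norm_eq_inner scaleC_adj scaleC_scaleC flip: scaleR_scaleC)
   (simp add: power_mult_distrib power2_norm_eq_inner)
 then show ?thesis by (rule power2_eq_imp_eq) auto
qed

lemma bounded_linear_scaleC: "bounded_linear (scaleC c :: 'a::complex_hilbert_space => 'a)"
proof (rule bounded_linear_intro[where K="cmod c"])
 show "scaleC c (r *\<^sub>R x) = r *\<^sub>R scaleC c x" for r and x :: 'a by (simp add: scaleR_scaleC scaleC_scaleC mult.commute)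
qed (auto simp: scaleC_add_right norm_scaleC mult.commute)

lemma scaleC_zero [simp]: "scaleC c (0 :: 'a::complex_hilbert_space) = 0" by (rule linear_simps(3)[OF bounded_linear_scaleC])

lemma bclin_bl: "bclin T ==> bounded_linear T" and bclin_scaleC: "bclin T ==> T (scaleC c x) = scaleC c (T x)" by (auto simp: bounded_clinear_def)
lemmas bclin_tendsto = bounded_linear.tendsto[OF bclin_bl]

lemma bclin_simps:
 assumes "bclin T" shows "T (x + y) = T x + T y" "T (x - y) = T x - T y" "T (r *\<^sub>R x) = r *\<^sub>R T x" "T 0 = 0" "T (- x) = - T x"
 using bclin_bl[OF assms] by (auto simp: linear_simps)

lemma bclinI:
 assumes "\<And>x y. T (x + y) = T x + T y" "\<And>c x. T (scaleC c x) = scaleC c (T x)" "\<And>x. norm (T x) \<le> K * norm x" shows "bclin T"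
 unfolding bounded_clinear_def using assms by (auto intro!: bounded_linear_intro[where K=K] simp: scaleR_scaleC mult.commute)

lemma bclin_bound:
 assumes "bclin T" obtains K where "0 < K" "\<And>x. norm (T x) \<le> K * norm x"
 using bounded_linear.pos_bounded[OF bclin_bl[OF assms]] by (auto simp: mult.commute)

lemma bclin_id: "bclin (\<lambda>x. x)" "bclin id" and bclin_zero: "bclin (\<lambda>_. 0)" by (rule bclinI[where K=1]; simp)+

lemma bclin_comp: "bclin S ==> bclin T ==> bclin (S \<circ> T)" by (auto simp: bounded_clinear_def comp_def intro: bounded_linear_compose)

lemma bclin_add: "bclin S ==> bclin T ==> bclin (\<lambda>x. S x + T x)"
 by (auto simp: bounded_clinear_def scaleC_add_right intro: bounded_linear_add)

lemma bclin_scale: "bclin S ==> bclin (\<lambda>x. scaleC c (S x))" by (auto simp: bounded_clinear_def scaleC_scaleC mult.commute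
   intro: bounded_linear_compose[OF bounded_linear_scaleC])

lemma bclin_minus: "bclin S ==> bclin (\<lambda>x. - S x)"
 by (auto simp: bounded_clinear_def linear_simps(4)[OF bounded_linear_scaleC] intro: bounded_linear_minus)

lemma adjoint_scaleC:
 assumes T: "bclin T" and S: "\<And>x y. inner (T x) y = inner x (S y)" shows "S (scaleC c y) = scaleC c (S y)"
proof (rule inner_eqI_right)
 fix x
 have "inner x (S (scaleC c y)) = inner (scaleC (cnj c) (T x)) y" by (simp add: S[symmetric] scaleC_adj)
 also have "\<dots> = inner x (scaleC c (S y))" by (simp add: bclin_scaleC[OF T, symmetric] S scaleC_adj)
 finally show "inner x (S (scaleC c y)) = inner x (scaleC c (S y))" .
qed

text \<open>Links \<open>cadjoint\<close>, which is defined by the complex inner product, to real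
  adjoints: the real adjoint of a complex-linear operator commutes with scalars, and by
  \<open>cinner_conv\<close> it is then the complex adjoint as well.\<close>

lemma
 assumes T: "bclin T" and S: "\<And>x y. inner (T x) y = inner x (S y)" shows adj_unique: "adj T = S" and bclin_adjoint: "bclin S"
proof -
 obtain S' where S': "bounded_linear S'" "\<And>x y. inner (T x) y = inner x (S' y)" using real_adjoint_exists[OF bclin_bl[OF T]] by blast
 have SS: "S' = S" by (rule ext, rule inner_eqI_right) (simp flip: S S'(2))
 have "S (scaleC c y) = scaleC c (S y)" for c y by (rule adjoint_scaleC[OF T S])
 then show bS: "bclin S" using S'(1) SS by (simp add: bounded_clinear_def)
 have iff: "(\<forall>x y. cinner (T x) y = cinner x (S2 y)) \<longleftrightarrow> S2 = S" for S2
 proof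
  assume "\<forall>x y. cinner (T x) y = cinner x (S2 y)"
  then have "inner (T x) y = inner x (S2 y)" for x y by (simp add: inner_cinner)
  then have "inner x (S2 y) = inner x (S y)" for x y by (rule trans[OF sym S])
  then show "S2 = S" by (intro ext) (rule inner_eqI_right)
 next
  assume "S2 = S"
  then show "\<forall>x y. cinner (T x) y = cinner x (S2 y)" by (simp add: cinner_conv S bclin_scaleC[OF bS])
 qed
 show "adj T = S" unfolding cadjoint_def using iff bS by (intro the_equality) auto
qed

lemma
 assumes T: "bclin T" shows bclin_adj: "bclin (adj T)" and adj_right: "inner (T x) y = inner x (adj T y)"
  and adj_left: "inner (adj T x) y = inner x (T y)" and adj_cinner: "cinner (T x) y = cinner x (adj T y)"
proof -
 obtain S where S: "bounded_linear S" "\<And>x y. inner (T x) y = inner x (S y)" using real_adjoint_exists[OF bclin_bl[OF T]] by blast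
 have e: "adj T = S" by (rule adj_unique[OF T S(2)])
 have b: "bclin S" by (rule bclin_adjoint[OF T S(2)])
 then show "bclin (adj T)" by (simp add: e)
 show "inner (T x) y = inner x (adj T y)" "inner (adj T x) y = inner x (T y)" by (auto simp: e S(2)) (metis S(2) inner_commute)
 show "cinner (T x) y = cinner x (adj T y)" by (simp add: cinner_conv e S(2) bclin_scaleC[OF b])
qed

lemma adj_adj: "bclin T ==> adj (adj T) = T" by (rule adj_unique) (auto simp: bclin_adj adj_left)

lemma adj_comp: "bclin S ==> bclin T ==> adj (S \<circ> T) = adj T \<circ> adj S" by (rule adj_unique) (auto simp: bclin_comp adj_right)

lemma adj_selfadjoint: "bclin T ==> (\<And>x y. inner (T x) y = inner x (T y)) ==> adj T = T" by (rule adj_unique)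

lemma norm_adj_comp: "bclin T ==> inner (adj T (T x)) x = (norm (T x))\<^sup>2" by (simp add: adj_left power2_norm_eq_inner)

lemma bclin_lim:
 assumes T: "\<And>n. bclin (T n)" "\<And>n x. norm (T n x) \<le> K * norm x" "\<And>x. (\<lambda>n. T n x) \<leadsto> S x" shows "bclin S"
proof (rule bclinI[where K=K])
 show "S (x + y) = S x + S y" for x y using tendsto_add[OF T(3)[of x] T(3)[of y]] T(3)[of "x+y"] by (simp add: bclin_simps[OF T(1)] LIMSEQ_unique)
 show "S (scaleC c x) = scaleC c (S x)" for c x using bounded_linear.tendsto[OF bounded_linear_scaleC T(3)[of x], of c] T(3)[of "scaleC c x"]
  by (simp add: bclin_scaleC[OF T(1)] LIMSEQ_unique)
 show "norm (S x) \<le> K * norm x" for x using T(2) by (intro LIMSEQ_le_const2[OF tendsto_norm[OF T(3)]]) auto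
qed

lemma bounded_comp_lim:
 assumes T: "\<And>n. bclin (T n)" "\<And>n x. norm (T n x) \<le> K * norm x" "\<And>x. (\<lambda>n. T n x) \<leadsto> S x" and y: "y \<leadsto> z"
 shows "(\<lambda>n. T n (y n)) \<leadsto> S z"
proof -
 have "(\<lambda>n. T n (y n - z)) \<leadsto> 0"
 proof (rule Lim_null_comparison)
  show "\<forall>\<^sub>F n in sequentially. norm (T n (y n - z)) \<le> K * norm (y n - z)" using T(2) by auto
  have "(\<lambda>n. K * norm (y n - z)) \<leadsto> K * norm (z - z)" by (intro tendsto_intros y)
  then show "(\<lambda>n. K * norm (y n - z)) \<leadsto> 0" by simp
 qed
 from tendsto_add[OF this T(3)[of z]] show ?thesis by (simp add: bclin_simps[OF T(1)])
qed


section \<open>Square roots, inverses and Douglas factorization\<close>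

text \<open>The classical iteration for \<open>1 - sqrt (1 - B)\<close>: a fixed point satisfies
  \<open>2 Y = B + Y\<^sup>2\<close>, that is \<open>(1 - Y)\<^sup>2 = 1 - B\<close>.\<close>

primrec sqrt_iter :: "('a::real_vector => 'a) => nat => 'a => 'a" where "sqrt_iter B 0 x = 0"
| "sqrt_iter B (Suc n) x = (1/2) *\<^sub>R (B x + sqrt_iter B n (sqrt_iter B n x))"

primrec sqrt_iter_real :: "nat => real" where "sqrt_iter_real 0 = 0"
| "sqrt_iter_real (Suc n) = (1 + (sqrt_iter_real n)\<^sup>2) / 2"

lemma sqrt_iter_real_bounds: "0 \<le> sqrt_iter_real n \<and> sqrt_iter_real n \<le> 1" by (induction n) (auto simp: power_le_one)

lemma sqrt_iter_real_mono: "sqrt_iter_real n \<le> sqrt_iter_real (Suc n)"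
proof -
 have "0 \<le> (1 - sqrt_iter_real n)\<^sup>2" by simp
 then show ?thesis by (simp add: power2_eq_square algebra_simps)
qed

lemma sqrt_iter_commute:
 assumes B: "\<And>x. C (B x) = B (C x)" and C: "linear C" shows "C (sqrt_iter B n x) = sqrt_iter B n (C x)"
 by (induction n arbitrary: x) (auto simp: linear_0[OF C] linear_add[OF C] linear_scale[OF C] B)

text \<open>With \<open>y\<^sub>n\<close> the iterates for the scalar 1, the increments of the iterates for \<open>B\<close> are bounded
 by those of \<open>y\<^sub>n\<close>, so the iterates converge pointwise.\<close>

lemma operator_sqrt:
 fixes B :: "'a::complex_hilbert_space => 'a"
 assumes B: "bclin B" and sa: "\<And>x y. inner (B x) y = inner x (B y)" and B1: "\<And>x. norm (B x) \<le> norm x"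
 obtains S where "bclin S" "\<And>x y. inner (S x) y = inner x (S y)" "\<And>x. 0 \<le> inner (S x) x" "\<And>x. S (S x) = x - B x"
  "\<And>C x. bclin C ==> (\<And>y. C (B y) = B (C y)) ==> C (S x) = S (C x)"
proof -
 let ?Y = "sqrt_iter B" and ?y = sqrt_iter_real
 have bY: "bclin (?Y n) \<and> (\<forall>x. norm (?Y n x) \<le> ?y n * norm x)" for n
 proof (induction n)
  case (Suc n)
  then have b: "bclin (?Y n)" and n: "\<And>x. norm (?Y n x) \<le> ?y n * norm x" by auto
  have nn: "norm (?Y (Suc n) x) \<le> ?y (Suc n) * norm x" for x
  proof -
   have "norm (?Y n (?Y n x)) \<le> ?y n * (?y n * norm x)"
    using n[of "?Y n x"] n[of x] sqrt_iter_real_bounds[of n] by (meson mult_left_mono order_trans)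
   then show ?thesis using norm_triangle_ineq[of "B x" "?Y n (?Y n x)"] B1[of x]
    by (simp add: power2_eq_square algebra_simps del: scaleR_add_right)
  qed
  have "bclin (?Y (Suc n))" by (rule bclinI[OF _ _ nn]) (auto simp: bclin_simps[OF B] bclin_simps[OF b]
     bclin_scaleC[OF B] bclin_scaleC[OF b] scaleC_add_right scaleR_scaleC
     scaleC_scaleC)
  with nn show ?case by blast
 qed (simp add: bclin_zero)
 then have bc: "bclin (?Y n)" and nY: "norm (?Y n x) \<le> ?y n * norm x" for n x by auto
 have lin: "linear (?Y n)" for n using bclin_bl[OF bc] bounded_linear.linear by blast
 have saY: "inner (?Y n x) y = inner x (?Y n y)" for n x y by (induction n arbitrary: x y) (auto simp: inner_add_left inner_add_right sa)
 have YB: "?Y n (B x) = B (?Y n x)" for n x by (rule sqrt_iter_commute[symmetric]) (auto simp: bclin_bl[OF B] bounded_linear.linear)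
 have YY: "?Y m (?Y n x) = ?Y n (?Y m x)" for m n x by (rule sqrt_iter_commute[of "?Y m" B, OF YB lin])
 \<comment> \<open>Since the iterates commute, the difference of two consecutive squares factors as
   sum times difference; the scalar iterates obey the same recursion with equality.\<close>
 have inc: "norm (?Y (Suc n) x - ?Y n x) \<le> (?y (Suc n) - ?y n) * norm x" for n x
 proof (induction n arbitrary: x)
  case 0 then show ?case using B1[of x] by simp
 next
  case (Suc n)
  let ?d = "?Y (Suc n) x - ?Y n x"
  have "?Y (Suc (Suc n)) x - ?Y (Suc n) x = (1/2) *\<^sub>R (?Y (Suc n) (?Y (Suc n) x) - ?Y n (?Y n x))"
   by (subst (1 2) sqrt_iter.simps(2)) (simp add: algebra_simps del: sqrt_iter.simps)
  also have "\<dots> = (1/2) *\<^sub>R (?Y (Suc n) ?d + ?Y n ?d)" by (simp add: linear_diff[OF lin] YY[of "Suc n" n] del: sqrt_iter.simps)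
  also have "norm \<dots> \<le> (1/2) * (?y (Suc n) * norm ?d + ?y n * norm ?d)"
   using norm_triangle_ineq[of "?Y (Suc n) ?d" "?Y n ?d"] nY[of "Suc n" ?d] nY[of n ?d] by (simp del: sqrt_iter.simps)
  also have "\<dots> = (?y (Suc n) + ?y n) / 2 * norm ?d" by (simp add: field_simps)
  also have "\<dots> \<le> (?y (Suc n) + ?y n) / 2 * ((?y (Suc n) - ?y n) * norm x)"
   using Suc.IH[of x] sqrt_iter_real_bounds[of n] sqrt_iter_real_bounds[of "Suc n"]
   by (intro mult_left_mono) (auto simp del: sqrt_iter.simps sqrt_iter_real.simps)
  also have "\<dots> = (?y (Suc (Suc n)) - ?y (Suc n)) * norm x"
  proof -
   have "?y (Suc (Suc n)) - ?y (Suc n) = (?y (Suc n) + ?y n) / 2 * (?y (Suc n) - ?y n)" by (simp add: power2_eq_square field_simps)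
   then show ?thesis by (simp only: mult.assoc)
  qed
  finally show ?case .
 qed
 have inc2: "norm (?Y (n + k) x - ?Y n x) \<le> (?y (n + k) - ?y n) * norm x" for n k x
 proof (induction k)
  case (Suc k)
  have "norm (?Y (n + Suc k) x - ?Y n x)
    \<le> norm (?Y (Suc (n + k)) x - ?Y (n + k) x) + norm (?Y (n + k) x - ?Y n x)"
   using norm_triangle_ineq[of "?Y (Suc (n + k)) x - ?Y (n + k) x" "?Y (n + k) x - ?Y n x"] by simp
  also have "\<dots> \<le> (?y (Suc (n + k)) - ?y (n + k)) * norm x + (?y (n + k) - ?y n) * norm x" using inc[of "n + k" x] Suc by linarith
  finally show ?case by (simp add: algebra_simps)
 qed simp
 have "Bseq ?y" using sqrt_iter_real_bounds by (intro BseqI'[of _ 1]) auto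
 moreover have yinc: "incseq ?y" by (rule incseq_SucI) (rule sqrt_iter_real_mono)
 ultimately have "convergent ?y" by (intro Bseq_mono_convergent) (auto simp: incseq_def)
 then obtain l where l: "?y \<leadsto> l" by (auto simp: convergent_def)
 have "\<exists>z. (\<lambda>n. ?Y n x) \<leadsto> z" for x
 proof (rule convergent_if_dist_le)
  have "(\<lambda>n. (l - ?y n) * norm x) \<leadsto> (l - l) * norm x" by (intro tendsto_intros l)
  then show "(\<lambda>n. (l - ?y n) * norm x) \<leadsto> 0" by simp
  fix m n :: nat assume "n \<le> m"
  then have "dist (?Y m x) (?Y n x) \<le> (?y m - ?y n) * norm x" using inc2[of n "m - n" x] by (simp add: dist_norm)
  also have "\<dots> \<le> (l - ?y n) * norm x" using incseq_le[OF yinc l] by (simp add: mult_right_mono)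
  finally show "dist (?Y m x) (?Y n x) \<le> (l - ?y n) * norm x" .
 qed
 then have "\<forall>x. \<exists>z. (\<lambda>n. ?Y n x) \<leadsto> z" by blast
 then obtain Y where Y: "\<And>x. (\<lambda>n. ?Y n x) \<leadsto> Y x" by (rule choice[THEN exE]) blast
 have nY1: "norm (?Y n x) \<le> 1 * norm x" for n x using nY[of n x] sqrt_iter_real_bounds[of n] by (meson mult_right_mono norm_ge_zero order_trans)
 have bYY: "bclin Y" by (rule bclin_lim[OF bc nY1 Y])
 have Y2: "(\<lambda>n. ?Y n (?Y n x)) \<leadsto> Y (Y x)" for x by (rule bounded_comp_lim[OF bc nY1 Y Y])
 have fix_eq: "Y x = (1/2) *\<^sub>R (B x + Y (Y x))" for x
 proof (rule LIMSEQ_unique[OF LIMSEQ_Suc[OF Y[of x]]])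
  show "(\<lambda>n. ?Y (Suc n) x) \<leadsto> (1/2) *\<^sub>R (B x + Y (Y x))" by (simp, intro tendsto_intros Y2)
 qed
 have saYY: "inner (Y x) y = inner x (Y y)" for x y
 proof (rule LIMSEQ_unique)
  show "(\<lambda>n. inner (?Y n x) y) \<leadsto> inner (Y x) y" by (intro tendsto_intros Y)
  show "(\<lambda>n. inner (?Y n x) y) \<leadsto> inner x (Y y)" unfolding saY by (intro tendsto_intros Y)
 qed
 have nYY: "norm (Y x) \<le> norm x" for x by (rule LIMSEQ_le_const2[OF tendsto_norm[OF Y]]) (use nY1 in auto)
 show ?thesis
 proof (rule that[of "\<lambda>x. x - Y x"])
  show "bclin (\<lambda>x. x - Y x)" using bclin_add[OF bclin_id(1) bclin_minus[OF bYY]] by simp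
  show "inner (x - Y x) y = inner x (y - Y y)" for x y by (simp add: inner_diff_left inner_diff_right saYY)
  show "0 \<le> inner (x - Y x) x" for x using norm_cauchy_schwarz[of "Y x" x] mult_right_mono[OF nYY[of x], of "norm x"]
   by (simp add: inner_diff_left power2_norm_eq_inner[symmetric] power2_eq_square)
  show "x - Y x - Y (x - Y x) = x - B x" for x
  proof -
   have "Y x + Y x = B x + Y (Y x)" by (subst (1 2) fix_eq) (simp flip: scaleR_add_left)
   then show ?thesis by (simp add: bclin_simps[OF bYY] algebra_simps)
  qed
  show "C (x - Y x) = C x - Y (C x)" if C: "bclin C" and CB: "\<And>y. C (B y) = B (C y)" for C x
  proof -
   have lC: "linear C" using bclin_bl[OF C] bounded_linear.linear by blast
   have "(\<lambda>n. C (?Y n x)) \<leadsto> C (Y x)" by (rule bclin_tendsto[OF C Y])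
   then have "(\<lambda>n. ?Y n (C x)) \<leadsto> C (Y x)" using sqrt_iter_commute[of C B, OF CB lC] by simp
   then show ?thesis using Y LIMSEQ_unique by (auto simp: linear_diff[OF lC])
  qed
 qed
qed

text \<open>The lower bound makes \<open>M\<close> injective with closed range, and by
  self-adjointness the complement of the range is the kernel of \<open>M\<close>, which is
  zero.\<close>

lemma bounded_below_inverse:
 fixes M :: "'a::complex_hilbert_space => 'a"
 assumes M: "bclin M" and sa: "\<And>x y. inner (M x) y = inner x (M y)" and c: "c > 0" "\<And>x. c * norm x \<le> norm (M x)"
 obtains W where "bclin W" "\<And>x. W (M x) = x" "\<And>x. M (W x) = x"
proof -
 have inj: "x = y" if "M x = M y" for x y using c(2)[of "x - y"] c(1) that by (simp add: bclin_simps[OF M] mult_le_0_iff)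
 have sub: "subspace (range M)" using bclin_bl[OF M] bounded_linear.linear linear_subspace_image subspace_UNIV by blast
 have "complete (range M)" by (rule complete_isometric_image[OF c(1) subspace_UNIV bclin_bl[OF M]]) (simp_all add: c(2) complete_UNIV)
 then have "closed (range M)" by (rule complete_imp_closed)
 moreover have "closure (range M) = UNIV"
 proof (rule dense_if_ortho_trivial[OF sub])
  fix x assume "x \<in> ortho (range M)"
  then have "inner (M x) y = 0" for y by (simp add: sa ortho_def)
  then have "M x = M 0" by (metis inner_eq_zero_iff bclin_simps(4)[OF M])
  then show "x = 0" by (rule inj)
 qed
 ultimately have surj: "range M = UNIV" by simp
 define W where "W = inv_into UNIV M"
 have MW: "M (W x) = x" for x unfolding W_def by (rule surj_f_inv_f[OF surj])
 have WM: "W (M x) = x" for x by (rule inj) (simp add: MW)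
 have "bclin W"
 proof (rule bclinI[where K="1/c"])
  show "W (x + y) = W x + W y" for x y by (rule inj) (simp add: MW bclin_simps[OF M])
  show "W (scaleC k x) = scaleC k (W x)" for k x by (rule inj) (simp add: MW bclin_scaleC[OF M])
  show "norm (W x) \<le> 1/c * norm x" for x using c(2)[of "W x"] c(1) by (simp add: MW field_simps)
 qed
 then show ?thesis using that WM MW by blast
qed

lemma closure_range_invariant:
 assumes C: "bclin C" "\<And>x. C (h x) = h (C x)" and x: "x \<in> closure (range h)" shows "C x \<in> closure (range h)"
proof -
 obtain f where f: "\<And>n. f n \<in> range h" "f \<leadsto> x" using x by (auto simp: closure_sequential)
 then have "C (f n) \<in> range h" for n using C(2) by (metis rangeE rangeI)
 then show ?thesis unfolding closure_sequential
  using bclin_tendsto[OF C(1) f(2)] by (intro exI[of _ "\<lambda>n. C (f n)"]) auto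
qed

lemma closure_graph_map:
 fixes G :: "('a::complex_hilbert_space \<times> 'a) set"
 assumes C: "bclin C" and G: "\<And>x y. (x, y) \<in> G ==> (C x, C y) \<in> G" and xy: "(x, y) \<in> closure G" shows "(C x, C y) \<in> closure G"
proof -
 obtain f where f: "\<And>n. f n \<in> G" "f \<leadsto> (x, y)" using xy by (auto simp: closure_sequential)
 have "(\<lambda>n. (C (fst (f n)), C (snd (f n)))) \<leadsto> (C x, C y)"
  using tendsto_fst[OF f(2)] tendsto_snd[OF f(2)] by (intro tendsto_Pair bclin_tendsto[OF C]) auto
 then show ?thesis unfolding closure_sequential by (intro exI[of _ "\<lambda>n. (C (fst (f n)), C (snd (f n)))"]) (simp add: G f(1))
qed

text \<open>The estimate \<open>norm y \<le> K * norm x\<close> survives in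
  \<open>closure G\<close>, so the closure is still single valued, and its domain is complete and
  therefore all of \<open>closure (Domain G)\<close>. Off this subspace the operator is made zero by
  composing with the projection, as the third conclusion records.\<close>

lemma extend_by_continuity:
 fixes G :: "('a::complex_hilbert_space \<times> 'a) set"
 assumes zero: "(0, 0) \<in> G" and add: "\<And>x y x' y'. (x, y) \<in> G ==> (x', y') \<in> G ==> (x + x', y + y') \<in> G"
  and scale: "\<And>c x y. (x, y) \<in> G ==> (scaleC c x, scaleC c y) \<in> G" and K: "K \<ge> 0" "\<And>x y. (x, y) \<in> G ==> norm y \<le> K * norm x"
 obtains v where "bclin v" "\<And>x y. (x, y) \<in> closure G ==> v x = y" "\<And>x. (pr (closure (Domain G)) x, v x) \<in> closure G"
  "\<And>x. norm (v x) \<le> K * norm x"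
proof -
 let ?H = "closure G" and ?D = "closure (Domain G)"
 have S: "subspace G" using scale[of _ _ "complex_of_real _"] by (auto simp: subspace_def zero_prod_def zero add scaleR_scaleC)
 then have H: "subspace ?H" by (rule subspace_closure)
 have "subspace (fst ` G)" by (rule linear_subspace_image[OF bounded_linear.linear[OF bounded_linear_fst] S])
 then have D: "csub ?D" by (simp add: subspace_closure Domain_fst)
 have sc: "bclin (scaleC c)" for c using bclin_scale[OF bclin_id(1)] .
 have "?H \<subseteq> {p. norm (snd p) \<le> K * norm (fst p)}" using K(2)
  by (intro closure_minimal closed_Collect_le continuous_intros) auto
 then have HK: "norm y \<le> K * norm x" if "(x, y) \<in> ?H" for x y using that by auto
 have "complete (fst ` ?H)"
 proof (rule complete_isometric_image[OF _ H bounded_linear_fst])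
  \<comment> \<open>On the closed graph \<open>norm p \<le> (1 + K) * norm (fst p)\<close>: the
    first coordinate is bounded below by this constant, which carries completeness of the graph over
    to its domain.\<close>
  show "0 < 1 / (1 + K)" using K(1) by simp
  have "norm p \<le> (1 + K) * norm (fst p)" if "p \<in> ?H" for p
   using HK[of "fst p" "snd p"] that norm_Pair_le[of "fst p" "snd p"] by (simp add: algebra_simps)
  then show "\<forall>p\<in>?H. 1 / (1 + K) * norm p \<le> norm (fst p)" using K(1) by (simp add: divide_le_eq mult.commute)
  show "complete ?H" by (simp add: complete_eq_closed)
 qed
 then have "?D \<subseteq> fst ` ?H" using closure_subset[of G] by (intro closure_minimal complete_imp_closed) force+
 then have ex: "\<exists>y. (pr ?D x, y) \<in> ?H" for x using pr_in[OF D, of x] by force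
 have HD: "x \<in> ?D" if "(x, y) \<in> ?H" for x y
  using image_closure_subset[of G fst ?D] closure_subset[of "Domain G"] that by (force simp: Domain_fst intro: continuous_intros)
 have sv: "y = y'" if "(x, y) \<in> ?H" "(x, y') \<in> ?H" for x y y' using HK[of 0 "y - y'"] subspace_diff[OF H that] by simp
 define v where "v x = (THE y. (pr ?D x, y) \<in> ?H)" for x
 have vI: "(pr ?D x, y) \<in> ?H ==> v x = y" for x y unfolding v_def using sv by (intro the_equality) auto
 have vH: "(pr ?D x, v x) \<in> ?H" for x using ex[of x] vI by auto
 have nv: "norm (v x) \<le> K * norm x" for x using HK[OF vH, of x] mult_left_mono[OF norm_pr_le[OF D] K(1), of x] by simp
 have "bclin v"
 proof (rule bclinI[OF _ _ nv])
  show "v (x + x') = v x + v x'" for x x' by (rule vI) (use subspace_add[OF H vH vH] in \<open>simp add: pr_add[OF D]\<close>)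
  have inD: "scaleC k y \<in> ?D" if "y \<in> ?D" for k y
  proof -
   have "scaleC k ` Domain G \<subseteq> Domain G" using scale by blast
   then show ?thesis using image_closure_subset[OF linear_continuous_on[OF bclin_bl[OF sc]], of ?D k "Domain G"] closure_subset that by blast
  qed
  have "pr ?D (scaleC c x) = scaleC c (pr ?D x)" for c x by (rule pr_commute[OF D _ scaleC_adj inD inD]) (simp_all add: bclin_simps[OF sc])
  then show "v (scaleC c x) = scaleC c (v x)" for c x by (intro vI) (use closure_graph_map[OF sc scale vH] in simp)
 qed
 moreover have "v x = y" if "(x, y) \<in> ?H" for x y by (rule vI) (use that HD[OF that] in \<open>simp add: pr_id[OF D]\<close>)
 ultimately show ?thesis using vH nv that by blast
qed

text \<open>The norm inequality makes \<open>h x \<mapsto> a x\<close> well defined and contractive.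
  The final clause asks for \<open>C\<close> and its adjoint \<open>C'\<close> to commute with
  \<open>h\<close>, because \<open>C\<close> must preserve both the closed range of \<open>h\<close>
  and its complement; for a commutant, which is closed under adjoints, it puts \<open>v\<close> into
  the algebra.\<close>

lemma Douglas_factorization:
 fixes h a :: "'a::complex_hilbert_space => 'a"
 assumes h: "bclin h" and a: "bclin a" and le: "\<And>x. norm (a x) \<le> norm (h x)"
 obtains v where "bclin v" "\<And>x. v (h x) = a x" "\<And>x. x \<in> ortho (range h) ==> v x = 0" "\<And>x. norm (v x) \<le> norm x"
  "\<And>C C' x. bclin C ==> (\<And>x y. inner (C x) y = inner x (C' y)) ==>
   (\<And>x. C (h x) = h (C x)) ==> (\<And>x. C' (h x) = h (C' x)) ==> (\<And>x. C (a x) = a (C x)) ==> C (v x) = v (C x)"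
proof -
 define K where "K = closure (range h)"
 have "subspace (range h)" using bclin_bl[OF h] bounded_linear.linear linear_subspace_image subspace_UNIV by blast
 then have K: "csub K" by (simp add: K_def subspace_closure)
 define G where "G = {(h x, a x) | x. True}"
 have D: "Domain G = range h" by (auto simp: G_def)
 have "(0, 0) \<in> G" by (auto simp: G_def bclin_simps[OF h] bclin_simps[OF a] intro!: exI[of _ 0])
 then obtain v where v: "bclin v" "\<And>x y. (x, y) \<in> closure G ==> v x = y" "\<And>x. (pr K x, v x) \<in> closure G" "\<And>x. norm (v x) \<le> 1 * norm x"
 proof (rule extend_by_continuity[where K=1], unfold D K_def[symmetric])
  show "(x + x', y + y') \<in> G" if "(x, y) \<in> G" "(x', y') \<in> G" for x y x' y'
   using that by (auto simp: G_def simp flip: bclin_simps(1)[OF h] bclin_simps(1)[OF a])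
  show "(scaleC c x, scaleC c y) \<in> G" if "(x, y) \<in> G" for c x y using that by (auto simp: G_def simp flip: bclin_scaleC[OF h] bclin_scaleC[OF a])
 qed (auto simp: G_def le)
 show ?thesis
 proof (rule that[OF v(1)])
  show "v (h x) = a x" for x by (rule v(2), rule subsetD[OF closure_subset]) (auto simp: G_def)
  show "v x = 0" if "x \<in> ortho (range h)" for x
  proof -
   have "x \<in> ortho K" using that by (simp add: K_def ortho_closure)
   then have "pr K x = 0" using pr_zero_iff[OF K] by (auto simp: ortho_def)
   then have "(0, v x) \<in> closure G" using v(3)[of x] by simp
   then show ?thesis using v(2) bclin_simps(4)[OF v(1)] by fastforce
  qed
  show "norm (v x) \<le> norm x" for x using v(4) by simp
  fix C C' x
  assume C: "bclin C" "\<And>x y. inner (C x) y = inner x (C' y)" "\<And>x. C (h x) = h (C x)"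
   "\<And>x. C' (h x) = h (C' x)" "\<And>x. C (a x) = a (C x)"
  have C': "bclin C'" by (rule bclin_adjoint[OF C(1,2)])
  have "pr K (C x) = C (pr K x)"
  proof (rule pr_commute[OF K])
   show "C x \<in> K" if "x \<in> K" for x unfolding K_def by (rule closure_range_invariant[OF C(1,3) that[unfolded K_def]])
   show "C' x \<in> K" if "x \<in> K" for x unfolding K_def by (rule closure_range_invariant[OF C' C(4) that[unfolded K_def]])
  qed (auto simp: bclin_simps[OF C(1)] C(2))
  moreover have "(C (pr K x), C (v x)) \<in> closure G"
   by (rule closure_graph_map[OF C(1) _ v(3)]) (auto simp: G_def C)
  ultimately show "C (v x) = v (C x)" using v(2) v(3)[of "C x"] by metis
 qed
qed

section \<open>Von Neumann algebras\<close>

lemma commutant_iff: "T \<in> commutant X \<longleftrightarrow> bclin T \<and> (\<forall>S\<in>X. \<forall>x. T (S x) = S (T x))"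
 by (auto simp: commutant_def fun_eq_iff)

locale vna =
 fixes N :: "('a::complex_hilbert_space => 'a) set"
 assumes vna: "von_neumann_algebra N"
begin

abbreviation "N' \<equiv> commutant N"

lemma N_bc: "a \<in> N ==> bclin a" and N_adj: "a \<in> N ==> adj a \<in> N" using vna by (auto simp: von_neumann_algebra_def)

lemma N_iff: "a \<in> N \<longleftrightarrow> bclin a \<and> (\<forall>S\<in>N'. \<forall>x. a (S x) = S (a x))"
 using vna by (auto simp: von_neumann_algebra_def commutant_iff[of a N', symmetric])

lemma N'_bc: "S \<in> N' ==> bclin S" by (auto simp: commutant_iff)

lemma N_comm: "a \<in> N ==> S \<in> N' ==> S (a x) = a (S x)" by (auto simp: commutant_iff)

lemma N'_adj: assumes S: "S \<in> N'" shows "adj S \<in> N'" unfolding commutant_iff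
proof (intro conjI ballI allI)
 show "bclin (adj S)" by (rule bclin_adj[OF N'_bc[OF S]])
 fix a x assume a: "a \<in> N"
 show "adj S (a x) = a (adj S x)"
 proof (rule inner_eqI_right)
  fix y
  have "inner y (adj S (a x)) = inner (adj a (S y)) x" by (simp add: adj_right[OF N'_bc[OF S], symmetric] adj_left[OF N_bc[OF a]])
  also have "\<dots> = inner y (a (adj S x))" by (simp add: N_comm[OF N_adj[OF a] S, symmetric] adj_right[OF N'_bc[OF S]] adj_left[OF N_bc[OF a]])
  finally show "inner y (adj S (a x)) = inner y (a (adj S x))" .
 qed
qed

text \<open>Scalars lie in the commutant, so invariance under the commutant already contains complex
  linearity.\<close>

lemma N'_scaleC: "scaleC c \<in> N'" using bclin_scale[OF bclin_id(1), of c] by (auto simp: commutant_iff bclin_scaleC[OF N_bc])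

lemma N_id: "id \<in> N" and N_id': "(\<lambda>x. x) \<in> N" by (auto simp: N_iff bclin_id)

lemma N_zero: "(\<lambda>_. 0) \<in> N" unfolding N_iff by (simp add: bclin_zero bclin_simps(4)[OF N'_bc])

lemma N_comp: "a \<in> N ==> b \<in> N ==> a \<circ> b \<in> N" unfolding N_iff by (auto simp: bclin_comp)

lemma N_comp': "a \<in> N ==> b \<in> N ==> (\<lambda>x. a (b x)) \<in> N" using N_comp by (auto simp: comp_def)

lemma N_add: "a \<in> N ==> b \<in> N ==> (\<lambda>x. a x + b x) \<in> N"
 by (auto simp: N_iff[of "\<lambda>x. a x + b x"] bclin_add N_bc bclin_simps[OF N'_bc] N_comm[symmetric])

lemma N_scale: "a \<in> N ==> (\<lambda>x. scaleC c (a x)) \<in> N"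
 by (auto simp: N_iff[of "\<lambda>x. scaleC c (a x)"] bclin_scale N_bc bclin_scaleC[OF N'_bc] N_comm[symmetric])

lemma N_scaleR: "a \<in> N ==> (\<lambda>x. r *\<^sub>R a x) \<in> N" using N_scale[of a "complex_of_real r"] by (simp add: scaleR_scaleC)

lemma N_minus: "a \<in> N ==> (\<lambda>x. - a x) \<in> N" using N_scaleR[of a "-1"] by simp

lemma N_diff: "a \<in> N ==> b \<in> N ==> (\<lambda>x. a x - b x) \<in> N" using N_add[OF _ N_minus] by fastforce

lemma N_lim:
 assumes T: "\<And>n. T n \<in> N" "\<And>n x. norm (T n x) \<le> K * norm x" "\<And>x. (\<lambda>n. T n x) \<leadsto> S x" shows "S \<in> N"
 unfolding N_iff
proof (intro conjI ballI allI)
 show "bclin S" by (rule bclin_lim[OF N_bc[OF T(1)] T(2,3)])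
 fix R x assume R: "R \<in> N'"
 have "(\<lambda>n. R (T n x)) \<leadsto> R (S x)" by (rule bclin_tendsto[OF N'_bc[OF R] T(3)])
 then show "S (R x) = R (S x)" using T(3)[of "R x"] LIMSEQ_unique by (auto simp: N_comm[OF T(1) R])
qed

text \<open>Invariance of \<open>G\<close> under the commutant is the bicommutant condition for
  \<open>pr G\<close>: these subspaces stand for the projections of the algebra
  (\<open>pr_N\<close>).\<close>

definition aff :: "'a set => bool" where "aff G \<longleftrightarrow> csub G \<and> (\<forall>S\<in>N'. \<forall>x\<in>G. S x \<in> G)"

lemma aff_cs: "aff G ==> csub G" by (simp add: aff_def)

lemma pr_N'_comm: "aff G ==> S \<in> N' ==> pr G (S x) = S (pr G x)" by (rule pr_commute[where S'="adj S"])
  (auto simp: aff_def bclin_simps[OF N'_bc] adj_right[OF N'_bc] N'_adj)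

lemma pr_bc: "aff G ==> bclin (pr G)" using bounded_linear_pr[OF aff_cs] pr_N'_comm[OF _ N'_scaleC] by (auto simp: bounded_clinear_def)

lemma pr_N: "aff G ==> pr G \<in> N" by (auto simp: N_iff pr_bc pr_N'_comm)

lemma pr_adj: "aff G ==> adj (pr G) = pr G" by (rule adj_selfadjoint) (auto simp: pr_bc pr_sym aff_cs)

lemma aff_ortho: "aff G ==> aff (ortho G)" using csub_ortho[of G] unfolding aff_def by (auto simp: ortho_def adj_right[OF N'_bc] N'_adj)

lemma aff_Int: "aff G ==> aff H ==> aff (G \<inter> H)" by (auto simp: aff_def subspace_inter)

lemma aff_INT: "(\<And>i. aff (G i)) ==> aff (\<Inter>i. G i)" by (auto simp: aff_def subspace_def)

lemma aff_UNIV: "aff UNIV" and aff_zero: "aff {0}" using bclin_simps(4)[OF N'_bc] by (auto simp: aff_def)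

section \<open>Kernels, closed ranges and square roots in the algebra\<close>

definition ker :: "('a => 'a) => 'a set" where "ker a = {x. a x = 0}"

lemma aff_ker: assumes a: "a \<in> N" shows "aff (ker a)" unfolding aff_def ker_def
proof (intro conjI ballI)
 show "closed {x. a x = 0}" by (intro closed_Collect_eq linear_continuous_on[OF bclin_bl[OF N_bc[OF a]]] continuous_on_const)
qed (auto simp: subspace_def bclin_simps[OF N_bc[OF a]] bclin_simps[OF N'_bc]
  N_comm[OF a, symmetric])

abbreviation "clran (a :: 'a => 'a) \<equiv> closure (range a)"

lemma ortho_range: "a \<in> N ==> ortho (range a) = ker (adj a)"
proof -
 assume a: "a \<in> N"
 have "x \<in> ortho (range a) \<longleftrightarrow> (\<forall>y. inner (adj a x) y = 0)" for x by (auto simp: ortho_def adj_left[OF N_bc[OF a]])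
 then show ?thesis by (auto simp: ker_def)
qed

lemma clran_ortho: "a \<in> N ==> clran a = ortho (ker (adj a))"
proof -
 assume a: "a \<in> N"
 have "subspace (range a)" using bclin_bl[OF N_bc[OF a]] bounded_linear.linear linear_subspace_image subspace_UNIV by blast
 then have "csub (clran a)" by (simp add: subspace_closure)
 from ortho_ortho[OF this] show ?thesis by (simp add: ortho_closure ortho_range[OF a])
qed

lemma aff_clran: "a \<in> N ==> aff (clran a)" by (simp add: clran_ortho aff_ortho aff_ker N_adj)

text \<open>One square root serves two purposes: for \<open>b = 0\<close> it is the absolute value
  of \<open>a\<close>, and in general it generates the left ideal spanned by \<open>a\<close> and
  \<open>b\<close>. The clause about \<open>C\<close> is kept because spectral projections must
  commute with everything that commutes with \<open>adj a a\<close>, not only with the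
  commutant.\<close>

lemma sqrt_sum_squares:
 assumes a: "a \<in> N" and b: "b \<in> N"
 obtains h where "h \<in> N" "\<And>x y. inner (h x) y = inner x (h y)" "\<And>x. 0 \<le> inner (h x) x"
  "\<And>x. h (h x) = adj a (a x) + adj b (b x)" "\<And>C x. bclin C ==> (\<And>y. C (adj a (a y) + adj b (b y)) = adj a (a (C y)) + adj b (b (C y)))
   ==> C (h x) = h (C x)"
proof -
 note ba = N_bc[OF a] and bb = N_bc[OF b]
 obtain A where A: "A > 0" "\<And>x. norm (a x) \<le> A * norm x" by (rule bclin_bound[OF ba]) (rule that)
 obtain A' where A': "A' > 0" "\<And>x. norm (b x) \<le> A' * norm x" by (rule bclin_bound[OF bb]) (rule that)
 define K where "K = A + A'"
 have K: "K > 0" using A A' by (simp add: K_def)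
 define D where "D x = (1/K) *\<^sub>R (a x, b x)" for x
 have nD: "norm (D x) \<le> norm x" for x
 proof -
  have "norm (a x, b x) \<le> norm (a x) + norm (b x)" by (simp add: norm_Pair real_le_lsqrt power2_sum)
  also have "\<dots> \<le> K * norm x" using A(2)[of x] A'(2)[of x] by (simp add: K_def algebra_simps)
  finally show ?thesis unfolding D_def using K by (simp only: norm_scaleR) (simp add: field_simps)
 qed
 \<comment> \<open>The scaled pair map \<open>D\<close> is a contraction and \<open>T\<close>
   represents the form \<open>inner (D x) (D y)\<close>. Hence \<open>1 - T\<close> is a
   self-adjoint contraction, and \<open>operator_sqrt\<close> applied to it returns a square root of
   \<open>T\<close>.\<close>
 define T where "T = (\<lambda>x. (1/K\<^sup>2) *\<^sub>R (adj a (a x) + adj b (b x)))"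
 have TN: "T \<in> N" unfolding T_def by (intro N_scaleR N_add N_comp'[OF N_adj[OF a] a] N_comp'[OF N_adj[OF b] b])
 have TD: "inner (T x) y = inner (D x) (D y)" for x y using K by (simp add: T_def D_def inner_add_left adj_left[OF ba] adj_left[OF bb]
    power2_eq_square field_simps)
 have nT: "norm (T x) \<le> norm (D x)" for x
 proof -
  have "norm (T x) * norm (T x) = inner (D x) (D (T x))" by (simp add: TD[symmetric] power2_norm_eq_inner[symmetric] power2_eq_square)
  also have "\<dots> \<le> norm (D x) * norm (T x)"
   using norm_cauchy_schwarz[of "D x" "D (T x)"] mult_left_mono[OF nD[of "T x"], of "norm (D x)"] by simp
  finally show ?thesis by (cases "T x = 0") auto
 qed
 let ?B = "\<lambda>x. x - T x"
 have "norm (x - T x) \<le> norm x" for x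
 proof (rule power2_le_imp_le)
  have "(norm (x - T x))\<^sup>2 = (norm x)\<^sup>2 - 2 * inner (T x) x + (norm (T x))\<^sup>2"
   by (simp add: power2_norm_eq_inner inner_diff_right inner_commute)
  also have "\<dots> = (norm x)\<^sup>2 - 2 * (norm (D x))\<^sup>2 + (norm (T x))\<^sup>2" by (simp add: TD power2_norm_eq_inner)
  also have "\<dots> \<le> (norm x)\<^sup>2" using power_mono[OF nT[of x] norm_ge_zero, of 2] zero_le_power2[of "norm (D x)"] by linarith
  finally show "(norm (x - T x))\<^sup>2 \<le> (norm x)\<^sup>2" .
 qed simp
 moreover have "inner (x - T x) y = inner x (y - T y)" for x y
  using TD[of x y] TD[of y x] by (simp add: inner_diff_right inner_commute)
 moreover have "bclin ?B" by (rule N_bc) (rule N_diff[OF N_id' TN])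
 ultimately obtain S where S: "bclin S" "\<And>x y. inner (S x) y = inner x (S y)" "\<And>x. 0 \<le> inner (S x) x" "\<And>x. S (S x) = x - ?B x"
  and comm: "\<And>C x. bclin C ==> (\<And>y. C (?B y) = ?B (C y)) ==> C (S x) = S (C x)" using operator_sqrt[of ?B] by blast
 have "S \<in> N" unfolding N_iff using S(1) comm[OF N'_bc] by (auto simp: bclin_simps[OF N'_bc] N_comm[OF TN])
 then have "(\<lambda>x. K *\<^sub>R S x) \<in> N" by (rule N_scaleR)
 then show ?thesis
 proof (rule that)
  show "K *\<^sub>R S (K *\<^sub>R S x) = adj a (a x) + adj b (b x)" for x
   using K by (simp add: bclin_simps[OF S(1)] S(4)) (simp add: T_def power2_eq_square)
  fix C x assume C: "bclin C" "\<And>y. C (adj a (a y) + adj b (b y)) = adj a (a (C y)) + adj b (b (C y))"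
  have "C (S x) = S (C x)" by (rule comm[OF C(1)]) (simp add: T_def bclin_simps(2,3)[OF C(1)] C(2))
  then show "C (K *\<^sub>R S x) = K *\<^sub>R S (C x)" by (simp add: bclin_simps[OF C(1)])
 qed (use S K in auto)
qed

lemma sqrt_square:
 assumes a: "a \<in> N"
 obtains h where "h \<in> N" "\<And>x y. inner (h x) y = inner x (h y)" "\<And>x. 0 \<le> inner (h x) x" "\<And>x. h (h x) = adj a (a x)"
  "\<And>C x. bclin C ==> (\<And>y. C (adj a (a y)) = adj a (a (C y))) ==> C (h x) = h (C x)"
proof (rule sqrt_sum_squares[OF a N_zero])
 have z: "adj (\<lambda>_::'a. 0::'a) = (\<lambda>_. 0)" by (rule adj_selfadjoint) (auto simp: bclin_zero)
 fix h
 assume h: "h \<in> N" "\<And>x y. inner (h x) y = inner x (h y)" "\<And>x. 0 \<le> inner (h x) x"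
  "\<And>x. h (h x) = adj a (a x) + adj (\<lambda>_. 0) 0"
  "\<And>C x. bclin C ==> (\<And>y. C (adj a (a y) + adj (\<lambda>_. 0) 0) = adj a (a (C y)) + adj (\<lambda>_. 0) 0)
   ==> C (h x) = h (C x)"
 show thesis by (rule that[OF h(1-3) h(4-5)[unfolded z add_0_right]])
qed

text \<open>An inverse commutes with everything that \<open>M\<close> commutes with, so it stays in
  the algebra.\<close>

lemma N_sa_inverse:
 assumes M: "M \<in> N" and sa: "\<And>x y. inner (M x) y = inner x (M y)" and c: "c > 0" "\<And>x. c * norm x \<le> norm (M x)"
 obtains W where "W \<in> N" "\<And>x. W (M x) = x" "\<And>x. M (W x) = x"
proof -
 obtain W where W: "bclin W" "\<And>x. W (M x) = x" "\<And>x. M (W x) = x" using bounded_below_inverse[OF N_bc[OF M] sa c] by blast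
 have "W (S x) = S (W x)" if "S \<in> N'" for S x using N_comm[OF M that, of "W x"] W(2)[of "S (W x)"] W(3)[of x] by simp
 then have "W \<in> N" using W(1) by (auto simp: N_iff)
 with W that show ?thesis by blast
qed

lemma N_Douglas:
 assumes h: "h \<in> N" and a: "a \<in> N" and le: "\<And>x. norm (a x) \<le> norm (h x)"
 obtains v where "v \<in> N" "\<And>x. v (h x) = a x" "\<And>x. x \<in> ortho (range h) ==> v x = 0" "\<And>x. norm (v x) \<le> norm x"
proof -
 obtain v where v: "bclin v" "\<And>x. v (h x) = a x" "\<And>x. x \<in> ortho (range h) ==> v x = 0" "\<And>x. norm (v x) \<le> norm x"
  "\<And>C C' x. bclin C ==> (\<And>x y. inner (C x) y = inner x (C' y)) ==>
   (\<And>x. C (h x) = h (C x)) ==> (\<And>x. C' (h x) = h (C' x)) ==> (\<And>x. C (a x) = a (C x)) ==> C (v x) = v (C x)"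
  proof (rule Douglas_factorization[OF N_bc[OF h] N_bc[OF a] le], goal_cases)
   case (1 v) show ?case by (rule that[OF 1(2-)])
  qed
 have "S (v x) = v (S x)" if S: "S \<in> N'" for S x by (rule v(5)[OF N'_bc[OF S] adj_right[OF N'_bc[OF S]]]) (auto intro!: N_comm h a S N'_adj)
 then have "v \<in> N" using v(1) by (auto simp: N_iff)
 with v that show ?thesis by blast
qed

text \<open>\<open>G\<close> plays the role of the spectral subspace of \<open>adj a a\<close> above
  \<open>\<delta>\<^sup>2\<close>: on \<open>G\<close> the element \<open>a\<close> is bounded below
  by \<open>\<delta>\<close> and has the left inverse \<open>y\<close>, on the complement it is
  bounded by \<open>\<delta>\<close>.\<close>

lemma spectral_projection:
 assumes a: "a \<in> N" and d: "\<delta> > 0"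
 obtains G y where "aff G" "y \<in> N" "\<And>x. y (a x) = pr G x"
  "\<And>x. x \<in> G ==> \<delta> * norm x \<le> norm (a x)" "\<And>x. x \<in> ortho G ==> norm (a x) \<le> \<delta> * norm x"
  "\<And>C x. bclin C ==> (\<And>y. C (adj a (a y)) = adj a (a (C y))) ==> C (pr G x) = pr G (C x)"
proof -
 note ba = N_bc[OF a]
 define T where "T = (\<lambda>x. adj a (a x))"
 define k where "k = (\<lambda>x. T x - \<delta>\<^sup>2 *\<^sub>R x)"
 have TN: "T \<in> N" unfolding T_def by (rule N_comp'[OF N_adj[OF a] a])
 have kN: "k \<in> N" unfolding k_def by (intro N_diff TN N_scaleR N_id')
 note bk = N_bc[OF kN] and bT = N_bc[OF TN]
 have Tsa: "inner (T x) y = inner x (T y)" for x y by (simp add: T_def adj_left[OF ba] adj_right[OF ba])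
 have ksa: "inner (k x) y = inner x (k y)" for x y by (simp add: k_def inner_diff_left inner_diff_right Tsa)
 have kadj: "adj k = k" by (rule adj_selfadjoint[OF bk ksa])
 obtain m where m: "m \<in> N" "\<And>x y. inner (m x) y = inner x (m y)" "\<And>x. 0 \<le> inner (m x) x"
  "\<And>x. m (m x) = k (k x)" and mcomm: "\<And>C x. bclin C ==> (\<And>y. C (k (k y)) = k (k (C y))) ==> C (m x) = m (C x)"
  proof (rule sqrt_square[OF kN, unfolded kadj], goal_cases)
   case (1 m) show ?case by (rule that[OF 1(2-)])
  qed
 note bm = N_bc[OF m(1)]
 \<comment> \<open>As \<open>m\<close> is the absolute value of \<open>k\<close>, this is twice the
   positive part of \<open>k\<close>. On its kernel \<open>k = - m\<close> is negative.\<close>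
 define p where "p = (\<lambda>x. m x + k x)"
 have pN: "p \<in> N" unfolding p_def by (intro N_add m kN)
 note bp = N_bc[OF pN]
 have padj: "adj p = p" by (rule adj_selfadjoint[OF bp]) (simp add: p_def inner_add_left inner_add_right m ksa)
 define G where "G = clran p"
 have G: "aff G" unfolding G_def by (rule aff_clran[OF pN])
 note cG = aff_cs[OF G]
 have oG: "ortho G = ker p" by (simp add: G_def ortho_closure ortho_range[OF pN] padj)
 have comm: "C (pr G x) = pr G (C x)" if C: "bclin C" "\<And>y. C (adj a (a y)) = adj a (a (C y))" for C x
 proof -
  have Ck: "C (k x) = k (C x)" for x using C(2)[of x] by (simp add: k_def T_def bclin_simps[OF C(1)])
  have Cm: "C (m x) = m (C x)" for x by (rule mcomm[OF C(1)]) (simp add: Ck)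
  have Cp: "C (p x) = p (C x)" for x by (simp add: p_def Ck Cm bclin_simps[OF C(1)])
  have "C x \<in> G" if "x \<in> G" for x using closure_range_invariant[of C p, OF C(1) Cp] that by (simp add: G_def)
  moreover have "C x \<in> ortho G" if "x \<in> ortho G" for x using that by (simp add: oG ker_def Cp[symmetric] bclin_simps[OF C(1)])
  ultimately have "pr G (C (pr G x)) = C (pr G x)" "pr G (C (x - pr G x)) = 0"
   using pr_in[OF cG] pr_in[OF csub_ortho, of G] pr_id[OF cG] pr_ortho[OF cG] by (force simp: pr_zero_iff[OF cG] ortho_def pr_ortho[OF cG])+
  then show ?thesis by (simp add: bclin_simps[OF C(1)] pr_diff[OF cG])
 qed
 have km: "m (k x) = k (m x)" for x by (rule mcomm[OF bk, symmetric]) simp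
 have norm_a: "(norm (a x))\<^sup>2 = inner (k x) x + \<delta>\<^sup>2 * (norm x)\<^sup>2" for x
  by (simp add: k_def T_def inner_diff_left adj_left[OF ba] power2_norm_eq_inner)
 have lo: "norm (a x) \<le> \<delta> * norm x" if "x \<in> ortho G" for x
 proof (rule power2_le_imp_le)
  have "m x + k x = 0" using that by (simp add: oG ker_def p_def)
  then have "k x = - m x" by (simp add: eq_neg_iff_add_eq_0 add.commute)
  then show "(norm (a x))\<^sup>2 \<le> (\<delta> * norm x)\<^sup>2" using m(3)[of x] by (simp add: norm_a power_mult_distrib)
 qed (use d in simp)
 have hi: "\<delta> * norm x \<le> norm (a x)" if "x \<in> G" for x
 proof (rule power2_le_imp_le)
  \<comment> \<open>\<open>m\<close> and \<open>k\<close> commute, so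
    \<open>(m - k) (m + k) = m\<^sup>2 - k\<^sup>2 = 0\<close>; hence \<open>k = m\<close> is
    positive on the closed range of \<open>p\<close>.\<close>
  have "range p \<subseteq> ker (\<lambda>x. m x - k x)" by (auto simp: ker_def p_def bclin_simps[OF bk] bclin_simps[OF bm] m(4) km)
  then have "G \<subseteq> ker (\<lambda>x. m x - k x)" unfolding G_def
   using aff_cs[OF aff_ker[OF N_diff[OF m(1) kN]]] by (intro closure_minimal) auto
  then have "m x = k x" using that by (auto simp: ker_def)
  then show "(\<delta> * norm x)\<^sup>2 \<le> (norm (a x))\<^sup>2" using m(3)[of x] by (simp add: norm_a power_mult_distrib)
 qed simp
 have Tp: "T (pr G x) = pr G (T x)" for x by (rule comm[OF bT]) (simp add: T_def)
 \<comment> \<open>\<open>M\<close> is \<open>T\<close> on \<open>G\<close> and the identity on the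
   complement, so it is bounded below by the smaller of \<open>\<delta>\<^sup>2\<close> and 1. Its
   inverse \<open>W\<close> sends \<open>pr G (T x) = M (pr G x)\<close> to \<open>pr G x\<close>,
   which makes \<open>W \<circ> pr G \<circ> adj a\<close> the left inverse sought.\<close>
 define M where "M = (\<lambda>x. T (pr G x) + (x - pr G x))"
 have MN: "M \<in> N" unfolding M_def by (intro N_add N_comp'[OF TN pr_N[OF G]] N_diff pr_N[OF G] N_id')
 have Msa: "inner (M x) y = inner x (M y)" for x y
  by (simp add: M_def inner_add_left inner_add_right inner_diff_left inner_diff_right pr_sym[OF cG] Tsa Tp)
 define c where "c = min 1 (\<delta>\<^sup>2)"
 have c0: "c > 0" using d by (simp add: c_def)
 have nM: "c * norm x \<le> norm (M x)" for x
 proof (cases "x = 0")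
  case False
  let ?u = "pr G x" and ?w = "x - pr G x"
  have "inner (M x) x = inner (T ?u) ?u + inner ?w ?w"
  proof -
   have "inner (T ?u) x = inner (T ?u) ?u" using pr_sym[OF cG, of "T x" x] pr_pr[OF cG, of "T x"] pr_sym[OF cG, of "pr G (T x)" x] by (simp add: Tp)
   moreover have "inner ?w x = inner ?w ?w" using pr_orth[OF cG pr_in[OF cG], of x x] by (simp add: inner_diff_right)
   ultimately show ?thesis by (simp add: M_def inner_add_left)
  qed
  also have "inner (T ?u) ?u = (norm (a ?u))\<^sup>2" by (simp add: T_def norm_adj_comp[OF ba])
  finally have Mx: "inner (M x) x = (norm (a ?u))\<^sup>2 + inner ?w ?w" .
  have "c * (norm ?u)\<^sup>2 \<le> (norm (a ?u))\<^sup>2"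
  proof -
   have "c * (norm ?u)\<^sup>2 \<le> \<delta>\<^sup>2 * (norm ?u)\<^sup>2" by (intro mult_right_mono) (auto simp: c_def)
   also have "\<dots> = (\<delta> * norm ?u)\<^sup>2" by (simp add: power_mult_distrib)
   also have "\<dots> \<le> (norm (a ?u))\<^sup>2" using hi[OF pr_in[OF cG]] d by (intro power_mono) auto
   finally show ?thesis .
  qed
  moreover have "inner ?w ?w \<ge> c * (norm ?w)\<^sup>2" using mult_right_mono[of c 1 "(norm ?w)\<^sup>2"] by (simp add: power2_norm_eq_inner c_def)
  ultimately have "c * (norm x)\<^sup>2 \<le> inner (M x) x" using norm_pr_Pythagoras[OF cG, of x] Mx by (simp add: distrib_left)
  also have "\<dots> \<le> norm (M x) * norm x" by (rule norm_cauchy_schwarz)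
  finally show ?thesis using False by (simp add: power2_eq_square)
 qed (simp add: bclin_simps[OF N_bc[OF MN]])
 obtain W where W: "W \<in> N" "\<And>x. W (M x) = x" "\<And>x. M (W x) = x" by (rule N_sa_inverse[OF MN Msa c0 nM]) (rule that)
 have "W (pr G (adj a (a x))) = pr G x" for x
 proof -
  have "M (pr G x) = pr G (T x)" by (simp add: M_def pr_pr[OF cG] Tp)
  then show ?thesis using W(2)[of "pr G x"] by (simp add: T_def)
 qed
 then show ?thesis by (intro that[of G "\<lambda>x. W (pr G (adj a x))"] G hi lo comm
    N_comp'[OF W(1) N_comp'[OF pr_N[OF G] N_adj[OF a]]])
qed

text \<open>Let \<open>h\<close> be the square root of \<open>adj a a + adj b b\<close>. Then
  \<open>norm (a x)\<close> and \<open>norm (b x)\<close> are at most \<open>norm (h x)\<close>, so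
  \<open>a = v1 h\<close> and \<open>b = v2 h\<close> by \<open>N_Douglas\<close>; conversely
  \<open>h = adj v1 a + adj v2 b\<close>. Thus \<open>h\<close> generates the left ideal of
  \<open>a\<close> and \<open>b\<close>.\<close>

lemma Bezout:
 assumes a: "a \<in> N" and b: "b \<in> N"
 obtains h v1 v2 w1 w2 where "h \<in> N" "v1 \<in> N" "v2 \<in> N" "w1 \<in> N" "w2 \<in> N"
  "\<And>x. v1 (h x) = a x" "\<And>x. v2 (h x) = b x" "\<And>x. h x = w1 (a x) + w2 (b x)"
proof -
 note ba = N_bc[OF a] and bb = N_bc[OF b]
 obtain h where h: "h \<in> N" "\<And>x y. inner (h x) y = inner x (h y)" "\<And>x. h (h x) = adj a (a x) + adj b (b x)"
  by (rule sqrt_sum_squares[OF a b]) (rule that; assumption)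
 have nh: "(norm (h x))\<^sup>2 = (norm (a x))\<^sup>2 + (norm (b x))\<^sup>2" for x
  by (simp add: power2_norm_eq_inner h(2) inner_commute[of x] h(3) inner_add_left adj_left[OF ba] adj_left[OF bb])
 have "norm (a x) \<le> norm (h x)" "norm (b x) \<le> norm (h x)" for x by (rule power2_le_imp_le; simp add: nh)+
 then have le: "\<And>x. norm (a x) \<le> norm (h x)" "\<And>x. norm (b x) \<le> norm (h x)" by auto
 obtain v1 where v1: "v1 \<in> N" "\<And>x. v1 (h x) = a x" "\<And>x. x \<in> ortho (range h) ==> v1 x = 0"
  by (rule N_Douglas[OF h(1) a le(1)]) (rule that)
 obtain v2 where v2: "v2 \<in> N" "\<And>x. v2 (h x) = b x" "\<And>x. x \<in> ortho (range h) ==> v2 x = 0"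
  by (rule N_Douglas[OF h(1) b le(2)]) (rule that)
 have "adj v1 (a x) + adj v2 (b x) = h x" for x
 proof -
  \<comment> \<open>The defect \<open>z\<close> is orthogonal to the range of \<open>h\<close>,
    where \<open>v1\<close> and \<open>v2\<close> are zero on the complement; so it is orthogonal to
    each of its own three summands.\<close>
  define z where "z = adj v1 (a x) + adj v2 (b x) - h x"
  have zh: "inner z (h y) = 0" for y
  proof -
   have "inner (h x) (h y) = inner (a x) (a y) + inner (b x) (b y)"
    by (simp add: h(2)[of "h x" y, symmetric] h(3) inner_add_left adj_left[OF ba] adj_left[OF bb])
   then show ?thesis by (simp add: z_def inner_diff_left inner_add_left adj_left[OF N_bc] v1 v2)
  qed
  then have "z \<in> ortho (range h)" by (auto simp: ortho_def)
  then have "inner z (adj v1 (a x)) = 0" "inner z (adj v2 (b x)) = 0"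
   by (auto simp: v1(3) v2(3) adj_right[OF N_bc[OF v1(1)], symmetric] adj_right[OF N_bc[OF v2(1)], symmetric])
  then have "inner z z = 0" using zh[of x] by (simp add: z_def inner_diff_right inner_add_right)
  then show ?thesis by (simp add: z_def)
 qed
 then show ?thesis by (intro that[of h v1 v2 "adj v1" "adj v2"] h(1) v1 v2 N_adj) simp
qed

text \<open>\<open>v\<close> is the partial isometry of the polar decomposition, obtained by
  factoring \<open>a\<close> through its absolute value \<open>h\<close>. It is a Murray-von Neumann
  equivalence between the complement of the kernel and the closed range.\<close>

lemma polar_equivalence:
 assumes a: "a \<in> N"
 obtains v where "v \<in> N" "\<And>x. adj v (v x) = pr (ortho (ker a)) x" "\<And>x. v (adj v x) = pr (clran a) x"
  "\<And>x. v (adj v (v x)) = v x" "\<And>x. adj v (v (adj v x)) = adj v x"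
proof -
 note ba = N_bc[OF a]
 obtain h where h: "h \<in> N" "\<And>x y. inner (h x) y = inner x (h y)" "\<And>x. h (h x) = adj a (a x)"
  by (rule sqrt_square[OF a]) (rule that; assumption)
 have hadj: "adj h = h" by (rule adj_selfadjoint[OF N_bc]) (auto simp: h)
 have nh: "norm (a x) = norm (h x)" for x by (rule power2_eq_imp_eq) (simp_all add: power2_norm_eq_inner h inner_commute[of x] adj_left[OF ba])
 obtain v where v: "v \<in> N" "\<And>x. v (h x) = a x" "\<And>x. x \<in> ortho (range h) ==> v x = 0"
  by (rule N_Douglas[OF h(1) a eq_refl[OF nh]]) (rule that)
 note bv = N_bc[OF v(1)]
 have kerh: "ker h = ker a" unfolding ker_def by (metis nh norm_eq_zero)
 have K: "clran h = ortho (ker a)" by (simp add: clran_ortho[OF h(1)] hadj kerh)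
 have cK: "csub (clran h)" by (rule aff_cs[OF aff_clran[OF h(1)]])
 have oh: "ortho (clran h) = ortho (range h)" by (rule ortho_closure)
 have v_pr: "v (pr (clran h) x) = v x" for x
 proof -
  have "x - pr (clran h) x \<in> ortho (range h)" using pr_orth[OF cK] oh by (auto simp: ortho_def)
  then show ?thesis using v(3) by (metis bclin_simps(2)[OF bv] right_minus_eq)
 qed
 have vv_h: "adj v (v (h x)) = h x" for x
 proof -
  define z where "z = adj v (v (h x)) - h x"
  have zh: "inner z (h y) = 0" for y using h(2)[of "h x" y] by (simp add: z_def inner_diff_left adj_left[OF bv] v(2) h(3) adj_left[OF ba])
  then have "z \<in> ortho (range h)" by (auto simp: ortho_def)
  then have "inner z (adj v (v (h x))) = 0" by (simp add: v(3) adj_right[OF bv, symmetric])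
  then have "inner z z = 0" using zh[of x] by (simp add: z_def inner_diff_right)
  then show ?thesis by (simp add: z_def)
 qed
 have vv: "adj v (v x) = x" if "x \<in> clran h" for x
 proof -
  have "(\<lambda>x. adj v (v x) - x) \<in> N" by (intro N_diff N_comp'[OF N_adj[OF v(1)] v(1)] N_id')
  from aff_cs[OF aff_ker[OF this]] have "clran h \<subseteq> ker (\<lambda>x. adj v (v x) - x)" by (intro closure_minimal) (auto simp: ker_def vv_h)
  then show ?thesis using that by (auto simp: ker_def)
 qed
 have 1: "adj v (v x) = pr (ortho (ker a)) x" for x using vv[OF pr_in[OF cK, of x]] unfolding v_pr by (simp only: K)
 have cA: "csub (clran a)" by (rule aff_cs[OF aff_clran[OF a]])
 have va: "v x \<in> clran a" for x
 proof -
  have "pr (clran h) x \<in> closure (range h)" by (rule pr_in[OF cK])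
  then obtain f where f: "\<And>n. f n \<in> range h" "f \<leadsto> pr (clran h) x" by (auto simp: closure_sequential)
  have "v (f n) \<in> range a" for n using f(1)[of n] v(2) by auto
  moreover have "(\<lambda>n. v (f n)) \<leadsto> v x" using bclin_tendsto[OF bv f(2)] by (simp add: v_pr)
  ultimately show ?thesis unfolding closure_sequential by (intro exI[of _ "\<lambda>n. v (f n)"]) simp
 qed
 have 2: "v (adj v x) = pr (clran a) x" for x
 proof (rule pr_unique[OF cA va, symmetric])
  fix y assume "y \<in> clran a"
  moreover have "x - v (adj v x) \<in> ortho (range a)"
  proof -
   have "inner (v (adj v x)) (a y) = inner x (a y)" for y
   proof -
    have "inner (v (adj v x)) (a y) = inner x (v (adj v (v (h y))))" by (simp add: adj_right[OF bv] adj_left[OF bv] flip: v(2))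
    moreover have "v (adj v (v (h y))) = v (h y)" by (simp only: vv_h)
    ultimately show ?thesis by (simp only: v(2))
   qed
   then show ?thesis by (auto simp: ortho_def inner_diff_left)
  qed
  ultimately show "inner (x - v (adj v x)) y = 0" using ortho_closure[of "range a"] by (auto simp: ortho_def)
 qed
 have 3: "v (adj v (v x)) = v x" for x unfolding 1 by (simp only: K[symmetric] v_pr)
 have "inner z (adj v (v (adj v x))) = inner z (adj v x)" for z x by (metis 3 adj_left[OF bv] adj_right[OF bv])
 then have 4: "adj v (v (adj v x)) = adj v x" for x by (rule inner_eqI_right)
 show ?thesis by (rule that[OF v(1) 1 2 3 4])
qed

end

section \<open>The dimension function of a finite trace\<close>

lemma pr_ortho_zero_iff: "csub G ==> pr (ortho G) x = 0 \<longleftrightarrow> x \<in> G" using pr_id_iff[of G x] by (metis pr_ortho right_minus_eq)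

text \<open>Normality takes the form of continuity from above along decreasing sequences of
  projections. This form can be verified for both instances: from suprema of self-adjoint elements
  for \<open>tr\<close>, and from strong convergence of projections for the vector functional on the
  completion.\<close>

locale tracial = vna N for N :: "('a::complex_hilbert_space => 'a) set" +
 fixes t :: "('a => 'a) => real"
 assumes t_add: "a \<in> N ==> b \<in> N ==> t (\<lambda>x. a x + b x) = t a + t b"
  and t_scale: "a \<in> N ==> t (\<lambda>x. r *\<^sub>R a x) = r * t a" and t_nonneg: "a \<in> N ==> 0 \<le> t (adj a \<circ> a)"
  and t_comm: "a \<in> N ==> b \<in> N ==> t (a \<circ> b) = t (b \<circ> a)"
  and t_faithful: "a \<in> N ==> t (adj a \<circ> a) = 0 ==> a = (\<lambda>_. 0)"
  and t_normal: "(\<And>n. aff (G n)) ==> decseq G ==> (\<And>n. c \<le> t (pr (G n))) ==> c \<le> t (pr (\<Inter>n. G n))"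
begin

lemma t_diff: "a \<in> N ==> b \<in> N ==> t (\<lambda>x. a x - b x) = t a - t b"
 using t_add[of a "\<lambda>x. - b x"] t_scale[of b "-1"] N_minus[of b] by simp

definition d :: "'a set => real" where "d G = t (pr G)"

lemma pr_comp_pr: "aff G ==> adj (pr G) \<circ> pr G = pr G" by (auto simp: pr_adj pr_pr aff_cs)

lemma d_nonneg: "aff G ==> 0 \<le> d G" using t_nonneg[of "pr G"] by (simp add: d_def pr_comp_pr pr_N)

lemma d_ortho: "aff G ==> d (ortho G) = d UNIV - d G"
proof -
 assume G: "aff G"
 have "pr (ortho G) = (\<lambda>x. pr UNIV x - pr G x)" using aff_cs[OF G] by (auto simp: pr_ortho pr_id)
 then show ?thesis using t_diff[OF pr_N[OF aff_UNIV] pr_N[OF G]] by (simp add: d_def)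
qed

text \<open>The difference \<open>q\<close> of nested projections is a projection, so
  \<open>q = adj q \<circ> q\<close> has nonnegative trace.\<close>

lemma d_mono: assumes G: "aff G" and H: "aff H" and GH: "G \<subseteq> H" shows "d G \<le> d H"
proof -
 note cG = aff_cs[OF G] and cH = aff_cs[OF H]
 let ?q = "\<lambda>x. pr H x - pr G x"
 have 1: "pr H (pr G x) = pr G x" for x by (rule pr_id[OF cH subsetD[OF GH pr_in[OF cG]]])
 have 2: "pr G (pr H x) = pr G x" for x by (rule inner_eqI_right) (simp add: pr_sym[OF cG, symmetric] pr_sym[OF cH, symmetric] 1)
 have q: "?q \<in> N" by (intro N_diff pr_N G H)
 have "adj ?q = ?q" by (rule adj_selfadjoint[OF N_bc[OF q]]) (simp add: inner_diff_left inner_diff_right pr_sym[OF cG] pr_sym[OF cH])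
 then have "adj ?q \<circ> ?q = ?q" by (auto simp: pr_diff[OF cG] pr_diff[OF cH] pr_pr cG cH 1 2)
 then show ?thesis using t_nonneg[OF q] t_diff[OF pr_N[OF H] pr_N[OF G]] by (simp add: d_def)
qed

lemma d_zero: "d {0} = 0" using d_ortho[OF aff_zero] by (auto simp: ortho_def)

lemma d_eq_0: "aff G ==> d G = 0 ==> G = {0}"
proof -
 assume G: "aff G" and "d G = 0"
 then have "pr G = (\<lambda>_. 0)" using t_faithful[OF pr_N[OF G]] by (simp add: d_def pr_comp_pr)
 then show ?thesis using pr_id[OF aff_cs[OF G]] subspace_0[of G] aff_cs[OF G] by (metis insertI1 singletonD subsetI subset_antisym insert_subset)
qed

lemma d_le_UNIV: "aff G ==> d G \<le> d UNIV" by (rule d_mono) (auto simp: aff_UNIV)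

text \<open>Equivalent projections \<open>v \<circ> adj v\<close> and \<open>adj v \<circ> v\<close>
  have the same trace.\<close>

lemma d_rank: assumes a: "a \<in> N" shows "d (clran a) + d (ker a) = d UNIV"
proof -
 obtain v where v: "v \<in> N" "\<And>x. adj v (v x) = pr (ortho (ker a)) x" "\<And>x. v (adj v x) = pr (clran a) x"
  by (rule polar_equivalence[OF a]) (rule that)
 have "d (clran a) = t (v \<circ> adj v)" by (simp add: d_def comp_def v)
 also have "\<dots> = t (adj v \<circ> v)" by (rule t_comm[OF v(1) N_adj[OF v(1)]])
 also have "\<dots> = d (ortho (ker a))" by (simp add: d_def comp_def v)
 also have "\<dots> = d UNIV - d (ker a)" by (rule d_ortho[OF aff_ker[OF a]])
 finally show ?thesis by simp
qed

text \<open>The kernel of \<open>pr (ortho H) \<circ> pr G\<close> is the orthogonal sum of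
  \<open>ortho G\<close> and \<open>G \<inter> H\<close>, while its range lies in
  \<open>ortho H\<close>; rank and nullity then give the estimate.\<close>

lemma d_Int: assumes G: "aff G" and H: "aff H" shows "d G + d H - d UNIV \<le> d (G \<inter> H)"
proof -
 note cG = aff_cs[OF G] and cH = aff_cs[OF H] and GH = aff_Int[OF G H]
 note cGH = aff_cs[OF GH]
 let ?a = "\<lambda>x. pr (ortho H) (pr G x)"
 have a: "?a \<in> N" by (rule N_comp'[OF pr_N[OF aff_ortho[OF H]] pr_N[OF G]])
 have ka: "ker ?a = {x. pr G x \<in> H}" by (simp add: ker_def pr_ortho_zero_iff[OF cH])
 have "pr (ker ?a) x = x - pr G x + pr (G \<inter> H) x" for x
 proof (rule pr_unique[OF aff_cs[OF aff_ker[OF a]]])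
  have "pr G (x - pr G x + pr (G \<inter> H) x) = pr (G \<inter> H) x"
   using pr_in[OF cGH, of x] by (simp add: pr_add[OF cG] pr_diff[OF cG] pr_pr[OF cG] pr_id[OF cG])
  then show "x - pr G x + pr (G \<inter> H) x \<in> ker ?a" using pr_in[OF cGH, of x] by (simp add: ka)
  fix y assume "y \<in> ker ?a"
  then have y: "pr G y \<in> G \<inter> H" using pr_in[OF cG] by (auto simp: ka)
  have "inner (pr G x - pr (G \<inter> H) x) y = inner (pr G (pr G x - pr (G \<inter> H) x)) y"
   using pr_in[OF cGH, of x] by (simp add: pr_diff[OF cG] pr_pr[OF cG] pr_id[OF cG])
  also have "\<dots> = inner (x - pr (G \<inter> H) x) (pr G y) - inner (x - pr G x) (pr G y)" by (simp add: pr_sym[OF cG] inner_diff_left)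
  also have "\<dots> = 0" using pr_orth[OF cGH y] pr_orth[OF cG pr_in[OF cG]] by simp
  finally show "inner (x - (x - pr G x + pr (G \<inter> H) x)) y = 0" by simp
 qed
 then have "pr (ker ?a) = (\<lambda>x. pr (ortho G) x + pr (G \<inter> H) x)" by (auto simp: pr_ortho[OF cG])
 then have "d (ker ?a) = d (ortho G) + d (G \<inter> H)" using t_add[OF pr_N[OF aff_ortho[OF G]] pr_N[OF GH]] by (simp add: d_def)
 moreover have "d (clran ?a) \<le> d (ortho H)" using csub_ortho[of H] pr_in[OF csub_ortho, of H]
  by (intro d_mono aff_clran[OF a] aff_ortho H closure_minimal) auto
 ultimately show ?thesis using d_rank[OF a] d_ortho[OF G] d_ortho[OF H] by simp
qed

text \<open>Codimension is countably subadditive: finitely many steps by \<open>d_Int\<close>, the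
  limit by normality.\<close>

lemma d_INT:
 fixes G :: "nat => 'a set"
 assumes G: "\<And>n. aff (G n)" "\<And>n. d UNIV - e n \<le> d (G n)" and e: "\<And>k. (\<Sum>n<k. e n) \<le> E"
 shows "d UNIV - E \<le> d (\<Inter>n. G n)"
proof -
 define H where "H k = (\<Inter>n. if n < k then G n else UNIV)" for k :: nat
 have H: "aff (H k)" for k unfolding H_def by (rule aff_INT) (simp add: G aff_UNIV)
 have H0: "H 0 = UNIV" and HS: "H (Suc k) = G k \<inter> H k" for k by (auto simp: H_def less_Suc_eq split: if_splits)
 have dH: "d UNIV - (\<Sum>n<k. e n) \<le> d (H k)" for k
 proof (induction k)
  case (Suc k)
  then show ?case using d_Int[OF G(1)[of k] H[of k]] G(2)[of k] by (simp add: HS)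
 qed (simp add: H0)
 have "d UNIV - E \<le> d (H k)" for k using e[of k] dH[of k] by linarith
 then have "d UNIV - E \<le> t (pr (H k))" for k by (simp add: d_def)
 moreover have "decseq H" by (rule decseq_SucI) (simp add: HS)
 ultimately have "d UNIV - E \<le> t (pr (\<Inter>k. H k))" by (intro t_normal H)
 moreover have "(\<Inter>k. H k) = (\<Inter>n. G n)" by (auto simp: H_def split: if_splits)
 ultimately show ?thesis by (simp add: d_def)
qed

lemma spectral_sequence:
 assumes a: "a \<in> N"
 obtains G y where "\<And>n::nat. aff (G n)" "\<And>n. y n \<in> N" "\<And>n x. y n (a x) = pr (G n) x" "incseq G"
  "\<And>n x. x \<in> ortho (G n) ==> norm (a x) \<le> 1 / Suc n * norm x"
  "\<And>\<epsilon>. \<epsilon> > 0 ==> \<exists>n. d UNIV - d (ker a) - \<epsilon> < d (G n)"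
proof -
 note ba = N_bc[OF a]
 define P where "P n G y \<longleftrightarrow> aff G \<and> y \<in> N \<and> (\<forall>x. y (a x) = pr G x) \<and> (\<forall>x\<in>G. 1 / Suc n * norm x \<le> norm (a x)) \<and>
  (\<forall>x\<in>ortho G. norm (a x) \<le> 1 / Suc n * norm x) \<and>
  (\<forall>C x. bclin C \<longrightarrow> (\<forall>y. C (adj a (a y)) = adj a (a (C y))) \<longrightarrow> C (pr G x) = pr G (C x))" for n G y
 have "\<exists>G y. P n G y" for n
 proof (rule spectral_projection[OF a, of "1 / Suc n"], goal_cases)
  case (2 G y) then show ?case by (intro exI[of _ G] exI[of _ y]) (simp add: P_def)
 qed simp
 then obtain G y where "\<And>n. P n (G n) (y n)" by metis
 then have G: "\<And>n. aff (G n)" "\<And>n. y n \<in> N" "\<And>n x. y n (a x) = pr (G n) x"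
  "\<And>n x. x \<in> G n ==> 1 / Suc n * norm x \<le> norm (a x)" "\<And>n x. x \<in> ortho (G n) ==> norm (a x) \<le> 1 / Suc n * norm x"
  and comm: "\<And>n C x. bclin C ==> (\<forall>y. C (adj a (a y)) = adj a (a (C y))) ==> C (pr (G n) x) = pr (G n) (C x)" unfolding P_def by blast+
 have T: "bclin (\<lambda>x. adj a (a x))" by (rule N_bc) (rule N_comp'[OF N_adj[OF a] a])
 note cG = aff_cs[OF G(1)] and oG = csub_ortho
 \<comment> \<open>The spectral projections commute, so the part \<open>?z\<close> of
   \<open>x\<close> outside \<open>G (Suc n)\<close> still lies in \<open>G n\<close>. There the
   lower bound \<open>1 / Suc n\<close> and the upper bound \<open>1 / Suc (Suc n)\<close> are
   compatible only with \<open>?z = 0\<close>.\<close>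
 have sub: "G n \<subseteq> G (Suc n)" for n
 proof
  fix x assume x: "x \<in> G n"
  let ?m = "Suc n"
  let ?z = "x - pr (G ?m) x"
  have "pr (G n) (pr (G ?m) x) = pr (G ?m) (pr (G n) x)" using comm[OF pr_bc[OF G(1)], of n ?m x] comm[OF T, of n] by simp
  then have "pr (G n) ?z = ?z" by (simp add: pr_diff[OF cG] pr_id[OF cG x])
  then have "1 / Suc n * norm ?z \<le> norm (a ?z)" using G(4) pr_id_iff[OF cG] by blast
  also have "\<dots> \<le> 1 / Suc ?m * norm ?z" by (rule G(5)) (use pr_in[OF oG, of "G ?m" x] pr_ortho[OF cG] in auto)
  finally have "(1 / Suc n - 1 / Suc ?m) * norm ?z \<le> 0" by (simp add: algebra_simps)
  moreover have "0 < 1 / real (Suc n) - 1 / Suc ?m" by (simp add: field_simps add_pos_nonneg)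
  ultimately have "norm ?z \<le> 0" by (simp add: mult_le_0_iff)
  then show "x \<in> G ?m" using pr_in[OF cG, of ?m x] by simp
 qed
 have inc: "incseq G" by (rule incseq_SucI) (rule sub)
 \<comment> \<open>Otherwise every complement has dimension at least
   \<open>d (ker a) + \<epsilon>\<close>, and by normality so has their intersection. But that
   intersection lies in the kernel, the norm of \<open>a\<close> on it being at most
   \<open>1 / Suc n\<close> for every \<open>n\<close>.\<close>
 have "\<exists>n. d UNIV - d (ker a) - \<epsilon> < d (G n)" if e: "\<epsilon> > 0" for \<epsilon>
 proof (rule ccontr)
  assume "\<not> ?thesis"
  then have "\<not> d UNIV - d (ker a) - \<epsilon> < d (G n)" for n by blast
  note nl = this
  have "d (ker a) + \<epsilon> \<le> d (ortho (G n))" for n using d_ortho[OF G(1)[of n]] nl[of n] by linarith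
  then have le: "d (ker a) + \<epsilon> \<le> t (pr (ortho (G n)))" for n by (simp add: d_def)
  have "decseq (\<lambda>n. ortho (G n))" using sub by (intro decseq_SucI) (auto simp: ortho_def)
  then have "d (ker a) + \<epsilon> \<le> d (\<Inter>n. ortho (G n))" unfolding d_def[of "\<Inter>n. _ n"] by (intro t_normal aff_ortho G(1) le)
  also have "\<dots> \<le> d (ker a)"
  proof (intro d_mono aff_INT aff_ortho G(1) aff_ker a subsetI)
   fix x assume x: "x \<in> (\<Inter>n. ortho (G n))"
   have "norm (a x) \<le> 0"
   proof (rule LIMSEQ_le_const)
    have "(\<lambda>n. 1 / real (Suc n) * norm x) \<leadsto> 0 * norm x" using LIMSEQ_Suc[OF lim_1_over_n] by (intro tendsto_intros) simp
    then show "(\<lambda>n. 1 / real (Suc n) * norm x) \<leadsto> 0" by simp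
    show "\<exists>N. \<forall>n\<ge>N. norm (a x) \<le> 1 / real (Suc n) * norm x" using G(5) x by blast
   qed
   then show "x \<in> ker a" by (simp add: ker_def)
  qed
  finally show False using e by simp
 qed
 then show ?thesis by (intro that[of G y] G inc)
qed

text \<open>Essential density with respect to the trace. Unlike norm density it is stable under
  finite intersections and under preimages, which is what sums and products of unbounded operators
  require.\<close>

definition tdense :: "'a set => bool" where
 "tdense D \<longleftrightarrow> (\<forall>\<epsilon>>0. \<exists>G. aff G \<and> G \<subseteq> D \<and> d UNIV - \<epsilon> < d G)"

lemma tdense_UNIV: "tdense UNIV" unfolding tdense_def using aff_UNIV by force

lemma tdense_mono: "tdense D ==> D \<subseteq> E ==> tdense E" unfolding tdense_def by (meson order_trans)

lemma tdense_Int: assumes "tdense D" "tdense E" shows "tdense (D \<inter> E)" unfolding tdense_def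
proof (intro allI impI)
 fix \<epsilon> :: real assume "\<epsilon> > 0"
 then have e: "\<epsilon> / 2 > 0" by simp
 obtain G where G: "aff G" "G \<subseteq> D" "d UNIV - \<epsilon> / 2 < d G" using assms(1) e unfolding tdense_def by blast
 obtain H where H: "aff H" "H \<subseteq> E" "d UNIV - \<epsilon> / 2 < d H" using assms(2) e unfolding tdense_def by blast
 show "\<exists>G. aff G \<and> G \<subseteq> D \<inter> E \<and> d UNIV - \<epsilon> < d G"
  using d_Int[OF G(1) H(1)] G H aff_Int[OF G(1) H(1)] by (intro exI[of _ "G \<inter> H"]) auto
qed

lemma tdense_meets: assumes D: "tdense D" and G: "aff G" "G \<noteq> {0}" shows "\<exists>x. x \<noteq> 0 \<and> x \<in> D \<and> x \<in> G"
proof -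
 have "d G > 0" using d_eq_0[OF G(1)] G(2) d_nonneg[OF G(1)] by force
 then obtain H where H: "aff H" "H \<subseteq> D" "d UNIV - d G < d H" using D unfolding tdense_def by blast
 have "G \<inter> H \<noteq> {0}" using d_Int[OF G(1) H(1)] H(3) d_zero by auto
 moreover have "0 \<in> G \<inter> H" using aff_cs[OF aff_Int[OF G(1) H(1)]] subspace_0 by blast
 ultimately show ?thesis using H(2) by blast
qed

text \<open>The vector lies in the complements of subspaces with codimension at most
  \<open>1 / Suc n\<close>, so in an affiliated subspace of dimension 0, and the trace is
  faithful.\<close>

lemma tdense_ortho: assumes D: "tdense D" and x: "x \<in> ortho D" shows "x = 0"
proof -
 have "\<exists>G. aff G \<and> G \<subseteq> D \<and> d UNIV - 1 / Suc n < d G" for n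
  using D unfolding tdense_def by (metis of_nat_0_less_iff zero_less_Suc zero_less_divide_1_iff)
 then obtain G where G: "\<And>n::nat. aff (G n)" "\<And>n. G n \<subseteq> D" "\<And>n. d UNIV - 1 / Suc n < d (G n)" by metis
 let ?K = "\<Inter>n. ortho (G n)"
 have K: "aff ?K" by (intro aff_INT aff_ortho G)
 have "d ?K \<le> 1 / Suc n" for n using d_mono[OF K aff_ortho[OF G(1)[of n]]] d_ortho[OF G(1)[of n]] G(3)[of n] by force
 then have "d ?K \<le> 0" using LIMSEQ_le_const[OF LIMSEQ_Suc[OF lim_1_over_n]] by force
 then have "?K = {0}" using d_eq_0[OF K] d_nonneg[OF K] by simp
 moreover have "x \<in> ?K" using x G(2) by (fastforce simp: ortho_def)
 ultimately show ?thesis by blast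
qed

text \<open>For an affiliated \<open>G\<close> inside \<open>D\<close>, the preimage of
  \<open>G\<close> is the kernel of \<open>pr (ortho G) \<circ> a\<close>; by rank and nullity its
  codimension is at most that of \<open>G\<close>.\<close>

lemma tdense_vimage: assumes a: "a \<in> N" and D: "tdense D" shows "tdense {x. a x \<in> D}" unfolding tdense_def
proof (intro allI impI)
 fix \<epsilon> :: real assume "\<epsilon> > 0"
 then obtain G where G: "aff G" "G \<subseteq> D" "d UNIV - \<epsilon> < d G" using D unfolding tdense_def by blast
 note cG = aff_cs[OF G(1)]
 let ?b = "\<lambda>x. pr (ortho G) (a x)"
 have b: "?b \<in> N" by (rule N_comp'[OF pr_N[OF aff_ortho[OF G(1)]] a])
 have "d (clran ?b) \<le> d (ortho G)" using csub_ortho[of G] pr_in[OF csub_ortho, of G]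
  by (intro d_mono aff_clran[OF b] aff_ortho G closure_minimal) auto
 then have "d UNIV - \<epsilon> < d (ker ?b)" using d_rank[OF b] d_ortho[OF G(1)] G(3) by simp
 moreover have "ker ?b \<subseteq> {x. a x \<in> D}" using G(2) by (auto simp: ker_def pr_ortho_zero_iff[OF cG])
 ultimately show "\<exists>G. aff G \<and> G \<subseteq> {x. a x \<in> D} \<and> d UNIV - \<epsilon> < d G" using aff_ker[OF b] by blast
qed

end

text \<open>The norms of the projections of \<open>x\<close> decrease, and by Pythagoras the
  distance of two projections is controlled by the difference of the squared norms.\<close>

lemma pr_decreasing_limit:
 fixes G :: "nat => 'a::{real_inner,complete_space} set"
 assumes G: "\<And>n. csub (G n)" and dec: "decseq G" shows "(\<lambda>n. pr (G n) x) \<leadsto> pr (\<Inter>n. G n) x"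
proof -
 define a where "a n = (norm (pr (G n) x))\<^sup>2" for n
 have step: "(norm (pr (G m) x - pr (G n) x))\<^sup>2 = a m - a n" if "m \<le> n" for m n
 proof -
  have "pr (G n) x \<in> G m" using pr_in[OF G] decseqD[OF dec that] by blast
  then have 1: "inner (pr (G m) x) (pr (G n) x) = inner x (pr (G n) x)" by (simp add: pr_sym[OF G] pr_id[OF G])
  show ?thesis using 1 pr_inner_self[OF G, of n x] by (simp add: a_def power2_norm_eq_inner inner_diff_right inner_commute)
 qed
 have "a n \<le> a m" if "m \<le> n" for m n using step[OF that] zero_le_power2[of "norm (pr (G m) x - pr (G n) x)"] by linarith
 then have da: "decseq a" by (auto simp: decseq_def)
 then obtain l where al: "a \<leadsto> l" by (rule decseq_convergent[of a 0]) (auto simp: a_def)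
 have "\<exists>l. (\<lambda>n. pr (G n) x) \<leadsto> l"
 proof (rule convergent_if_dist_le)
  have "(\<lambda>n. sqrt (a n - l)) \<leadsto> sqrt (l - l)" by (intro tendsto_intros al)
  then show "(\<lambda>n. sqrt (a n - l)) \<leadsto> 0" by simp
  fix m n :: nat assume "n \<le> m"
  then show "dist (pr (G m) x) (pr (G n) x) \<le> sqrt (a n - l)"
   using step[of n m] decseq_ge[OF da al, of m] by (intro real_le_rsqrt) (simp add: dist_norm norm_minus_commute)
 qed
 then obtain l where l: "(\<lambda>n. pr (G n) x) \<leadsto> l" ..
 have cI: "csub (\<Inter>n. G n)" using G by (auto simp: subspace_def)
 have "l \<in> G m" for m
 proof (rule closed_sequentially)
  show "closed (G m)" using G by simp
  show "(\<lambda>n. pr (G (n + m)) x) \<leadsto> l" by (rule LIMSEQ_ignore_initial_segment[OF l])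
  show "pr (G (n + m)) x \<in> G m" for n using pr_in[OF G] decseqD[OF dec, of m "n + m"] by auto
 qed
 moreover have "inner (x - l) h = 0" if h: "h \<in> (\<Inter>n. G n)" for h
 proof (rule LIMSEQ_unique)
  show "(\<lambda>n. inner (x - pr (G n) x) h) \<leadsto> inner (x - l) h" by (intro tendsto_intros l)
  have "inner (x - pr (G n) x) h = 0" for n using h pr_orth[OF G] by blast
  then show "(\<lambda>n. inner (x - pr (G n) x) h) \<leadsto> 0" by simp
 qed
 ultimately have "pr (\<Inter>n. G n) x = l" by (intro pr_unique[OF cI]) auto
 with l show ?thesis by simp
qed

lemma pr_pr_subset:
 assumes G: "csub G" and H: "csub H" and GH: "G \<subseteq> H" shows "pr G (pr H x) = pr G x" by (rule inner_eqI_right)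
  (simp add: pr_sym[OF G, symmetric] pr_sym[OF H, symmetric] pr_id[OF H subsetD[OF GH pr_in[OF G]]])

lemma pr_inner_mono:
 assumes G: "csub G" and H: "csub H" and GH: "G \<subseteq> H" shows "inner (pr G x) x \<le> inner (pr H x) x"
 using norm_pr_le[OF G, of "pr H x"] by (simp add: pr_inner_self G H pr_pr_subset[OF assms])

section \<open>Trace inequalities\<close>

context tracial
begin

text \<open>With \<open>c\<close> the square root of \<open>1 - adj a a / K\<^sup>2\<close>, the
  difference of the two sides is, up to the factor \<open>K\<^sup>2\<close>, the trace of
  \<open>adj (c \<circ> b) \<circ> (c \<circ> b)\<close>.\<close>

lemma t_contraction:
 assumes a: "a \<in> N" and b: "b \<in> N" and K: "K > 0" "\<And>x. norm (a x) \<le> K * norm x"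
 shows "t (adj (a \<circ> b) \<circ> (a \<circ> b)) \<le> K\<^sup>2 * t (adj b \<circ> b)"
proof -
 note ba = N_bc[OF a] and bb = N_bc[OF b]
 let ?B = "\<lambda>x. (1 / K\<^sup>2) *\<^sub>R adj a (a x)"
 have BN: "?B \<in> N" by (intro N_scaleR N_comp'[OF N_adj[OF a] a])
 have aa: "(norm (adj a (a x))) \<le> K * norm (a x)" for x
 proof (cases "adj a (a x) = 0")
  case False
  have "norm (adj a (a x)) * norm (adj a (a x)) = inner (a x) (a (adj a (a x)))"
   by (simp add: adj_left[OF ba, symmetric] power2_norm_eq_inner[symmetric] power2_eq_square)
  also have "\<dots> \<le> norm (a x) * (K * norm (adj a (a x)))" by (rule order_trans[OF norm_cauchy_schwarz mult_left_mono[OF K(2)]]) simp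
  finally show ?thesis using False by (simp add: mult.commute)
 qed (use K in simp)
 have nB: "norm (?B x) \<le> norm x" for x
 proof -
  have "norm (adj a (a x)) \<le> K * (K * norm x)" by (rule order_trans[OF aa mult_left_mono[OF K(2)]]) (use K in simp)
  then show ?thesis using K(1) by (simp add: field_simps power2_eq_square)
 qed
 have saB: "inner (?B x) y = inner x (?B y)" for x y by (simp add: adj_left[OF ba] adj_right[OF ba])
 obtain c where c: "bclin c" "\<And>x y. inner (c x) y = inner x (c y)" "\<And>x. c (c x) = x - ?B x"
  and comm: "\<And>C x. bclin C ==> (\<And>y. C (?B y) = ?B (C y)) ==> C (c x) = c (C x)"
 proof (rule operator_sqrt[OF N_bc[OF BN] saB nB], goal_cases)
  case (1 S) show ?case by (rule 1(1)[OF 1(2,3,5,6)])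
 qed
 have cN: "c \<in> N" unfolding N_iff
 proof (intro conjI ballI allI)
  fix S x assume S: "S \<in> N'"
  show "c (S x) = S (c x)" by (rule comm[OF N'_bc[OF S] N_comm[OF BN S], symmetric])
 qed (rule c(1))
 have cadj: "adj c = c" by (rule adj_selfadjoint[OF c(1,2)])
 have "adj (c \<circ> b) \<circ> (c \<circ> b) = (\<lambda>x. (adj b \<circ> b) x - (1 / K\<^sup>2) *\<^sub>R (adj (a \<circ> b) \<circ> (a \<circ> b)) x)"
  by (auto simp: adj_comp[OF c(1) bb] adj_comp[OF ba bb] cadj c(3) bclin_simps[OF bclin_adj[OF bb]])
 moreover have "0 \<le> t (adj (c \<circ> b) \<circ> (c \<circ> b))" by (rule t_nonneg[OF N_comp[OF cN b]])
 ultimately have "0 \<le> t (\<lambda>x. (adj b \<circ> b) x - (1 / K\<^sup>2) *\<^sub>R (adj (a \<circ> b) \<circ> (a \<circ> b)) x)" by simp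
 also have "\<dots> = t (adj b \<circ> b) - (1 / K\<^sup>2) * t (adj (a \<circ> b) \<circ> (a \<circ> b))"
 proof -
  have 1: "adj b \<circ> b \<in> N" and 2: "adj (a \<circ> b) \<circ> (a \<circ> b) \<in> N" by (auto intro: N_comp N_adj a b)
  show ?thesis by (simp only: t_diff[OF 1 N_scaleR[OF 2]] t_scale[OF 2])
 qed
 finally show ?thesis using K(1) by (simp add: field_simps)
qed

text \<open>\<open>N_Douglas\<close> yields a contraction \<open>v\<close> with
  \<open>v \<circ> c = \<delta> pr G\<close>, and contractions do not increase the trace of the
  square.\<close>

lemma t_bounded_below:
 assumes G: "aff G" and c: "c \<in> N" and dl: "\<delta> > 0" "\<And>x. \<delta> * norm (pr G x) \<le> norm (c x)"
 shows "\<delta>\<^sup>2 * d G \<le> t (adj c \<circ> c)"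
proof -
 have p: "(\<lambda>x. \<delta> *\<^sub>R pr G x) \<in> N" by (intro N_scaleR pr_N G)
 have "norm (\<delta> *\<^sub>R pr G x) \<le> norm (c x)" for x using dl by simp
 then have le: "\<And>x. norm (\<delta> *\<^sub>R pr G x) \<le> norm (c x)" .
 obtain v where v: "v \<in> N" "\<And>x. v (c x) = \<delta> *\<^sub>R pr G x" "\<And>x. norm (v x) \<le> norm x"
  by (rule N_Douglas[OF c p le]) (rule that)
 have vc: "v \<circ> c = (\<lambda>x. \<delta> *\<^sub>R pr G x)" using v(2) by auto
 have "adj (v \<circ> c) = v \<circ> c" unfolding vc by (rule adj_selfadjoint[OF N_bc[OF p]]) (simp add: pr_sym[OF aff_cs[OF G]])
 then have "adj (v \<circ> c) \<circ> (v \<circ> c) = (\<lambda>x. (\<delta>\<^sup>2) *\<^sub>R pr G x)"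
  by (auto simp: vc pr_scale[OF aff_cs[OF G]] pr_pr[OF aff_cs[OF G]] power2_eq_square)
 then show ?thesis using t_contraction[OF v(1) c, of 1] v(3) t_scale[OF pr_N[OF G]] by (simp add: d_def)
qed

text \<open>A noncommutative Chebyshev inequality: \<open>G\<close> is the spectral subspace where
  \<open>c\<close> is at least \<open>\<delta>\<close>.\<close>

lemma Chebyshev:
 assumes c: "c \<in> N" and dl: "\<delta> > 0"
 obtains G where "aff G" "\<And>x. x \<in> ortho G ==> norm (c x) \<le> \<delta> * norm x" "\<delta>\<^sup>2 * d G \<le> t (adj c \<circ> c)"
proof (rule spectral_projection[OF c dl], goal_cases)
 case (1 G y)
 note bc = N_bc[OF c] and G = 1(2) and cG = aff_cs[OF 1(2)]
 have T: "bclin (\<lambda>x. adj c (c x))" by (rule N_bc) (rule N_comp'[OF N_adj[OF c] c])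
 have comm: "adj c (c (pr G x)) = pr G (adj c (c x))" for x by (rule 1(7)[OF T]) simp
 have "\<delta> * norm (pr G x) \<le> norm (c x)" for x
 proof -
  \<comment> \<open>Because \<open>pr G\<close> commutes with \<open>adj c c\<close>, the images
    under \<open>c\<close> of the two parts of \<open>x\<close> are orthogonal; hence
    \<open>c\<close> is at least as large on \<open>x\<close> as on \<open>pr G x\<close>.\<close>
  have "inner (c (pr G x)) (c (x - pr G x)) = inner (adj c (c (pr G x))) (x - pr G x)" by (simp add: adj_left[OF bc])
  also have "\<dots> = 0" by (simp add: comm pr_sym[OF cG] pr_diff[OF cG] pr_pr[OF cG])
  finally have z: "inner (c (pr G x)) (c (x - pr G x)) = 0" .
  have "c (pr G x + (x - pr G x)) = c (pr G x) + c (x - pr G x)" by (rule bclin_simps(1)[OF bc])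
  then have "(norm (c x))\<^sup>2 = (norm (c (pr G x) + c (x - pr G x)))\<^sup>2" by simp
  also have "\<dots> = (norm (c (pr G x)))\<^sup>2 + (norm (c (x - pr G x)))\<^sup>2"
   using z by (simp add: power2_norm_eq_inner inner_add_right inner_commute)
  finally have "(norm (c (pr G x)))\<^sup>2 \<le> (norm (c x))\<^sup>2" by simp
  then have "norm (c (pr G x)) \<le> norm (c x)" by (rule power2_le_imp_le) simp
  then show ?thesis using 1(5)[OF pr_in[OF cG], of x] by simp
 qed
 from t_bounded_below[OF G c dl this] show ?case by (intro that[OF G 1(6)])
qed

text \<open>Recovers an operator bound on the given space from a bound in the trace norm. For
  \<open>\<delta> > K\<close>, testing the hypothesis at the spectral projection \<open>G\<close> of
  \<open>b\<close> above \<open>\<delta>\<close> gives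
  \<open>\<delta>\<^sup>2 * d G \<le> K\<^sup>2 * d G\<close>, so \<open>G\<close> is zero.\<close>

lemma norm_le_if_t_le:
 assumes b: "b \<in> N" and K: "0 < K"
  and le: "\<And>c. c \<in> N ==> t (adj (b \<circ> c) \<circ> (b \<circ> c)) \<le> K\<^sup>2 * t (adj c \<circ> c)"
 shows "norm (b x) \<le> K * norm x"
proof -
 have *: "norm (b x) \<le> \<delta> * norm x" if dl: "\<delta> > K" for \<delta>
 proof (rule spectral_projection[OF b order.strict_trans[OF K dl]], goal_cases)
  case (1 G y)
  note G = 1(1) and cG = aff_cs[OF 1(1)]
  have "\<delta>\<^sup>2 * d G \<le> t (adj (b \<circ> pr G) \<circ> (b \<circ> pr G))"
   using 1(4)[OF pr_in[OF cG]] dl K by (intro t_bounded_below[OF G N_comp[OF b pr_N[OF G]]]) auto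
  also have "\<dots> \<le> K\<^sup>2 * d G" using le[OF pr_N[OF G]] by (simp add: pr_comp_pr[OF G] d_def)
  finally have "(\<delta>\<^sup>2 - K\<^sup>2) * d G \<le> 0" by (simp add: algebra_simps)
  moreover have "\<delta>\<^sup>2 - K\<^sup>2 > 0" using dl K by (simp add: power_strict_mono)
  ultimately have "d G = 0" using d_nonneg[OF G] by (simp add: mult_le_0_iff)
  then have "G = {0}" by (rule d_eq_0[OF G])
  then show ?case by (intro 1(5)) (simp add: ortho_def)
 qed
 show ?thesis
 proof (rule field_le_epsilon)
  fix e :: real assume "e > 0"
  show "norm (b x) \<le> K * norm x + e"
  proof (cases "x = 0")
   case False
   then have "K + e / norm x > K" using \<open>e > 0\<close> by simp
   from *[OF this] False show ?thesis by (simp add: distrib_right)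
  qed (use \<open>e > 0\<close> bclin_simps[OF N_bc[OF b]] in simp)
 qed
qed

end


lemma scaleC_minus_one: "scaleC (-1) x = - (x :: 'a::complex_hilbert_space)" using scaleR_scaleC[of "-1" x] by simp

section \<open>The regular representation\<close>

locale regular_representation =
 fixes A :: "('a::complex_hilbert_space => 'a) set" and tr :: "('a => 'a) => complex"
  and \<Lambda> :: "('a => 'a) => 'k::complex_hilbert_space"
 assumes finite_vn: "finite_von_neumann_algebra A tr" and completion: "l2_completion A tr \<Lambda>"
begin

sublocale vna A using finite_vn by unfold_locales (simp add: finite_von_neumann_algebra_def)

abbreviation "tt a \<equiv> Re (tr a)"

lemma tr_add: "a \<in> A ==> b \<in> A ==> tr (\<lambda>x. a x + b x) = tr a + tr b"
 and tr_scale: "a \<in> A ==> tr (\<lambda>x. scaleC c (a x)) = c * tr a"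
 and tr_nonneg: "a \<in> A ==> tr (adj a \<circ> a) \<in> \<real>\<^sub>\<ge>\<^sub>0"
 and tr_comm: "a \<in> A ==> b \<in> A ==> tr (a \<circ> b) = tr (b \<circ> a)"
 and tr_faithful: "a \<in> A ==> tr (adj a \<circ> a) = 0 ==> a = (\<lambda>_. 0)"
 using finite_vn unfolding finite_von_neumann_algebra_def trace_on_def faithful_on_def by blast+

lemma tr_normal: "D \<noteq> {} ==> D \<subseteq> A ==> \<forall>d\<in>D. self_adjoint d ==> is_sa_sup A D s ==>
  \<forall>d\<in>D. \<forall>e\<in>D. \<exists>f\<in>D. op_le d f \<and> op_le e f ==> tt s = (SUP d\<in>D. tt d)"
 using finite_vn unfolding finite_von_neumann_algebra_def normal_on_def by blast

text \<open>\<open>op_le\<close> demands that a complex inner product be a nonnegative real; for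
  self-adjoint elements its imaginary part vanishes automatically.\<close>

lemma op_le_iff: "a \<in> A ==> b \<in> A ==> adj a = a ==> adj b = b ==>
  op_le a b \<longleftrightarrow> (\<forall>x. inner (a x) x \<le> inner (b x) x)"
proof -
 assume a: "a \<in> A" and b: "b \<in> A" and s: "adj a = a" "adj b = b"
 have "cinner (b x - a x) x = cnj (cinner (b x - a x) x)" for x
 proof -
  have m: "(\<lambda>x. b x - a x) \<in> A" by (rule N_diff[OF b a])
  have "adj (\<lambda>x. b x - a x) = (\<lambda>x. b x - a x)" by (rule adj_selfadjoint[OF N_bc[OF m]])
    (metis (no_types, lifting) adj_right[OF N_bc[OF a]] adj_right[OF N_bc[OF b]] inner_diff_left inner_diff_right s)
  with adj_cinner[OF N_bc[OF m], of x x] show ?thesis by (metis cinner_commute)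
 qed
 then have "Im (cinner (b x - a x) x) = 0" for x by (metis complex_eq_iff cnj.simps(2) equal_neg_zero)
 then show "op_le a b \<longleftrightarrow> (\<forall>x. inner (a x) x \<le> inner (b x) x)"
  by (simp add: op_le_def complex_nonneg_Reals_iff inner_cinner[symmetric] inner_diff_left)
qed

lemma pr_self_adjoint: "aff G ==> self_adjoint (pr G)" by (simp add: self_adjoint_def pr_adj)

text \<open>The complements of a decreasing sequence of projections increase strongly to the
  complement of the intersection, which is therefore their supremum among the self-adjoint elements;
  normality applies to this directed family.\<close>

lemma trace_normal:
 assumes G: "\<And>n. aff (G n)" and dec: "decseq G" and c: "\<And>n. c \<le> tt (pr (G n))" shows "c \<le> tt (pr (\<Inter>n. G n))"
proof -
 let ?I = "\<Inter>n. G n"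
 have I: "aff ?I" by (rule aff_INT[OF G])
 let ?D = "range (\<lambda>n. pr (ortho (G n)))" and ?s = "pr (ortho ?I)"
 note oG = aff_ortho[OF G] and oI = aff_ortho[OF I]
 have lim: "(\<lambda>n. pr (ortho (G n)) x) \<leadsto> ?s x" for x unfolding pr_ortho[OF aff_cs[OF G]] pr_ortho[OF aff_cs[OF I]]
  by (intro tendsto_intros pr_decreasing_limit aff_cs G dec)
 have mono: "inner (pr (ortho (G m)) x) x \<le> inner (pr (ortho (G n)) x) x" if "m \<le> n" for m n x
 proof -
  have "ortho (G m) \<subseteq> ortho (G n)" using decseqD[OF dec that] by (auto simp: ortho_def)
  then show ?thesis by (rule pr_inner_mono[OF aff_cs[OF oG] aff_cs[OF oG]])
 qed
 have le: "inner (pr (ortho (G m)) x) x \<le> inner (?s x) x" for m x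
  by (rule LIMSEQ_le_const[OF tendsto_inner[OF lim tendsto_const]]) (use mono in blast)
 have sa: "self_adjoint d \<and> d \<in> A" if "d \<in> ?D" for d using that pr_self_adjoint[OF oG] pr_N[OF oG] by auto
 have "is_sa_sup A ?D ?s" unfolding is_sa_sup_def
 proof (intro conjI ballI impI)
  show "?s \<in> A" "self_adjoint ?s" by (auto simp: pr_N pr_self_adjoint oI)
  show "op_le d ?s" if "d \<in> ?D" for d using that le by (auto simp: op_le_iff pr_N pr_adj oG oI)
  fix b assume b: "b \<in> A" "self_adjoint b \<and> (\<forall>d\<in>?D. op_le d b)"
  have "inner (?s x) x \<le> inner (b x) x" for x by (rule LIMSEQ_le_const2[OF tendsto_inner[OF lim tendsto_const]])
    (use b in \<open>auto simp: op_le_iff pr_N pr_adj oG self_adjoint_def\<close>)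
  then show "op_le ?s b" using b by (simp add: op_le_iff pr_N pr_adj oI self_adjoint_def)
 qed
 moreover have "\<forall>d\<in>?D. \<forall>e\<in>?D. \<exists>f\<in>?D. op_le d f \<and> op_le e f"
 proof (intro ballI)
  fix d e assume "d \<in> ?D" "e \<in> ?D"
  then obtain m n where mn: "d = pr (ortho (G m))" "e = pr (ortho (G n))" by auto
  show "\<exists>f\<in>?D. op_le d f \<and> op_le e f"
   by (rule bexI[of _ "pr (ortho (G (max m n)))"]) (auto simp: mn op_le_iff pr_N pr_adj oG intro: mono)
 qed
 ultimately have sup: "tt ?s = (SUP d\<in>?D. tt d)" by (intro tr_normal) (use sa in auto)
 have split: "tt (pr (ortho H)) = tt (pr UNIV) - tt (pr H)" if H: "aff H" for H
 proof -
  have "(\<lambda>x. pr (ortho H) x + pr H x) = pr UNIV" using aff_cs[OF H] by (auto simp: pr_ortho pr_id)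
  then show ?thesis using tr_add[OF pr_N[OF aff_ortho[OF H]] pr_N[OF H]] by simp
 qed
 have "(SUP d\<in>?D. tt d) \<le> tt (pr UNIV) - c"
 proof (rule cSUP_least)
  fix b assume "b \<in> ?D"
  then obtain n where "b = pr (ortho (G n))" by blast
  then show "tt b \<le> tt (pr UNIV) - c" using split[OF G[of n]] c[of n] by simp
 qed simp
 then show ?thesis using sup split[OF I] by simp
qed

sublocale tracial A "\<lambda>a. Re (tr a)"
proof
 fix a b and r :: real
 assume a: "a \<in> A"
 show "tt (\<lambda>x. r *\<^sub>R a x) = r * tt a" using tr_scale[OF a, of "complex_of_real r"] by (simp add: scaleR_scaleC)
 show "0 \<le> tt (adj a \<circ> a)" using tr_nonneg[OF a] by (simp add: complex_nonneg_Reals_iff)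
 show "a = (\<lambda>_. 0)" if "tt (adj a \<circ> a) = 0"
  using tr_nonneg[OF a] that by (intro tr_faithful[OF a]) (simp add: complex_nonneg_Reals_iff complex_eq_iff)
 assume b: "b \<in> A"
 show "tt (\<lambda>x. a x + b x) = tt a + tt b" by (simp add: tr_add[OF a b])
 show "tt (a \<circ> b) = tt (b \<circ> a)" by (simp add: tr_comm[OF a b])
qed (rule trace_normal)

section \<open>The completion and left multiplication on it\<close>

lemma Lam_add: "a \<in> A ==> b \<in> A ==> \<Lambda> (\<lambda>x. a x + b x) = \<Lambda> a + \<Lambda> b"
 and Lam_scale: "a \<in> A ==> \<Lambda> (\<lambda>x. scaleC c (a x)) = scaleC c (\<Lambda> a)"
 and Lam_cinner: "a \<in> A ==> b \<in> A ==> cinner (\<Lambda> a) (\<Lambda> b) = tr (a \<circ> adj b)"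
 and Lam_dense: "closure (\<Lambda> ` A) = UNIV" using completion unfolding l2_completion_def by blast+

lemma Lam_inner: "a \<in> A ==> b \<in> A ==> inner (\<Lambda> a) (\<Lambda> b) = tt (a \<circ> adj b)" by (simp add: inner_cinner Lam_cinner)

lemma Lam_norm: "a \<in> A ==> (norm (\<Lambda> a))\<^sup>2 = tt (adj a \<circ> a)" by (simp add: power2_norm_eq_inner Lam_inner t_comm N_adj)

lemma Lam_diff: "a \<in> A ==> b \<in> A ==> \<Lambda> (\<lambda>x. a x - b x) = \<Lambda> a - \<Lambda> b"
 using Lam_add[of a "\<lambda>x. - b x"] Lam_scale[of b "-1"] N_minus[of b] by (simp add: scaleC_minus_one)

lemma Lam_eq_0: "a \<in> A ==> \<Lambda> a = 0 ==> a = (\<lambda>_. 0)" using Lam_norm[of a] t_faithful[of a] by simp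

lemma tendsto_Lam: obtains f where "\<And>n::nat. f n \<in> A" "(\<lambda>n. \<Lambda> (f n)) \<leadsto> y"
proof -
 have "y \<in> closure (\<Lambda> ` A)" by (simp add: Lam_dense)
 then obtain g where g: "\<And>n. g n \<in> \<Lambda> ` A" "g \<leadsto> y" by (auto simp: closure_sequential)
 then have "\<forall>n. \<exists>a\<in>A. g n = \<Lambda> a" by blast
 then obtain f where "\<And>n. f n \<in> A" "\<And>n. g n = \<Lambda> (f n)" by metis
 moreover from this(2) have "g = (\<lambda>n. \<Lambda> (f n))" by auto
 ultimately show ?thesis using that[of f] g(2) by simp
qed

lemma eq_on_Lam:
 assumes S: "bclin S" and T: "bclin T" and eq: "\<And>a. a \<in> A ==> S (\<Lambda> a) = T (\<Lambda> a)" shows "S = T"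
proof
 fix y
 obtain f where f: "\<And>n::nat. f n \<in> A" "(\<lambda>n. \<Lambda> (f n)) \<leadsto> y" by (rule tendsto_Lam[of y]) (rule that)
 from bclin_tendsto[OF S f(2)] bclin_tendsto[OF T f(2)]
 show "S y = T y" by (simp add: eq f(1) LIMSEQ_unique)
qed

lemma extend_operator:
 fixes g :: "('a => 'a) => 'k"
 assumes add: "\<And>a b. a \<in> A ==> b \<in> A ==> g (\<lambda>x. a x + b x) = g a + g b"
  and scale: "\<And>a c. a \<in> A ==> g (\<lambda>x. scaleC c (a x)) = scaleC c (g a)"
  and K: "K > 0" "\<And>a. a \<in> A ==> norm (g a) \<le> K * norm (\<Lambda> a)" shows "\<exists>T. bclin T \<and> (\<forall>a\<in>A. T (\<Lambda> a) = g a)"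
proof -
 define G where "G = {(\<Lambda> a, g a) | a. a \<in> A}"
 have GI: "(\<Lambda> a, g a) \<in> G" if "a \<in> A" for a using that by (auto simp: G_def)
 have "(0, 0) \<in> G" using GI[OF N_zero] Lam_add[OF N_zero N_zero] add[OF N_zero N_zero] by simp
 then obtain T where T: "bclin T" "\<And>x y. (x, y) \<in> closure G ==> T x = y"
 proof (rule extend_by_continuity[where K=K])
  show "(x + x', y + y') \<in> G" if "(x, y) \<in> G" "(x', y') \<in> G" for x y x' y'
  proof -
   from that obtain a b where "a \<in> A" "b \<in> A" "x = \<Lambda> a" "y = g a" "x' = \<Lambda> b" "y' = g b" by (auto simp: G_def)
   then show ?thesis using GI[OF N_add[of a b]] by (simp add: Lam_add add)
  qed
  show "(scaleC c x, scaleC c y) \<in> G" if "(x, y) \<in> G" for c x y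
  proof -
   from that obtain a where "a \<in> A" "x = \<Lambda> a" "y = g a" by (auto simp: G_def)
   then show ?thesis using GI[OF N_scale[of a c]] by (simp add: Lam_scale scale)
  qed
 qed (use K in \<open>auto simp: G_def\<close>)
 have "T (\<Lambda> a) = g a" if "a \<in> A" for a by (rule T(2)[OF subsetD[OF closure_subset GI[OF that]]])
 with T(1) show ?thesis by blast
qed

definition L :: "('a => 'a) => 'k => 'k" where "L = left_mult A \<Lambda>"

lemma Lam_left_bound:
 assumes a: "a \<in> A" and b: "b \<in> A" and K: "K > 0" "\<And>x. norm (a x) \<le> K * norm x"
 shows "norm (\<Lambda> (a \<circ> b)) \<le> K * norm (\<Lambda> b)"
proof (rule power2_le_imp_le)
 show "(norm (\<Lambda> (a \<circ> b)))\<^sup>2 \<le> (K * norm (\<Lambda> b))\<^sup>2"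
  using t_contraction[OF a b K] by (simp only: Lam_norm[OF N_comp[OF a b]] Lam_norm[OF b] power_mult_distrib)
qed (use K in simp)

text \<open>By the trace property \<open>\<Lambda> c\<close> and \<open>\<Lambda> (adj c)\<close>
  have the same norm, and taking adjoints turns right multiplication by \<open>b\<close> into left
  multiplication by \<open>adj b\<close>.\<close>

lemma Lam_right_bound:
 assumes a: "a \<in> A" and b: "b \<in> A" and K: "K > 0" "\<And>x. norm (adj b x) \<le> K * norm x"
 shows "norm (\<Lambda> (a \<circ> b)) \<le> K * norm (\<Lambda> a)"
proof (rule power2_le_imp_le)
 have "adj (adj b \<circ> adj a) \<circ> (adj b \<circ> adj a) = (a \<circ> b) \<circ> adj (a \<circ> b)"
  by (simp add: adj_comp bclin_adj adj_adj N_bc a b)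
 then have "(norm (\<Lambda> (a \<circ> b)))\<^sup>2 \<le> K\<^sup>2 * tt (adj (adj a) \<circ> adj a)"
  using t_contraction[OF N_adj[OF b] N_adj[OF a] K] by (simp add: power2_norm_eq_inner Lam_inner N_comp a b)
 also have "\<dots> = (K * norm (\<Lambda> a))\<^sup>2" by (simp add: power_mult_distrib power2_norm_eq_inner Lam_inner a adj_adj N_bc)
 finally show "(norm (\<Lambda> (a \<circ> b)))\<^sup>2 \<le> (K * norm (\<Lambda> a))\<^sup>2" .
qed (use K in simp)

lemma L: assumes a: "a \<in> A" shows L_bc: "bclin (L a)" and L_Lam: "b \<in> A ==> L a (\<Lambda> b) = \<Lambda> (a \<circ> b)"
proof -
 note ba = N_bc[OF a]
 obtain K where K: "K > 0" "\<And>x. norm (a x) \<le> K * norm x" by (rule bclin_bound[OF ba]) (rule that)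
 have "\<exists>T. bclin T \<and> (\<forall>b\<in>A. T (\<Lambda> b) = \<Lambda> (a \<circ> b))"
 proof (rule extend_operator[where K=K])
  fix b c assume b: "b \<in> A" and c: "c \<in> A"
  show "\<Lambda> (a \<circ> (\<lambda>x. b x + c x)) = \<Lambda> (a \<circ> b) + \<Lambda> (a \<circ> c)"
   using Lam_add[OF N_comp[OF a b] N_comp[OF a c]] by (simp add: comp_def bclin_simps[OF ba])
 next
  fix b c assume b: "b \<in> A"
  show "\<Lambda> (a \<circ> (\<lambda>x. scaleC c (b x))) = scaleC c (\<Lambda> (a \<circ> b))"
   using Lam_scale[OF N_comp[OF a b]] by (simp add: comp_def bclin_scaleC[OF ba])
 next
  fix b assume b: "b \<in> A"
  then show "norm (\<Lambda> (a \<circ> b)) \<le> K * norm (\<Lambda> b)" by (rule Lam_left_bound[OF a _ K])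
 qed (rule K(1))
 then obtain T where T: "bclin T" "\<And>b. b \<in> A ==> T (\<Lambda> b) = \<Lambda> (a \<circ> b)" by blast
 have "L a = T" unfolding L_def left_mult_def
 proof (rule the_equality)
  fix S assume "bclin S \<and> (\<forall>b\<in>A. S (\<Lambda> b) = \<Lambda> (a \<circ> b))"
  then show "S = T" using T by (intro eq_on_Lam) auto
 qed (use T in auto)
 with T show "bclin (L a)" "b \<in> A ==> L a (\<Lambda> b) = \<Lambda> (a \<circ> b)" by auto
qed

lemma L_eqI: "a \<in> A ==> bclin T ==> (\<And>b. b \<in> A ==> T (\<Lambda> b) = \<Lambda> (a \<circ> b)) ==> L a = T"
 by (rule eq_on_Lam) (auto simp: L_bc L_Lam)

lemma L_add: "a \<in> A ==> b \<in> A ==> L (\<lambda>x. a x + b x) = (\<lambda>x. L a x + L b x)"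
proof (rule L_eqI)
 assume a: "a \<in> A" and b: "b \<in> A"
 fix c assume c: "c \<in> A"
 show "L a (\<Lambda> c) + L b (\<Lambda> c) = \<Lambda> ((\<lambda>x. a x + b x) \<circ> c)"
  using Lam_add[OF N_comp[OF a c] N_comp[OF b c]] by (simp add: L_Lam a b c comp_def)
qed (auto simp: N_add bclin_add L_bc)

lemma L_comp: "a \<in> A ==> b \<in> A ==> L (a \<circ> b) = L a \<circ> L b" by (rule L_eqI) (auto simp: N_comp bclin_comp L_bc L_Lam comp_assoc)

lemma L_id: "L id = id" and L_zero: "L (\<lambda>_. 0) = (\<lambda>_. 0)"
proof -
 show "L id = id" by (rule L_eqI) (auto simp: N_id bclin_id)
 have "\<Lambda> (\<lambda>_. 0) = 0" using Lam_scale[OF N_zero, of 0] scaleR_scaleC[of 0 "\<Lambda> (\<lambda>_. 0)"] by simp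
 then show "L (\<lambda>_. 0) = (\<lambda>_. 0)" by (intro L_eqI) (auto simp: N_zero bclin_zero comp_def)
qed

lemma L_adj: assumes a: "a \<in> A" shows "adj (L a) = L (adj a)"
proof (rule adj_unique[OF L_bc[OF a]])
 have eq: "inner (L a (\<Lambda> b)) (\<Lambda> c) = inner (\<Lambda> b) (L (adj a) (\<Lambda> c))" if b: "b \<in> A" and c: "c \<in> A" for b c
 proof -
  have "tt (a \<circ> (b \<circ> adj c)) = tt ((b \<circ> adj c) \<circ> a)" by (intro t_comm N_comp N_adj a b c)
  then show ?thesis by (simp add: L_Lam Lam_inner N_adj N_comp a b c adj_comp N_bc adj_adj comp_assoc)
 qed
 fix x y
 obtain f where f: "\<And>n::nat. f n \<in> A" "(\<lambda>n. \<Lambda> (f n)) \<leadsto> x" by (rule tendsto_Lam[of x]) (rule that)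
 obtain g where g: "\<And>n::nat. g n \<in> A" "(\<lambda>n. \<Lambda> (g n)) \<leadsto> y" by (rule tendsto_Lam[of y]) (rule that)
 have "(\<lambda>n. inner (L a (\<Lambda> (f n))) (\<Lambda> (g n))) \<leadsto> inner (L a x) y"
  by (intro tendsto_intros g bclin_tendsto[OF L_bc[OF a] f(2)])
 moreover have "(\<lambda>n. inner (\<Lambda> (f n)) (L (adj a) (\<Lambda> (g n)))) \<leadsto> inner x (L (adj a) y)"
  by (intro tendsto_intros f bounded_linear.tendsto[OF bclin_bl[OF L_bc[OF N_adj[OF a]]] g(2)])
 ultimately show "inner (L a x) y = inner x (L (adj a) y)" by (simp add: eq f(1) g(1) LIMSEQ_unique)
qed

lemma L_inj: "a \<in> A ==> b \<in> A ==> L a = L b ==> a = b"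
proof -
 assume a: "a \<in> A" and b: "b \<in> A" and e: "L a = L b"
 from e have "L a (\<Lambda> id) = L b (\<Lambda> id)" by simp
 then have "\<Lambda> (\<lambda>x. a x - b x) = 0" by (simp add: L_Lam N_id a b Lam_diff)
 then have "(\<lambda>x. a x - b x) = (\<lambda>_. 0)" by (rule Lam_eq_0[OF N_diff[OF a b]])
 then show "a = b" by (auto simp: fun_eq_iff)
qed

text \<open>Right multiplications lie in the commutant of the left ones. They suffice to determine
  an operator of the bicommutant from its value at \<open>\<Lambda> id\<close>.\<close>

lemma right_mult_exists:
 assumes b: "b \<in> A" shows "\<exists>T\<in>commutant (L ` A). \<forall>a\<in>A. T (\<Lambda> a) = \<Lambda> (a \<circ> b)"
proof -
 obtain K where K: "K > 0" "\<And>x. norm (adj b x) \<le> K * norm x" by (rule bclin_bound[OF N_bc[OF N_adj[OF b]]]) (rule that)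
 have "\<exists>T. bclin T \<and> (\<forall>a\<in>A. T (\<Lambda> a) = \<Lambda> (a \<circ> b))"
 proof (rule extend_operator[where K=K])
  fix a c assume a: "a \<in> A" and c: "c \<in> A"
  show "\<Lambda> ((\<lambda>x. a x + c x) \<circ> b) = \<Lambda> (a \<circ> b) + \<Lambda> (c \<circ> b)"
   using Lam_add[OF N_comp[OF a b] N_comp[OF c b]] by (simp add: comp_def)
 next
  fix a c assume a: "a \<in> A"
  show "\<Lambda> ((\<lambda>x. scaleC c (a x)) \<circ> b) = scaleC c (\<Lambda> (a \<circ> b))"
   using Lam_scale[OF N_comp[OF a b]] by (simp add: comp_def)
 next
  fix a assume a: "a \<in> A"
  then show "norm (\<Lambda> (a \<circ> b)) \<le> K * norm (\<Lambda> a)" by (rule Lam_right_bound[OF _ b K])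
 qed (rule K(1))
 then obtain T where T: "bclin T" "\<And>a. a \<in> A ==> T (\<Lambda> a) = \<Lambda> (a \<circ> b)" by blast
 have "T \<circ> L a = L a \<circ> T" if a: "a \<in> A" for a by (rule eq_on_Lam) (auto simp: bclin_comp T L_bc a L_Lam N_comp b comp_assoc)
 then have "T \<in> commutant (L ` A)" using T(1) by (auto simp: commutant_def)
 with T(2) show ?thesis by blast
qed


lemma right_mult_Lam:
 assumes T: "T \<in> commutant (commutant (L ` A))" and b: "b \<in> A"
  and S: "S \<in> commutant (L ` A)" "\<And>a. a \<in> A ==> S (\<Lambda> a) = \<Lambda> (a \<circ> b)" and a: "a \<in> A"
 shows "S (T (\<Lambda> a)) = T (\<Lambda> (a \<circ> b))"
proof -
 have "T (S (\<Lambda> a)) = S (T (\<Lambda> a))" using T S(1) unfolding commutant_iff[of T] by blast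
 then show ?thesis by (simp add: S(2)[OF a])
qed

text \<open>Every \<open>T\<close> in the bicommutant of the image is left multiplication by a vector \<open>\<xi>\<close>. Elements of
 \<open>A\<close> converging to \<open>\<xi>\<close> fast enough converge uniformly on projections \<open>E\<^sub>k\<close> increasing to 1 (as in
 Egorov's theorem); as \<open>T\<close> is bounded, the limits on the \<open>E\<^sub>k\<close> fit together to an element of \<open>A\<close>.\<close>

lemma bicommutant_L_approx:
 assumes T: "T \<in> commutant (commutant (L ` A))"
 obtains E b where "\<And>k::nat. aff (E k)" "incseq E" "\<And>k. d UNIV - 2 / 2 ^ k \<le> d (E k)"
  "\<And>k. b k \<in> A" "\<And>k x. b k x = b k (pr (E k) x)" "\<And>j k x. j \<le> k ==> x \<in> E j ==> b k x = b j x"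
  "\<And>k. L (b k) = T \<circ> L (pr (E k))"
proof -
 have bT: "bclin T" using T by (simp add: commutant_iff)
 define \<xi> where "\<xi> = T (\<Lambda> id)"
 \<comment> \<open>The rate is chosen so that consecutive differences have trace norm at most
   \<open>(1/4) ^ n\<close>; \<open>Chebyshev\<close> with threshold \<open>(1/2) ^ n\<close> then
   leaves an exceptional projection of dimension at most \<open>(1/2) ^ n\<close>.\<close>
 have "\<exists>a\<in>A. norm (\<Lambda> a - \<xi>) \<le> (1/4) ^ n / 2" for n
 proof -
  obtain f where f: "\<And>n::nat. f n \<in> A" "(\<lambda>n. \<Lambda> (f n)) \<leadsto> \<xi>" by (rule tendsto_Lam[of \<xi>]) (rule that)
  have "(0::real) < (1/4) ^ n / 2" by simp
  from LIMSEQ_D[OF f(2) this] f(1) show ?thesis by (meson le_refl less_imp_le)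
 qed
 then obtain a where a: "\<And>n. a n \<in> A" "\<And>n. norm (\<Lambda> (a n) - \<xi>) \<le> (1/4) ^ n / 2" by metis
 define c where "c n = (\<lambda>x. a (Suc n) x - a n x)" for n
 have cA: "c n \<in> A" for n unfolding c_def by (rule N_diff[OF a(1) a(1)])
 have nc: "norm (\<Lambda> (c n)) \<le> (1/4) ^ n" for n
 proof -
  have "norm (\<Lambda> (c n)) \<le> norm (\<Lambda> (a (Suc n)) - \<xi>) + norm (\<Lambda> (a n) - \<xi>)"
   using norm_triangle_ineq4[of "\<Lambda> (a (Suc n)) - \<xi>" "\<Lambda> (a n) - \<xi>"] by (simp add: c_def Lam_diff a)
  also have "\<dots> \<le> (1/4) ^ Suc n / 2 + (1/4) ^ n / 2" by (intro add_mono a)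
  also have "\<dots> \<le> (1/4) ^ n" by simp
  finally show ?thesis .
 qed
 have "\<exists>F. aff F \<and> (\<forall>x\<in>F. norm (c n x) \<le> (1/2) ^ n * norm x) \<and> d UNIV - (1/2) ^ n \<le> d F" for n
 proof (rule Chebyshev[OF cA[of n], of "(1/2) ^ n"], goal_cases)
  case (2 G)
  have "tt (adj (c n) \<circ> c n) \<le> ((1/4) ^ n)\<^sup>2" unfolding Lam_norm[OF cA, symmetric] by (intro power_mono nc) simp
  then have "((1/2) ^ n)\<^sup>2 * d G \<le> ((1/4) ^ n)\<^sup>2" using 2(3) by simp
  also have "(1/4 :: real) ^ n = (1/2) ^ n * (1/2) ^ n" by (simp flip: power_mult_distrib)
  finally have "d G \<le> ((1/2) ^ n)\<^sup>2" by (simp add: power2_eq_square)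
  also have "\<dots> \<le> (1/2) ^ n" by (simp add: power2_eq_square power_le_one)
  finally show ?case using 2 d_ortho[OF 2(1)] by (intro exI[of _ "ortho G"]) (simp add: aff_ortho)
 qed simp
 then obtain F where F: "\<And>n. aff (F n)" "\<And>n x. x \<in> F n ==> norm (c n x) \<le> (1/2) ^ n * norm x"
  "\<And>n. d UNIV - (1/2) ^ n \<le> d (F n)" by metis
 \<comment> \<open>Discarding the first \<open>k\<close> exceptional sets makes the remaining
   codimensions sum to at most \<open>2 / 2 ^ k\<close>, and on \<open>E k\<close> the differences
   from index \<open>k\<close> on are summable in operator norm.\<close>
 define E where "E k = (\<Inter>n. F (n + k))" for k
 have E: "aff (E k)" for k unfolding E_def by (rule aff_INT[OF F(1)])
 note cE = aff_cs[OF E]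
 have incE: "incseq E"
 proof (rule incseq_SucI, rule subsetI)
  fix k x assume "x \<in> E k"
  then have "x \<in> F (Suc n + k)" for n unfolding E_def by blast
  then show "x \<in> E (Suc k)" by (simp add: E_def)
 qed
 have dE: "d UNIV - 2 / 2 ^ k \<le> d (E k)" for k unfolding E_def
 proof (rule d_INT[OF F(1) F(3)])
  fix m :: nat
  have "(\<Sum>n<m. (1/2 :: real) ^ (n + k)) = (\<Sum>n<m. (1/2) ^ n) * (1/2) ^ k" by (simp add: power_add sum_distrib_right)
  also have "(\<Sum>n<m. (1/2 :: real) ^ n) \<le> 2" by (simp add: sum_gp_strict)
  finally show "(\<Sum>n<m. (1/2 :: real) ^ (n + k)) \<le> 2 / 2 ^ k" by (simp add: field_simps)
 qed
 have step: "norm (a (k + n + m) x - a (k + n) x) \<le> 2 * (1/2) ^ (k + n) * norm x" if x: "x \<in> E k" for k n m x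
 proof -
  have "norm (a (k + n + m) x - a (k + n) x) \<le> (2 * (1/2) ^ (k + n) - 2 * (1/2) ^ (k + n + m)) * norm x"
  proof (induction m)
   case (Suc m)
   have "x \<in> F (k + n + m)" using x unfolding E_def by (metis INT_D UNIV_I add.assoc add.commute)
   from F(2)[OF this] Suc
    norm_triangle_ineq[of "c (k + n + m) x" "a (k + n + m) x - a (k + n) x"]
   show ?case by (simp add: c_def algebra_simps)
  qed simp
  also have "\<dots> \<le> 2 * (1/2) ^ (k + n) * norm x" by (intro mult_right_mono) auto
  finally show ?thesis .
 qed
 have half: "(\<lambda>n. 2 * (1/2) ^ (k + n) * r) \<leadsto> 0" for k and r :: real
  by (intro tendsto_mult_left_zero tendsto_mult_right_zero LIMSEQ_ignore_initial_segment[OF LIMSEQ_power_zero, of _ k, unfolded add.commute[of _ k]]) simp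
 have "\<exists>l. (\<lambda>n. a (k + n) (pr (E k) x)) \<leadsto> l" for k x
 proof -
  let ?y = "pr (E k) x"
  show ?thesis
  proof (rule convergent_if_dist_le)
   show "dist (a (k + m) ?y) (a (k + n) ?y) \<le> 2 * (1/2) ^ (k + n) * norm ?y" if "n \<le> m" for m n
    using step[OF pr_in[OF cE], of k n "m - n" x] that by (simp add: dist_norm)
   show "(\<lambda>n. 2 * (1/2) ^ (k + n) * norm ?y) \<leadsto> 0" by (rule half)
  qed
 qed
 then obtain b where b: "\<And>k x. (\<lambda>n. a (k + n) (pr (E k) x)) \<leadsto> b k x" by metis
 have bstep: "norm (b k x - a (k + n) (pr (E k) x)) \<le> 2 * (1/2) ^ (k + n) * norm x" for k n x
 proof (rule LIMSEQ_le_const2[OF tendsto_norm[OF tendsto_diff[OF b tendsto_const]]], intro exI allI impI)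
  fix m assume "n \<le> m"
  then have "norm (a (k + m) (pr (E k) x) - a (k + n) (pr (E k) x)) \<le> 2 * (1/2) ^ (k + n) * norm (pr (E k) x)"
   using step[OF pr_in[OF cE], of k n "m - n" x] by simp
  also have "\<dots> \<le> 2 * (1/2) ^ (k + n) * norm x" by (intro mult_left_mono norm_pr_le cE) simp
  finally show "norm (a (k + m) (pr (E k) x) - a (k + n) (pr (E k) x)) \<le> 2 * (1/2) ^ (k + n) * norm x" .
 qed
 have bA: "b k \<in> A" for k
 proof -
  obtain K where K: "K > 0" "\<And>x. norm (a k x) \<le> K * norm x" by (rule bclin_bound[OF N_bc[OF a(1)]]) (rule that)
  show ?thesis
  proof (rule N_lim[OF _ _ b])
   show "(\<lambda>x. a (k + n) (pr (E k) x)) \<in> A" for n by (rule N_comp'[OF a(1) pr_N[OF E]])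
   fix n x
   let ?y = "pr (E k) x"
   have "norm (a (k + n) ?y) \<le> norm (a k ?y) + norm (a (k + 0 + n) ?y - a (k + 0) ?y)"
    using norm_triangle_ineq[of "a k ?y" "a (k + n) ?y - a k ?y"] by simp
   also have "\<dots> \<le> K * norm ?y + 2 * (1/2) ^ (k + 0) * norm ?y" by (intro add_mono K step pr_in cE)
   also have "\<dots> \<le> (K + 2 * (1/2) ^ k) * norm x"
    using norm_pr_le[OF cE, of k x] K(1) by (simp add: add_mono distrib_right del: mult_le_cancel_left_pos)
   finally show "norm (a (k + n) ?y) \<le> (K + 2 * (1/2) ^ k) * norm x" .
  qed
 qed
 have bpr: "b k x = b k (pr (E k) x)" for k x using b[of k x] b[of k "pr (E k) x"] by (simp add: pr_pr[OF cE] LIMSEQ_unique)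
 have bcons: "b k x = b j x" if jk: "j \<le> k" and x: "x \<in> E j" for j k x
 proof (rule LIMSEQ_unique)
  have xk: "x \<in> E k" using incE jk x by (auto simp: incseq_def)
  show "(\<lambda>n. a (k + n) x) \<leadsto> b k x" using b[of k x] by (simp add: pr_id[OF cE xk])
  have "(\<lambda>n. a (j + (n + (k - j))) x) \<leadsto> b j x"
   using LIMSEQ_ignore_initial_segment[OF b[of j x], of "k - j"] by (simp add: pr_id[OF cE x])
  moreover have "j + (n + (k - j)) = k + n" for n using jk by simp
  ultimately show "(\<lambda>n. a (k + n) x) \<leadsto> b j x" by simp
 qed
 have "L (b k) = T \<circ> L (pr (E k))" for k
 proof (rule L_eqI[OF bA])
  show "bclin (T \<circ> L (pr (E k)))" by (rule bclin_comp[OF bT L_bc[OF pr_N[OF E]]])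
  fix e assume e: "e \<in> A"
  obtain R where R: "R \<in> commutant (L ` A)" "\<And>a. a \<in> A ==> R (\<Lambda> a) = \<Lambda> (a \<circ> pr (E k))"
   using right_mult_exists[OF pr_N[OF E[of k]]] by blast
  have bR: "bclin R" using R by (simp add: commutant_iff)
  have "(\<lambda>n. \<Lambda> (a (k + n))) \<leadsto> \<xi>"
  proof (rule Lim_null[THEN iffD2], rule Lim_null_comparison)
   show "\<forall>\<^sub>F n in sequentially. norm (\<Lambda> (a (k + n)) - \<xi>) \<le> (1/4) ^ (k + n) / 2" by (intro always_eventually allI a)
   have "(\<lambda>n. (1/4 :: real) ^ (k + n) / 2) \<leadsto> 0 / 2"
    by (intro tendsto_intros LIMSEQ_ignore_initial_segment[OF LIMSEQ_power_zero, of _ k, unfolded add.commute[of _ k]]) auto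
   then show "(\<lambda>n. (1/4 :: real) ^ (k + n) / 2) \<leadsto> 0" by simp
  qed
  then have "(\<lambda>n. R (\<Lambda> (a (k + n)))) \<leadsto> R \<xi>" by (rule bclin_tendsto[OF bR])
  then have 1: "(\<lambda>n. \<Lambda> (a (k + n) \<circ> pr (E k))) \<leadsto> R \<xi>" by (simp add: R a)
  have 2: "(\<lambda>n. \<Lambda> (a (k + n) \<circ> pr (E k))) \<leadsto> \<Lambda> (b k)"
  proof (rule Lim_null[THEN iffD2], rule Lim_null_comparison)
   have "norm (\<Lambda> (a (k + n) \<circ> pr (E k)) - \<Lambda> (b k)) \<le> 2 * (1/2) ^ (k + n) * norm (\<Lambda> id)" for n
   proof -
    have ap: "a (k + n) \<circ> pr (E k) \<in> A" by (rule N_comp[OF a(1) pr_N[OF E]])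
    have "\<Lambda> (b k) - \<Lambda> (a (k + n) \<circ> pr (E k)) = \<Lambda> ((\<lambda>x. b k x - (a (k + n) \<circ> pr (E k)) x) \<circ> id)"
     using Lam_diff[OF bA ap] by simp
    also have "norm \<dots> \<le> 2 * (1/2) ^ (k + n) * norm (\<Lambda> id)" by (rule Lam_left_bound[OF N_diff[OF bA ap] N_id]) (use bstep in auto)
    finally show ?thesis by (subst norm_minus_commute)
   qed
   then show "\<forall>\<^sub>F n in sequentially. norm (\<Lambda> (a (k + n) \<circ> pr (E k)) - \<Lambda> (b k)) \<le> 2 * (1/2) ^ (k + n) * norm (\<Lambda> id)" by simp
   show "(\<lambda>n. 2 * (1/2) ^ (k + n) * norm (\<Lambda> id)) \<leadsto> 0" by (rule half)
  qed
  \<comment> \<open>\<open>R\<close>, right multiplication by \<open>pr (E k)\<close>, commutes with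
    \<open>T\<close>, so \<open>R \<xi> = T (\<Lambda> (pr (E k)))\<close>; this is one of the two
    limits of the same sequence. Right multiplication by \<open>e\<close> then carries the identity
    from \<open>id\<close> to every \<open>e\<close>.\<close>
  have bk: "\<Lambda> (b k) = T (\<Lambda> (pr (E k)))" using LIMSEQ_unique[OF 2 1] right_mult_Lam[OF T pr_N[OF E] R N_id] by (simp add: \<xi>_def)
  obtain S where S: "S \<in> commutant (L ` A)" "\<And>a. a \<in> A ==> S (\<Lambda> a) = \<Lambda> (a \<circ> e)"
   using right_mult_exists[OF e] by blast
  have "\<Lambda> (b k \<circ> e) = S (T (\<Lambda> (pr (E k))))" by (simp add: S(2)[OF bA, symmetric] bk)
  also have "\<dots> = T (\<Lambda> (pr (E k) \<circ> e))" by (rule right_mult_Lam[OF T e S pr_N[OF E]])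
  finally show "(T \<circ> L (pr (E k))) (\<Lambda> e) = \<Lambda> (b k \<circ> e)" by (simp add: L_Lam pr_N E e)
 qed
 then show ?thesis by (intro that[of E b] E incE dE bA bpr bcons)
qed

lemma bicommutant_L:
 assumes T: "T \<in> commutant (commutant (L ` A))" shows "T \<in> L ` A"
proof -
 have bT: "bclin T" using T by (simp add: commutant_iff)
 obtain E b where E: "\<And>k::nat. aff (E k)" and incE: "incseq E" and dE: "\<And>k. d UNIV - 2 / 2 ^ k \<le> d (E k)"
  and bA: "\<And>k. b k \<in> A" and bpr: "\<And>k x. b k x = b k (pr (E k) x)"
  and bcons: "\<And>j k x. j \<le> k ==> x \<in> E j ==> b k x = b j x" and Lb: "\<And>k. L (b k) = T \<circ> L (pr (E k))"
  by (rule bicommutant_L_approx[OF T]) (rule that)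
 note cE = aff_cs[OF E]
 obtain K where K: "K > 0" "\<And>x. norm (T x) \<le> K * norm x" by (rule bclin_bound[OF bT]) (rule that)
 \<comment> \<open>The bound on \<open>b k\<close> that its construction gives depends on
   \<open>k\<close>. A uniform one comes from the completion, where \<open>b k\<close> acts as
   \<open>T\<close> after a projection, by way of \<open>norm_le_if_t_le\<close>.\<close>
 have nb: "norm (b k x) \<le> K * norm x" for k x
 proof (rule norm_le_if_t_le[OF bA K(1)])
  fix c assume c: "c \<in> A"
  have "norm (\<Lambda> (b k \<circ> c)) = norm (T (\<Lambda> (pr (E k) \<circ> c)))"
   using fun_cong[OF Lb[of k], of "\<Lambda> c"] by (simp add: L_Lam bA c pr_N E)
  also have "\<dots> \<le> K * norm (\<Lambda> (pr (E k) \<circ> c))" by (rule K)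
  also have "norm (\<Lambda> (pr (E k) \<circ> c)) \<le> 1 * norm (\<Lambda> c)" by (rule Lam_left_bound[OF pr_N[OF E] c]) (auto simp: norm_pr_le cE)
  finally have "norm (\<Lambda> (b k \<circ> c)) \<le> K * norm (\<Lambda> c)" using K(1) by simp
  then have "(norm (\<Lambda> (b k \<circ> c)))\<^sup>2 \<le> (K * norm (\<Lambda> c))\<^sup>2" by (intro power_mono) auto
  then show "tt (adj (b k \<circ> c) \<circ> (b k \<circ> c)) \<le> K\<^sup>2 * tt (adj c \<circ> c)"
   by (simp only: Lam_norm[OF N_comp[OF bA c]] Lam_norm[OF c] power_mult_distrib)
 qed
 have dense: "closure (\<Union>k. E k) = UNIV"
 proof (rule dense_if_ortho_trivial)
  show "subspace (\<Union>k. E k)"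
  proof (rule subspaceI)
   show "0 \<in> (\<Union>k. E k)" using cE subspace_0 by blast
   show "r *\<^sub>R x \<in> (\<Union>k. E k)" if "x \<in> (\<Union>k. E k)" for r x using that cE subspace_scale by blast
   fix x y assume "x \<in> (\<Union>k. E k)" "y \<in> (\<Union>k. E k)"
   then obtain i j where "x \<in> E i" "y \<in> E j" by blast
   then have "x \<in> E (max i j)" "y \<in> E (max i j)" using incseqD[OF incE] by (meson max.cobounded1 max.cobounded2 subsetD)+
   then show "x + y \<in> (\<Union>k. E k)" using cE subspace_add by blast
  qed
  have "tdense (\<Union>k. E k)" unfolding tdense_def
  proof (intro allI impI)
   fix e :: real assume e: "e > 0"
   have "(\<lambda>k. 2 * (1/2) ^ k) \<leadsto> (2 * 0 :: real)" by (intro tendsto_intros LIMSEQ_power_zero) simp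
   from order_tendstoD(2)[OF this, of e] e obtain k where "2 * (1/2) ^ k < e" unfolding eventually_sequentially by auto
   then have "d UNIV - e < d (E k)" using dE[of k] by (simp add: power_divide)
   then show "\<exists>G. aff G \<and> G \<subseteq> (\<Union>k. E k) \<and> d UNIV - e < d G" using E by blast
  qed
  then show "x = 0" if "x \<in> ortho (\<Union>k. E k)" for x using tdense_ortho that by blast
 qed
 have "\<exists>l. (\<lambda>k. b k x) \<leadsto> l" for x
 proof -
  have "Cauchy (\<lambda>k. b k x)"
  proof (rule metric_CauchyI)
   fix e :: real assume e: "0 < e"
   have "x \<in> closure (\<Union>k. E k)" by (simp add: dense)
   then obtain z where z: "z \<in> (\<Union>k. E k)" "dist z x < e / (2 * K)"
    using e K(1) unfolding closure_approachable by (meson divide_pos_pos mult_pos_pos zero_less_numeral)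
   then obtain j where j: "z \<in> E j" by blast
   have "dist (b m x) (b n x) < e" if "m \<ge> j" "n \<ge> j" for m n
   proof -
    have "b m x - b n x = b m (x - z) - b n (x - z)" by (simp add: bclin_simps[OF N_bc[OF bA]] bcons[OF that(1) j] bcons[OF that(2) j])
    then have "dist (b m x) (b n x) \<le> K * norm (x - z) + K * norm (x - z)"
     using norm_triangle_ineq4[of "b m (x - z)" "b n (x - z)"] nb[of m "x - z"] nb[of n "x - z"] by (simp add: dist_norm)
    also have "\<dots> < e" using z(2) K(1) by (simp add: dist_norm norm_minus_commute field_simps)
    finally show ?thesis .
   qed
   then show "\<exists>M. \<forall>m\<ge>M. \<forall>n\<ge>M. dist (b m x) (b n x) < e" by blast
  qed
  then show ?thesis using convergent_eq_Cauchy by blast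
 qed
 then obtain a where a: "\<And>x. (\<lambda>k. b k x) \<leadsto> a x" by metis
 have aA: "a \<in> A" by (rule N_lim[OF bA nb a])
 have apr: "a \<circ> pr (E k) = b k" for k
 proof
  fix x
  have "(\<lambda>n. b n (pr (E k) x)) \<leadsto> b k x"
  proof (rule tendsto_eventually)
   show "\<forall>\<^sub>F n in sequentially. b n (pr (E k) x) = b k x" using bcons[OF _ pr_in[OF cE]] bpr unfolding eventually_sequentially by metis
  qed
  then show "(a \<circ> pr (E k)) x = b k x" using a[of "pr (E k) x"] LIMSEQ_unique by auto
 qed
 have "L a = T"
 proof (rule eq_on_Lam[OF L_bc[OF aA] bT])
  fix c assume c: "c \<in> A"
  obtain M where M: "M > 0" "\<And>x. norm (adj c x) \<le> M * norm x" by (rule bclin_bound[OF N_bc[OF N_adj[OF c]]]) (rule that)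
  \<comment> \<open>Right multiplication by \<open>c\<close> is bounded by \<open>M\<close>, and the
    squared norm of \<open>\<Lambda> (pr (ortho (E k)))\<close> is the codimension of
    \<open>E k\<close>, at most \<open>2 / 2 ^ k\<close>.\<close>
  have "(\<lambda>k. \<Lambda> (pr (E k) \<circ> c)) \<leadsto> \<Lambda> c"
  proof (rule Lim_null[THEN iffD2], rule Lim_null_comparison)
   have "norm (\<Lambda> (pr (E k) \<circ> c) - \<Lambda> c) \<le> M * sqrt (2 / 2 ^ k)" for k
   proof -
    note oE = aff_ortho[OF E[of k]]
    have "\<Lambda> c - \<Lambda> (pr (E k) \<circ> c) = \<Lambda> (pr (ortho (E k)) \<circ> c)"
     using Lam_diff[OF c N_comp[OF pr_N[OF E] c]] by (simp add: comp_def pr_ortho[OF cE])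
    also have "norm \<dots> \<le> M * norm (\<Lambda> (pr (ortho (E k))))" by (rule Lam_right_bound[OF pr_N[OF oE] c M])
    also have "norm (\<Lambda> (pr (ortho (E k)))) \<le> sqrt (2 / 2 ^ k)"
    proof (rule real_le_rsqrt)
     have "(norm (\<Lambda> (pr (ortho (E k)))))\<^sup>2 = d (ortho (E k))" by (simp only: Lam_norm[OF pr_N[OF oE]] pr_comp_pr[OF oE] d_def)
     then show "(norm (\<Lambda> (pr (ortho (E k)))))\<^sup>2 \<le> 2 / 2 ^ k" using dE[of k] d_ortho[OF E[of k]] by simp
    qed
    finally show ?thesis using M(1) by (simp add: norm_minus_commute)
   qed
   then show "\<forall>\<^sub>F k in sequentially. norm (\<Lambda> (pr (E k) \<circ> c) - \<Lambda> c) \<le> M * sqrt (2 / 2 ^ k)" by simp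
   have "(\<lambda>k. M * sqrt (2 * (1/2) ^ k)) \<leadsto> M * sqrt (2 * 0)" by (intro tendsto_intros LIMSEQ_power_zero) simp
   then show "(\<lambda>k. M * sqrt (2 / 2 ^ k)) \<leadsto> 0" by (simp add: power_divide)
  qed
  moreover have "L a (\<Lambda> (pr (E k) \<circ> c)) = T (\<Lambda> (pr (E k) \<circ> c))" for k
  proof -
   have "L a (\<Lambda> (pr (E k) \<circ> c)) = \<Lambda> ((a \<circ> pr (E k)) \<circ> c)"
    by (simp add: L_Lam[OF aA N_comp[OF pr_N[OF E] c]] comp_assoc)
   also have "\<dots> = L (b k) (\<Lambda> c)" by (simp add: apr L_Lam bA c)
   also have "\<dots> = T (\<Lambda> (pr (E k) \<circ> c))" by (simp add: Lb L_Lam pr_N E c)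
   finally show ?thesis .
  qed
  ultimately show "L a (\<Lambda> c) = T (\<Lambda> c)"
   using bclin_tendsto[OF L_bc[OF aA], of "\<lambda>k. \<Lambda> (pr (E k) \<circ> c)" "\<Lambda> c" sequentially]
    bclin_tendsto[OF bT, of "\<lambda>k. \<Lambda> (pr (E k) \<circ> c)" "\<Lambda> c" sequentially]
   by (simp add: LIMSEQ_unique)
 qed
 with aA show ?thesis by blast
qed

section \<open>The image algebra and its trace\<close>

definition M :: "('k => 'k) set" where "M = L ` A"

text \<open>The given trace transported to \<open>M\<close> (\<open>tau_L\<close>), written as a
  vector functional so that normality reduces to strong convergence of projections.\<close>

definition \<tau> :: "('k => 'k) => real" where "\<tau> T = inner (T (\<Lambda> id)) (\<Lambda> id)"

lemma tau_L: "a \<in> A ==> \<tau> (L a) = tt a"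
proof -
 assume a: "a \<in> A"
 have "adj (id :: 'a => 'a) = id" by (rule adj_selfadjoint) (auto simp: bclin_id)
 then show ?thesis by (simp add: \<tau>_def L_Lam N_id Lam_inner a)
qed

lemma von_neumann_algebra_M: "von_neumann_algebra M" unfolding von_neumann_algebra_def
proof (intro conjI ballI subset_antisym)
 show "commutant (commutant M) \<subseteq> M" using bicommutant_L by (auto simp: M_def)
 show "M \<subseteq> commutant (commutant M)" by (auto simp: commutant_iff M_def L_bc)
 fix T assume "T \<in> M"
 then show "bclin T" "adj T \<in> M" by (auto simp: M_def L_bc L_adj N_adj)
qed

end

text \<open>From here on the dimension theory is available twice, for \<open>A\<close> on its given
  space and, with the prefix \<open>M\<close>, for its image on the completion, where the affiliated
  operators live.\<close>

sublocale regular_representation \<subseteq> M: tracial M \<tau>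
proof (unfold_locales)
 interpret V: vna M by unfold_locales (rule von_neumann_algebra_M)
 show "von_neumann_algebra M" by (rule von_neumann_algebra_M)
 fix S T and r :: real
 assume S: "S \<in> M"
 then obtain a where a: "a \<in> A" "S = L a" by (auto simp: M_def)
 show "\<tau> (\<lambda>x. r *\<^sub>R S x) = r * \<tau> S" by (simp add: \<tau>_def)
 have sq: "\<tau> (adj S \<circ> S) = (norm (S (\<Lambda> id)))\<^sup>2" by (simp add: \<tau>_def norm_adj_comp V.N_bc S)
 show "0 \<le> \<tau> (adj S \<circ> S)" by (simp add: sq)
 show "S = (\<lambda>_. 0)" if "\<tau> (adj S \<circ> S) = 0"
 proof -
  have "S (\<Lambda> id) = 0" using that sq by simp
  then have "\<Lambda> a = 0" by (simp add: a L_Lam N_id)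
  then show ?thesis using Lam_eq_0[OF a(1)] L_zero a(2) by simp
 qed
 assume T: "T \<in> M"
 then obtain b where b: "b \<in> A" "T = L b" by (auto simp: M_def)
 show "\<tau> (\<lambda>x. S x + T x) = \<tau> S + \<tau> T" by (simp add: \<tau>_def inner_add_left)
 show "\<tau> (S \<circ> T) = \<tau> (T \<circ> S)" using t_comm[OF a(1) b(1)] by (simp add: a b flip: L_comp) (simp add: tau_L N_comp a b)
next
 interpret V: vna M by unfold_locales (rule von_neumann_algebra_M)
 fix G :: "nat => 'k set" and c
 assume G: "\<And>n. V.aff (G n)" "decseq G" "\<And>n. c \<le> \<tau> (pr (G n))"
 have "(\<lambda>n. inner (pr (G n) (\<Lambda> id)) (\<Lambda> id)) \<leadsto> inner (pr (\<Inter>n. G n) (\<Lambda> id)) (\<Lambda> id)"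
  by (intro tendsto_intros pr_decreasing_limit G V.aff_cs)
 then show "c \<le> \<tau> (pr (\<Inter>n. G n))" unfolding \<tau>_def by (rule LIMSEQ_le_const) (use G(3) in \<open>auto simp: \<tau>_def\<close>)
qed

section \<open>Affiliated operators\<close>

context tracial
begin

definition Aff :: "('a \<times> 'a) set set" where
 "Aff = {T. closed_densely_defined T \<and> (\<forall>S\<in>N'. \<forall>(x, y)\<in>T. (S x, S y) \<in> T)}"

text \<open>The subspaces of the doubled Hilbert space that are affiliated with the 2 by 2 matrices
  over the algebra; graphs of affiliated operators are of this kind.\<close>

definition invariant2 :: "('a \<times> 'a) set => bool" where
 "invariant2 G \<longleftrightarrow> csub G \<and> (\<forall>S\<in>N'. \<forall>(x, y)\<in>G. (S x, S y) \<in> G)"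

text \<open>For a spectral subspace \<open>G\<close> of \<open>adj a\<close> with left inverse
  \<open>y\<close>, taking adjoints in \<open>y \<circ> adj a = pr G\<close> gives
  \<open>pr G = a \<circ> adj y\<close>, so \<open>G\<close> lies in the range itself and not merely
  in its closure.\<close>

lemma range_contains_aff:
 assumes a: "a \<in> N" and e: "\<epsilon> > 0" shows "\<exists>G. aff G \<and> G \<subseteq> range a \<and> d UNIV - d (ker a) - \<epsilon> < d G"
proof -
 note a' = N_adj[OF a]
 obtain G y where G: "\<And>n::nat. aff (G n)" "\<And>n. y n \<in> N" "\<And>n x. y n (adj a x) = pr (G n) x"
  "\<And>\<epsilon>. \<epsilon> > 0 ==> \<exists>n. d UNIV - d (ker (adj a)) - \<epsilon> < d (G n)" by (rule spectral_sequence[OF a']) (rule that)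
 have "G n \<subseteq> range a" for n
 proof
  fix x assume "x \<in> G n"
  then have "x = pr (G n) x" using pr_id[OF aff_cs[OF G(1)]] by simp
  also have "\<dots> = a (adj (y n) x)"
  proof (rule inner_eqI_right)
   fix z
   have "inner z (pr (G n) x) = inner (y n (adj a z)) x" by (simp add: G(3) pr_sym[OF aff_cs[OF G(1)]])
   then show "inner z (pr (G n) x) = inner z (a (adj (y n) x))" by (simp add: adj_right[OF N_bc[OF G(2)]] adj_left[OF N_bc[OF a]])
  qed
  finally show "x \<in> range a" by blast
 qed
 moreover have "d (ker (adj a)) = d (ker a)" using d_rank[OF a] d_ortho[OF aff_ker[OF a']] clran_ortho[OF a] by simp
 ultimately show ?thesis using G(1) G(4)[OF e] by auto
qed

lemma tdense_range: "a \<in> N ==> ker a = {0} ==> tdense (range a)" unfolding tdense_def using range_contains_aff[of a] by (simp add: d_zero)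

text \<open>This is where finiteness shows: by rank and nullity an injective element has dense
  range, and the complement of the range is the kernel of the adjoint.\<close>

lemma adj_ker_trivial: "a \<in> N ==> ker a = {0} ==> ker (adj a) = {0}"
proof -
 assume a: "a \<in> N" and k: "ker a = {0}"
 have "d (clran a) = d UNIV" using d_rank[OF a] k d_zero by simp
 then have "d (ker (adj a)) = 0" using d_ortho[OF aff_ker[OF N_adj[OF a]]] clran_ortho[OF a] by simp
 then show ?thesis by (rule d_eq_0[OF aff_ker[OF N_adj[OF a]]])
qed

text \<open>For an affiliated \<open>G\<close> inside \<open>D\<close>, the element
  \<open>s \<circ> pr G\<close> has kernel \<open>ortho G\<close> because \<open>s\<close> is
  injective; its range, contained in the image of \<open>D\<close>, contains affiliated subspaces of
  almost the dimension of \<open>G\<close>.\<close>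

lemma tdense_image:
 assumes s: "s \<in> N" and k: "ker s = {0}" and D: "tdense D" shows "tdense (s ` D)" unfolding tdense_def
proof (intro allI impI)
 fix \<epsilon> :: real assume "\<epsilon> > 0"
 then have e: "\<epsilon> / 2 > 0" by simp
 then obtain G where G: "aff G" "G \<subseteq> D" "d UNIV - \<epsilon> / 2 < d G" using D unfolding tdense_def by blast
 note cG = aff_cs[OF G(1)]
 let ?b = "\<lambda>x. s (pr G x)"
 have b: "?b \<in> N" by (rule N_comp'[OF s pr_N[OF G(1)]])
 have "s x = 0 \<longleftrightarrow> x = 0" for x using k by (auto simp: ker_def)
 then have "ker ?b = ortho G" by (auto simp: ker_def ortho_def pr_zero_iff[OF cG])
 then have "d (ker ?b) = d UNIV - d G" by (simp add: d_ortho G)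
 moreover obtain H where "aff H" "H \<subseteq> range ?b" "d UNIV - d (ker ?b) - \<epsilon> / 2 < d H" using range_contains_aff[OF b e] by blast
 moreover have "range ?b \<subseteq> s ` D" using pr_in[OF cG] G(2) by blast
 ultimately show "\<exists>G. aff G \<and> G \<subseteq> s ` D \<and> d UNIV - \<epsilon> < d G" using G(3) by (intro exI[of _ H]) auto
qed

text \<open>The projection commutes with the diagonal action of the commutant, hence each of its
  four matrix blocks commutes with the commutant.\<close>

lemma pr_blocks:
 assumes G: "invariant2 G" shows "(\<lambda>x. fst (pr G (x, 0))) \<in> N" "(\<lambda>x. snd (pr G (x, 0))) \<in> N"
  "(\<lambda>x. fst (pr G (0, x))) \<in> N" "(\<lambda>x. snd (pr G (0, x))) \<in> N"
proof -
 have cG: "csub G" using G by (simp add: invariant2_def)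
 have comm: "pr G (S x, S y) = (S (fst (pr G (x, y))), S (snd (pr G (x, y))))" if S: "S \<in> N'" for S x y
 proof -
  let ?m = "\<lambda>S z. (S (fst z), S (snd z))"
  have "pr G (?m S (x, y)) = ?m S (pr G (x, y))"
  proof (rule pr_commute[OF cG, where S'="?m (adj S)"])
   show "?m S z \<in> G" if "z \<in> G" for z using G S that by (cases z) (auto simp: invariant2_def)
   show "?m (adj S) z \<in> G" if "z \<in> G" for z using G N'_adj[OF S] that by (cases z) (auto simp: invariant2_def)
   show "inner (?m S z) w = inner z (?m (adj S) w)" for z w by (simp add: inner_prod_def adj_right[OF N'_bc[OF S]])
  qed (simp add: bclin_simps[OF N'_bc[OF S]])
  then show ?thesis by simp
 qed
 have add: "pr G (x + x', y + y') = pr G (x, y) + pr G (x', y')" for x x' y y' using pr_add[OF cG, of "(x, y)" "(x', y')"] by simp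
 have nrm: "norm (fst (pr G z)) \<le> norm z" "norm (snd (pr G z)) \<le> norm z" for z
  using norm_fst_le[of "fst (pr G z)" "snd (pr G z)"] norm_snd_le[of "snd (pr G z)" "fst (pr G z)"] norm_pr_le[OF cG, of z] by auto
 have S0: "S 0 = 0" if "S \<in> N'" for S using bclin_simps(4)[OF N'_bc[OF that]] .
 have c1: "pr G (S x, 0) = (S (fst (pr G (x, 0))), S (snd (pr G (x, 0))))"
 and c2: "pr G (0, S x) = (S (fst (pr G (0, x))), S (snd (pr G (0, x))))" if "S \<in> N'" for S x
  using comm[OF that, of x 0] comm[OF that, of 0 x] by (simp_all add: S0[OF that])
 have a1: "pr G (x + y, 0) = pr G (x, 0) + pr G (y, 0)" and a2: "pr G (0, x + y) = pr G (0, x) + pr G (0, y)" for x y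
  using add[of x y 0 0] add[of 0 0 x y] by simp_all
 have "bclin (\<lambda>x. fst (pr G (x, 0)))" "bclin (\<lambda>x. snd (pr G (x, 0)))"
  "bclin (\<lambda>x. fst (pr G (0, x)))" "bclin (\<lambda>x. snd (pr G (0, x)))" using nrm[of "(_, 0)"] nrm[of "(0, _)"]
  by (auto intro!: bclinI[where K=1] simp: a1 a2 c1[OF N'_scaleC] c2[OF N'_scaleC])
 then show "(\<lambda>x. fst (pr G (x, 0))) \<in> N" "(\<lambda>x. snd (pr G (x, 0))) \<in> N"
  "(\<lambda>x. fst (pr G (0, x))) \<in> N" "(\<lambda>x. snd (pr G (0, x))) \<in> N" by (simp_all add: N_iff c1 c2)
qed

lemma
 assumes T: "T \<in> Aff" shows Aff_zero: "(0, 0) \<in> T" and Aff_add: "(x, y) \<in> T ==> (x', y') \<in> T ==> (x + x', y + y') \<in> T"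
  and Aff_scaleC: "(x, y) \<in> T ==> (scaleC c x, scaleC c y) \<in> T" and Aff_sv: "(x, y) \<in> T ==> (x, z) \<in> T ==> y = z"
  and Aff_inv: "(x, y) \<in> T ==> S \<in> N' ==> (S x, S y) \<in> T" and Aff_closed: "closed T"
  and Aff_invariant2: "invariant2 T"
proof -
 show 1: "(0, 0) \<in> T" and add: "\<And>x x' y y'. (x, y) \<in> T ==> (x', y') \<in> T ==> (x + x', y + y') \<in> T"
  and sc: "\<And>c x y. (x, y) \<in> T ==> (scaleC c x, scaleC c y) \<in> T"
  and inv: "\<And>S x y. (x, y) \<in> T ==> S \<in> N' ==> (S x, S y) \<in> T" and c: "closed T"
  and "(x, y) \<in> T ==> (x, z) \<in> T ==> y = z" for x y z using T unfolding Aff_def closed_densely_defined_def by (auto dest: single_valuedD)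
 have "subspace T" unfolding subspace_def using 1 add sc[of _ _ "complex_of_real _"] by (auto simp: zero_prod_def simp flip: scaleR_scaleC)
 then show "invariant2 T" using c inv by (auto simp: invariant2_def)
qed

lemma Aff_zero_D: "T \<in> Aff ==> (0, y) \<in> T ==> y = 0" using Aff_sv Aff_zero by blast

lemma AffI:
 assumes T: "invariant2 T" and z: "\<And>y. (0, y) \<in> T ==> y = 0" and D: "tdense (Domain T)" shows "T \<in> Aff"
proof -
 have sub: "subspace T" and c: "closed T" and inv: "\<And>S x y. S \<in> N' ==> (x, y) \<in> T ==> (S x, S y) \<in> T"
  using T by (auto simp: invariant2_def)
 have "(0, 0) \<in> T" using subspace_0[OF sub] by (simp add: zero_prod_def)
 moreover have "(x + x', y + y') \<in> T" if "(x, y) \<in> T" "(x', y') \<in> T" for x y x' y' using subspace_add[OF sub that] by simp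
 moreover have "single_valued T"
 proof (rule single_valuedI)
  fix x y y' assume "(x, y) \<in> T" "(x, y') \<in> T"
  from subspace_diff[OF sub this] z[of "y - y'"] show "y = y'" by simp
 qed
 moreover have "closure (Domain T) = UNIV"
 proof (rule dense_if_ortho_trivial)
  show "subspace (Domain T)" using linear_subspace_image[OF linear_fst sub] by (simp add: fst_eq_Domain)
 qed (rule tdense_ortho[OF D])
 ultimately show ?thesis using c inv inv[OF N'_scaleC] unfolding Aff_def closed_densely_defined_def by blast
qed

text \<open>The blocks of the projection onto the graph of an affiliated operator provide fractions
 with numerator and denominator in the algebra.\<close>

lemma right_fraction:
 assumes T: "T \<in> Aff"
 obtains s a where "s \<in> N" "a \<in> N" "ker s = {0}" "\<And>x. (s x, a x) \<in> T"
proof -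
 note inv = Aff_invariant2[OF T]
 have cT: "csub T" using inv by (simp add: invariant2_def)
 \<comment> \<open>With \<open>T'\<close> the adjoint of \<open>T\<close>, these are the bounded
   operators \<open>(1 + T' T)^(-1)\<close> and \<open>T (1 + T' T)^(-1)\<close>.\<close>
 let ?s = "\<lambda>x. fst (pr T (x, 0))" and ?a = "\<lambda>x. snd (pr T (x, 0))"
 have "x = 0" if "?s x = 0" for x
 proof (rule orth_dense_zero[of "Domain T"])
  show "closure (Domain T) = UNIV" using T by (simp add: Aff_def closed_densely_defined_def)
  fix g assume "g \<in> Domain T"
  then obtain h where gh: "(g, h) \<in> T" by blast
  have "pr T (x, 0) = (0, ?a x)" using that by (simp add: prod_eq_iff)
  moreover have "(0, ?a x) \<in> T" using pr_in[OF cT, of "(x, 0)"] calculation by simp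
  then have "?a x = 0" by (rule Aff_zero_D[OF T])
  ultimately have "pr T (x, 0) = 0" by (simp add: zero_prod_def)
  then have "inner (x, 0) (g, h) = 0" using pr_zero_iff[OF cT] gh by blast
  then show "inner x g = 0" by simp
 qed
 moreover have "?s 0 = 0" by (rule bclin_simps(4)[OF N_bc[OF pr_blocks(1)[OF inv]]])
 ultimately have "ker ?s = {0}" unfolding ker_def by blast
 then show ?thesis using pr_in[OF cT] by (intro that[OF pr_blocks(1,2)[OF inv]]) auto
qed

lemma left_fraction:
 assumes T: "T \<in> Aff"
 obtains s a where "s \<in> N" "a \<in> N" "ker s = {0}" "\<And>x y. (x, y) \<in> T ==> s y = a x"
proof -
 note inv = Aff_invariant2[OF T]
 have cT: "csub T" using inv by (simp add: invariant2_def)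
 \<comment> \<open>In the same notation \<open>?s\<close> is \<open>(1 + T T')^(-1)\<close>. The
   inclusion of \<open>?s T\<close> in \<open>?a\<close> is read off from the fact that the
   projection fixes \<open>(x, y) = (x, 0) + (0, y)\<close> for a point of the graph.\<close>
 let ?s = "\<lambda>x. x - snd (pr T (0, x))" and ?a = "\<lambda>x. snd (pr T (x, 0))"
 have s: "?s \<in> N" by (rule N_diff[OF N_id' pr_blocks(4)[OF inv]])
 have "x = 0" if "?s x = 0" for x
 proof -
  have "inner (pr T (0, x)) (0, x) = (norm x)\<^sup>2" using that by (simp add: inner_prod_def power2_norm_eq_inner)
  then have "(norm (pr T (0, x)))\<^sup>2 = (norm (0::'a, x))\<^sup>2" using pr_inner_self[OF cT, of "(0, x)"] by simp
  then have "(0, x) - pr T (0, x) = 0" using norm_pr_Pythagoras[OF cT, of "(0, x)"] by simp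
  then have "(0, x) \<in> T" using pr_in[OF cT, of "(0, x)"] by simp
  then show ?thesis by (rule Aff_zero_D[OF T])
 qed
 moreover have "?s 0 = 0" by (rule bclin_simps(4)[OF N_bc[OF s]])
 ultimately have "ker ?s = {0}" unfolding ker_def by blast
 moreover have "?s y = ?a x" if "(x, y) \<in> T" for x y
 proof -
  have "pr T (x, 0) + pr T (0, y) = (x, y)" using pr_id[OF cT that] pr_add[OF cT, of "(x, 0)" "(0, y)"] by simp
  then have "snd (pr T (x, 0)) + snd (pr T (0, y)) = y" by (metis snd_add snd_conv)
  then show ?thesis by (simp add: algebra_simps)
 qed
 ultimately show ?thesis by (intro that[OF s pr_blocks(2)[OF inv]])
qed

text \<open>For a right fraction of \<open>T\<close> with denominator \<open>s\<close> and numerator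
  \<open>a\<close>, the set contains the image under \<open>s\<close> of the preimage of
  \<open>D\<close> under \<open>a\<close>.\<close>

lemma tdense_rel_vimage:
 assumes T: "T \<in> Aff" and D: "tdense D" shows "tdense {x. \<exists>y. (x, y) \<in> T \<and> y \<in> D}"
proof -
 obtain s a where sa: "s \<in> N" "a \<in> N" "ker s = {0}" "\<And>x. (s x, a x) \<in> T" by (rule right_fraction[OF T]) (rule that)
 have "tdense (s ` {x. a x \<in> D})" by (rule tdense_image[OF sa(1,3) tdense_vimage[OF sa(2) D]])
 then show ?thesis by (rule tdense_mono) (use sa(4) in auto)
qed

lemma tdense_Domain: "T \<in> Aff ==> tdense (Domain T)" by (rule tdense_mono[OF tdense_rel_vimage[OF _ tdense_UNIV]]) auto

text \<open>Affiliated operators have no proper affiliated extensions. The part \<open>G\<close> of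
  the larger graph orthogonal to the smaller one would have a nonzero block \<open>?p\<close>; its
  range contains an affiliated subspace of positive dimension, which meets the domain of
  \<open>S\<close>. At such a point single-valuedness of \<open>T\<close> puts one nonzero pair into
  both \<open>S\<close> and \<open>ortho S\<close>.\<close>

lemma Aff_subset_eq:
 assumes S: "S \<in> Aff" and T: "T \<in> Aff" and ST: "S \<subseteq> T" shows "S = T"
proof (rule ccontr)
 assume ne: "S \<noteq> T"
 have cS: "csub S" and cT: "csub T" using Aff_invariant2[OF S] Aff_invariant2[OF T] by (auto simp: invariant2_def)
 define G where "G = T \<inter> ortho S"
 have "(R x, R y) \<in> ortho S" if "R \<in> N'" "(x, y) \<in> ortho S" for R x y unfolding ortho_def
 proof (clarify)
  fix u v assume "(u, v) \<in> S"
  then have "(adj R u, adj R v) \<in> S" using Aff_inv[OF S _ N'_adj[OF that(1)]] by blast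
  then show "inner (R x, R y) (u, v) = 0" using that(2) by (auto simp: ortho_def adj_right[OF N'_bc[OF that(1)]])
 qed
 then have G: "invariant2 G" using cT csub_ortho[of S] Aff_inv[OF T] by (auto simp: invariant2_def G_def subspace_inter)
 have cG: "csub G" using G by (simp add: invariant2_def)
 let ?p = "\<lambda>x. fst (pr G (x, 0))"
 have p: "?p \<in> N" by (rule pr_blocks(1)[OF G])
 obtain z where z: "z \<in> T" "z \<notin> S" using ne ST by blast
 define w where "w = z - pr S z"
 have w0: "w \<noteq> 0" using z(2) pr_in[OF cS, of z] by (auto simp: w_def)
 have "pr S z \<in> T" using pr_in[OF cS] ST by blast
 then have "w \<in> T" using z(1) cT by (simp add: w_def subspace_diff)
 moreover have "w \<in> ortho S" using pr_orth[OF cS] by (auto simp: ortho_def w_def)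
 ultimately have wG: "w \<in> G" by (simp add: G_def)
 have "ker ?p \<noteq> UNIV"
 proof
  assume k: "ker ?p = UNIV"
  have "pr G (x, 0) = 0" for x
  proof -
   have "pr G (x, 0) = (0, snd (pr G (x, 0)))" using k by (auto simp: ker_def prod_eq_iff)
   moreover have "pr G (x, 0) \<in> T" using pr_in[OF cG] by (auto simp: G_def)
   ultimately show ?thesis using Aff_zero_D[OF T] by (metis zero_prod_def)
  qed
  then have "inner (x, 0) w = 0" for x using pr_zero_iff[OF cG] wG by blast
  then have "inner (fst w) (fst w) = 0" by (metis fst_conv inner_prod_def inner_zero_left snd_conv add.right_neutral)
  then have "w = (0, snd w)" by (simp add: prod_eq_iff)
  then show False using Aff_zero_D[OF T] \<open>w \<in> T\<close> w0 by (metis zero_prod_def)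
 qed
 moreover have "ortho {0} = UNIV" by (simp add: ortho_def)
 ultimately have "ortho (ker ?p) \<noteq> {0}" using ortho_ortho[OF aff_cs[OF aff_ker[OF p]]] by metis
 then have "d (ortho (ker ?p)) > 0" using d_eq_0[OF aff_ortho[OF aff_ker[OF p]]] d_nonneg[OF aff_ortho[OF aff_ker[OF p]]] by fastforce
 then have "d UNIV - d (ker ?p) > 0" by (simp add: d_ortho[OF aff_ker[OF p]])
 from range_contains_aff[OF p this] obtain H where H: "aff H" "H \<subseteq> range ?p" "0 < d H" by auto
 have "H \<noteq> {0}" using H(3) d_zero by auto
 from tdense_meets[OF tdense_Domain[OF S] H(1) this] obtain x where x: "x \<noteq> 0" "x \<in> Domain S" "x \<in> H" by blast
 then obtain y v where xy: "(x, y) \<in> S" and v: "x = ?p v" using H(2) by blast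
 have "pr G (v, 0) = (x, snd (pr G (v, 0)))" by (simp add: v)
 with pr_in[OF cG, of "(v, 0)"] have xG: "(x, snd (pr G (v, 0))) \<in> G" by simp
 then have "snd (pr G (v, 0)) = y" using xy ST Aff_sv[OF T] by (auto simp: G_def)
 then have "inner (x, y) (x, y) = 0" using xG xy by (auto simp: G_def ortho_def)
 then have "(x, y) = 0" by (simp only: inner_eq_zero_iff)
 then show False using x(1) by (simp add: zero_prod_def)
qed

text \<open>The intersection of the two graphs is again affiliated, and by maximality it equals
  both. Every ring identity below becomes a pointwise computation on a \<open>tdense\<close>
  set.\<close>

lemma Aff_eqI:
 assumes S: "S \<in> Aff" and T: "T \<in> Aff" and D: "tdense D" and eq: "\<And>x. x \<in> D ==> \<exists>y. (x, y) \<in> S \<and> (x, y) \<in> T"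
 shows "S = T"
proof -
 have "S \<inter> T \<in> Aff"
 proof (rule AffI)
  show "invariant2 (S \<inter> T)" using Aff_invariant2[OF S] Aff_invariant2[OF T] unfolding invariant2_def by (auto simp: subspace_inter)
  show "tdense (Domain (S \<inter> T))" by (rule tdense_mono[OF D]) (use eq in blast)
  show "y = 0" if "(0, y) \<in> S \<inter> T" for y using that by (intro Aff_zero_D[OF S]) simp
 qed
 from Aff_subset_eq[OF this S] Aff_subset_eq[OF this T] show ?thesis by blast
qed

lemma closure_linear2:
 fixes f :: "'a => 'a"
 assumes f: "bounded_linear f" and R: "\<And>x y. (x, y) \<in> R ==> (f x, f y) \<in> R" and xy: "(x, y) \<in> closure R"
 shows "(f x, f y) \<in> closure R"
proof -
 obtain g where g: "\<And>n. g n \<in> R" "g \<leadsto> (x, y)" using xy by (auto simp: closure_sequential)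
 have "(\<lambda>n. (f (fst (g n)), f (snd (g n)))) \<leadsto> (f x, f y)" using tendsto_fst[OF g(2)] tendsto_snd[OF g(2)]
  by (intro tendsto_Pair bounded_linear.tendsto[OF f]) auto
 moreover have "(f (fst (g n)), f (snd (g n))) \<in> R" for n using R[of "fst (g n)" "snd (g n)"] g(1) by simp
 ultimately show ?thesis unfolding closure_sequential by (intro exI[of _ "\<lambda>n. (f (fst (g n)), f (snd (g n)))"]) simp
qed

text \<open>The adjoint criterion for closability: the formal adjoint is defined on the
  \<open>tdense\<close> set \<open>D\<close> of test vectors, so a limit point \<open>(0, y)\<close>
  of the relation has \<open>y\<close> orthogonal to \<open>D\<close>.\<close>

lemma closure_Aff:
 assumes R: "(0, 0) \<in> R" "\<And>x y x' y'. (x, y) \<in> R ==> (x', y') \<in> R ==> (x + x', y + y') \<in> R"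
  "\<And>S x y. S \<in> N' ==> (x, y) \<in> R ==> (S x, S y) \<in> R" and dom: "tdense (Domain R)" and D: "tdense D"
  and adj: "\<And>z. z \<in> D ==> \<exists>w. \<forall>(x, y)\<in>R. inner y z = inner x w" shows "closure R \<in> Aff"
proof -
 have inv: "(S x, S y) \<in> closure R" if "S \<in> N'" "(x, y) \<in> closure R" for S x y
  using closure_linear2[OF bclin_bl[OF N'_bc[OF that(1)]] _ that(2)] R(3)[OF that(1)] by blast
 have "subspace R" unfolding subspace_def
  using R(1,2) R(3)[OF N'_scaleC[of "complex_of_real _"]] by (auto simp: zero_prod_def simp flip: scaleR_scaleC)
 then have sub: "subspace (closure R)" by (rule subspace_closure)
 have z: "y = 0" if "(0, y) \<in> closure R" for y
 proof (rule tdense_ortho[OF D])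
  show "y \<in> ortho D" unfolding ortho_def
  proof (clarify)
   fix z assume "z \<in> D"
   then obtain w where w: "\<And>x y. (x, y) \<in> R ==> inner y z = inner x w" using adj by blast
   have "closed {p. inner (snd p) z = inner (fst p) w}"
    by (intro closed_Collect_eq bounded_linear.continuous_on[OF bounded_linear_inner_left] continuous_on_fst
      continuous_on_snd continuous_on_id)
   then have "closure R \<subseteq> {p. inner (snd p) z = inner (fst p) w}" using w by (intro closure_minimal) auto
   then show "inner y z = 0" using that by auto
  qed
 qed
 show ?thesis
 proof (rule AffI)
  show "invariant2 (closure R)" using sub inv by (auto simp: invariant2_def)
  show "tdense (Domain (closure R))" by (rule tdense_mono[OF dom Domain_mono[OF closure_subset]])
 qed (rule z)
qed

text \<open>Taking adjoints in a left fraction \<open>s y = a x\<close> shows that the adjoint of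
  \<open>T\<close> is defined on the range of \<open>adj s\<close>, a \<open>tdense\<close> set;
  this feeds the criterion \<open>closure_Aff\<close>.\<close>

lemma Aff_codomain:
 assumes T: "T \<in> Aff"
 obtains s a where "s \<in> N" "a \<in> N" "ker s = {0}" "\<And>x y z. (x, y) \<in> T ==> inner y (s z) = inner x (a z)"
proof -
 obtain s a where sa: "s \<in> N" "a \<in> N" "ker s = {0}" "\<And>x y. (x, y) \<in> T ==> s y = a x" by (rule left_fraction[OF T]) (rule that)
 show ?thesis
 proof (rule that[of "adj s" "adj a"])
  show "inner y (adj s z) = inner x (adj a z)" if "(x, y) \<in> T" for x y z
   using sa(4)[OF that] by (simp flip: adj_right[OF N_bc[OF sa(1)]] adj_right[OF N_bc[OF sa(2)]])
 qed (auto intro: N_adj sa simp: adj_ker_trivial[OF sa(1,3)])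
qed

section \<open>Sum and product of affiliated operators\<close>

definition aplus :: "('a \<times> 'a) set => ('a \<times> 'a) set => ('a \<times> 'a) set" where
 "aplus S T = closure {(x, y + z) | x y z. (x, y) \<in> S \<and> (x, z) \<in> T}"

definition atimes :: "('a \<times> 'a) set => ('a \<times> 'a) set => ('a \<times> 'a) set" where
 "atimes S T = closure {(x, z). \<exists>y. (x, y) \<in> T \<and> (y, z) \<in> S}"

lemma aplusI: "(x, y) \<in> S ==> (x, z) \<in> T ==> (x, y + z) \<in> aplus S T"
 and atimesI: "(x, y) \<in> T ==> (y, z) \<in> S ==> (x, z) \<in> atimes S T"
 unfolding aplus_def atimes_def by (rule subsetD[OF closure_subset]; blast)+

lemma aplus_Aff: assumes S: "S \<in> Aff" and T: "T \<in> Aff" shows "aplus S T \<in> Aff" unfolding aplus_def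
proof -
 obtain s a where sa: "s \<in> N" "a \<in> N" "ker s = {0}" "\<And>x y z. (x, y) \<in> S ==> inner y (s z) = inner x (a z)"
  by (rule Aff_codomain[OF S]) (rule that)
 obtain t b where tb: "t \<in> N" "b \<in> N" "ker t = {0}" "\<And>x y z. (x, y) \<in> T ==> inner y (t z) = inner x (b z)"
  by (rule Aff_codomain[OF T]) (rule that)
 show "closure {(x, y + z) | x y z. (x, y) \<in> S \<and> (x, z) \<in> T} \<in> Aff"
 proof (rule closure_Aff)
  show "tdense (Domain {(x, y + z) | x y z. (x, y) \<in> S \<and> (x, z) \<in> T})"
   by (rule tdense_mono[OF tdense_Int[OF tdense_Domain[OF S] tdense_Domain[OF T]]]) blast
  show "tdense (range s \<inter> range t)" by (intro tdense_Int tdense_range sa tb)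
  fix z assume "z \<in> range s \<inter> range t"
  then obtain u v where "z = s u" "z = t v" by blast
  then show "\<exists>w. \<forall>(x, y)\<in>{(x, y + z) | x y z. (x, y) \<in> S \<and> (x, z) \<in> T}. inner y z = inner x w"
   using sa(4) tb(4) by (intro exI[of _ "a u + b v"]) (auto simp: inner_add_left inner_add_right, metis)
 next
  show "(0, 0) \<in> {(x, y + z) | x y z. (x, y) \<in> S \<and> (x, z) \<in> T}" using Aff_zero[OF S] Aff_zero[OF T] by force
 next
  fix R x y assume R: "R \<in> N'" and "(x, y) \<in> {(x, y + z) | x y z. (x, y) \<in> S \<and> (x, z) \<in> T}"
  then obtain u v where "(x, u) \<in> S" "(x, v) \<in> T" "y = u + v" by blast
  then show "(R x, R y) \<in> {(x, y + z) | x y z. (x, y) \<in> S \<and> (x, z) \<in> T}"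
   using Aff_inv[OF S _ R] Aff_inv[OF T _ R] bclin_simps(1)[OF N'_bc[OF R]] by blast
 next
  fix x y x' y'
  assume "(x, y) \<in> {(x, y + z) | x y z. (x, y) \<in> S \<and> (x, z) \<in> T}" "(x', y') \<in> {(x, y + z) | x y z. (x, y) \<in> S \<and> (x, z) \<in> T}"
  then obtain u v u' v' where uv: "(x, u) \<in> S" "(x, v) \<in> T" "y = u + v" "(x', u') \<in> S" "(x', v') \<in> T" "y' = u' + v'" by blast
  have "y + y' = (u + u') + (v + v')" by (simp add: uv)
  then show "(x + x', y + y') \<in> {(x, y + z) | x y z. (x, y) \<in> S \<and> (x, z) \<in> T}"
   using Aff_add[OF S uv(1,4)] Aff_add[OF T uv(2,5)] by blast
 qed
qed

lemma atimes_Aff: assumes S: "S \<in> Aff" and T: "T \<in> Aff" shows "atimes S T \<in> Aff" unfolding atimes_def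
proof -
 obtain s a where sa: "s \<in> N" "a \<in> N" "ker s = {0}" "\<And>x y z. (x, y) \<in> S ==> inner y (s z) = inner x (a z)"
  by (rule Aff_codomain[OF S]) (rule that)
 obtain t b where tb: "t \<in> N" "b \<in> N" "ker t = {0}" "\<And>x y z. (x, y) \<in> T ==> inner y (t z) = inner x (b z)"
  by (rule Aff_codomain[OF T]) (rule that)
 let ?R = "{(x, z). \<exists>y. (x, y) \<in> T \<and> (y, z) \<in> S}"
 show "closure ?R \<in> Aff"
 proof (rule closure_Aff)
  show "tdense (Domain ?R)" by (rule tdense_mono[OF tdense_rel_vimage[OF T tdense_Domain[OF S]]]) blast
  \<comment> \<open>On \<open>z = s u\<close> with \<open>a u = t v\<close> the adjoint fractions
    carry first \<open>S\<close> and then \<open>T\<close> across the inner product, with resulting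
    adjoint value \<open>b v\<close>.\<close>
  show "tdense (s ` {z. a z \<in> range t})" by (intro tdense_image tdense_vimage tdense_range sa tb)
  fix z assume "z \<in> s ` {z. a z \<in> range t}"
  then obtain u v where "z = s u" "a u = t v" by blast
  then show "\<exists>w. \<forall>(x, y)\<in>?R. inner y z = inner x w" using sa(4) tb(4) by (intro exI[of _ "b v"]) auto
 next
  show "(0, 0) \<in> ?R" using Aff_zero[OF S] Aff_zero[OF T] by blast
 next
  fix R x y assume R: "R \<in> N'" and "(x, y) \<in> ?R"
  then show "(R x, R y) \<in> ?R" using Aff_inv[OF S _ R] Aff_inv[OF T _ R] by blast
 next
  fix x y x' y' assume "(x, y) \<in> ?R" "(x', y') \<in> ?R"
  then show "(x + x', y + y') \<in> ?R" using Aff_add[OF S] Aff_add[OF T] by blast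
 qed
qed

section \<open>Graphs of elements of the algebra and their inverses\<close>

lemma gr_iff: "(x, y) \<in> gr a \<longleftrightarrow> y = a x" by (auto simp: op_graph_def)

lemma gr_Aff: assumes a: "a \<in> N" shows "gr a \<in> Aff"
proof -
 note b = bclin_simps[OF N_bc[OF a]]
 have "gr a = {p. snd p = a (fst p)}" by (auto simp: op_graph_def)
 moreover have "closed {p. snd p = a (fst p)}" by (intro closed_Collect_eq continuous_intros bounded_linear.continuous_on[OF bclin_bl[OF N_bc[OF a]]])
 ultimately have "invariant2 (gr a)" by (auto simp: invariant2_def subspace_def b N_comm[OF a])
 then show ?thesis by (rule AffI) (auto simp: op_graph_def b tdense_UNIV Domain_unfold)
qed

lemma converse_Aff: assumes s: "s \<in> N" and k: "ker s = {0}" shows "(gr s)\<inverse> \<in> Aff"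
proof -
 note b = bclin_simps[OF N_bc[OF s]]
 have inj: "x = y" if "s x = s y" for x y
 proof -
  have "x - y \<in> ker s" using that by (simp add: ker_def b)
  then show ?thesis using k by simp
 qed
 have e: "(gr s)\<inverse> = {p. fst p = s (snd p)}" by (auto simp: op_graph_def)
 have "closed {p. fst p = s (snd p)}" by (intro closed_Collect_eq continuous_intros bounded_linear.continuous_on[OF bclin_bl[OF N_bc[OF s]]])
 then have "invariant2 ((gr s)\<inverse>)" by (auto simp: e invariant2_def subspace_def b N_comm[OF s])
 then show ?thesis
 proof (rule AffI)
  show "y = 0" if "(0, y) \<in> (gr s)\<inverse>" for y using that inj[of y 0] by (simp add: e b)
  show "tdense (Domain ((gr s)\<inverse>))" by (rule tdense_mono[OF tdense_range[OF s k]]) (auto simp: op_graph_def)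
 qed
qed

section \<open>The ring of affiliated operators and its fractions\<close>

definition aring :: "('a \<times> 'a) set ring" where
 "aring = \<lparr>carrier = Aff, monoid.mult = atimes, one = gr id, ring.zero = gr (\<lambda>_. 0), ring.add = aplus\<rparr>"

lemma aring_simps [simp]: "carrier aring = Aff" "S \<otimes>\<^bsub>aring\<^esub> T = atimes S T" "\<one>\<^bsub>aring\<^esub> = gr id"
 "\<zero>\<^bsub>aring\<^esub> = gr (\<lambda>_. 0)" "S \<oplus>\<^bsub>aring\<^esub> T = aplus S T" by (simp_all add: aring_def)

lemma aplus_commute: "aplus S T = aplus T S"
proof -
 have "{(x, y + z) | x y z. (x, y) \<in> S \<and> (x, z) \<in> T} \<subseteq> {(x, y + z) | x y z. (x, y) \<in> T \<and> (x, z) \<in> S}"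
  for S T :: "('a \<times> 'a) set"
 proof clarify
  fix x y z assume "(x, y) \<in> S" "(x, z) \<in> T"
  then show "\<exists>x' y' z'. (x, y + z) = (x', y' + z') \<and> (x', y') \<in> T \<and> (x', z') \<in> S"
   by (rule_tac exI[of _ x], rule_tac exI[of _ z], rule_tac exI[of _ y]) (simp)
 qed
 then show ?thesis unfolding aplus_def by (intro arg_cong[of _ _ closure] equalityI)
qed

lemma aplus_assoc:
 assumes S: "S \<in> Aff" and T: "T \<in> Aff" and V: "V \<in> Aff" shows "aplus (aplus S T) V = aplus S (aplus T V)"
proof (rule Aff_eqI)
 show "tdense (Domain S \<inter> Domain T \<inter> Domain V)" by (intro tdense_Int tdense_Domain S T V)
 fix x assume "x \<in> Domain S \<inter> Domain T \<inter> Domain V"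
 then obtain a b c where "(x, a) \<in> S" "(x, b) \<in> T" "(x, c) \<in> V" by blast
 then have "(x, a + b + c) \<in> aplus (aplus S T) V" "(x, a + (b + c)) \<in> aplus S (aplus T V)" by (auto intro!: aplusI)
 then show "\<exists>y. (x, y) \<in> aplus (aplus S T) V \<and> (x, y) \<in> aplus S (aplus T V)" by (auto simp: add.assoc)
qed (intro aplus_Aff S T V)+

lemma aplus_zero: assumes T: "T \<in> Aff" shows "aplus (gr (\<lambda>_. 0)) T = T"
proof (rule Aff_eqI[OF _ T tdense_Domain[OF T]])
 fix x assume "x \<in> Domain T"
 then obtain y where y: "(x, y) \<in> T" by blast
 have "(x, 0 + y) \<in> aplus (gr (\<lambda>_. 0)) T" by (rule aplusI[OF _ y]) (simp add: gr_iff)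
 with y show "\<exists>y. (x, y) \<in> aplus (gr (\<lambda>_. 0)) T \<and> (x, y) \<in> T" by auto
qed (intro aplus_Aff gr_Aff N_zero T)

lemma aplus_neg: assumes T: "T \<in> Aff" shows "aplus (atimes (gr uminus) T) T = gr (\<lambda>_. 0)"
proof (rule Aff_eqI[OF _ _ tdense_Domain[OF T]])
 have m: "uminus \<in> N" using N_minus[OF N_id'] by simp
 show "aplus (atimes (gr uminus) T) T \<in> Aff" by (intro aplus_Aff atimes_Aff gr_Aff m T)
 show "gr (\<lambda>_. 0) \<in> Aff" by (rule gr_Aff[OF N_zero])
 fix x assume "x \<in> Domain T"
 then obtain y where y: "(x, y) \<in> T" by blast
 have "(x, - y + y) \<in> aplus (atimes (gr uminus) T) T" by (rule aplusI[OF atimesI[OF y] y]) (simp add: gr_iff)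
 then show "\<exists>y. (x, y) \<in> aplus (atimes (gr uminus) T) T \<and> (x, y) \<in> gr (\<lambda>_. 0)" by (auto simp: gr_iff)
qed

lemma atimes_assoc:
 assumes S: "S \<in> Aff" and T: "T \<in> Aff" and V: "V \<in> Aff" shows "atimes (atimes S T) V = atimes S (atimes T V)"
proof (rule Aff_eqI)
 let ?D = "{x. \<exists>y. (x, y) \<in> V \<and> y \<in> {y. \<exists>z. (y, z) \<in> T \<and> z \<in> Domain S}}"
 show "tdense ?D" by (intro tdense_rel_vimage tdense_Domain S T V)
 fix x assume "x \<in> ?D"
 then obtain a b c where abc: "(x, a) \<in> V" "(a, b) \<in> T" "(b, c) \<in> S" by blast
 then show "\<exists>y. (x, y) \<in> atimes (atimes S T) V \<and> (x, y) \<in> atimes S (atimes T V)" by (meson atimesI)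
qed (intro atimes_Aff S T V)+

lemma atimes_one: assumes T: "T \<in> Aff" shows "atimes (gr id) T = T" "atimes T (gr id) = T"
proof -
 show "atimes (gr id) T = T"
 proof (rule Aff_eqI[OF _ T tdense_Domain[OF T]])
  fix x assume "x \<in> Domain T"
  then obtain y where y: "(x, y) \<in> T" by blast
  then have "(x, y) \<in> atimes (gr id) T" by (rule atimesI) (simp add: gr_iff)
  with y show "\<exists>y. (x, y) \<in> atimes (gr id) T \<and> (x, y) \<in> T" by blast
 qed (intro atimes_Aff gr_Aff N_id T)
 show "atimes T (gr id) = T"
 proof (rule Aff_eqI[OF _ T tdense_Domain[OF T]])
  fix x assume "x \<in> Domain T"
  then obtain y where y: "(x, y) \<in> T" by blast
  then have "(x, y) \<in> atimes T (gr id)" by (intro atimesI[of x x]) (simp add: gr_iff)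
  with y show "\<exists>y. (x, y) \<in> atimes T (gr id) \<and> (x, y) \<in> T" by blast
 qed (intro atimes_Aff gr_Aff N_id T)
qed

lemma atimes_distrib_right:
 assumes S: "S \<in> Aff" and T: "T \<in> Aff" and V: "V \<in> Aff" shows "atimes (aplus S T) V = aplus (atimes S V) (atimes T V)"
proof (rule Aff_eqI)
 let ?D = "{x. \<exists>y. (x, y) \<in> V \<and> y \<in> Domain S \<inter> Domain T}"
 show "tdense ?D" by (intro tdense_rel_vimage tdense_Int tdense_Domain S T V)
 fix x assume "x \<in> ?D"
 then obtain a b c where abc: "(x, a) \<in> V" "(a, b) \<in> S" "(a, c) \<in> T" by blast
 then show "\<exists>y. (x, y) \<in> atimes (aplus S T) V \<and> (x, y) \<in> aplus (atimes S V) (atimes T V)" by (meson atimesI aplusI)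
qed (intro atimes_Aff aplus_Aff S T V)+

lemma atimes_distrib_left:
 assumes S: "S \<in> Aff" and T: "T \<in> Aff" and V: "V \<in> Aff" shows "atimes V (aplus S T) = aplus (atimes V S) (atimes V T)"
proof (rule Aff_eqI)
 let ?D = "{x. \<exists>y. (x, y) \<in> S \<and> y \<in> Domain V} \<inter> {x. \<exists>y. (x, y) \<in> T \<and> y \<in> Domain V}"
 show "tdense ?D" by (intro tdense_rel_vimage tdense_Int tdense_Domain S T V)
 fix x assume "x \<in> ?D"
 then obtain a b a' b' where ab: "(x, a) \<in> S" "(a, a') \<in> V" "(x, b) \<in> T" "(b, b') \<in> V" by blast
 then have "(x, a' + b') \<in> aplus (atimes V S) (atimes V T)" by (intro aplusI atimesI)
 moreover have "(x, a' + b') \<in> atimes V (aplus S T)" by (rule atimesI[OF aplusI[OF ab(1,3)] Aff_add[OF V ab(2,4)]])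
 ultimately show "\<exists>y. (x, y) \<in> atimes V (aplus S T) \<and> (x, y) \<in> aplus (atimes V S) (atimes V T)" by blast
qed (intro atimes_Aff aplus_Aff S T V)+

lemma ring_aring: "ring aring"
proof (rule ringI)
 show "abelian_group aring"
 proof (rule abelian_groupI)
  fix T assume "T \<in> carrier aring"
  then have T: "T \<in> Aff" by simp
  have m: "uminus \<in> N" using N_minus[OF N_id'] by simp
  show "\<exists>y\<in>carrier aring. y \<oplus>\<^bsub>aring\<^esub> T = \<zero>\<^bsub>aring\<^esub>"
   using aplus_neg[OF T] by (auto intro!: atimes_Aff gr_Aff m T)
 next
  fix S T assume "S \<in> carrier aring" "T \<in> carrier aring"
  show "S \<oplus>\<^bsub>aring\<^esub> T = T \<oplus>\<^bsub>aring\<^esub> S" by (simp only: aring_simps aplus_commute[of S T])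
 qed (auto simp: aplus_Aff aplus_assoc aplus_zero gr_Aff N_zero)
 show "monoid aring" by (rule monoidI) (auto simp: atimes_Aff atimes_assoc atimes_one gr_Aff N_id)
qed (auto simp: atimes_distrib_right atimes_distrib_left)

lemma aplus_op_graph: assumes a: "a \<in> N" and b: "b \<in> N" shows "aplus (gr a) (gr b) = gr (\<lambda>x. a x + b x)"
proof (rule Aff_eqI[OF _ _ tdense_UNIV])
 fix x show "\<exists>y. (x, y) \<in> aplus (gr a) (gr b) \<and> (x, y) \<in> gr (\<lambda>x. a x + b x)"
  by (intro exI[of _ "a x + b x"] conjI aplusI) (auto simp: gr_iff)
qed (intro aplus_Aff gr_Aff N_add a b)+

lemma atimes_op_graph: assumes a: "a \<in> N" and b: "b \<in> N" shows "atimes (gr a) (gr b) = gr (a \<circ> b)"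
proof (rule Aff_eqI[OF _ _ tdense_UNIV])
 fix x show "\<exists>y. (x, y) \<in> atimes (gr a) (gr b) \<and> (x, y) \<in> gr (a \<circ> b)"
  by (intro exI[of _ "a (b x)"] conjI atimesI) (auto simp: gr_iff)
qed (intro atimes_Aff gr_Aff N_comp a b)+

lemma gr_Units: assumes s: "s \<in> N" and k: "ker s = {0}" shows "gr s \<in> Units aring"
proof -
 note c = converse_Aff[OF s k] and g = gr_Aff[OF s]
 have "atimes ((gr s)\<inverse>) (gr s) = gr id"
 proof (rule Aff_eqI[OF _ _ tdense_UNIV])
  fix x show "\<exists>y. (x, y) \<in> atimes ((gr s)\<inverse>) (gr s) \<and> (x, y) \<in> gr id"
   by (intro exI[of _ x] conjI atimesI[of x "s x"]) (auto simp: gr_iff)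
 qed (intro atimes_Aff gr_Aff c g N_id)+
 moreover have "atimes (gr s) ((gr s)\<inverse>) = gr id"
 proof (rule Aff_eqI[OF _ _ tdense_range[OF s k]])
  fix x assume "x \<in> range s"
  then obtain z where "x = s z" by blast
  then show "\<exists>y. (x, y) \<in> atimes (gr s) ((gr s)\<inverse>) \<and> (x, y) \<in> gr id"
   by (intro exI[of _ x] conjI atimesI[of x z]) (auto simp: gr_iff)
 qed (intro atimes_Aff gr_Aff c g N_id)+
 ultimately show ?thesis using c g by (auto simp: Units_def)
qed

lemma aring_right_fraction:
 assumes T: "T \<in> Aff"
 obtains s a where "s \<in> N" "a \<in> N" "gr s \<in> Units aring" "atimes T (gr s) = gr a"
proof -
 obtain s a where sa: "s \<in> N" "a \<in> N" "ker s = {0}" "\<And>x. (s x, a x) \<in> T" by (rule right_fraction[OF T]) (rule that)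
 have "atimes T (gr s) = gr a"
 proof (rule Aff_eqI[OF _ _ tdense_UNIV])
  fix x show "\<exists>y. (x, y) \<in> atimes T (gr s) \<and> (x, y) \<in> gr a"
   by (intro exI[of _ "a x"] conjI atimesI[of x "s x"]) (auto simp: gr_iff sa)
 qed (intro atimes_Aff gr_Aff T sa)+
 then show ?thesis using that sa gr_Units by blast
qed

lemma aring_left_fraction:
 assumes T: "T \<in> Aff"
 obtains s a where "s \<in> N" "a \<in> N" "gr s \<in> Units aring" "atimes (gr s) T = gr a"
proof -
 obtain s a where sa: "s \<in> N" "a \<in> N" "ker s = {0}" "\<And>x y. (x, y) \<in> T ==> s y = a x" by (rule left_fraction[OF T]) (rule that)
 have "atimes (gr s) T = gr a"
 proof (rule Aff_eqI[OF _ _ tdense_Domain[OF T]])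
  fix x assume "x \<in> Domain T"
  then obtain y where y: "(x, y) \<in> T" by blast
  have "(x, s y) \<in> atimes (gr s) T" by (rule atimesI[OF y]) (simp add: gr_iff)
  then show "\<exists>y. (x, y) \<in> atimes (gr s) T \<and> (x, y) \<in> gr a" using sa(4)[OF y] by (auto simp: gr_iff)
 qed (intro atimes_Aff gr_Aff T sa)+
 then show ?thesis using that sa gr_Units by blast
qed

end

section \<open>Left ideals of a finite von Neumann algebra\<close>

lemma bounded_incseq_small_step:
 fixes a :: "nat => real"
 assumes "\<And>n. a n \<le> a (Suc n)" "\<And>n. a n \<le> B" "e > 0" shows "\<exists>n. a (Suc n) - a n < e"
proof -
 have "incseq a" by (rule incseq_SucI) (rule assms(1))
 then obtain l where l: "a \<leadsto> l" by (rule incseq_convergent[of a B]) (use assms(2) in auto)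
 have "(\<lambda>n. a (Suc n) - a n) \<leadsto> l - l" by (intro tendsto_diff LIMSEQ_Suc l)
 from order_tendstoD(2)[OF this, of e] assms(3) show ?thesis unfolding eventually_sequentially by auto
qed

lemma pr_of_ortho: "csub G ==> x \<in> ortho G ==> pr G x = 0" by (auto simp: pr_zero_iff ortho_def)

context tracial
begin

text \<open>Left ideals phrased for operators rather than for a ring record, so that one analysis
  applies to \<open>A\<close> and to its image on the completion.\<close>

definition lideal :: "('a => 'a) set => bool" where
 "lideal I \<longleftrightarrow> I \<subseteq> N \<and> (\<lambda>_. 0) \<in> I \<and> (\<forall>a\<in>I. \<forall>b\<in>I. (\<lambda>x. a x + b x) \<in> I) \<and> (\<forall>r\<in>N. \<forall>a\<in>I. r \<circ> a \<in> I)"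

lemma
 assumes I: "lideal I" shows lideal_N: "a \<in> I ==> a \<in> N" and lideal_zero: "(\<lambda>_. 0) \<in> I"
  and lideal_add: "a \<in> I ==> b \<in> I ==> (\<lambda>x. a x + b x) \<in> I"
  and lideal_mult: "r \<in> N ==> a \<in> I ==> (\<lambda>x. r (a x)) \<in> I"
  and lideal_diff: "a \<in> I ==> b \<in> I ==> (\<lambda>x. a x - b x) \<in> I"
proof -
 show "a \<in> I ==> a \<in> N" "(\<lambda>_. 0) \<in> I" and add: "\<And>a b. a \<in> I ==> b \<in> I ==> (\<lambda>x. a x + b x) \<in> I"
  and mult: "\<And>r a. r \<in> N ==> a \<in> I ==> (\<lambda>x. r (a x)) \<in> I" using I unfolding lideal_def comp_def by blast+
 show "(\<lambda>x. a x - b x) \<in> I" if "a \<in> I" "b \<in> I" using add[OF that(1) mult[OF N_minus[OF N_id'] that(2)]] by simp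
qed

lemma pr_sum_orth:
 assumes F: "aff F" and H: "aff H" and HF: "H \<subseteq> ortho F"
 obtains G where "aff G" "F \<subseteq> G" "\<And>x. pr G x = pr F x + pr H x" "d G = d F + d H"
proof -
 note cF = aff_cs[OF F] and cH = aff_cs[OF H]
 have HF0: "pr H (pr F x) = 0" for x using HF pr_in[OF cF, of x] by (auto simp: pr_zero_iff[OF cH] ortho_def inner_commute)
 have FH0: "pr F (pr H x) = 0" for x using HF pr_in[OF cH, of x] by (auto simp: pr_zero_iff[OF cF] ortho_def)
 let ?p = "\<lambda>x. pr F x + pr H x"
 have p: "?p \<in> N" by (intro N_add pr_N F H)
 let ?G = "ker (\<lambda>x. x - ?p x)"
 have G: "aff ?G" by (rule aff_ker[OF N_diff[OF N_id' p]])
 have "pr ?G x = ?p x" for x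
 proof (rule pr_unique[OF aff_cs[OF G]])
  show "?p x \<in> ?G" by (simp add: ker_def pr_add[OF cF] pr_add[OF cH] pr_pr[OF cF] pr_pr[OF cH] HF0 FH0)
  fix h assume "h \<in> ?G"
  then have h: "h = ?p h" by (simp add: ker_def)
  have "inner (x - ?p x) h = inner x h - inner x (?p h)" by (simp add: inner_diff_left inner_add_left inner_add_right pr_sym[OF cF] pr_sym[OF cH])
  then show "inner (x - ?p x) h = 0" using h by simp
 qed
 then have prG: "pr ?G = ?p" by auto
 moreover have "F \<subseteq> ?G"
 proof
  fix x assume x: "x \<in> F"
  then have "pr H x = 0" using HF0[of x] by (simp add: pr_id[OF cF])
  then show "x \<in> ?G" using x by (simp add: ker_def pr_id[OF cF])
 qed
 moreover have "d ?G = d F + d H" unfolding d_def prG by (rule t_add[OF pr_N[OF F] pr_N[OF H]])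
 ultimately show ?thesis by (intro that[OF G]) auto
qed

text \<open>A greedy choice of orthogonal projections in the ideal, each of at least half the possible
 dimension, exhausts the ideal.\<close>

lemma lideal_projections:
 assumes I: "lideal I"
 obtains g E where "\<And>n::nat. aff (g n)" "incseq g" "\<And>n. pr (g n) \<in> I" "aff E" "\<And>n. g n \<subseteq> E"
  "\<And>e. e > 0 ==> \<exists>n. d E - e < d (g n)" "\<And>a x. a \<in> I ==> a (pr E x) = a x"
  "\<And>y. y \<in> E ==> \<forall>n. pr (g n) y = 0 ==> y = 0"
proof -
 define P where "P F \<longleftrightarrow> aff F \<and> pr F \<in> I" for F
 \<comment> \<open>The supremum of the dimensions of projections of \<open>I\<close> orthogonal to
   \<open>F\<close> need not be attained; the factor 2 asks the step to gain only half of
   it.\<close>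
 define Q where "Q F F' \<longleftrightarrow> F \<subseteq> F' \<and> (\<forall>H. P H \<and> H \<subseteq> ortho F \<longrightarrow> d H \<le> 2 * (d F' - d F))" for F F'
 have "pr {0::'a} = (\<lambda>_. 0)" using pr_in[OF aff_cs[OF aff_zero]] by auto
 then have z: "P {0}" using lideal_zero[OF I] aff_zero by (simp add: P_def)
 have step: "\<exists>F'. P F' \<and> Q F F'" if F: "P F" for F
 proof -
  have aF: "aff F" and FI: "pr F \<in> I" using F by (auto simp: P_def)
  let ?S = "d ` {H. P H \<and> H \<subseteq> ortho F}"
  define s where "s = Sup ?S"
  have bdd: "bdd_above ?S" by (rule bdd_aboveI[of _ "d UNIV"]) (auto simp: P_def d_le_UNIV)
  have le: "d H \<le> s" if "P H" "H \<subseteq> ortho F" for H unfolding s_def by (rule cSUP_upper[OF _ bdd]) (use that in auto)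
  have "\<exists>H. P H \<and> H \<subseteq> ortho F \<and> s \<le> 2 * d H"
  proof (cases "s \<le> 0")
   case True then show ?thesis using z d_zero by (intro exI[of _ "{0}"]) (auto simp: ortho_def)
  next
   case False
   have ne: "?S \<noteq> {}" using z by (auto simp: ortho_def intro!: exI[of _ "{0}"])
   have "s / 2 < Sup ?S" using False by (simp add: s_def)
   then obtain H where "P H" "H \<subseteq> ortho F" "s / 2 < d H" using less_cSup_iff[OF ne bdd] by auto
   then show ?thesis by (intro exI[of _ H]) auto
  qed
  then obtain H where H: "aff H" "pr H \<in> I" "H \<subseteq> ortho F" "s \<le> 2 * d H" by (auto simp: P_def)
  obtain G where G: "aff G" "F \<subseteq> G" "\<And>x. pr G x = pr F x + pr H x" "d G = d F + d H" by (rule pr_sum_orth[OF aF H(1,3)]) (rule that)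
  have "pr G = (\<lambda>x. pr F x + pr H x)" using G(3) by auto
  then have "P G" using lideal_add[OF I FI H(2)] G(1) by (simp add: P_def)
  moreover have "Q F G" unfolding Q_def using G le H(4) by force
  ultimately show ?thesis by blast
 qed
 have "\<exists>g. \<forall>n. P (g n) \<and> Q (g n) (g (Suc n))" using dependent_nat_choice[of "\<lambda>_. P" "\<lambda>_. Q"] z step by blast
 then obtain g where gP: "\<And>n. P (g n)" and gQ: "\<And>n. Q (g n) (g (Suc n))" by blast
 have g: "\<And>n. aff (g n)" "\<And>n. pr (g n) \<in> I" using gP by (auto simp: P_def)
 have inc: "incseq g" by (rule incseq_SucI) (use gQ in \<open>auto simp: Q_def\<close>)
 \<comment> \<open>The dimensions of the \<open>g n\<close> are bounded, so some increment is below
   \<open>e / 2\<close>, and by \<open>Q\<close> this bounds every projection of the ideal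
   orthogonal to \<open>g n\<close>.\<close>
 have small: "\<exists>n. \<forall>H. P H \<and> H \<subseteq> ortho (g n) \<longrightarrow> d H < e" if e: "e > 0" for e
 proof -
  have "\<exists>n. d (g (Suc n)) - d (g n) < e / 2"
  proof (rule bounded_incseq_small_step)
   show "d (g n) \<le> d (g (Suc n))" for n by (rule d_mono[OF g(1) g(1)]) (use gQ in \<open>simp add: Q_def\<close>)
   show "d (g n) \<le> d UNIV" for n by (rule d_le_UNIV[OF g(1)])
  qed (use e in simp)
  then obtain n where "d (g (Suc n)) - d (g n) < e / 2" by blast
  then show ?thesis using gQ[of n] unfolding Q_def by (intro exI[of _ n]) force
 qed
 define K where "K = (\<Inter>n. ortho (g n))"
 have K: "aff K" unfolding K_def by (intro aff_INT aff_ortho g)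
 define E where "E = ortho K"
 have E: "aff E" unfolding E_def by (rule aff_ortho[OF K])
 have oE: "ortho E = K" unfolding E_def by (rule ortho_ortho[OF aff_cs[OF K]])
 have "g n \<subseteq> E" for n unfolding E_def K_def by (force simp: ortho_def inner_commute[of _ "_ :: 'a"])
 moreover have "\<exists>n. d E - e < d (g n)" if e: "e > 0" for e
 proof (rule ccontr)
  assume "\<not> ?thesis"
  then have "d (g n) \<le> d E - e" for n by (auto simp: not_less)
  then have "d UNIV - d E + e \<le> t (pr (ortho (g n)))" for n using d_ortho[OF g(1)[of n]] unfolding d_def by (smt (verit))
  moreover have "decseq (\<lambda>n. ortho (g n))" using inc by (fastforce simp: ortho_def incseq_def decseq_def)
  ultimately have "d UNIV - d E + e \<le> t (pr K)" unfolding K_def by (intro t_normal aff_ortho g)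
  then show False using e d_ortho[OF E] oE by (simp add: d_def)
 qed
 moreover have "a (pr E x) = a x" if a: "a \<in> I" for a x
 proof -
  note aN = lideal_N[OF I a] and cK = aff_cs[OF K]
  let ?c = "\<lambda>x. a (pr K x)"
  have c: "?c \<in> N" by (rule N_comp'[OF aN pr_N[OF K]])
  \<comment> \<open>Suppose that the spectral subspace \<open>G\<close> of
    \<open>a \<circ> pr K\<close> above \<open>2 * \<delta>\<close> had positive dimension. The
    element \<open>?b\<close> of the ideal vanishes on \<open>g n\<close>, so its spectral
    projection \<open>H\<close> above \<open>\<delta>\<close> is orthogonal to \<open>g n\<close>
    and, for suitable \<open>n\<close>, smaller than \<open>G\<close>. A nonzero vector of
    \<open>G\<close> in \<open>ortho H\<close> then satisfies the bounds \<open>2 * \<delta>\<close>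
    from below and \<open>\<delta>\<close> from above.\<close>
  have bound: "norm (?c x) \<le> 2 * \<delta> * norm x" if dl: "\<delta> > 0" for \<delta> x
  proof (rule spectral_projection[OF c, of "2 * \<delta>"], goal_cases)
   case (2 G y)
   note G = 2(1) and cG = aff_cs[OF 2(1)]
   have GK: "G \<subseteq> K"
   proof
    fix x assume x: "x \<in> G"
    have "pr G (pr K z) = pr G z" for z using 2(3)[of z] 2(3)[of "pr K z"] by (simp add: pr_pr[OF cK])
    then have "inner z x = inner z (pr K x)" for z
     using pr_sym[OF cG, of z x] pr_sym[OF cG, of "pr K z" x] pr_sym[OF cK, of z x] by (simp add: pr_id[OF cG x])
    then have "x = pr K x" by (rule inner_eqI_right)
    then show "x \<in> K" using pr_in[OF cK] by metis
   qed
   have "d G \<le> 0"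
   proof (rule ccontr)
    assume "\<not> d G \<le> 0"
    then obtain n where n: "\<And>H. P H ==> H \<subseteq> ortho (g n) ==> d H < d G" using small[of "d G"] by auto
    let ?b = "\<lambda>x. a x - a (pr (g n) x)"
    have bI: "?b \<in> I" by (rule lideal_diff[OF I a lideal_mult[OF I aN g(2)]])
    have "\<exists>H. aff H \<and> pr H \<in> I \<and> H \<subseteq> ortho (g n) \<and> (\<forall>x\<in>ortho H. norm (?b x) \<le> \<delta> * norm x)"
    proof (rule spectral_projection[OF lideal_N[OF I bI] dl], goal_cases)
     case (1 H y)
     \<comment> \<open>The left inverse \<open>y\<close> on the spectral subspace places its
       projection in the left ideal.\<close>
     have "pr H = (\<lambda>x. y (?b x))" using 1(3) by auto
     then have "pr H \<in> I" using lideal_mult[OF I 1(2) bI] by simp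
     moreover have "H \<subseteq> ortho (g n)"
     proof
      fix x assume x: "x \<in> H"
      have "inner x u = 0" if "u \<in> g n" for u
      proof -
       have "pr H u = 0" using 1(3)[of u] pr_id[OF aff_cs[OF g(1)] that] by (simp add: bclin_simps[OF N_bc[OF 1(2)]])
       then show ?thesis using x inner_commute[of x u] by (simp add: pr_zero_iff[OF aff_cs[OF 1(1)]])
      qed
      then show "x \<in> ortho (g n)" by (auto simp: ortho_def)
     qed
     ultimately show ?case using 1(1,5) by blast
    qed
    then obtain H where H: "aff H" "pr H \<in> I" "H \<subseteq> ortho (g n)" "\<And>x. x \<in> ortho H ==> norm (?b x) \<le> \<delta> * norm x" by blast
    have "d H < d G" by (rule n) (use H in \<open>auto simp: P_def\<close>)
    then have "0 < d (G \<inter> ortho H)" using d_Int[OF G aff_ortho[OF H(1)]] d_ortho[OF H(1)] by simp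
    then have "G \<inter> ortho H \<noteq> {0}" using d_zero by auto
    moreover have "0 \<in> G \<inter> ortho H" using aff_cs[OF aff_Int[OF G aff_ortho[OF H(1)]]] subspace_0 by blast
    ultimately obtain x where x: "x \<in> G" "x \<in> ortho H" "x \<noteq> 0" by blast
    have "x \<in> K" using GK x(1) by blast
    then have "x \<in> ortho (g n)" "pr K x = x" by (auto simp: K_def pr_id[OF cK, unfolded K_def])
    then have "pr (g n) x = 0" "pr K x = x" by (auto simp: pr_of_ortho[OF aff_cs[OF g(1)]])
    then have "2 * \<delta> * norm x \<le> \<delta> * norm x" using H(4)[OF x(2)] 2(4)[OF x(1)] by (simp add: bclin_simps[OF N_bc[OF aN]])
    then show False using x(3) dl by simp
   qed
   then have "G = {0}" using d_eq_0[OF G] d_nonneg[OF G] by simp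
   then show ?case by (intro 2(5)) (simp add: ortho_def)
  qed (use dl in simp)
  have "norm (?c x) \<le> 0"
  proof (rule field_le_epsilon)
   fix e :: real assume e: "e > 0"
   have "norm (?c x) \<le> 2 * (e / (2 * (norm x + 1))) * norm x" by (rule bound) (use e in \<open>simp add: add_nonneg_pos\<close>)
   also have "\<dots> \<le> e" using e by (simp add: divide_le_eq add_nonneg_pos)
   finally show "norm (?c x) \<le> 0 + e" by simp
  qed
  moreover have "pr E x = x - pr K x" unfolding E_def by (rule pr_ortho[OF cK])
  ultimately show ?thesis by (simp add: bclin_simps[OF N_bc[OF aN]])
 qed
 moreover have "y = 0" if "y \<in> E" "\<forall>n. pr (g n) y = 0" for y
 proof -
  have "y \<in> K" using that(2) by (auto simp: K_def ortho_def pr_zero_iff[OF aff_cs[OF g(1)]])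
  then show ?thesis using that(1) by (auto simp: E_def ortho_def)
 qed
 ultimately show ?thesis by (intro that[of g E] g inc E)
qed

section \<open>Compressions and the support of a left ideal\<close>

lemma d_clran_le:
 assumes a: "a \<in> N" and G: "aff G" and z: "\<And>x. x \<in> ortho G ==> a x = 0" shows "d (clran a) \<le> d G"
proof -
 have "ortho G \<subseteq> ker a" using z by (auto simp: ker_def)
 then show ?thesis using d_rank[OF a] d_mono[OF aff_ortho[OF G] aff_ker[OF a]] d_ortho[OF G] by simp
qed

lemma pr_Int_ortho:
 assumes E: "aff E" and G: "aff G" and GE: "G \<subseteq> E"
 shows "aff (E \<inter> ortho G)" "pr (E \<inter> ortho G) = (\<lambda>x. pr E x - pr G x)" "d (E \<inter> ortho G) = d E - d G"
proof -
 note cE = aff_cs[OF E] and cG = aff_cs[OF G]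
 show J: "aff (E \<inter> ortho G)" by (intro aff_Int E aff_ortho G)
 have "pr (E \<inter> ortho G) x = pr E x - pr G x" for x
 proof (rule pr_unique[OF aff_cs[OF J]])
  have "pr (ortho G) (pr E x) = pr E x - pr G x" by (simp add: pr_ortho[OF cG] pr_pr_subset[OF cG cE GE])
  moreover have "pr E x - pr G x \<in> E" using pr_in[OF cE] pr_in[OF cG, of x] GE cE by (blast intro: subspace_diff)
  ultimately show "pr E x - pr G x \<in> E \<inter> ortho G" using pr_in[OF aff_cs[OF aff_ortho[OF G]], of "pr E x"] by auto
  fix h assume h: "h \<in> E \<inter> ortho G"
  then have "inner (pr G x) h = 0" using pr_in[OF cG, of x] by (auto simp: ortho_def inner_commute)
  then show "inner (x - (pr E x - pr G x)) h = 0" using pr_orth[OF cE, of h x] h by (simp add: inner_diff_left)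
 qed
 then show p: "pr (E \<inter> ortho G) = (\<lambda>x. pr E x - pr G x)" by auto
 show "d (E \<inter> ortho G) = d E - d G" unfolding d_def p by (rule t_diff[OF pr_N[OF E] pr_N[OF G]])
qed

text \<open>The error \<open>a - a \<circ> pr G\<close> vanishes off
  \<open>E \<inter> ortho G\<close>, so its range has dimension at most \<open>d E - d G\<close>;
  \<open>Q\<close> is the complement of that range.\<close>

lemma compression:
 assumes E: "aff E" and G: "aff G" and GE: "G \<subseteq> E" and a: "a \<in> N" "\<And>x. a (pr E x) = a x"
 obtains Q where "aff Q" "d UNIV - (d E - d G) \<le> d Q" "pr Q \<circ> a = (pr Q \<circ> a) \<circ> pr G"
proof -
 let ?b = "\<lambda>x. a x - a (pr G x)"
 note J = pr_Int_ortho[OF E G GE]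
 have b: "?b \<in> N" by (intro N_diff N_comp'[OF a(1) pr_N[OF G]] a)
 have z: "?b x = 0" if "x \<in> ortho (E \<inter> ortho G)" for x
  using pr_of_ortho[OF aff_cs[OF J(1)] that] a(2)[of x] by (simp add: J(2))
 have Q: "aff (ortho (clran ?b))" by (intro aff_ortho aff_clran b)
 have "pr (ortho (clran ?b)) (?b x) = 0" for x
  by (rule pr_ortho_zero_iff[OF aff_cs[OF aff_clran[OF b]], THEN iffD2]) (rule subsetD[OF closure_subset], rule rangeI)
 then show ?thesis using d_clran_le[OF b J(1) z] d_ortho[OF aff_clran[OF b]]
  by (intro that[OF Q]) (auto simp: J(3) pr_diff[OF aff_cs[OF Q]])
qed

text \<open>The closure of \<open>I\<close> is generated by the projection \<open>E\<close>, and \<open>I\<close> is dense in it.\<close>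

lemma lideal_support:
 assumes I: "lideal I"
 obtains E where "aff E" "\<And>a x. a \<in> I ==> a (pr E x) = a x"
  "\<And>a y. a \<in> N ==> (\<And>x. a (pr E x) = a x) ==> y \<in> N ==> y \<noteq> (\<lambda>_. 0) ==>
   \<exists>r\<in>N. r \<circ> y \<noteq> (\<lambda>_. 0) \<and> r \<circ> a \<in> I"
proof -
 obtain g E where g: "\<And>n::nat. aff (g n)" "\<And>n. pr (g n) \<in> I" and E: "aff E" "\<And>n. g n \<subseteq> E"
  "\<And>e. e > 0 ==> \<exists>n. d E - e < d (g n)" "\<And>a x. a \<in> I ==> a (pr E x) = a x" by (rule lideal_projections[OF I]) (rule that; assumption)
 show ?thesis
 proof (rule that[OF E(1,4)])
  fix a y assume a: "a \<in> N" "\<And>x. a (pr E x) = a x" and y: "y \<in> N" "y \<noteq> (\<lambda>_. 0)"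
  have "clran y \<noteq> {0}" using y(2) closure_subset[of "range y"] by fastforce
  then have "d (clran y) > 0" using d_eq_0[OF aff_clran[OF y(1)]] d_nonneg[OF aff_clran[OF y(1)]] by fastforce
  \<comment> \<open>With this \<open>n\<close> the codimension of \<open>Q\<close> is below the
    dimension of the range of \<open>y\<close>, so \<open>pr Q\<close> cannot annihilate
    \<open>y\<close>.\<close>
  then obtain n where n: "d E - d (clran y) < d (g n)" using E(3) by blast
  obtain Q where Q: "aff Q" "d UNIV - (d E - d (g n)) \<le> d Q" "pr Q \<circ> a = (pr Q \<circ> a) \<circ> pr (g n)"
   by (rule compression[OF E(1) g(1) E(2) a])
  show "\<exists>r\<in>N. r \<circ> y \<noteq> (\<lambda>_. 0) \<and> r \<circ> a \<in> I"
  proof (intro bexI[of _ "pr Q"] conjI notI pr_N Q)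
   show "pr Q \<circ> a \<in> I" using lideal_mult[OF I N_comp[OF pr_N[OF Q(1)] a(1)] g(2)] by (subst Q(3)) (simp add: comp_def)
   assume "pr Q \<circ> y = (\<lambda>_. 0)"
   then have "range y \<subseteq> ortho Q" by (auto simp: fun_eq_iff ortho_def pr_zero_iff[OF aff_cs[OF Q(1)]])
   then have "clran y \<subseteq> ortho Q" by (intro closure_minimal) (use aff_cs[OF aff_ortho[OF Q(1)]] in auto)
   then show False using d_mono[OF aff_clran[OF y(1)] aff_ortho[OF Q(1)]] d_ortho[OF Q(1)] Q(2) n by simp
  qed
 qed
qed

section \<open>Homomorphisms from a left ideal to the affiliated operators\<close>

lemma Aff_range_in:
 assumes G: "aff G" and T: "T \<in> Aff" and e: "atimes (gr (pr G)) T = T" and xy: "(x, y) \<in> T" shows "y \<in> G"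
proof -
 have "(x, pr G y) \<in> T" using atimesI[OF xy, of "pr G y" "gr (pr G)"] by (simp add: gr_iff e)
 then have "pr G y = y" using Aff_sv[OF T] xy by blast
 then show ?thesis using pr_in[OF aff_cs[OF G]] by metis
qed

text \<open>Rank and nullity for an unbounded operator: in a right fraction the numerator
  \<open>a\<close> has range in \<open>G\<close>, and the injective denominator \<open>s\<close>
  maps the kernel of \<open>a\<close> into the null space of \<open>T\<close> without loss of
  dimension.\<close>

lemma Aff_null_space:
 assumes G: "aff G" and T: "T \<in> Aff" and e: "atimes (gr (pr G)) T = T"
 shows "aff {x. (x, 0) \<in> T}" and "d UNIV - d G \<le> d {x. (x, 0) \<in> T}"
proof -
 let ?Z = "{x. (x, 0) \<in> T}"
 have "closed ((\<lambda>x. (x, 0)) -` T)" by (rule continuous_closed_vimage[OF Aff_closed[OF T]])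
   (intro bounded_linear.continuous[OF bounded_linear_Pair] bounded_linear_ident bounded_linear_zero continuous_ident)
 moreover have "(\<lambda>x. (x, 0)) -` T = ?Z" by auto
 moreover have "subspace ?Z" using Aff_zero[OF T] Aff_add[OF T, of _ 0 _ 0] Aff_scaleC[OF T, of _ 0 "complex_of_real _"]
  by (auto simp: subspace_def simp flip: scaleR_scaleC)
 moreover have "\<forall>S\<in>N'. \<forall>x\<in>?Z. S x \<in> ?Z" using Aff_inv[OF T, of _ 0] bclin_simps(4)[OF N'_bc] by fastforce
 ultimately show Z: "aff ?Z" by (simp add: aff_def)
 obtain s a where sa: "s \<in> N" "a \<in> N" "ker s = {0}" "\<And>x. (s x, a x) \<in> T" by (rule right_fraction[OF T]) (rule that)
 have K: "aff (ker a)" by (rule aff_ker[OF sa(2)])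
 note cK = aff_cs[OF K]
 let ?b = "\<lambda>x. s (pr (ker a) x)"
 have b: "?b \<in> N" by (rule N_comp'[OF sa(1) pr_N[OF K]])
 have "s x = 0 \<longleftrightarrow> x = 0" for x using sa(3) by (auto simp: ker_def)
 then have "ker ?b = ortho (ker a)" by (auto simp: ker_def[of ?b] ortho_def pr_zero_iff[OF cK])
 then have "d (clran ?b) = d (ker a)" using d_rank[OF b] d_ortho[OF K] by simp
 moreover have "range ?b \<subseteq> ?Z" using sa(4) pr_in[OF cK] by (auto simp: ker_def) (metis (mono_tags, lifting) mem_Collect_eq)
 then have "d (clran ?b) \<le> d ?Z" using aff_cs[OF Z] by (intro d_mono aff_clran b Z closure_minimal) auto
 moreover have "d (clran a) \<le> d G" using Aff_range_in[OF G T e sa(4)] aff_cs[OF G] by (intro d_mono aff_clran sa G closure_minimal) auto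
 ultimately show "d UNIV - d G \<le> d ?Z" using d_rank[OF sa(2)] by simp
qed

lemma Aff_eq_if_compressions_eq:
 assumes X: "X \<in> Aff" and Y: "Y \<in> Aff"
  and G: "\<And>e. e > 0 ==> \<exists>G. aff G \<and> d UNIV - e < d G \<and> atimes (gr (pr G)) X = atimes (gr (pr G)) Y" shows "X = Y"
proof (rule Aff_eqI[OF X Y tdense_Int[OF tdense_Domain[OF X] tdense_Domain[OF Y]]])
 fix x assume "x \<in> Domain X \<inter> Domain Y"
 then obtain y y' where y: "(x, y) \<in> X" "(x, y') \<in> Y" by blast
 define D where "D = \<Union>{G. aff G \<and> atimes (gr (pr G)) X = atimes (gr (pr G)) Y}"
 have "tdense D" unfolding tdense_def
 proof (intro allI impI)
  fix e :: real assume "e > 0"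
  from G[OF this] show "\<exists>G. aff G \<and> G \<subseteq> D \<and> d UNIV - e < d G" unfolding D_def by blast
 qed
 moreover have "y - y' \<in> ortho D" unfolding ortho_def D_def
 proof clarify
  fix g G assume g: "g \<in> G" and G: "aff G" "atimes (gr (pr G)) X = atimes (gr (pr G)) Y"
  have "(x, pr G y) \<in> atimes (gr (pr G)) X" "(x, pr G y') \<in> atimes (gr (pr G)) Y"
   by (rule atimesI[OF y(1)], simp add: gr_iff) (rule atimesI[OF y(2)], simp add: gr_iff)
  then have "pr G y = pr G y'" using G(2) Aff_sv[OF atimes_Aff[OF gr_Aff[OF pr_N[OF G(1)]] X]] by metis
  then have "pr G (y - y') = 0" by (simp add: pr_diff[OF aff_cs[OF G(1)]])
  then show "inner (y - y') g = 0" using pr_zero_iff[OF aff_cs[OF G(1)]] g by blast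
 qed
 ultimately have "y = y'" using tdense_ortho by fastforce
 with y show "\<exists>y. (x, y) \<in> X \<and> (x, y) \<in> Y" by blast
qed

text \<open>If \<open>f\<close> is right multiplication by \<open>u\<close>, then the compression of
  \<open>u\<close> to \<open>g n\<close> must be \<open>w n = f (pr (g n))\<close>. The
  \<open>w n\<close> are compatible, and \<open>u\<close> is glued from them; what has to be proved
  is that the glued operator has a large enough domain and that it reproduces \<open>f\<close> on
  all of \<open>I\<close>.\<close>

lemma hom_extends:
 assumes I: "lideal I" and fA: "\<And>a. a \<in> I ==> f a \<in> Aff"
  and add: "\<And>a b. a \<in> I ==> b \<in> I ==> f (\<lambda>x. a x + b x) = aplus (f a) (f b)"
  and mult: "\<And>r a. r \<in> N ==> a \<in> I ==> f (r \<circ> a) = atimes (gr r) (f a)"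
 obtains u where "u \<in> Aff" "\<And>a. a \<in> I ==> f a = atimes (gr a) u"
proof -
 obtain g E where g: "\<And>n::nat. aff (g n)" and inc: "incseq g" and gI: "\<And>n. pr (g n) \<in> I"
  and E: "aff E" "\<And>n. g n \<subseteq> E" "\<And>e. e > 0 ==> \<exists>n. d E - e < d (g n)" "\<And>a x. a \<in> I ==> a (pr E x) = a x"
  and sep: "\<And>y. y \<in> E ==> \<forall>n. pr (g n) y = 0 ==> y = 0"
  by (rule lideal_projections[OF I]) (rule that)
 note cg = aff_cs[OF g] and cE = aff_cs[OF E(1)]
 define w where "w n = f (pr (g n))" for n
 have w: "w n \<in> Aff" for n unfolding w_def by (rule fA[OF gI])
 have prpr: "pr (g m) \<circ> pr (g n) = pr (g m)" if "m \<le> n" for m n using pr_pr_subset[OF cg cg incseqD[OF inc that]] by auto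
 have prpr': "pr (g n) (pr (g m) x) = pr (g m) x" if "m \<le> n" for m n x using incseqD[OF inc that] pr_in[OF cg] by (intro pr_id cg) blast
 have ww: "atimes (gr (pr (g m))) (w n) = w m" if "m \<le> n" for m n
  unfolding w_def by (simp add: mult[OF pr_N[OF g] gI, symmetric] prpr[OF that])
 have w_mem: "(x, pr (g m) y) \<in> w m" if "(x, y) \<in> w n" "m \<le> n" for m n x y
  using atimesI[OF that(1), of "pr (g m) y" "gr (pr (g m))"] by (simp add: gr_iff ww[OF that(2)])
 have w_in: "y \<in> g n" if "(x, y) \<in> w n" for n x y by (rule Aff_range_in[OF g w ww[OF order_refl] that])
 \<comment> \<open>A vector of \<open>E\<close> is determined by its projections onto all
   \<open>g n\<close>. Restricting to \<open>y \<in> E\<close> makes the relation single valued, and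
   it is already closed, being cut out by preimages of closed graphs.\<close>
 define u where "u = {(x, y). y \<in> E \<and> (\<forall>n. (x, pr (g n) y) \<in> w n)}"
 have uI: "(x, y) \<in> u" if y: "\<And>n. n \<ge> m ==> (x, y) \<in> w n" for x y m
 proof -
  have ym: "y \<in> g m" by (rule w_in[OF y]) simp
  have "(x, pr (g n) y) \<in> w n" for n
  proof (cases "m \<le> n")
   case True
   then have "pr (g n) y = y" using ym incseqD[OF inc True] by (intro pr_id cg) blast
   then show ?thesis using y[OF True] by simp
  next
   case False then show ?thesis using w_mem[OF y, of m n] by simp
  qed
  then show ?thesis using ym E(2) by (auto simp: u_def)
 qed
 have uA: "u \<in> Aff"
 proof (rule AffI)
  have "closed ((\<lambda>p. (fst p, pr (g n) (snd p))) -` w n)" for n by (rule continuous_closed_vimage[OF Aff_closed[OF w]])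
    (intro bounded_linear.continuous[OF bounded_linear_Pair] bounded_linear_fst
     bounded_linear_compose[OF bounded_linear_pr[OF cg] bounded_linear_snd] continuous_ident)
  moreover have "closed (snd -` E)" by (rule closed_vimage_snd) (use cE in simp)
  moreover have "u = snd -` E \<inter> (\<Inter>n. (\<lambda>p. (fst p, pr (g n) (snd p))) -` w n)" by (auto simp: u_def)
  ultimately have "closed u" by auto
  moreover have "subspace u" unfolding subspace_def using Aff_zero[OF w] Aff_add[OF w] Aff_scaleC[OF w, of _ _ _ "complex_of_real _"] cE
    pr_add[OF cg] pr_scale[OF cg] linear_simps(3)[OF bounded_linear_pr[OF cg]]
   by (auto simp: u_def zero_prod_def subspace_0 subspace_add subspace_scale simp flip: scaleR_scaleC)
  moreover have "(S x, S y) \<in> u" if S: "S \<in> N'" and xy: "(x, y) \<in> u" for S x y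
  proof -
   have "(S x, pr (g n) (S y)) \<in> w n" for n using xy Aff_inv[OF w _ S, of x "pr (g n) y" n] pr_N'_comm[OF g S] by (simp add: u_def)
   moreover have "S y \<in> E" using xy E(1) S by (auto simp: u_def aff_def)
   ultimately show ?thesis by (simp add: u_def)
  qed
  ultimately show "invariant2 u" by (auto simp: invariant2_def)
  show "y = 0" if "(0, y) \<in> u" for y
  proof (rule sep)
   show "y \<in> E" using that by (simp add: u_def)
   show "\<forall>n. pr (g n) y = 0" using that by (intro allI Aff_zero_D[OF w]) (auto simp: u_def)
  qed
  show "tdense (Domain u)" unfolding tdense_def
  proof (intro allI impI)
   fix e :: real assume "e > 0"
   then have e2: "e / 2 > 0" by simp
   from E(3)[OF this] obtain m where m: "d E - e / 2 < d (g m)" by blast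
   \<comment> \<open>The range of \<open>v n\<close> lies in \<open>J n\<close>, of dimension at
     most \<open>e / 2\<close>, so the null space \<open>Z n\<close> has codimension at most
     \<open>e / 2\<close>. The \<open>Z n\<close> decrease, hence by normality the same bound holds
     for their intersection, on which \<open>w m\<close> has the same values as all later
     \<open>w (m + n)\<close>.\<close>
   define v where "v n = f (\<lambda>x. pr (g (m + n)) x - pr (g m) x)" for n
   have difI: "(\<lambda>x. pr (g (m + n)) x - pr (g m) x) \<in> I" for n by (intro lideal_diff[OF I] gI)
   have v: "v n \<in> Aff" for n unfolding v_def by (rule fA[OF difI])
   have wv: "aplus (w m) (v n) = w (m + n)" for n using add[OF gI difI, of m n] by (simp add: w_def v_def)
   define J where "J n = g (m + n) \<inter> ortho (g m)" for n
   note J' = pr_Int_ortho[OF g g incseqD[OF inc le_add1[of m]], folded J_def]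
   note J = J'(1) and Jf = J'(2)
   have Jv: "atimes (gr (pr (J n))) (v n) = v n" for n
   proof -
    have JI: "pr (J n) \<in> I" using difI by (simp only: Jf)
    have vJ: "v n = f (pr (J n))" by (simp only: v_def Jf)
    have JJ: "pr (J n) \<circ> pr (J n) = pr (J n)" using pr_pr[OF aff_cs[OF J]] by auto
    show ?thesis using mult[OF pr_N[OF J] JI, of n] by (simp only: vJ JJ)
   qed
   have dJ: "d (J n) \<le> e / 2" for n using d_mono[OF g E(1) E(2), of "m + n"] m by (simp add: J'(3))
   define Z where "Z n = {x. (x, 0) \<in> v n}" for n
   have Z: "aff (Z n)" and dZ: "d UNIV - e / 2 \<le> d (Z n)" for n
    using Aff_null_space(1)[OF J v Jv, of n] Aff_null_space(2)[OF J v Jv, of n] dJ[of n] unfolding Z_def by auto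
   have "decseq Z"
   proof (rule decseq_SucI, rule subsetI)
    fix n x assume "x \<in> Z (Suc n)"
    then have "(x, pr (g (m + n)) 0) \<in> atimes (gr (pr (g (m + n)))) (v (Suc n))" by (intro atimesI[of x 0]) (auto simp: Z_def gr_iff)
    moreover have "atimes (gr (pr (g (m + n)))) (v (Suc n)) = v n"
    proof -
     have "pr (g (m + n)) \<circ> (\<lambda>x. pr (g (m + Suc n)) x - pr (g m) x) = (\<lambda>x. pr (g (m + n)) x - pr (g m) x)"
      using prpr[of "m + n" "m + Suc n"] prpr'[of m "m + n"] by (auto simp: fun_eq_iff pr_diff[OF cg])
     then show ?thesis using mult[OF pr_N[OF g] difI, of "m + n" "Suc n"] by (simp add: v_def)
    qed
    ultimately show "x \<in> Z n" by (simp add: Z_def linear_simps(3)[OF bounded_linear_pr[OF cg]])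
   qed
   then have "d UNIV - e / 2 \<le> t (pr (\<Inter>n. Z n))" by (intro t_normal Z) (use dZ in \<open>simp_all add: d_def\<close>)
   then have dI: "d UNIV - e / 2 \<le> d (\<Inter>n. Z n)" by (simp add: d_def)
   obtain H where H: "aff H" "H \<subseteq> Domain (w m)" "d UNIV - e / 2 < d H" using tdense_Domain[OF w, of m] e2 unfolding tdense_def by blast
   let ?G = "H \<inter> (\<Inter>n. Z n)"
   have aI: "aff (\<Inter>n. Z n)" by (rule aff_INT[OF Z])
   have "d UNIV - e < d ?G" using d_Int[OF H(1) aI] dI H(3) by simp
   moreover have "?G \<subseteq> Domain u"
   proof
    fix x assume x: "x \<in> ?G"
    then obtain y where y: "(x, y) \<in> w m" using H(2) by blast
    have "(x, y) \<in> w k" if "k \<ge> m" for k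
    proof -
     have "(x, 0) \<in> v (k - m)" using x by (auto simp: Z_def)
     from aplusI[OF y this] show ?thesis using wv[of "k - m"] that by simp
    qed
    then have "(x, y) \<in> u" by (rule uI)
    then show "x \<in> Domain u" by blast
   qed
   ultimately show "\<exists>G. aff G \<and> G \<subseteq> Domain u \<and> d UNIV - e < d G" using aff_Int[OF H(1) aI] by blast
  qed
 qed
 have gu: "atimes (gr (pr (g n))) u = w n" for n
 proof (rule Aff_eqI[OF _ w tdense_Domain[OF uA]])
  show "atimes (gr (pr (g n))) u \<in> Aff" by (intro atimes_Aff gr_Aff pr_N g uA)
  fix x assume "x \<in> Domain u"
  then obtain y where y: "(x, y) \<in> u" by blast
  then have "(x, pr (g n) y) \<in> atimes (gr (pr (g n))) u" by (rule atimesI) (simp add: gr_iff)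
  with y show "\<exists>y. (x, y) \<in> atimes (gr (pr (g n))) u \<and> (x, y) \<in> w n" by (auto simp: u_def)
 qed
 \<comment> \<open>\<open>a\<close> need not factor through any \<open>pr (g n)\<close>, but its
   compression \<open>pr Q \<circ> a\<close> does, with \<open>Q\<close> of arbitrarily small
   codimension; agreement of such compressions is enough.\<close>
 have "f a = atimes (gr a) u" if a: "a \<in> I" for a
 proof (rule Aff_eq_if_compressions_eq[OF fA[OF a]])
  note aN = lideal_N[OF I a]
  show "atimes (gr a) u \<in> Aff" by (intro atimes_Aff gr_Aff aN uA)
  fix e :: real assume "e > 0"
  then obtain n where n: "d E - e < d (g n)" using E(3) by blast
  obtain Q where Q: "aff Q" "d UNIV - (d E - d (g n)) \<le> d Q" "pr Q \<circ> a = (pr Q \<circ> a) \<circ> pr (g n)"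
   by (rule compression[OF E(1) g E(2) aN E(4)[OF a]])
  note QN = pr_N[OF Q(1)] and QaN = N_comp[OF pr_N[OF Q(1)] aN]
  have "atimes (gr (pr Q)) (f a) = f ((pr Q \<circ> a) \<circ> pr (g n))" by (simp add: mult[OF QN a, symmetric] Q(3)[symmetric])
  also have "\<dots> = atimes (gr (pr Q \<circ> a)) (atimes (gr (pr (g n))) u)" by (simp add: mult[OF QaN gI] gu w_def)
  also have "\<dots> = atimes (gr (pr Q)) (atimes (gr a) u)"
   by (simp add: atimes_assoc[symmetric] gr_Aff QaN QN aN pr_N[OF g] uA atimes_op_graph Q(3)[symmetric])
  finally show "\<exists>G. aff G \<and> d UNIV - e < d G \<and> atimes (gr (pr G)) (f a) = atimes (gr (pr G)) (atimes (gr a) u)"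
   using Q(1,2) n by (intro exI[of _ Q]) auto
 qed
 with uA show ?thesis by (rule that)
qed

end

section \<open>Modules over a noncommutative ring\<close>

lemma
 assumes "submodule N R M" shows sub_subset: "N \<subseteq> carrier M" and sub_zero: "\<zero>\<^bsub>M\<^esub> \<in> N"
  and sub_add: "x \<in> N ==> y \<in> N ==> x \<oplus>\<^bsub>M\<^esub> y \<in> N"
  and sub_smult: "r \<in> carrier R ==> x \<in> N ==> r \<odot>\<^bsub>M\<^esub> x \<in> N"
proof -
 have s: "subgroup N (add_monoid M)" by (rule submodule.axioms(1)[OF assms])
 show "N \<subseteq> carrier M" "\<zero>\<^bsub>M\<^esub> \<in> N" "x \<in> N ==> y \<in> N ==> x \<oplus>\<^bsub>M\<^esub> y \<in> N"
  using subgroup.subset[OF s] subgroup.one_closed[OF s] subgroup.m_closed[OF s] by auto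
 show "r \<in> carrier R ==> x \<in> N ==> r \<odot>\<^bsub>M\<^esub> x \<in> N" by (rule submodule.smult_closed[OF assms])
qed

lemma left_moduleI:
 assumes "ring R" "\<zero>\<^bsub>M\<^esub> \<in> carrier M"
  and "\<And>x y. x \<in> carrier M ==> y \<in> carrier M ==> x \<oplus>\<^bsub>M\<^esub> y \<in> carrier M"
  and "\<And>x y z. x \<in> carrier M ==> y \<in> carrier M ==> z \<in> carrier M ==> (x \<oplus>\<^bsub>M\<^esub> y) \<oplus>\<^bsub>M\<^esub> z = x \<oplus>\<^bsub>M\<^esub> (y \<oplus>\<^bsub>M\<^esub> z)"
  and "\<And>x y. x \<in> carrier M ==> y \<in> carrier M ==> x \<oplus>\<^bsub>M\<^esub> y = y \<oplus>\<^bsub>M\<^esub> x"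
  and "\<And>x. x \<in> carrier M ==> \<zero>\<^bsub>M\<^esub> \<oplus>\<^bsub>M\<^esub> x = x"
  and "\<And>x. x \<in> carrier M ==> \<exists>y\<in>carrier M. y \<oplus>\<^bsub>M\<^esub> x = \<zero>\<^bsub>M\<^esub>"
  and "\<And>r x. r \<in> carrier R ==> x \<in> carrier M ==> r \<odot>\<^bsub>M\<^esub> x \<in> carrier M"
  and "\<And>r s x. r \<in> carrier R ==> s \<in> carrier R ==> x \<in> carrier M ==>
    (r \<oplus>\<^bsub>R\<^esub> s) \<odot>\<^bsub>M\<^esub> x = r \<odot>\<^bsub>M\<^esub> x \<oplus>\<^bsub>M\<^esub> s \<odot>\<^bsub>M\<^esub> x"
  and "\<And>r x y. r \<in> carrier R ==> x \<in> carrier M ==> y \<in> carrier M ==>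
    r \<odot>\<^bsub>M\<^esub> (x \<oplus>\<^bsub>M\<^esub> y) = r \<odot>\<^bsub>M\<^esub> x \<oplus>\<^bsub>M\<^esub> r \<odot>\<^bsub>M\<^esub> y"
  and "\<And>r s x. r \<in> carrier R ==> s \<in> carrier R ==> x \<in> carrier M ==>
    (r \<otimes>\<^bsub>R\<^esub> s) \<odot>\<^bsub>M\<^esub> x = r \<odot>\<^bsub>M\<^esub> (s \<odot>\<^bsub>M\<^esub> x)"
  and "\<And>x. x \<in> carrier M ==> \<one>\<^bsub>R\<^esub> \<odot>\<^bsub>M\<^esub> x = x" shows "lmod R M"
 by (intro left_module.intro left_module_axioms.intro abelian_groupI) (rule assms; assumption?)+

context left_module
begin

abbreviation (input) zeroM ("\<zero>\<^sub>M") where "\<zero>\<^sub>M \<equiv> \<zero>\<^bsub>M\<^esub>"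
abbreviation (input) addM (infixl "\<oplus>\<^sub>M" 65) where "x \<oplus>\<^sub>M y \<equiv> x \<oplus>\<^bsub>M\<^esub> y"
abbreviation (input) minusM (infixl "\<ominus>\<^sub>M" 65) where "x \<ominus>\<^sub>M y \<equiv> x \<ominus>\<^bsub>M\<^esub> y"
abbreviation (input) uminusM ("\<ominus>\<^sub>M _" [81] 80) where "\<ominus>\<^sub>M x \<equiv> \<ominus>\<^bsub>M\<^esub> x"
abbreviation (input) smultM (infixl "\<odot>\<^sub>M" 70) where "r \<odot>\<^sub>M x \<equiv> r \<odot>\<^bsub>M\<^esub> x"

lemma smult_zero_left: "x \<in> carrier M ==> \<zero> \<odot>\<^sub>M x = \<zero>\<^sub>M"
proof -
 assume x: "x \<in> carrier M"
 have "\<zero> \<odot>\<^sub>M x \<oplus>\<^sub>M \<zero> \<odot>\<^sub>M x = \<zero> \<odot>\<^sub>M x"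
  using smult_l_distr[of "\<zero>" "\<zero>" x] x by simp
 then show ?thesis using smult_closed[of "\<zero>" x] x by simp
qed

lemma smult_zero_right: "r \<in> carrier R ==> r \<odot>\<^sub>M \<zero>\<^sub>M = \<zero>\<^sub>M"
proof -
 assume r: "r \<in> carrier R"
 have "r \<odot>\<^sub>M \<zero>\<^sub>M \<oplus>\<^sub>M r \<odot>\<^sub>M \<zero>\<^sub>M = r \<odot>\<^sub>M \<zero>\<^sub>M"
  using smult_r_distr[of r "\<zero>\<^sub>M" "\<zero>\<^sub>M"] r by simp
 then show ?thesis using smult_closed[of r "\<zero>\<^sub>M"] r by simp
qed

lemma smult_minus_one: "x \<in> carrier M ==> (\<ominus> \<one>) \<odot>\<^sub>M x = \<ominus>\<^sub>M x"
proof -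
 assume x: "x \<in> carrier M"
 have "(\<ominus> \<one>) \<odot>\<^sub>M x \<oplus>\<^sub>M x = \<zero>\<^sub>M"
  using smult_l_distr[of "\<ominus> \<one>" "\<one>" x] x by (simp add: R.l_neg smult_one smult_zero_left)
 then show ?thesis using x smult_closed[of "\<ominus> \<one>" x] by (simp add: M.minus_equality)
qed

lemma diff_eq_zero: "x \<in> carrier M ==> y \<in> carrier M ==> x \<ominus>\<^sub>M y = \<zero>\<^sub>M \<longleftrightarrow> x = y"
 using M.minus_equality[of x "\<ominus>\<^sub>M y"] by (auto simp: a_minus_def M.r_neg)

lemma smult_neg: "r \<in> carrier R ==> x \<in> carrier M ==> r \<odot>\<^sub>M (\<ominus>\<^sub>M x) = \<ominus>\<^sub>M (r \<odot>\<^sub>M x)"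
 using smult_r_distr[of r "\<ominus>\<^sub>M x" x] smult_closed[of r x] smult_closed[of r "\<ominus>\<^sub>M x"]
 by (simp add: M.l_neg smult_zero_right M.minus_equality)

lemma smult_diff:
 "r \<in> carrier R ==> x \<in> carrier M ==> y \<in> carrier M ==> r \<odot>\<^sub>M (x \<ominus>\<^sub>M y) = r \<odot>\<^sub>M x \<ominus>\<^sub>M r \<odot>\<^sub>M y"
 by (simp add: a_minus_def smult_r_distr smult_neg)

lemma submoduleI:
 assumes "H \<subseteq> carrier M" "\<zero>\<^sub>M \<in> H" "\<And>x y. x \<in> H ==> y \<in> H ==> x \<oplus>\<^sub>M y \<in> H"
  "\<And>r x. r \<in> carrier R ==> x \<in> H ==> r \<odot>\<^sub>M x \<in> H" shows "submodule H R M"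
proof (intro submodule.intro submodule_axioms.intro)
 show "subgroup H (add_monoid M)"
 proof (rule M.add.subgroupI)
  fix x assume x: "x \<in> H"
  show "\<ominus>\<^sub>M x \<in> H"
   using assms(4)[of "\<ominus> \<one>" x] smult_minus_one[of x] x assms(1) by auto
 qed (use assms in auto)
qed (use assms in auto)

lemma submodule_neg: "submodule H R M ==> x \<in> H ==> \<ominus>\<^sub>M x \<in> H"
 using subgroup.m_inv_closed[OF submodule.axioms(1), of H R M x] by (simp add: a_inv_def)

lemma submodule_diff: "submodule H R M ==> x \<in> H ==> y \<in> H ==> x \<ominus>\<^sub>M y \<in> H"
 unfolding a_minus_def by (intro sub_add[of H R M] submodule_neg)

lemma sub_carrier: "submodule (carrier M) R M" and submodule_zero_set: "submodule {\<zero>\<^sub>M} R M"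
 by (rule submoduleI; auto simp: smult_closed smult_zero_right)+

lemma restr_lm: "submodule N R M ==> lmod R (restr M N)"
proof (rule left_moduleI)
 assume N: "submodule N R M"
 fix x assume "x \<in> carrier (restr M N)"
 then show "\<exists>y\<in>carrier (restr M N). y \<oplus>\<^bsub>restr M N\<^esub> x = \<zero>\<^bsub>restr M N\<^esub>"
  using submodule_neg[OF N] sub_subset[OF N] by (intro bexI[of _ "\<ominus>\<^sub>M x"]) (auto simp: M.l_neg)
qed (use sub_subset[of N R M] in \<open>auto simp: sub_zero sub_add sub_smult R.ring_axioms M.a_ac
   subset_iff smult_l_distr smult_r_distr smult_assoc smult_one\<close>)

lemma submodule_restr: "submodule N R M ==> submodule K R (restr M N) \<longleftrightarrow> submodule K R M \<and> K \<subseteq> N"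
proof
 assume N: "submodule N R M" and K: "submodule K R (restr M N)"
 have s: "K \<subseteq> N" using sub_subset[OF K] by simp
 then show "submodule K R M \<and> K \<subseteq> N" using sub_subset[OF N] sub_zero[OF K] sub_add[OF K] sub_smult[OF K]
  by (auto intro!: submoduleI)
next
 assume N: "submodule N R M" and K: "submodule K R M \<and> K \<subseteq> N"
 interpret N: left_module R "restr M N" by (rule restr_lm[OF N])
 show "submodule K R (restr M N)" using K sub_zero[of K R M] sub_add[of K R M] sub_smult[of K R M] by (intro N.submoduleI) auto
qed

end

section \<open>The standard constructions as left modules\<close>

lemma Reg_simps [simp]: "carrier (Reg R) = carrier R" "\<zero>\<^bsub>Reg R\<^esub> = \<zero>\<^bsub>R\<^esub>"
 "x \<oplus>\<^bsub>Reg R\<^esub> y = x \<oplus>\<^bsub>R\<^esub> y" "r \<odot>\<^bsub>Reg R\<^esub> x = r \<otimes>\<^bsub>R\<^esub> x"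
 by (simp_all add: regular_module_def)

lemma RS_simps [simp]: "carrier (RS \<phi> M) = carrier M" "\<zero>\<^bsub>RS \<phi> M\<^esub> = \<zero>\<^bsub>M\<^esub>"
 "x \<oplus>\<^bsub>RS \<phi> M\<^esub> y = x \<oplus>\<^bsub>M\<^esub> y" "r \<odot>\<^bsub>RS \<phi> M\<^esub> x = \<phi> r \<odot>\<^bsub>M\<^esub> x"
 by (simp_all add: restrict_scalars_def)

lemma DSum_simps [simp]:
 "carrier (DSum M N) = carrier M \<times> carrier N" "\<zero>\<^bsub>DSum M N\<^esub> = (\<zero>\<^bsub>M\<^esub>, \<zero>\<^bsub>N\<^esub>)"
 "(x, y) \<oplus>\<^bsub>DSum M N\<^esub> (x', y') = (x \<oplus>\<^bsub>M\<^esub> x', y \<oplus>\<^bsub>N\<^esub> y')"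
 "r \<odot>\<^bsub>DSum M N\<^esub> (x, y) = (r \<odot>\<^bsub>M\<^esub> x, r \<odot>\<^bsub>N\<^esub> y)" by (simp_all add: direct_sum_def)

lemma Free_simps [simp]:
 "carrier (Free R n) = {..<n} \<rightarrow>\<^sub>E carrier R" "\<zero>\<^bsub>Free R n\<^esub> = (\<lambda>i\<in>{..<n}. \<zero>\<^bsub>R\<^esub>)"
 "v \<oplus>\<^bsub>Free R n\<^esub> w = (\<lambda>i\<in>{..<n}. v i \<oplus>\<^bsub>R\<^esub> w i)" "r \<odot>\<^bsub>Free R n\<^esub> v = (\<lambda>i\<in>{..<n}. r \<otimes>\<^bsub>R\<^esub> v i)"
 by (simp_all add: free_module_def)

context ring
begin

lemma Reg_lm: "lmod R (Reg R)" by (rule left_moduleI) (auto simp: ring_axioms a_ac l_distr r_distr m_assoc intro: l_neg)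

lemma free_lm: "lmod R (Free R n)"
proof (rule left_moduleI)
 fix v assume "v \<in> carrier (Free R n)"
 then have v: "v i \<in> carrier R" if "i < n" for i using that by auto
 have "(\<lambda>i\<in>{..<n}. (\<lambda>i\<in>{..<n}. \<ominus> v i) i \<oplus> v i) = (\<lambda>i\<in>{..<n}. \<zero>)" using v by (auto simp: l_neg)
 then show "\<exists>w\<in>carrier (Free R n). w \<oplus>\<^bsub>Free R n\<^esub> v = \<zero>\<^bsub>Free R n\<^esub>"
  using v by (intro bexI[of _ "\<lambda>i\<in>{..<n}. \<ominus> v i"]) auto
qed (auto simp: ring_axioms fun_eq_iff PiE_def Pi_def extensional_def a_ac l_distr r_distr m_assoc)

end

lemma RS_lm:
 assumes R: "ring R" and \<phi>: "\<phi> \<in> ring_hom R S" and M: "lmod S M" shows "lmod R (RS \<phi> M)"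
proof -
 interpret M: left_module S M by (rule M)
 show ?thesis using ring_hom_closed[OF \<phi>] ring_hom_mult[OF \<phi>] ring_hom_add[OF \<phi>] ring_hom_one[OF \<phi>] by (intro left_moduleI)
   (auto simp: R M.M.a_ac M.smult_closed M.smult_l_distr M.smult_r_distr M.smult_assoc M.smult_one
    intro: M.M.l_neg)
qed

lemma DSum_lm:
 assumes M: "lmod R M" and N: "lmod R N" shows "lmod R (DSum M N)"
proof -
 interpret M: left_module R M by (rule M)
 interpret N: left_module R N by (rule N)
 show ?thesis
 proof (rule left_moduleI)
  fix z assume "z \<in> carrier (DSum M N)"
  then show "\<exists>w\<in>carrier (DSum M N). w \<oplus>\<^bsub>DSum M N\<^esub> z = \<zero>\<^bsub>DSum M N\<^esub>"
   by (intro bexI[of _ "(\<ominus>\<^bsub>M\<^esub> fst z, \<ominus>\<^bsub>N\<^esub> snd z)"]) (auto simp: M.M.l_neg N.M.l_neg)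
 qed (auto simp: M.R.ring_axioms M.M.a_ac N.M.a_ac M.smult_closed N.smult_closed
   M.smult_l_distr N.smult_l_distr M.smult_r_distr N.smult_r_distr M.smult_assoc N.smult_assoc M.smult_one N.smult_one)
qed

subsection \<open>Homomorphisms\<close>

lemma HomI:
 assumes "\<And>x. x \<in> carrier M ==> f x \<in> carrier N"
  "\<And>x y. x \<in> carrier M ==> y \<in> carrier M ==> f (x \<oplus>\<^bsub>M\<^esub> y) = f x \<oplus>\<^bsub>N\<^esub> f y"
  "\<And>r x. r \<in> carrier R ==> x \<in> carrier M ==> f (r \<odot>\<^bsub>M\<^esub> x) = r \<odot>\<^bsub>N\<^esub> f x" shows "f \<in> Hom R M N"
 using assms by (auto simp: left_module_hom_def)

lemma
 assumes "f \<in> Hom R M N" shows hom_closed: "x \<in> carrier M ==> f x \<in> carrier N"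
  and hom_add: "x \<in> carrier M ==> y \<in> carrier M ==> f (x \<oplus>\<^bsub>M\<^esub> y) = f x \<oplus>\<^bsub>N\<^esub> f y"
  and hom_smult: "r \<in> carrier R ==> x \<in> carrier M ==> f (r \<odot>\<^bsub>M\<^esub> x) = r \<odot>\<^bsub>N\<^esub> f x"
 using assms by (auto simp: left_module_hom_def)

lemma Hom_restr: "f \<in> Hom R M N ==> K \<subseteq> carrier M ==> f \<in> Hom R (restr M K) N"
 by (rule HomI) (auto simp: hom_closed hom_add hom_smult subset_iff)

lemma Hom_into_restr: "f \<in> Hom R M N ==> f ` carrier M \<subseteq> K ==> f \<in> Hom R M (restr N K)"
 by (rule HomI) (auto simp: hom_add hom_smult)

lemma Hom_from_restr: "f \<in> Hom R M (restr N K) ==> K \<subseteq> carrier N ==> f \<in> Hom R M N"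
 by (rule HomI) (use hom_closed[of f R M "restr N K"] hom_add[of f R M "restr N K"] hom_smult[of f R M "restr N K"] in auto)

lemma Hom_comp: "f \<in> Hom R M N ==> g \<in> Hom R N K ==> (\<lambda>x. g (f x)) \<in> Hom R M K"
 by (rule HomI) (auto simp: hom_closed[of f] hom_closed[of g] hom_add[of f] hom_add[of g] hom_smult[of f] hom_smult[of g])

lemma Hom_id: "(\<lambda>x. x) \<in> Hom R M M" by (rule HomI) auto

lemma Hom_cong:
 assumes "lmod R M" "f \<in> Hom R M N" "\<And>x. x \<in> carrier M ==> g x = f x" shows "g \<in> Hom R M N"
proof -
 interpret left_module R M by (rule assms(1))
 show ?thesis using assms(2,3) by (intro HomI) (auto simp: hom_closed[of f] hom_add[of f R M N] hom_smult[of f R M N] smult_closed)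
qed

lemma Hom_sum:
 assumes N: "lmod R N" and f: "f \<in> Hom R M N" and g: "g \<in> Hom R M N"
 shows "(\<lambda>x. f x \<oplus>\<^bsub>N\<^esub> g x) \<in> Hom R M N"
proof -
 interpret left_module R N by (rule N)
 show ?thesis by (rule HomI) (auto simp: hom_closed[OF f] hom_closed[OF g] hom_add[OF f] hom_add[OF g] hom_smult[OF f] hom_smult[OF g]
    smult_r_distr M.a_ac)
qed

lemma (in left_module) Hom_id_diff:
 assumes f: "f \<in> Hom R M M" shows "(\<lambda>x. x \<ominus>\<^sub>M f x) \<in> Hom R M M"
proof (rule HomI)
 note fc = hom_closed[OF f]
 show "x \<ominus>\<^sub>M f x \<in> carrier M" if "x \<in> carrier M" for x using that fc by simp
 show "(x \<oplus>\<^sub>M y) \<ominus>\<^sub>M f (x \<oplus>\<^sub>M y) = (x \<ominus>\<^sub>M f x) \<oplus>\<^sub>M (y \<ominus>\<^sub>M f y)"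
  if "x \<in> carrier M" "y \<in> carrier M" for x y
  using that fc[OF that(1)] fc[OF that(2)] by (simp add: hom_add[OF f] a_minus_def M.minus_add M.a_ac)
 show "r \<odot>\<^sub>M x \<ominus>\<^sub>M f (r \<odot>\<^sub>M x) = r \<odot>\<^sub>M (x \<ominus>\<^sub>M f x)" if "r \<in> carrier R" "x \<in> carrier M" for r x
  using that fc by (simp add: hom_smult[OF f] smult_diff)
qed

lemma hom_zero:
 assumes "lmod R M" "lmod R N" "f \<in> Hom R M N" shows "f \<zero>\<^bsub>M\<^esub> = \<zero>\<^bsub>N\<^esub>"
proof -
 interpret M: left_module R M by fact
 interpret N: left_module R N by fact
 have "f (\<zero>\<^bsub>R\<^esub> \<odot>\<^bsub>M\<^esub> \<zero>\<^bsub>M\<^esub>) = \<zero>\<^bsub>R\<^esub> \<odot>\<^bsub>N\<^esub> f \<zero>\<^bsub>M\<^esub>" by (rule hom_smult[OF assms(3)]) auto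
 then show ?thesis using hom_closed[OF assms(3), of "\<zero>\<^bsub>M\<^esub>"] by (simp add: M.smult_zero_left N.smult_zero_left)
qed

lemma hom_neg:
 assumes "lmod R M" "lmod R N" "f \<in> Hom R M N" "x \<in> carrier M"
 shows "f (\<ominus>\<^bsub>M\<^esub> x) = \<ominus>\<^bsub>N\<^esub> f x"
proof -
 interpret M: left_module R M by fact
 interpret N: left_module R N by fact
 show ?thesis using hom_smult[OF assms(3), of "\<ominus>\<^bsub>R\<^esub> \<one>\<^bsub>R\<^esub>" x] hom_closed[OF assms(3,4)] assms(4)
  by (simp add: M.smult_minus_one N.smult_minus_one)
qed

lemma hom_diff:
 assumes "lmod R M" "lmod R N" "f \<in> Hom R M N" "x \<in> carrier M" "y \<in> carrier M"
 shows "f (x \<ominus>\<^bsub>M\<^esub> y) = f x \<ominus>\<^bsub>N\<^esub> f y"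
proof -
 interpret M: left_module R M by fact
 show ?thesis using assms(4,5) by (simp add: a_minus_def hom_add[OF assms(3)] hom_neg[OF assms(1-3)])
qed

lemma hom_inj_on:
 assumes "lmod R M" "lmod R N" "f \<in> Hom R M N"
  "\<And>x. x \<in> carrier M ==> f x = \<zero>\<^bsub>N\<^esub> ==> x = \<zero>\<^bsub>M\<^esub>" shows "inj_on f (carrier M)"
proof (rule inj_onI)
 interpret M: left_module R M by fact
 interpret N: left_module R N by fact
 fix x y assume x: "x \<in> carrier M" and y: "y \<in> carrier M" and e: "f x = f y"
 have "f (x \<ominus>\<^bsub>M\<^esub> y) = \<zero>\<^bsub>N\<^esub>"
  using hom_diff[OF assms(1-3) x y] e hom_closed[OF assms(3) y] by (simp add: N.M.r_neg a_minus_def)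
 then have "x \<ominus>\<^bsub>M\<^esub> y = \<zero>\<^bsub>M\<^esub>" using assms(4) x y by simp
 then show "x = y" using x y by (simp add: M.diff_eq_zero)
qed

lemma vimage_submodule:
 assumes M: "lmod R M" and N: "lmod R N" and f: "f \<in> Hom R M N" and K: "submodule K R N"
 shows "submodule {x \<in> carrier M. f x \<in> K} R M"
proof -
 interpret M: left_module R M by (rule M)
 show ?thesis using sub_zero[OF K] sub_add[OF K] sub_smult[OF K] hom_zero[OF M N f]
  by (intro M.submoduleI) (auto simp: hom_add[OF f] hom_smult[OF f] M.smult_closed)
qed

lemma hom_kernel_submodule:
 assumes "lmod R M" "lmod R N" "f \<in> Hom R M N" shows "submodule {x \<in> carrier M. f x = \<zero>\<^bsub>N\<^esub>} R M"
 using vimage_submodule[OF assms left_module.submodule_zero_set[OF assms(2)]] by simp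

lemma image_submodule:
 assumes M: "lmod R M" and N: "lmod R N" and f: "f \<in> Hom R M N" and K: "submodule K R M" shows "submodule (f ` K) R N"
proof -
 interpret N: left_module R N by (rule N)
 note s = sub_subset[OF K]
 show ?thesis
 proof (rule N.submoduleI)
  show "f ` K \<subseteq> carrier N" using s hom_closed[OF f] by auto
  show "\<zero>\<^bsub>N\<^esub> \<in> f ` K" using sub_zero[OF K] hom_zero[OF M N f] by force
  show "x \<oplus>\<^bsub>N\<^esub> y \<in> f ` K" if "x \<in> f ` K" "y \<in> f ` K" for x y
   using that s sub_add[OF K] by (force simp: hom_add[OF f, symmetric] subset_iff)
  show "r \<odot>\<^bsub>N\<^esub> x \<in> f ` K" if "r \<in> carrier R" "x \<in> f ` K" for r x
   using that s sub_smult[OF K] by (force simp: hom_smult[OF f, symmetric])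
 qed
qed

lemma hom_inv_into:
 assumes M: "lmod R M" and f: "f \<in> Hom R M N" and b: "bij_betw f (carrier M) (carrier N)" shows "inv_into (carrier M) f \<in> Hom R N M"
proof -
 interpret M: left_module R M by (rule M)
 have inv: "inv_into (carrier M) f y \<in> carrier M" "f (inv_into (carrier M) f y) = y" if "y \<in> carrier N" for y
  using b that by (auto simp: bij_betw_def inv_into_into f_inv_into_f)
 have left: "inv_into (carrier M) f (f x) = x" if "x \<in> carrier M" for x using b that by (simp add: bij_betw_def)
 show ?thesis
 proof (rule HomI)
  show "inv_into (carrier M) f (x \<oplus>\<^bsub>N\<^esub> y) = inv_into (carrier M) f x \<oplus>\<^bsub>M\<^esub> inv_into (carrier M) f y"
   if "x \<in> carrier N" "y \<in> carrier N" for x y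
   using left[of "inv_into (carrier M) f x \<oplus>\<^bsub>M\<^esub> inv_into (carrier M) f y"] that by (simp add: hom_add[OF f] inv)
  show "inv_into (carrier M) f (r \<odot>\<^bsub>N\<^esub> x) = r \<odot>\<^bsub>M\<^esub> inv_into (carrier M) f x" if "r \<in> carrier R" "x \<in> carrier N" for r x
   using left[of "r \<odot>\<^bsub>M\<^esub> inv_into (carrier M) f x"] that by (simp add: hom_smult[OF f] inv M.smult_closed)
 qed (rule inv)
qed

lemma IsomI:
 assumes "f \<in> Hom R M N" "g \<in> Hom R N M" "\<And>x. x \<in> carrier M ==> g (f x) = x" "\<And>y. y \<in> carrier N ==> f (g y) = y"
 shows "Isom R M N" unfolding module_isomorphic_def using assms
 by (intro bexI[of _ f] bij_betw_byWitness[where f'=g]) (auto simp: hom_closed[of f] hom_closed[of g])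

lemma IsomE:
 assumes "Isom R M N" "lmod R M"
 obtains f g where "f \<in> Hom R M N" "g \<in> Hom R N M" "\<And>x. x \<in> carrier M ==> g (f x) = x" "\<And>y. y \<in> carrier N ==> f (g y) = y"
proof -
 obtain f where f: "f \<in> Hom R M N" "bij_betw f (carrier M) (carrier N)" using assms(1) by (auto simp: module_isomorphic_def)
 show ?thesis using f by (intro that[OF f(1) hom_inv_into[OF assms(2) f]]) (auto simp: bij_betw_def f_inv_into_f)
qed

lemma Isom_refl: "Isom R M M" by (rule IsomI[OF Hom_id Hom_id]) auto

lemma Isom_sym: "Isom R M N ==> lmod R M ==> Isom R N M" by (erule IsomE, assumption) (rule IsomI)

lemma Isom_trans: "Isom R M N ==> Isom R N K ==> Isom R M K" unfolding module_isomorphic_def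
proof (elim bexE)
 fix f g assume f: "f \<in> Hom R M N" "bij_betw f (carrier M) (carrier N)" and g: "g \<in> Hom R N K" "bij_betw g (carrier N) (carrier K)"
 show "\<exists>h\<in>Hom R M K. bij_betw h (carrier M) (carrier K)"
  using Hom_comp[OF f(1) g(1)] bij_betw_trans[OF f(2) g(2)] by (auto simp: comp_def)
qed

lemma Isom_image:
 assumes "f \<in> Hom R M N" "inj_on f (carrier M)" shows "Isom R M (restr N (f ` carrier M))" unfolding module_isomorphic_def
 using Hom_into_restr[OF assms(1) order_refl] assms(2) by (auto simp: bij_betw_def)

lemma DSum_hom_fst: "fst \<in> Hom R (DSum M N) M" and DSum_hom_snd: "snd \<in> Hom R (DSum M N) N" by (rule HomI; auto)+

lemma DSum_hom_inl: "lmod R N ==> (\<lambda>x. (x, \<zero>\<^bsub>N\<^esub>)) \<in> Hom R M (DSum M N)"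
 and DSum_hom_inr: "lmod R M ==> (\<lambda>x. (\<zero>\<^bsub>M\<^esub>, x)) \<in> Hom R N (DSum M N)"
proof -
 show "(\<lambda>x. (x, \<zero>\<^bsub>N\<^esub>)) \<in> Hom R M (DSum M N)" if "lmod R N"
 proof -
  interpret left_module R N by (rule that)
  show ?thesis by (rule HomI) (auto simp: smult_zero_right)
 qed
 show "(\<lambda>x. (\<zero>\<^bsub>M\<^esub>, x)) \<in> Hom R N (DSum M N)" if "lmod R M"
 proof -
  interpret left_module R M by (rule that)
  show ?thesis by (rule HomI) (auto simp: smult_zero_right)
 qed
qed

lemma DSum_hom_pair: "f \<in> Hom R K M ==> g \<in> Hom R K N ==> (\<lambda>x. (f x, g x)) \<in> Hom R K (DSum M N)"
 by (rule HomI) (auto simp: hom_closed[of f] hom_closed[of g] hom_add[of f] hom_add[of g] hom_smult[of f] hom_smult[of g])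

lemma DSum_hom_copair:
 assumes K: "lmod R K" and f: "f \<in> Hom R M K" and g: "g \<in> Hom R N K"
 shows "(\<lambda>z. f (fst z) \<oplus>\<^bsub>K\<^esub> g (snd z)) \<in> Hom R (DSum M N) K"
 by (intro Hom_sum[OF K] Hom_comp[OF DSum_hom_fst f] Hom_comp[OF DSum_hom_snd g])

lemma DSum_hom_map:
 assumes f: "f \<in> Hom R M M'" and g: "g \<in> Hom R N N'" shows "(\<lambda>z. (f (fst z), g (snd z))) \<in> Hom R (DSum M N) (DSum M' N')"
 by (intro DSum_hom_pair Hom_comp[OF DSum_hom_fst f] Hom_comp[OF DSum_hom_snd g])

lemma DSum_isomorphic:
 assumes M: "lmod R M" "Isom R M M'" and N: "lmod R N" "Isom R N N'" shows "Isom R (DSum M N) (DSum M' N')"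
proof -
 obtain f f' where f: "f \<in> Hom R M M'" "f' \<in> Hom R M' M"
  "\<And>x. x \<in> carrier M ==> f' (f x) = x" "\<And>y. y \<in> carrier M' ==> f (f' y) = y" by (rule IsomE[OF M(2,1)]) (rule that)
 obtain g g' where g: "g \<in> Hom R N N'" "g' \<in> Hom R N' N"
  "\<And>x. x \<in> carrier N ==> g' (g x) = x" "\<And>y. y \<in> carrier N' ==> g (g' y) = y" by (rule IsomE[OF N(2,1)]) (rule that)
 show ?thesis by (rule IsomI[OF DSum_hom_map[OF f(1) g(1)] DSum_hom_map[OF f(2) g(2)]]) (auto simp: f(3,4) g(3,4))
qed

lemma DSum_commute: "Isom R (DSum M N) (DSum N M)" by (rule IsomI[OF DSum_hom_pair[OF DSum_hom_snd DSum_hom_fst]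
    DSum_hom_pair[OF DSum_hom_snd DSum_hom_fst]]) auto

lemma DSum_assoc: "Isom R (DSum (DSum M N) K) (DSum M (DSum N K))"
 by (rule IsomI[where f="\<lambda>z. (fst (fst z), (snd (fst z), snd z))" and g="\<lambda>z. ((fst z, fst (snd z)), snd (snd z))"])
  (auto intro!: HomI)

lemma DSum_zero_left:
 assumes M: "lmod R M" "carrier M = {\<zero>\<^bsub>M\<^esub>}" and N: "lmod R N" shows "Isom R (DSum M N) N"
 by (rule IsomI[OF DSum_hom_snd DSum_hom_inr[OF M(1)]]) (use M(2) in auto)

lemma split_hom_isomorphic:
 assumes M: "lmod R M" and N: "lmod R N"
  and f: "f \<in> Hom R M N" and g: "g \<in> Hom R N M" and fg: "\<And>y. y \<in> carrier N ==> f (g y) = y"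
 shows "Isom R M (DSum (restr M {x \<in> carrier M. f x = \<zero>\<^bsub>N\<^esub>}) N)"
proof -
 interpret M: left_module R M by (rule M)
 interpret N: left_module R N by (rule N)
 let ?K = "{x \<in> carrier M. f x = \<zero>\<^bsub>N\<^esub>}"
 have gf: "g (f x) \<in> carrier M" if "x \<in> carrier M" for x using that by (simp add: hom_closed[OF f] hom_closed[OF g])
 have K: "submodule ?K R M" by (rule hom_kernel_submodule[OF M N f])
 have z: "x \<ominus>\<^bsub>M\<^esub> g (f x) \<in> ?K" if "x \<in> carrier M" for x
  using that gf[OF that] hom_closed[OF f that] hom_diff[OF M N f that gf[OF that]] by (simp add: fg N.M.r_neg a_minus_def)
 have h: "(\<lambda>x. x \<ominus>\<^bsub>M\<^esub> g (f x)) \<in> Hom R M M" by (rule M.Hom_id_diff[OF Hom_comp[OF f g]])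
 have h': "(\<lambda>x. x \<ominus>\<^bsub>M\<^esub> g (f x)) \<in> Hom R M (restr M ?K)" by (rule Hom_into_restr[OF h]) (use z in auto)
 have i: "(\<lambda>x. x) \<in> Hom R (restr M ?K) M" by (rule Hom_restr[OF Hom_id]) auto
 show ?thesis
 proof (rule IsomI[OF DSum_hom_pair[OF h' f] DSum_hom_copair[OF M i g]])
  fix x assume x: "x \<in> carrier M"
  then show "fst (x \<ominus>\<^bsub>M\<^esub> g (f x), f x) \<oplus>\<^bsub>M\<^esub> g (snd (x \<ominus>\<^bsub>M\<^esub> g (f x), f x)) = x"
   using gf[OF x] by (simp add: a_minus_def M.M.a_assoc M.M.l_neg)
 next
  fix z assume "z \<in> carrier (DSum (restr M ?K) N)"
  then obtain x y where xy: "z = (x, y)" "x \<in> carrier M" "f x = \<zero>\<^bsub>N\<^esub>" "y \<in> carrier N" by auto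
  have gy: "g y \<in> carrier M" by (rule hom_closed[OF g xy(4)])
  have "f (x \<oplus>\<^bsub>M\<^esub> g y) = y" using xy gy by (simp add: hom_add[OF f] fg)
  then show "(fst z \<oplus>\<^bsub>M\<^esub> g (snd z) \<ominus>\<^bsub>M\<^esub> g (f (fst z \<oplus>\<^bsub>M\<^esub> g (snd z))), f (fst z \<oplus>\<^bsub>M\<^esub> g (snd z))) = z"
   using xy gy by (simp add: a_minus_def M.M.a_assoc M.M.r_neg)
 qed
qed

text \<open>Copies a module along an injection into another type. This is needed because
  \<open>fg_projective\<close> and \<open>goldie_torsion\<close> quantify over modules carried by
  prescribed types.\<close>

definition transport :: "('m => 'n) => ('r, 'm, 'c) module_scheme => ('r, 'n) module" where
 "transport \<sigma> M = \<lparr>carrier = \<sigma> ` carrier M, monoid.mult = undefined, one = undefined, ring.zero = \<sigma> \<zero>\<^bsub>M\<^esub>,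
  ring.add = (\<lambda>x y. \<sigma> (inv_into (carrier M) \<sigma> x \<oplus>\<^bsub>M\<^esub> inv_into (carrier M) \<sigma> y)),
  module.smult = (\<lambda>r x. \<sigma> (r \<odot>\<^bsub>M\<^esub> inv_into (carrier M) \<sigma> x))\<rparr>"

lemma
 assumes M: "lmod R M" and \<sigma>: "inj_on \<sigma> (carrier M)" shows transport_left_module: "lmod R (transport \<sigma> M)"
  and transport_hom: "\<sigma> \<in> Hom R M (transport \<sigma> M)" and transport_isomorphic: "Isom R M (transport \<sigma> M)"
proof -
 interpret M: left_module R M by (rule M)
 have s [simp]: "carrier (transport \<sigma> M) = \<sigma> ` carrier M" "\<zero>\<^bsub>transport \<sigma> M\<^esub> = \<sigma> \<zero>\<^bsub>M\<^esub>"
  "\<And>x y. x \<in> carrier M ==> y \<in> carrier M ==> \<sigma> x \<oplus>\<^bsub>transport \<sigma> M\<^esub> \<sigma> y = \<sigma> (x \<oplus>\<^bsub>M\<^esub> y)"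
  "\<And>r x. x \<in> carrier M ==> r \<odot>\<^bsub>transport \<sigma> M\<^esub> \<sigma> x = \<sigma> (r \<odot>\<^bsub>M\<^esub> x)"
  using \<sigma> by (auto simp: transport_def)
 show "lmod R (transport \<sigma> M)"
 proof (rule left_moduleI)
  fix y assume "y \<in> carrier (transport \<sigma> M)"
  then obtain x where x: "x \<in> carrier M" "y = \<sigma> x" by auto
  then show "\<exists>z\<in>carrier (transport \<sigma> M). z \<oplus>\<^bsub>transport \<sigma> M\<^esub> y = \<zero>\<^bsub>transport \<sigma> M\<^esub>"
   by (intro bexI[of _ "\<sigma> (\<ominus>\<^bsub>M\<^esub> x)"]) (auto simp: M.M.l_neg)
 qed (auto simp: M.R.ring_axioms M.M.a_ac M.smult_closed M.smult_l_distr M.smult_r_distr M.smult_assoc M.smult_one)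
 show h: "\<sigma> \<in> Hom R M (transport \<sigma> M)" by (rule HomI) auto
 show "Isom R M (transport \<sigma> M)" unfolding module_isomorphic_def using h \<sigma> by (auto simp: bij_betw_def)
qed

subsection \<open>Quotient modules\<close>

context left_module
begin

lemma quotient_abelian_subgroup: "submodule N R M ==> abelian_subgroup N M"
 by (intro abelian_subgroupI3 M.abelian_group_axioms additive_subgroup.intro submodule.axioms(1))

lemma coset_eq_iff:
 assumes N: "submodule N R M" and x: "x \<in> carrier M" and y: "y \<in> carrier M"
 shows "N +>\<^bsub>M\<^esub> x = N +>\<^bsub>M\<^esub> y \<longleftrightarrow> x \<ominus>\<^sub>M y \<in> N"
proof -
 interpret N: abelian_subgroup N M by (rule quotient_abelian_subgroup[OF N])
 have "N +>\<^bsub>M\<^esub> x = N +>\<^bsub>M\<^esub> y \<longleftrightarrow> x \<in> N +>\<^bsub>M\<^esub> y"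
  using N.a_rcos_self[OF x] M.a_repr_independence[OF _ y submodule.axioms(1)[OF N], of x] by auto
 also have "\<dots> \<longleftrightarrow> x \<ominus>\<^sub>M y \<in> N" unfolding a_minus_def by (rule N.a_rcos_module[OF y x]) 
 finally show ?thesis .
qed


lemma quotient_carrier: "carrier (quotient_module M N) = (\<lambda>x. N +>\<^bsub>M\<^esub> x) ` carrier M"
 by (auto simp: quotient_module_def A_RCOSETS_def')

lemma
 assumes N: "submodule N R M" shows quotient_zero: "\<zero>\<^bsub>quotient_module M N\<^esub> = N +>\<^bsub>M\<^esub> \<zero>\<^sub>M"
  and quotient_add: "x \<in> carrier M ==> y \<in> carrier M ==>
   (N +>\<^bsub>M\<^esub> x) \<oplus>\<^bsub>quotient_module M N\<^esub> (N +>\<^bsub>M\<^esub> y) = N +>\<^bsub>M\<^esub> (x \<oplus>\<^sub>M y)"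
  and quotient_smult: "r \<in> carrier R ==> x \<in> carrier M ==>
   r \<odot>\<^bsub>quotient_module M N\<^esub> (N +>\<^bsub>M\<^esub> x) = N +>\<^bsub>M\<^esub> (r \<odot>\<^sub>M x)"
proof -
 interpret N: abelian_subgroup N M by (rule quotient_abelian_subgroup[OF N])
 show "\<zero>\<^bsub>quotient_module M N\<^esub> = N +>\<^bsub>M\<^esub> \<zero>\<^sub>M"
  using M.a_coset_add_zero[OF sub_subset[OF N]] by (simp add: quotient_module_def)
 show "(N +>\<^bsub>M\<^esub> x) \<oplus>\<^bsub>quotient_module M N\<^esub> (N +>\<^bsub>M\<^esub> y) = N +>\<^bsub>M\<^esub> (x \<oplus>\<^sub>M y)"
  if "x \<in> carrier M" "y \<in> carrier M" using N.a_rcos_sum[OF that] by (simp add: quotient_module_def)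
 assume r: "r \<in> carrier R" and x: "x \<in> carrier M"
 have *: "N +>\<^bsub>M\<^esub> (r \<odot>\<^sub>M y) = N +>\<^bsub>M\<^esub> (r \<odot>\<^sub>M x)" if y: "y \<in> N +>\<^bsub>M\<^esub> x" for y
 proof -
  have yM: "y \<in> carrier M" using y M.a_r_coset_subset_G[OF sub_subset[OF N] x] by blast
  have e: "N +>\<^bsub>M\<^esub> y = N +>\<^bsub>M\<^esub> x" by (rule M.a_repr_independence[OF y x submodule.axioms(1)[OF N], symmetric])
  then have "y \<ominus>\<^sub>M x \<in> N" using coset_eq_iff[OF N yM x] by simp
  then have "r \<odot>\<^sub>M (y \<ominus>\<^sub>M x) \<in> N" by (rule sub_smult[OF N r])
  then show ?thesis using coset_eq_iff[OF N smult_closed[OF r yM] smult_closed[OF r x]] x yM r by (simp add: smult_diff)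
 qed
 have "x \<in> N +>\<^bsub>M\<^esub> x" by (rule N.a_rcos_self[OF x])
 then have "(\<Union>y\<in>N +>\<^bsub>M\<^esub> x. N +>\<^bsub>M\<^esub> (r \<odot>\<^sub>M y)) = N +>\<^bsub>M\<^esub> (r \<odot>\<^sub>M x)"
  by (intro SUP_eq_const *) auto
 then show "r \<odot>\<^bsub>quotient_module M N\<^esub> (N +>\<^bsub>M\<^esub> x) = N +>\<^bsub>M\<^esub> (r \<odot>\<^sub>M x)"
  by (simp add: quotient_module_def)
qed

lemma quotient_lm: assumes N: "submodule N R M" shows "lmod R (quotient_module M N)" unfolding quotient_carrier
proof (rule left_moduleI)
 fix X assume "X \<in> carrier (quotient_module M N)"
 then obtain x where x: "x \<in> carrier M" "X = N +>\<^bsub>M\<^esub> x" by (auto simp: quotient_carrier)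
 then show "\<exists>Y\<in>carrier (quotient_module M N). Y \<oplus>\<^bsub>quotient_module M N\<^esub> X = \<zero>\<^bsub>quotient_module M N\<^esub>"
  by (intro bexI[of _ "N +>\<^bsub>M\<^esub> (\<ominus>\<^sub>M x)"]) (auto simp: quotient_carrier quotient_add[OF N] quotient_zero[OF N] M.l_neg)
qed (auto simp: R.ring_axioms quotient_carrier quotient_add[OF N] quotient_zero[OF N] quotient_smult[OF N] M.a_ac
  smult_closed smult_l_distr smult_r_distr smult_assoc smult_one)

lemma quotient_hom: "submodule N R M ==> (\<lambda>x. N +>\<^bsub>M\<^esub> x) \<in> Hom R M (quotient_module M N)"
 by (rule HomI) (auto simp: quotient_carrier quotient_add quotient_smult)

end

section \<open>Baer's criterion\<close>

text \<open>Partial extensions of \<open>f\<close> are represented by their graphs, which are submodules of \<open>P \<oplus> E\<close>.\<close>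

lemma graph_hom:
 assumes P: "lmod R P" and E: "lmod R E" and G: "submodule G R (DSum P E)"
  and sv: "\<And>y. (\<zero>\<^bsub>P\<^esub>, y) \<in> G ==> y = \<zero>\<^bsub>E\<^esub>"
 obtains g where "g \<in> Hom R (restr P (fst ` G)) E" "\<And>x y. (x, y) \<in> G \<longleftrightarrow> x \<in> fst ` G \<and> y = g x"
proof -
 note D = DSum_lm[OF P E]
 note lG = left_module.restr_lm[OF D G]
 note f = Hom_restr[OF DSum_hom_fst sub_subset[OF G]]
 note lP = left_module.restr_lm[OF P image_submodule[OF D P DSum_hom_fst G]]
 have h: "fst \<in> Hom R (restr (DSum P E) G) (restr P (fst ` G))" by (rule Hom_into_restr[OF f]) simp
 have "inj_on fst G" using hom_inj_on[OF lG lP h] sv by fastforce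
 then have b: "bij_betw fst (carrier (restr (DSum P E) G)) (carrier (restr P (fst ` G)))"
  and i: "\<And>z. z \<in> G ==> inv_into G fst (fst z) = z" by (auto simp: bij_betw_def)
 have "(\<lambda>x. snd (inv_into G fst x)) \<in> Hom R (restr P (fst ` G)) E"
  using Hom_comp[OF hom_inv_into[OF lG h b] Hom_restr[OF DSum_hom_snd sub_subset[OF G]]] by simp
 then show ?thesis by (rule that) (use i in \<open>force\<close>)
qed

text \<open>Zorn's lemma for the single-valued submodules of \<open>DSum P E\<close> that contain
  the graph of \<open>f\<close>. Left ideals suffice as test objects for modules on any type, which
  gives the type \<open>'q\<close> in the conclusion its freedom.\<close>

lemma Baer_criterion:
 fixes E :: "('r, 'm, 'c) module_scheme"
 assumes E: "lmod R E" and ext: "\<And>I f. left_ideal R I ==> f \<in> Hom R (restr (Reg R) I) E ==>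
   \<exists>e\<in>carrier E. \<forall>a\<in>I. f a = a \<odot>\<^bsub>E\<^esub> e" shows "injective_module TYPE('q) R E"
 unfolding injective_module_def
proof (intro conjI E allI impI ballI)
 fix P :: "('r, 'q) module" and N f
 assume "lmod R P \<and> submodule N R P" and f: "f \<in> Hom R (restr P N) E"
 then have P: "lmod R P" and N: "submodule N R P" by auto
 let ?D = "DSum P E"
 interpret P: left_module R P by (rule P)
 interpret E: left_module R E by (rule E)
 interpret D: left_module R ?D by (rule DSum_lm[OF P E])
 note reg = P.R.Reg_lm
 define W where "W = {G. submodule G R ?D \<and> (\<forall>y. (\<zero>\<^bsub>P\<^esub>, y) \<in> G \<longrightarrow> y = \<zero>\<^bsub>E\<^esub>) \<and> (\<forall>x\<in>N. (x, f x) \<in> G)}"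
 have "(\<lambda>x. (x, f x)) \<in> Hom R (restr P N) ?D" by (rule DSum_hom_pair[OF Hom_restr[OF Hom_id sub_subset[OF N]] f])
 from image_submodule[OF P.restr_lm[OF N] D.left_module_axioms this, of N]
 have "submodule ((\<lambda>x. (x, f x)) ` N) R ?D" using P.submodule_restr[OF N, of N] N by simp
 moreover have "f \<zero>\<^bsub>P\<^esub> = \<zero>\<^bsub>E\<^esub>" using hom_zero[OF P.restr_lm[OF N] E f] by simp
 ultimately have "(\<lambda>x. (x, f x)) ` N \<in> W" by (auto simp: W_def)
 moreover have "\<Union>C \<in> W" if C: "C \<noteq> {}" "subset.chain W C" for C
 proof -
  have CW: "C \<subseteq> W" and chain: "\<And>X Y. X \<in> C ==> Y \<in> C ==> X \<subseteq> Y \<or> Y \<subseteq> X"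
   using C(2) by (auto simp: subset.chain_def)
  then have sub: "submodule X R ?D" if "X \<in> C" for X using that by (auto simp: W_def)
  have "submodule (\<Union>C) R ?D"
  proof (rule D.submoduleI)
   show "\<Union>C \<subseteq> carrier ?D" using sub_subset[OF sub] by blast
   show "\<zero>\<^bsub>?D\<^esub> \<in> \<Union>C" using sub_zero[OF sub] C(1) by blast
   show "x \<oplus>\<^bsub>?D\<^esub> y \<in> \<Union>C" if "x \<in> \<Union>C" "y \<in> \<Union>C" for x y
    using that chain sub_add[OF sub] by blast
   show "r \<odot>\<^bsub>?D\<^esub> x \<in> \<Union>C" if "r \<in> carrier R" "x \<in> \<Union>C" for r x using that sub_smult[OF sub] by blast
  qed
  then show ?thesis using CW C(1) by (auto simp: W_def)
 qed
 ultimately obtain G where GW: "G \<in> W" and max: "\<And>X. X \<in> W ==> G \<subseteq> X ==> X = G" using subset_Zorn_nonempty[of W] by blast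
 then have G: "submodule G R ?D" and G0: "\<And>y. (\<zero>\<^bsub>P\<^esub>, y) \<in> G ==> y = \<zero>\<^bsub>E\<^esub>"
  and Gf: "\<And>x. x \<in> N ==> (x, f x) \<in> G" by (auto simp: W_def)
 obtain g where g: "g \<in> Hom R (restr P (fst ` G)) E" "\<And>x y. (x, y) \<in> G \<longleftrightarrow> x \<in> fst ` G \<and> y = g x"
  by (rule graph_hom[OF P E G]) (erule G0, rule that)
 have sG: "submodule (fst ` G) R P" by (rule image_submodule[OF D.left_module_axioms P DSum_hom_fst G])
 have "p \<in> fst ` G" if p: "p \<in> carrier P" for p
 proof -
  have hp: "(\<lambda>r. r \<odot>\<^bsub>P\<^esub> p) \<in> Hom R (Reg R) P"
   by (rule HomI) (auto simp: p P.smult_closed P.smult_l_distr P.smult_assoc)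
  \<comment> \<open>The multiples of \<open>p\<close> already in the domain are governed by this
    left ideal. The hypothesis supplies \<open>e\<close> with \<open>g (r p) = r e\<close> on it,
    which is exactly the condition for the graph to stay single valued after \<open>(p, e)\<close>
    is adjoined.\<close>
  let ?I = "{r \<in> carrier (Reg R). r \<odot>\<^bsub>P\<^esub> p \<in> fst ` G}"
  have "(\<lambda>r. r \<odot>\<^bsub>P\<^esub> p) \<in> Hom R (restr (Reg R) ?I) (restr P (fst ` G))"
   by (rule Hom_into_restr[OF Hom_restr[OF hp]]) auto
  from ext[OF vimage_submodule[OF reg P hp sG] Hom_comp[OF this g(1)]]
  obtain e where e: "e \<in> carrier E" "\<And>r. r \<in> carrier R ==> r \<odot>\<^bsub>P\<^esub> p \<in> fst ` G ==> g (r \<odot>\<^bsub>P\<^esub> p) = r \<odot>\<^bsub>E\<^esub> e" by auto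
  have he: "(\<lambda>r. r \<odot>\<^bsub>E\<^esub> e) \<in> Hom R (Reg R) E"
   by (rule HomI) (auto simp: e(1) E.smult_closed E.smult_l_distr E.smult_assoc)
  let ?h = "\<lambda>z. fst z \<oplus>\<^bsub>?D\<^esub> (snd z \<odot>\<^bsub>P\<^esub> p, snd z \<odot>\<^bsub>E\<^esub> e)"
  have h: "?h \<in> Hom R (DSum (restr ?D G) (Reg R)) ?D" by (rule DSum_hom_copair[OF D.left_module_axioms Hom_restr[OF Hom_id sub_subset[OF G]]
      DSum_hom_pair[OF hp he]])
  let ?G = "?h ` (G \<times> carrier R)"
  have Gc: "x \<in> carrier P" "y \<in> carrier E" if "(x, y) \<in> G" for x y using sub_subset[OF G] that by auto
  have "submodule ?G R ?D" using image_submodule[OF DSum_lm[OF D.restr_lm[OF G] reg] D.left_module_axioms h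
     left_module.sub_carrier[OF DSum_lm[OF D.restr_lm[OF G] reg]]] by simp
  moreover have GG: "G \<subseteq> ?G"
  proof clarify
   fix x y assume "(x, y) \<in> G"
   then show "(x, y) \<in> ?G" using Gc p e(1)
    by (intro image_eqI[of _ _ "((x, y), \<zero>\<^bsub>R\<^esub>)"]) (auto simp: P.smult_zero_left E.smult_zero_left)
  qed
  moreover have "y = \<zero>\<^bsub>E\<^esub>" if y: "(\<zero>\<^bsub>P\<^esub>, y) \<in> ?G" for y
  proof -
   obtain x v r where z: "\<zero>\<^bsub>P\<^esub> = x \<oplus>\<^bsub>P\<^esub> r \<odot>\<^bsub>P\<^esub> p" "y = v \<oplus>\<^bsub>E\<^esub> r \<odot>\<^bsub>E\<^esub> e" "(x, v) \<in> G" "r \<in> carrier R"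
    using y by auto
   have "\<ominus>\<^bsub>P\<^esub> x = r \<odot>\<^bsub>P\<^esub> p"
    using z Gc[OF z(3)] p by (intro P.M.minus_equality) (auto simp: P.smult_closed P.M.a_comm)
   moreover have "(\<ominus>\<^bsub>R\<^esub> \<one>\<^bsub>R\<^esub>) \<odot>\<^bsub>?D\<^esub> (x, v) \<in> G" by (rule sub_smult[OF G _ z(3)]) simp
   ultimately have "(r \<odot>\<^bsub>P\<^esub> p, \<ominus>\<^bsub>E\<^esub> v) \<in> G" using Gc[OF z(3)] by (simp add: P.smult_minus_one E.smult_minus_one)
   then have "r \<odot>\<^bsub>E\<^esub> e = \<ominus>\<^bsub>E\<^esub> v" using e(2) z(4) by (simp add: g(2))
   then show ?thesis using z(2) Gc[OF z(3)] by (simp add: E.M.r_neg)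
  qed
  ultimately have "?G = G" using Gf by (intro max) (unfold W_def, blast)+
  moreover have "(p, e) \<in> ?G"
   using sub_zero[OF G] p e(1) by (intro image_eqI[of _ _ "(\<zero>\<^bsub>?D\<^esub>, \<one>\<^bsub>R\<^esub>)"]) (auto simp: P.smult_one E.smult_one)
  ultimately show ?thesis by force
 qed
 then have "fst ` G = carrier P" using sub_subset[OF sG] by blast
 then show "\<exists>g\<in>Hom R P E. \<forall>x\<in>N. g x = f x" using g Gf by (intro bexI[of _ g]) (auto)
qed

section \<open>Finitely generated projective modules\<close>

lemma fgI:
 "finite X ==> X \<subseteq> carrier M ==> (\<And>N. submodule N R M ==> X \<subseteq> N ==> carrier M \<subseteq> N) ==> fin_gen R M"
 unfolding finitely_generated_def by (blast dest: sub_subset)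

lemma fgE:
 assumes "fin_gen R M"
 obtains X where "finite X" "X \<subseteq> carrier M" "\<And>K. submodule K R M ==> X \<subseteq> K ==> K = carrier M"
proof -
 from assms obtain X where X: "finite X" "X \<subseteq> carrier M" "\<forall>K. submodule K R M \<and> X \<subseteq> K \<longrightarrow> K = carrier M"
  unfolding finitely_generated_def by (elim exE conjE)
 show ?thesis by (rule that[OF X(1,2)]) (use X(3) in simp)
qed

lemma fg_image:
 assumes M: "lmod R M" and N: "lmod R N" and f: "f \<in> Hom R M N"
  and surj: "f ` carrier M = carrier N" and fg: "fin_gen R M" shows "fin_gen R N"
proof -
 obtain X where X: "finite X" "X \<subseteq> carrier M" "\<And>K. submodule K R M ==> X \<subseteq> K ==> K = carrier M"
  by (rule fgE[OF fg]) (rule that)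
 show ?thesis
 proof (rule fgI[of "f ` X"])
  show "f ` X \<subseteq> carrier N" using X(2) hom_closed[OF f] by auto
  fix K assume K: "submodule K R N" "f ` X \<subseteq> K"
  have "{x \<in> carrier M. f x \<in> K} = carrier M" by (rule X(3)[OF vimage_submodule[OF M N f K(1)]]) (use X(2) K(2) in auto)
  then show "carrier N \<subseteq> K" unfolding surj[symmetric] by blast
 qed (use X(1) in simp)
qed

lemma fg_DSum:
 assumes M: "lmod R M" "fin_gen R M" and N: "lmod R N" "fin_gen R N" shows "fin_gen R (DSum M N)"
proof -
 interpret M: left_module R M by (rule M(1))
 interpret N: left_module R N by (rule N(1))
 obtain X where X: "finite X" "X \<subseteq> carrier M" "\<And>K. submodule K R M ==> X \<subseteq> K ==> K = carrier M"
  by (rule fgE[OF M(2)]) (rule that)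
 obtain Y where Y: "finite Y" "Y \<subseteq> carrier N" "\<And>K. submodule K R N ==> Y \<subseteq> K ==> K = carrier N"
  by (rule fgE[OF N(2)]) (rule that)
 note D = DSum_lm[OF M(1) N(1)]
 show ?thesis
 proof (rule fgI)
  show "finite ((\<lambda>x. (x, \<zero>\<^bsub>N\<^esub>)) ` X \<union> (\<lambda>y. (\<zero>\<^bsub>M\<^esub>, y)) ` Y)" using X Y by simp
  show "(\<lambda>x. (x, \<zero>\<^bsub>N\<^esub>)) ` X \<union> (\<lambda>y. (\<zero>\<^bsub>M\<^esub>, y)) ` Y \<subseteq> carrier (DSum M N)" using X Y by auto
  fix K assume K: "submodule K R (DSum M N)" "(\<lambda>x. (x, \<zero>\<^bsub>N\<^esub>)) ` X \<union> (\<lambda>y. (\<zero>\<^bsub>M\<^esub>, y)) ` Y \<subseteq> K"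
  have 1: "{x \<in> carrier M. (x, \<zero>\<^bsub>N\<^esub>) \<in> K} = carrier M"
   by (rule X(3)[OF vimage_submodule[OF M(1) D DSum_hom_inl[OF N(1)] K(1)]]) (use X(2) K(2) in auto)
  have 2: "{y \<in> carrier N. (\<zero>\<^bsub>M\<^esub>, y) \<in> K} = carrier N"
   by (rule Y(3)[OF vimage_submodule[OF N(1) D DSum_hom_inr[OF M(1)] K(1)]]) (use Y(2) K(2) in auto)
  show "carrier (DSum M N) \<subseteq> K"
  proof
   fix z assume "z \<in> carrier (DSum M N)"
   then obtain x y where z: "z = (x, y)" "x \<in> carrier M" "y \<in> carrier N" by auto
   then have "(x, \<zero>\<^bsub>N\<^esub>) \<in> K" "(\<zero>\<^bsub>M\<^esub>, y) \<in> K" using 1 2 by blast+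
   from sub_add[OF K(1) this] z show "z \<in> K" by simp
  qed
 qed
qed

lemma fgp_lm: "fgp R P ==> lmod R P" and fgp_fg: "fgp R P ==> fin_gen R P" by (auto simp: fg_projective_def)

lemma fgp_lift:
 fixes M N :: "('r, nat => 'r) module"
 assumes "fgp R P" "lmod R M" "lmod R N" "g \<in> Hom R M N" "g ` carrier M = carrier N" "f \<in> Hom R P N"
 obtains h where "h \<in> Hom R P M" "\<And>x. x \<in> carrier P ==> g (h x) = f x"
proof -
 have "\<exists>h\<in>Hom R P M. \<forall>x\<in>carrier P. g (h x) = f x"
  using assms(1) unfolding fg_projective_def by (elim conjE allE[of _ M] allE[of _ N] allE[of _ g] allE[of _ f] impE) (use assms in auto)
 then show ?thesis using that by blast
qed

lemma fgp_retract:
 assumes P: "fgp R P" and Q: "lmod R Q"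
  and i: "i \<in> Hom R Q P" and r: "r \<in> Hom R P Q" and ri: "\<And>x. x \<in> carrier Q ==> r (i x) = x" shows "fgp R Q"
 unfolding fg_projective_def
proof (intro conjI Q allI impI)
 have "r ` carrier P = carrier Q" using hom_closed[OF r] hom_closed[OF i] ri by (metis image_subsetI image_eqI subsetI subset_antisym)
 then show "fin_gen R Q" using fg_image[OF fgp_lm[OF P] Q r] fgp_fg[OF P] by blast
next
 fix M N :: "('a, nat => 'a) module" and g f
 assume "lmod R M \<and> lmod R N \<and> g \<in> Hom R M N \<and> g ` carrier M = carrier N \<and> f \<in> Hom R Q N"
 then have a: "lmod R M" "lmod R N" "g \<in> Hom R M N" "g ` carrier M = carrier N" and f: "f \<in> Hom R Q N" by auto
 obtain h where h: "h \<in> Hom R P M" "\<And>x. x \<in> carrier P ==> g (h x) = f (r x)" by (rule fgp_lift[OF P a Hom_comp[OF r f]]) (rule that)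
 show "\<exists>h\<in>Hom R Q M. \<forall>x\<in>carrier Q. g (h x) = f x"
  using Hom_comp[OF i h(1)] h(2) ri hom_closed[OF i] by (intro bexI[of _ "\<lambda>x. h (i x)"]) auto
qed

lemma fgp_isomorphic:
 assumes P: "fgp R P" and Q: "lmod R Q" and iso: "Isom R P Q" shows "fgp R Q" by (rule IsomE[OF iso fgp_lm[OF P]]) (rule fgp_retract[OF P Q])

lemma fgp_DSum:
 assumes P: "fgp R P" and Q: "fgp R Q" shows "fgp R (DSum P Q)" unfolding fg_projective_def
proof (intro conjI allI impI)
 note lP = fgp_lm[OF P] and lQ = fgp_lm[OF Q]
 interpret P: left_module R P by (rule lP)
 interpret Q: left_module R Q by (rule lQ)
 show "lmod R (DSum P Q)" by (rule DSum_lm[OF lP lQ])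
 show "fin_gen R (DSum P Q)" by (intro fg_DSum lP lQ fgp_fg P Q)
 fix M N :: "('a, nat => 'a) module" and g f
 assume "lmod R M \<and> lmod R N \<and> g \<in> Hom R M N \<and> g ` carrier M = carrier N \<and> f \<in> Hom R (DSum P Q) N"
 then have a: "lmod R M" "lmod R N" "g \<in> Hom R M N" "g ` carrier M = carrier N" and f: "f \<in> Hom R (DSum P Q) N" by auto
 obtain h where h: "h \<in> Hom R P M" "\<And>x. x \<in> carrier P ==> g (h x) = f (x, \<zero>\<^bsub>Q\<^esub>)"
  by (rule fgp_lift[OF P a Hom_comp[OF DSum_hom_inl[OF lQ] f]]) (rule that)
 obtain k where k: "k \<in> Hom R Q M" "\<And>x. x \<in> carrier Q ==> g (k x) = f (\<zero>\<^bsub>P\<^esub>, x)"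
  by (rule fgp_lift[OF Q a Hom_comp[OF DSum_hom_inr[OF lP] f]]) (rule that)
 show "\<exists>h\<in>Hom R (DSum P Q) M. \<forall>x\<in>carrier (DSum P Q). g (h x) = f x"
 proof (intro bexI ballI)
  fix z assume "z \<in> carrier (DSum P Q)"
  then obtain x y where z: "z = (x, y)" "x \<in> carrier P" "y \<in> carrier Q" by auto
  have "f ((x, \<zero>\<^bsub>Q\<^esub>) \<oplus>\<^bsub>DSum P Q\<^esub> (\<zero>\<^bsub>P\<^esub>, y)) = f (x, \<zero>\<^bsub>Q\<^esub>) \<oplus>\<^bsub>N\<^esub> f (\<zero>\<^bsub>P\<^esub>, y)"
   by (rule hom_add[OF f]) (use z in auto)
  then show "g (h (fst z) \<oplus>\<^bsub>M\<^esub> k (snd z)) = f z"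
   using z hom_add[OF a(3), of "h x" "k y"] hom_closed[OF h(1)] hom_closed[OF k(1)] by (simp add: h(2) k(2))
 qed (rule DSum_hom_copair[OF a(1) h(1) k(1)])
qed

lemma fgp_trivial:
 assumes M: "lmod R P" "carrier P = {\<zero>\<^bsub>P\<^esub>}" shows "fgp R P" unfolding fg_projective_def
proof (intro conjI allI impI M)
 interpret P: left_module R P by (rule M)
 show "fin_gen R P" by (rule fgI[of "{}"]) (use sub_zero[of _ R P] M(2) in auto)
 fix M N :: "('a, nat => 'a) module" and g f
 assume a: "lmod R M \<and> lmod R N \<and> g \<in> Hom R M N \<and> g ` carrier M = carrier N \<and> f \<in> Hom R P N"
 then interpret M: left_module R M by simp
 have "(\<lambda>_. \<zero>\<^bsub>M\<^esub>) \<in> Hom R P M" by (rule HomI) (auto simp: M.smult_zero_right)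
 moreover have "g \<zero>\<^bsub>M\<^esub> = f \<zero>\<^bsub>P\<^esub>" using a hom_zero[of R M N g] hom_zero[of R P N f] assms(1) by simp
 ultimately show "\<exists>h\<in>Hom R P M. \<forall>x\<in>carrier P. g (h x) = f x" using M(2) by auto
qed

section \<open>Free modules and their direct summands\<close>

context ring
begin

lemma fgp_regular: "fgp R (Reg R)" unfolding fg_projective_def
proof (intro conjI allI impI Reg_lm)
 interpret Reg: left_module R "Reg R" by (rule Reg_lm)
 show "fin_gen R (Reg R)"
 proof (rule fgI[of "{\<one>}"])
  fix N assume N: "left_ideal R N" "{\<one>} \<subseteq> N"
  then show "carrier (Reg R) \<subseteq> N" using sub_smult[OF N(1), of _ \<one>] by auto
 qed auto
 fix M N :: "('a, nat => 'a) module" and g f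
 assume a: "lmod R M \<and> lmod R N \<and> g \<in> Hom R M N \<and> g ` carrier M = carrier N \<and> f \<in> Hom R (Reg R) N"
 then interpret M: left_module R M by simp
 have g: "g \<in> Hom R M N" and f: "f \<in> Hom R (Reg R) N" using a by auto
 have "f \<one> \<in> g ` carrier M" using hom_closed[OF f, of \<one>] a by simp
 then obtain m where m: "m \<in> carrier M" "g m = f \<one>" by auto
 have "(\<lambda>r. r \<odot>\<^bsub>M\<^esub> m) \<in> Hom R (Reg R) M" by (rule HomI) (auto simp: m M.smult_closed M.smult_l_distr M.smult_assoc)
 moreover have "g (r \<odot>\<^bsub>M\<^esub> m) = f r" if "r \<in> carrier R" for r
  using hom_smult[OF f, of r \<one>] that by (simp add: hom_smult[OF g] m)
 ultimately show "\<exists>h\<in>Hom R (Reg R) M. \<forall>x\<in>carrier (Reg R). g (h x) = f x"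
  by (intro bexI[of _ "\<lambda>r. r \<odot>\<^bsub>M\<^esub> m"]) auto
qed

lemma Free_Suc: "Isom R (Free R (Suc n)) (DSum (Free R n) (Reg R))"
 by (rule IsomI[where f="\<lambda>v. (restrict v {..<n}, v n)" and g="\<lambda>z. \<lambda>i\<in>{..<Suc n}. if i = n then snd z else fst z i"])
  (auto intro!: HomI simp: fun_eq_iff PiE_def Pi_def extensional_def)

lemma Free_0: "carrier (Free R 0) = {\<zero>\<^bsub>Free R 0\<^esub>}" by auto

lemma fgp_free: "fgp R (Free R n)"
proof (induction n)
 case 0
 show ?case by (rule fgp_trivial[OF free_lm Free_0])
next
 case (Suc n)
 show ?case by (rule fgp_isomorphic[OF fgp_DSum[OF Suc fgp_regular] free_lm
     Isom_sym[OF Free_Suc free_lm]])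
qed

lemma Free_onto:
 assumes M: "lmod R M" and X: "finite X" "X \<subseteq> carrier M"
 shows "\<exists>n. \<exists>f\<in>Hom R (Free R n) M. X \<subseteq> f ` carrier (Free R n)" using X
proof (induction X)
 case empty
 then show ?case using HomI[of "Free R 0" "\<lambda>_. \<zero>\<^bsub>M\<^esub>" M R] left_module.smult_zero_right[OF M] abelian_group.axioms(1)[OF left_module.axioms(2)[OF M]] abelian_monoid.l_zero
  by (intro exI[of _ 0] bexI[of _ "\<lambda>_. \<zero>\<^bsub>M\<^esub>"]) (auto simp: abelian_monoid.zero_closed abelian_monoid.l_zero)
next
 case (insert x X)
 interpret M: left_module R M by (rule M)
 obtain n f where f: "f \<in> Hom R (Free R n) M" "X \<subseteq> f ` carrier (Free R n)" using insert by auto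
 have x: "x \<in> carrier M" using insert by simp
 have s: "(\<lambda>r. r \<odot>\<^bsub>M\<^esub> x) \<in> Hom R (Reg R) M" by (rule HomI) (auto simp: x M.smult_closed M.smult_l_distr M.smult_assoc)
 let ?h = "\<lambda>z. f (fst z) \<oplus>\<^bsub>M\<^esub> snd z \<odot>\<^bsub>M\<^esub> x"
 have h: "?h \<in> Hom R (DSum (Free R n) (Reg R)) M" by (rule DSum_hom_copair[OF M f(1) s])
 obtain \<alpha> \<beta> where \<alpha>: "\<alpha> \<in> Hom R (Free R (Suc n)) (DSum (Free R n) (Reg R))"
  "\<beta> \<in> Hom R (DSum (Free R n) (Reg R)) (Free R (Suc n))" "\<And>y. y \<in> carrier (DSum (Free R n) (Reg R)) ==> \<alpha> (\<beta> y) = y"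
  by (rule IsomE[OF Free_Suc free_lm]) (rule that)
 have img: "z \<in> (\<lambda>v. ?h (\<alpha> v)) ` carrier (Free R (Suc n))" if "y \<in> carrier (DSum (Free R n) (Reg R))" "z = ?h y" for y z
  using that \<alpha>(3)[OF that(1)] hom_closed[OF \<alpha>(2) that(1)] by (intro image_eqI[of _ _ "\<beta> y"]) simp_all
 have "f \<zero>\<^bsub>Free R n\<^esub> = \<zero>\<^bsub>M\<^esub>" by (rule hom_zero[OF free_lm M f(1)])
 then have "x = ?h (\<zero>\<^bsub>Free R n\<^esub>, \<one>)" using x by (simp add: M.smult_one)
 then have "x \<in> (\<lambda>v. ?h (\<alpha> v)) ` carrier (Free R (Suc n))" by (rule img[rotated]) auto
 moreover have "f v = ?h (v, \<zero>)" if "v \<in> carrier (Free R n)" for v using hom_closed[OF f(1) that] x by (simp add: M.smult_zero_left)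
 then have "f v \<in> (\<lambda>v. ?h (\<alpha> v)) ` carrier (Free R (Suc n))" if "v \<in> carrier (Free R n)" for v
  using that by (intro img[of "(v, \<zero>)"]) auto
 then have "X \<subseteq> (\<lambda>v. ?h (\<alpha> v)) ` carrier (Free R (Suc n))" using f(2) by blast
 ultimately have "insert x X \<subseteq> (\<lambda>v. ?h (\<alpha> v)) ` carrier (Free R (Suc n))" by (rule insert_subsetI)
 with Hom_comp[OF \<alpha>(1) h] show ?case by (intro exI[of _ "Suc n"] bexI)
qed

lemma fg_free_onto:
 assumes M: "lmod R M" and fg: "fin_gen R M"
 obtains n f where "f \<in> Hom R (Free R n) M" "f ` carrier (Free R n) = carrier M"
proof -
 obtain X where X: "finite X" "X \<subseteq> carrier M" "\<And>K. submodule K R M ==> X \<subseteq> K ==> K = carrier M"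
  by (rule fgE[OF fg]) (rule that)
 obtain n f where f: "f \<in> Hom R (Free R n) M" "X \<subseteq> f ` carrier (Free R n)" using Free_onto[OF M X(1,2)] by blast
 have "f ` carrier (Free R n) = carrier M" by (rule X(3)[OF image_submodule[OF free_lm M f(1) left_module.sub_carrier[OF free_lm]] f(2)])
 then show ?thesis by (rule that[OF f(1)])
qed

text \<open>The lifting property is available only for target modules on the type of coordinate
  vectors. Choosing preimages under \<open>f\<close> injects \<open>P\<close> into that type, and
  the identity is lifted through the transported copy.\<close>

lemma fgp_section:
 assumes P: "fgp R P" and f: "f \<in> Hom R (Free R n) P" and surj: "f ` carrier (Free R n) = carrier P"
 obtains i where "i \<in> Hom R P (Free R n)" "\<And>x. x \<in> carrier P ==> f (i x) = x"
proof -
 note lP = fgp_lm[OF P]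
 define \<sigma> where "\<sigma> = inv_into (carrier (Free R n)) f"
 have \<sigma>: "inj_on \<sigma> (carrier P)" unfolding \<sigma>_def by (rule inj_on_inv_into) (simp only: surj order_refl)
 note N = transport_left_module[OF lP \<sigma>] and h\<sigma> = transport_hom[OF lP \<sigma>]
 have "(\<lambda>v. \<sigma> (f v)) ` carrier (Free R n) = carrier (transport \<sigma> P)"
  using surj by (auto simp: transport_def image_image[symmetric, of \<sigma> f])
 then obtain i where i: "i \<in> Hom R P (Free R n)" "\<And>x. x \<in> carrier P ==> \<sigma> (f (i x)) = \<sigma> x"
  by (rule fgp_lift[OF P free_lm N Hom_comp[OF f h\<sigma>] _ h\<sigma>]) (rule that)
 have "f (i x) = x" if x: "x \<in> carrier P" for x using i(2)[OF x] \<sigma> x hom_closed[OF f hom_closed[OF i(1) x]] by (auto dest: inj_onD)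
 then show ?thesis by (rule that[OF i(1)])
qed

lemma fgp_free_retract:
 assumes P: "fgp R P"
 obtains n i r where "i \<in> Hom R P (Free R n)" "r \<in> Hom R (Free R n) P" "\<And>x. x \<in> carrier P ==> r (i x) = x"
proof -
 obtain n f where f: "f \<in> Hom R (Free R n) P" "f ` carrier (Free R n) = carrier P" by (rule fg_free_onto[OF fgp_lm[OF P] fgp_fg[OF P]])
 then show ?thesis by (rule fgp_section[OF P]) (rule that[OF _ f(1)])
qed

lemma fgp_split:
 assumes M: "lmod R M" "fin_gen R M" and N: "fgp R N" and f: "f \<in> Hom R M N" "f ` carrier M = carrier N"
 shows "Isom R M (DSum (restr M {x \<in> carrier M. f x = \<zero>\<^bsub>N\<^esub>}) N)"
proof -
 obtain n h where h: "h \<in> Hom R (Free R n) M" "h ` carrier (Free R n) = carrier M" by (rule fg_free_onto[OF M])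
 have "(\<lambda>v. f (h v)) ` carrier (Free R n) = carrier N" using h(2) f(2) by (simp only: image_image[symmetric, of f h])
 then obtain i where i: "i \<in> Hom R N (Free R n)" "\<And>x. x \<in> carrier N ==> f (h (i x)) = x"
  by (rule fgp_section[OF N Hom_comp[OF h(1) f(1)]]) (rule that)
 show ?thesis by (rule split_hom_isomorphic[OF M(1) fgp_lm[OF N] f(1) Hom_comp[OF i(1) h(1)] i(2)])
qed

lemma summand_projection:
 assumes M: "lmod R M" and L: "summand R M L"
 obtains \<pi> where "\<pi> \<in> Hom R M M" "\<And>x. x \<in> carrier M ==> \<pi> x \<in> L" "\<And>x. x \<in> L ==> \<pi> x = x"
proof -
 interpret M: left_module R M by (rule M)
 obtain L' where L: "submodule L R M" and L': "submodule L' R M" "L \<inter> L' = {\<zero>\<^bsub>M\<^esub>}" "L <+>\<^bsub>M\<^esub> L' = carrier M"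
  using L by (auto simp: direct_summand_def)
 note sL = sub_subset[OF L] and sL' = sub_subset[OF L'(1)]
 note D = DSum_lm[OF M.restr_lm[OF L] M.restr_lm[OF L'(1)]]
 let ?D = "DSum (restr M L) (restr M L')" and ?f = "\<lambda>z. fst z \<oplus>\<^bsub>M\<^esub> snd z"
 have f: "?f \<in> Hom R ?D M" by (intro DSum_hom_copair[OF M] Hom_restr[OF Hom_id] sL sL')
 have "inj_on ?f (carrier ?D)"
 proof (rule hom_inj_on[OF D M f])
  fix z assume z: "z \<in> carrier ?D" "?f z = \<zero>\<^bsub>M\<^esub>"
  then have c: "fst z \<in> carrier M" "snd z \<in> carrier M" using sL sL' by auto
  then have e: "fst z = \<ominus>\<^bsub>M\<^esub> snd z" using z(2) by (simp add: M.M.minus_equality)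
  then have "fst z \<in> L \<inter> L'" using z(1) M.submodule_neg[OF L'(1), of "snd z"] by auto
  then have "fst z = \<zero>\<^bsub>M\<^esub>" using L'(2) by simp
  then show "z = \<zero>\<^bsub>?D\<^esub>" using z(2) c by (cases z) auto
 qed
 moreover have "?f ` carrier ?D = carrier M" unfolding L'(3)[symmetric] by (force simp: set_add_def')
 ultimately have b: "bij_betw ?f (carrier ?D) (carrier M)" by (simp add: bij_betw_def)
 let ?h = "inv_into (carrier ?D) ?f"
 have h: "?h \<in> Hom R M ?D" by (rule hom_inv_into[OF D f b])
 show ?thesis
 proof (rule that)
  show "(\<lambda>x. fst (?h x)) \<in> Hom R M M" by (rule Hom_from_restr[OF Hom_comp[OF h DSum_hom_fst] sL])
  show "fst (?h x) \<in> L" if "x \<in> carrier M" for x using hom_closed[OF h that] by auto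
  show "fst (?h x) = x" if "x \<in> L" for x
   using inv_into_f_eq[OF bij_betw_imp_inj_on[OF b], of "(x, \<zero>\<^bsub>M\<^esub>)" x] that sL sub_zero[OF L'(1)] by auto
 qed
qed

lemma summandI:
 assumes M: "lmod R M" and L: "submodule L R M" and \<pi>: "\<pi> \<in> Hom R M M"
  and \<pi>L: "\<And>x. x \<in> carrier M ==> \<pi> x \<in> L" and id: "\<And>x. x \<in> L ==> \<pi> x = x" shows "summand R M L"
 unfolding direct_summand_def
proof (intro conjI L exI)
 interpret M: left_module R M by (rule M)
 let ?K = "{x \<in> carrier M. \<pi> x = \<zero>\<^bsub>M\<^esub>}"
 note sL = sub_subset[OF L]
 show "submodule ?K R M" by (rule hom_kernel_submodule[OF M M \<pi>])
 show "L \<inter> ?K = {\<zero>\<^bsub>M\<^esub>}" using id sub_zero[OF L] by auto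
 show "L <+>\<^bsub>M\<^esub> ?K = carrier M"
 proof
  show "L <+>\<^bsub>M\<^esub> ?K \<subseteq> carrier M" using sL by (auto simp: set_add_def')
  show "carrier M \<subseteq> L <+>\<^bsub>M\<^esub> ?K"
  proof
   fix x assume x: "x \<in> carrier M"
   have p: "\<pi> x \<in> carrier M" by (rule hom_closed[OF \<pi> x])
   have "x \<ominus>\<^bsub>M\<^esub> \<pi> x \<in> ?K" using x p hom_diff[OF M M \<pi> x p] id[OF \<pi>L[OF x]] by (simp add: a_minus_def M.M.r_neg)
   moreover have "x = \<pi> x \<oplus>\<^bsub>M\<^esub> (x \<ominus>\<^bsub>M\<^esub> \<pi> x)" using x p by (simp add: a_minus_def M.M.a_lcomm M.M.r_neg)
   ultimately show "x \<in> L <+>\<^bsub>M\<^esub> ?K" using \<pi>L[OF x] by (auto simp: set_add_def')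
  qed
 qed
qed

lemma fgp_summand:
 assumes L: "summand R (Free R n) L" shows "fgp R (restr (Free R n) L)"
proof -
 have sL: "submodule L R (Free R n)" using L by (simp add: direct_summand_def)
 obtain \<pi> where \<pi>: "\<pi> \<in> Hom R (Free R n) (Free R n)"
  "\<And>x. x \<in> carrier (Free R n) ==> \<pi> x \<in> L" "\<And>x. x \<in> L ==> \<pi> x = x"
  by (rule summand_projection[OF free_lm L]) (rule that)
 show ?thesis
 proof (rule fgp_retract[OF fgp_free])
  show "lmod R (restr (Free R n) L)" by (rule left_module.restr_lm[OF free_lm sL])
  show "(\<lambda>x. x) \<in> Hom R (restr (Free R n) L) (Free R n)" by (rule Hom_restr[OF Hom_id sub_subset[OF sL]])
  show "\<pi> \<in> Hom R (Free R n) (restr (Free R n) L)" by (rule Hom_into_restr[OF \<pi>(1)]) (use \<pi>(2) in auto)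
 qed (use \<pi>(3) in simp)
qed

lemma fgp_summand_exists:
 assumes P: "fgp R P"
 obtains n i L where "summand R (Free R n) L" "i \<in> Hom R P (Free R n)" "inj_on i (carrier P)" "i ` carrier P = L"
proof -
 note lP = fgp_lm[OF P]
 obtain n i r where i: "i \<in> Hom R P (Free R n)" "r \<in> Hom R (Free R n) P" "\<And>x. x \<in> carrier P ==> r (i x) = x"
  by (rule fgp_free_retract[OF P]) (rule that)
 have s: "submodule (i ` carrier P) R (Free R n)" by (rule image_submodule[OF lP free_lm i(1) left_module.sub_carrier[OF lP]])
 have "summand R (Free R n) (i ` carrier P)"
  by (rule summandI[OF free_lm s Hom_comp[OF i(2,1)]]) (auto simp: i(3) hom_closed[OF i(2)])
 moreover have "inj_on i (carrier P)" by (rule inj_on_inverseI[of _ r]) (rule i(3))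
 ultimately show ?thesis using that i(1) by blast
qed

end

section \<open>The monoid of finitely generated projective modules\<close>

lemma in_iso_class: "P' \<in> iso_class R P \<longleftrightarrow> fgp R P' \<and> Isom R P P'" by (simp add: iso_class_def)

lemma iso_class_cong:
 assumes "lmod R P" "Isom R P Q" shows "iso_class R P = iso_class R Q" using Isom_trans[OF Isom_sym[OF assms(2,1)]] Isom_trans[OF assms(2)]
 by (auto simp: iso_class_def)

lemma Proj_one: "\<one>\<^bsub>Proj R\<^esub> = iso_class R (Free R 0)" by (simp add: Proj_def)

context ring
begin

lemma fgp_representative:
 assumes "fgp R P"
 obtains P' where "P' \<in> iso_class R P"
proof -
 obtain n i L where L: "summand R (Free R n) L" "i \<in> Hom R P (Free R n)" "inj_on i (carrier P)" "i ` carrier P = L"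
  by (rule fgp_summand_exists[OF assms])
 show ?thesis using that fgp_summand[OF L(1)] Isom_image[OF L(2,3)] L(4) by (simp add: in_iso_class)
qed

lemma iso_class_eqD:
 assumes "fgp R P" "lmod R Q" "iso_class R P = iso_class R Q" shows "Isom R P Q"
 using fgp_representative[OF assms(1)] assms(2,3) Isom_trans Isom_sym unfolding in_iso_class set_eq_iff by metis

lemma iso_class_Proj:
 assumes "fgp R P" shows "iso_class R P \<in> carrier (Proj R)"
proof -
 obtain P' where "P' \<in> iso_class R P" by (rule fgp_representative[OF assms])
 then show ?thesis using iso_class_cong[OF fgp_lm[OF assms], of P'] by (auto simp: Proj_def in_iso_class)
qed

lemma Proj_carrierE:
 assumes "X \<in> carrier (Proj R)"
 obtains P :: "('a, nat => 'a) module" where "fgp R P" "X = iso_class R P" using assms by (auto simp: Proj_def)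

text \<open>Operations on classes are defined as unions over all representatives. A union of a
  constant family is the constant once the class is nonempty, which is what
  \<open>fgp_representative\<close> provides.\<close>

lemma iso_class_UN:
 assumes P: "fgp R P" and f: "\<And>P' :: ('a, nat => 'a) module. fgp R P' ==> Isom R P P' ==> f P' = c"
 shows "(\<Union>P'\<in>iso_class R P. f P') = c"
proof -
 obtain P' where "P' \<in> iso_class R P" by (rule fgp_representative[OF P])
 then show ?thesis using f unfolding in_iso_class[symmetric] by (intro SUP_eq_const) (auto simp: in_iso_class)
qed

lemma Proj_mult:
 assumes P: "fgp R P" and Q: "fgp R Q" shows "iso_class R P \<otimes>\<^bsub>Proj R\<^esub> iso_class R Q = iso_class R (DSum P Q)"
proof -
 note lP = fgp_lm[OF P] and lQ = fgp_lm[OF Q]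
 have "iso_class R (DSum P' Q') = iso_class R (DSum P Q)" if "Isom R P P'" "Isom R Q Q'" for P' Q' :: "('a, nat => 'a) module"
  using DSum_isomorphic[OF lP that(1) lQ that(2)] DSum_lm[OF lP lQ] by (intro iso_class_cong[symmetric])
 then have "(\<Union>P'\<in>iso_class R P. \<Union>Q'\<in>iso_class R Q. iso_class R (DSum P' Q')) = iso_class R (DSum P Q)"
  by (intro iso_class_UN[OF P] iso_class_UN[OF Q])
 then show ?thesis by (simp add: Proj_def)
qed

lemma Proj_comm_monoid: "comm_monoid (Proj R)"
proof (rule comm_monoidI)
 fix X Y Z assume "X \<in> carrier (Proj R)" "Y \<in> carrier (Proj R)" "Z \<in> carrier (Proj R)"
 then obtain P Q K :: "('a, nat => 'a) module" where PQK: "fgp R P" "fgp R Q" "fgp R K"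
  and [simp]: "X = iso_class R P" "Y = iso_class R Q" "Z = iso_class R K" by (meson Proj_carrierE)
 note d = fgp_DSum and l = fgp_lm
 show "X \<otimes>\<^bsub>Proj R\<^esub> Y \<otimes>\<^bsub>Proj R\<^esub> Z = X \<otimes>\<^bsub>Proj R\<^esub> (Y \<otimes>\<^bsub>Proj R\<^esub> Z)"
  using PQK by (simp add: Proj_mult d) (intro iso_class_cong DSum_assoc l d)
next
 fix X Y assume "X \<in> carrier (Proj R)" "Y \<in> carrier (Proj R)"
 then obtain P Q :: "('a, nat => 'a) module" where PQ: "fgp R P" "fgp R Q" and [simp]: "X = iso_class R P" "Y = iso_class R Q"
  by (meson Proj_carrierE)
 show "X \<otimes>\<^bsub>Proj R\<^esub> Y \<in> carrier (Proj R)" using PQ by (simp add: Proj_mult iso_class_Proj fgp_DSum)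
 show "X \<otimes>\<^bsub>Proj R\<^esub> Y = Y \<otimes>\<^bsub>Proj R\<^esub> X"
  using PQ by (simp add: Proj_mult) (intro iso_class_cong DSum_commute fgp_lm fgp_DSum)
next
 fix X assume "X \<in> carrier (Proj R)"
 then obtain P :: "('a, nat => 'a) module" where P: "fgp R P" and [simp]: "X = iso_class R P" by (meson Proj_carrierE)
 show "\<one>\<^bsub>Proj R\<^esub> \<otimes>\<^bsub>Proj R\<^esub> X = X" unfolding Proj_one \<open>X = _\<close> Proj_mult[OF fgp_free P]
  by (intro iso_class_cong DSum_zero_left[OF free_lm Free_0] DSum_lm
    free_lm fgp_lm[OF P])
qed (simp add: Proj_one iso_class_Proj fgp_free)

end

section \<open>The Grothendieck group\<close>

abbreviation groth_class :: "('a, 'b) monoid_scheme => 'a => 'a => ('a \<times> 'a) set" where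
 "groth_class G a b \<equiv> groth_rel G `` {(a, b)}"

context comm_monoid
begin

lemma groth_rel_equiv: "equiv (carrier G \<times> carrier G) (groth_rel G)"
proof (rule equivI)
 show "refl_on (carrier G \<times> carrier G) (groth_rel G)" by (auto simp: refl_on_def groth_rel_def)
 show "sym (groth_rel G)" by (auto simp: sym_def groth_rel_def) metis
 show "groth_rel G \<subseteq> (carrier G \<times> carrier G) \<times> (carrier G \<times> carrier G)" by (auto simp: groth_rel_def)
 show "trans (groth_rel G)"
 proof (rule transI, clarsimp simp: groth_rel_def)
  fix a b c d g h e f
  assume c: "a \<in> carrier G" "b \<in> carrier G" "c \<in> carrier G" "d \<in> carrier G" "g \<in> carrier G" "h \<in> carrier G"
   "e \<in> carrier G" "f \<in> carrier G" and ad: "a \<otimes> d \<otimes> e = c \<otimes> b \<otimes> e" and ch: "c \<otimes> h \<otimes> f = g \<otimes> d \<otimes> f"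
  \<comment> \<open>Without cancellation in \<open>G\<close>, the witness for transitivity joins the
    two stabilizing elements \<open>e\<close> and \<open>f\<close> with the middle term
    \<open>d\<close>.\<close>
  have "a \<otimes> h \<otimes> (d \<otimes> e \<otimes> f) = (a \<otimes> d \<otimes> e) \<otimes> (h \<otimes> f)" using c by (simp add: m_ac)
  also have "\<dots> = (c \<otimes> h \<otimes> f) \<otimes> (b \<otimes> e)" unfolding ad using c by (simp add: m_ac)
  also have "\<dots> = g \<otimes> b \<otimes> (d \<otimes> e \<otimes> f)" unfolding ch using c by (simp add: m_ac)
  finally show "\<exists>e\<in>carrier G. a \<otimes> h \<otimes> e = g \<otimes> b \<otimes> e" using c by (intro bexI[of _ "d \<otimes> e \<otimes> f"]) auto
 qed
qed

lemma groth_class_eq_iff: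
 assumes "a \<in> carrier G" "b \<in> carrier G" "c \<in> carrier G" "d \<in> carrier G"
 shows "groth_class G a b = groth_class G c d \<longleftrightarrow> (\<exists>e\<in>carrier G. a \<otimes> d \<otimes> e = c \<otimes> b \<otimes> e)"
 using eq_equiv_class_iff[OF groth_rel_equiv, of "(a, b)" "(c, d)"] assms by (auto simp: groth_rel_def)

lemma groth_class_in: "a \<in> carrier G ==> b \<in> carrier G ==> groth_class G a b \<in> carrier (Groth G)"
 by (auto simp: grothendieck_group_def intro!: quotientI)

lemma GrothE:
 assumes "X \<in> carrier (Groth G)"
 obtains a b where "a \<in> carrier G" "b \<in> carrier G" "X = groth_class G a b" using assms by (auto simp: grothendieck_group_def elim!: quotientE)

lemma groth_class_UN:
 assumes a: "a \<in> carrier G" "b \<in> carrier G"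
  and f: "\<And>c d e. c \<in> carrier G ==> d \<in> carrier G ==> e \<in> carrier G ==> a \<otimes> d \<otimes> e = c \<otimes> b \<otimes> e ==> f c d = C"
 shows "(\<Union>(c, d)\<in>groth_class G a b. f c d) = C"
proof (rule SUP_eq_const)
 show "groth_class G a b \<noteq> {}" using equiv_class_self[OF groth_rel_equiv, of "(a, b)"] a by auto
 fix z assume "z \<in> groth_class G a b"
 then obtain c d e where "z = (c, d)" "c \<in> carrier G" "d \<in> carrier G" "e \<in> carrier G" "a \<otimes> d \<otimes> e = c \<otimes> b \<otimes> e"
  by (cases z) (auto simp: groth_rel_def)
 then show "(case z of (c, d) => f c d) = C" by (simp add: f)
qed

lemma groth_mult:
 assumes "a \<in> carrier G" "b \<in> carrier G" "c \<in> carrier G" "d \<in> carrier G"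
 shows "groth_class G a b \<otimes>\<^bsub>Groth G\<^esub> groth_class G c d = groth_class G (a \<otimes> c) (b \<otimes> d)"
proof -
 have "groth_class G (a' \<otimes> c') (b' \<otimes> d') = groth_class G (a \<otimes> c) (b \<otimes> d)"
  if m: "a' \<in> carrier G" "b' \<in> carrier G" "e \<in> carrier G" "c' \<in> carrier G" "d' \<in> carrier G" "f \<in> carrier G"
   and e: "a \<otimes> b' \<otimes> e = a' \<otimes> b \<otimes> e" and f: "c \<otimes> d' \<otimes> f = c' \<otimes> d \<otimes> f" for a' b' e c' d' f
 proof -
  have "a' \<otimes> c' \<otimes> (b \<otimes> d) \<otimes> (e \<otimes> f) = (a' \<otimes> b \<otimes> e) \<otimes> (c' \<otimes> d \<otimes> f)" using assms m by (simp add: m_ac)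
  also have "\<dots> = (a \<otimes> c) \<otimes> (b' \<otimes> d') \<otimes> (e \<otimes> f)" unfolding e[symmetric] f[symmetric] using assms m by (simp add: m_ac)
  finally show ?thesis using assms m by (subst groth_class_eq_iff) (auto)
 qed
 then have "(\<Union>(a', b')\<in>groth_class G a b. \<Union>(c', d')\<in>groth_class G c d. groth_class G (a' \<otimes> c') (b' \<otimes> d'))
   = groth_class G (a \<otimes> c) (b \<otimes> d)" by (intro groth_class_UN assms)
 then show ?thesis by (simp add: grothendieck_group_def)
qed

lemma groth_one: "\<one>\<^bsub>Groth G\<^esub> = groth_class G \<one> \<one>" by (simp add: grothendieck_group_def)

lemma grothendieck_comm_group: "comm_group (Groth G)"
proof (rule comm_groupI)
 fix X Y Z
 assume "X \<in> carrier (Groth G)" "Y \<in> carrier (Groth G)" "Z \<in> carrier (Groth G)"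
 then obtain a b c d e f where "a \<in> carrier G" "b \<in> carrier G" "c \<in> carrier G" "d \<in> carrier G" "e \<in> carrier G" "f \<in> carrier G"
  and "X = groth_class G a b" "Y = groth_class G c d" "Z = groth_class G e f" by (meson GrothE)
 then show "X \<otimes>\<^bsub>Groth G\<^esub> Y \<otimes>\<^bsub>Groth G\<^esub> Z = X \<otimes>\<^bsub>Groth G\<^esub> (Y \<otimes>\<^bsub>Groth G\<^esub> Z)"
  by (simp add: groth_mult m_assoc)
next
 fix X Y assume "X \<in> carrier (Groth G)" "Y \<in> carrier (Groth G)"
 then obtain a b c d where "a \<in> carrier G" "b \<in> carrier G" "c \<in> carrier G" "d \<in> carrier G"
  and "X = groth_class G a b" "Y = groth_class G c d" by (meson GrothE)
 then show "X \<otimes>\<^bsub>Groth G\<^esub> Y \<in> carrier (Groth G)"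
  and "X \<otimes>\<^bsub>Groth G\<^esub> Y = Y \<otimes>\<^bsub>Groth G\<^esub> X" by (simp_all add: groth_mult groth_class_in m_comm)
next
 fix X assume "X \<in> carrier (Groth G)"
 then obtain a b where ab: "a \<in> carrier G" "b \<in> carrier G" and X: "X = groth_class G a b" by (meson GrothE)
 then show "\<one>\<^bsub>Groth G\<^esub> \<otimes>\<^bsub>Groth G\<^esub> X = X" by (simp add: groth_mult groth_one)
 have "groth_class G b a \<otimes>\<^bsub>Groth G\<^esub> X = groth_class G \<one> \<one>"
  using ab unfolding X by (simp add: groth_mult groth_class_eq_iff m_comm) blast
 then show "\<exists>Y\<in>carrier (Groth G). Y \<otimes>\<^bsub>Groth G\<^esub> X = \<one>\<^bsub>Groth G\<^esub>"
  using ab groth_one groth_class_in by (intro bexI[of _ "groth_class G b a"]) auto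
qed (simp add: groth_one groth_class_in)

lemma
 assumes H: "comm_monoid H" and f: "f \<in> iso G H"
 shows groth_map_class: "a \<in> carrier G ==> b \<in> carrier G ==> groth_map H f (groth_class G a b) = groth_class H (f a) (f b)"
  and groth_map_iso: "groth_map H f \<in> iso (Groth G) (Groth H)"
proof -
 interpret H: comm_monoid H by (rule H)
 have fc: "f x \<in> carrier H" if "x \<in> carrier G" for x using f that by (auto simp: iso_def hom_def)
 have fm: "f (x \<otimes> y) = f x \<otimes>\<^bsub>H\<^esub> f y" if "x \<in> carrier G" "y \<in> carrier G" for x y
  using f that by (auto simp: iso_def hom_def)
 have fb: "inj_on f (carrier G)" "f ` carrier G = carrier H" using f by (auto simp: iso_def bij_betw_def)
 show cls: "groth_map H f (groth_class G a b) = groth_class H (f a) (f b)" if a: "a \<in> carrier G" "b \<in> carrier G" for a b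
  unfolding groth_map_def
 proof (rule groth_class_UN[OF a])
  fix c d e assume c: "c \<in> carrier G" "d \<in> carrier G" "e \<in> carrier G" and "a \<otimes> d \<otimes> e = c \<otimes> b \<otimes> e"
  then have "f (a \<otimes> d \<otimes> e) = f (c \<otimes> b \<otimes> e)" by simp
  then show "groth_class H (f c) (f d) = groth_class H (f a) (f b)"
   using a c by (subst H.groth_class_eq_iff) (auto simp: fc fm intro!: bexI[of _ "f e"])
 qed
 show "groth_map H f \<in> iso (Groth G) (Groth H)" unfolding iso_def bij_betw_def
 proof (intro CollectI conjI)
  show "groth_map H f \<in> hom (Groth G) (Groth H)"
  proof (rule homI)
   fix X assume "X \<in> carrier (Groth G)"
  then show "groth_map H f X \<in> carrier (Groth H)" by (elim GrothE) (simp add: cls fc H.groth_class_in)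
  next
  fix X Y assume "X \<in> carrier (Groth G)" "Y \<in> carrier (Groth G)"
  then show "groth_map H f (X \<otimes>\<^bsub>Groth G\<^esub> Y) = groth_map H f X \<otimes>\<^bsub>Groth H\<^esub> groth_map H f Y"
   by (elim GrothE) (simp add: cls fc fm groth_mult H.groth_mult)
  qed
  show "inj_on (groth_map H f) (carrier (Groth G))"
  proof (rule inj_onI)
  fix X Y assume "X \<in> carrier (Groth G)" "Y \<in> carrier (Groth G)"
  then obtain a b c d where c: "a \<in> carrier G" "b \<in> carrier G" "c \<in> carrier G" "d \<in> carrier G"
   and X: "X = groth_class G a b" "Y = groth_class G c d" by (meson GrothE)
  assume "groth_map H f X = groth_map H f Y"
  then obtain e' where e': "e' \<in> carrier H" "f a \<otimes>\<^bsub>H\<^esub> f d \<otimes>\<^bsub>H\<^esub> e' = f c \<otimes>\<^bsub>H\<^esub> f b \<otimes>\<^bsub>H\<^esub> e'"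
   using c by (auto simp: X cls H.groth_class_eq_iff fc)
  moreover obtain e where e: "e \<in> carrier G" "e' = f e" using e'(1) fb(2) by auto
  ultimately have "f a \<otimes>\<^bsub>H\<^esub> f d \<otimes>\<^bsub>H\<^esub> f e = f c \<otimes>\<^bsub>H\<^esub> f b \<otimes>\<^bsub>H\<^esub> f e" by simp
  then have "f (a \<otimes> d \<otimes> e) = f (c \<otimes> b \<otimes> e)" using c e by (simp add: fm)
  then have "a \<otimes> d \<otimes> e = c \<otimes> b \<otimes> e" by (rule inj_onD[OF fb(1)]) (use c e in auto)
  then show "X = Y" using c e(1) by (auto simp: X groth_class_eq_iff)
  qed
  show "groth_map H f ` carrier (Groth G) = carrier (Groth H)"
  proof (intro equalityI subsetI)
  fix Z assume "Z \<in> groth_map H f ` carrier (Groth G)"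
  then show "Z \<in> carrier (Groth H)" by (auto elim!: GrothE simp: cls fc H.groth_class_in)
 next
  fix Z assume "Z \<in> carrier (Groth H)"
  then obtain a' b' where "a' \<in> f ` carrier G" "b' \<in> f ` carrier G" "Z = groth_class H a' b'" unfolding fb(2) by (rule H.GrothE)
  then obtain a b where "a \<in> carrier G" "b \<in> carrier G" "Z = groth_class H (f a) (f b)" by blast
  then show "Z \<in> groth_map H f ` carrier (Groth G)" using cls groth_class_in by (intro image_eqI[of _ _ "groth_class G a b"]) auto
  qed
 qed
qed

end

section \<open>Extension of scalars\<close>

text \<open>The value at \<open>c\<close> of the additive extension of \<open>g\<close> to the free
  abelian group.\<close>

definition free_sum :: "('g, 'b) ring_scheme => ('p => 'g) => ('p \<Rightarrow>\<^sub>0 int) => 'g" where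
 "free_sum V g c = finsum V (\<lambda>p. add_pow V (lookup c p) (g p)) (keys c)"

context abelian_group
begin

lemma add_pow_zero: "add_pow G (0 :: int) x = \<zero>" by (simp add: add_pow_def)

lemma free_sum_superset:
 assumes g: "g \<in> S \<rightarrow> carrier G" and S: "finite S" "keys c \<subseteq> S"
 shows "free_sum G g c = finsum G (\<lambda>p. add_pow G (lookup c p) (g p)) S" unfolding free_sum_def
 using g S by (intro add.finprod_mono_neutral_cong_left) (auto simp: in_keys_iff add_pow_zero)

lemma free_sum_closed: "g \<in> S \<rightarrow> carrier G ==> keys c \<subseteq> S ==> free_sum G g c \<in> carrier G"
 unfolding free_sum_def by (intro finsum_closed) (auto)

lemma free_sum_add:
 assumes g: "g \<in> S \<rightarrow> carrier G" and a: "keys a \<subseteq> S" and b: "keys b \<subseteq> S"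
 shows "free_sum G g (a + b) = free_sum G g a \<oplus> free_sum G g b"
proof -
 let ?T = "keys a \<union> keys b"
 have g': "g \<in> ?T \<rightarrow> carrier G" using g a b by auto
 have k: "keys (a + b) \<subseteq> ?T" by (rule keys_add)
 show ?thesis unfolding free_sum_superset[OF g' _ k, simplified] free_sum_superset[OF g' _ Un_upper1, simplified]
   free_sum_superset[OF g' _ Un_upper2, simplified]
  using g' by (subst finsum_addf[symmetric]; intro finsum_cong' refl Pi_I) (auto simp: lookup_add add.int_pow_mult Pi_def)
qed

lemma free_sum_frag_of: "g p \<in> carrier G ==> free_sum G g (frag_of p) = g p" by (simp add: free_sum_def)

lemma free_sum_zero: "free_sum G g 0 = \<zero>" by (simp add: free_sum_def)

lemma free_sum_diff:
 assumes g: "g \<in> S \<rightarrow> carrier G" and a: "keys a \<subseteq> S" and b: "keys b \<subseteq> S"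
 shows "free_sum G g (a - b) = free_sum G g a \<ominus> free_sum G g b"
proof -
 have k: "keys (a - b) \<subseteq> S" using keys_diff[of a b] a b by auto
 show ?thesis using free_sum_add[OF g k b] free_sum_closed[OF g b] free_sum_closed[OF g k]
  by (simp add: a_minus_def a_assoc r_neg)
qed

end

locale scalar_extension = R: ring R + U: ring U for R :: "('r, 'a) ring_scheme" (structure) and U :: "('s, 'b) ring_scheme" and \<phi> :: "'r => 's" +
 assumes hom: "\<phi> \<in> ring_hom R U"
begin

abbreviation (input) zeroU ("\<zero>\<^sub>U") where "\<zero>\<^sub>U \<equiv> \<zero>\<^bsub>U\<^esub>"
abbreviation (input) oneU ("\<one>\<^sub>U") where "\<one>\<^sub>U \<equiv> \<one>\<^bsub>U\<^esub>"
abbreviation (input) addU (infixl "\<oplus>\<^sub>U" 65) where "x \<oplus>\<^sub>U y \<equiv> x \<oplus>\<^bsub>U\<^esub> y"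
abbreviation (input) minusU (infixl "\<ominus>\<^sub>U" 65) where "x \<ominus>\<^sub>U y \<equiv> x \<ominus>\<^bsub>U\<^esub> y"
abbreviation (input) U_mult (infixl "\<star>" 70) where "x \<star> y \<equiv> x \<otimes>\<^bsub>U\<^esub> y"
abbreviation (input) uminusU ("\<ominus>\<^sub>U _" [81] 80) where "\<ominus>\<^sub>U x \<equiv> \<ominus>\<^bsub>U\<^esub> x"

lemmas \<phi>_closed [simp] = ring_hom_closed[OF hom]
lemmas \<phi>_add = ring_hom_add[OF hom]
lemmas \<phi>_mult = ring_hom_mult[OF hom]
lemmas \<phi>_one [simp] = ring_hom_one[OF hom]

end

locale mod_ext = scalar_extension R U \<phi> + M: left_module R M
 for R :: "('r, 'a) ring_scheme" (structure) and U :: "('s, 'b) ring_scheme" and \<phi> :: "'r => 's" and M :: "('r, 'm, 'c) module_scheme"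
begin

abbreviation "K \<equiv> tensor_kernel R U \<phi> M"
abbreviation "C \<equiv> carrier U \<times> carrier M"
abbreviation "T \<equiv> BC R U \<phi> M"

definition coset :: "('s \<times> 'm \<Rightarrow>\<^sub>0 int) => ('s \<times> 'm \<Rightarrow>\<^sub>0 int) set" where
 "coset c = K #>\<^bsub>tensor_free U M\<^esub> c"

definition left_act :: "'s => ('s \<times> 'm \<Rightarrow>\<^sub>0 int) => ('s \<times> 'm \<Rightarrow>\<^sub>0 int)" where
 "left_act s = frag_extend (\<lambda>(t, x). frag_of (s \<star> t, x))"

definition tens :: "'s => 'm => ('s \<times> 'm \<Rightarrow>\<^sub>0 int) set" where "tens s x = coset (frag_of (s, x))"

lemma relations_keys: "z \<in> tensor_relations R U \<phi> M ==> keys z \<subseteq> C" unfolding tensor_relations_def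
 by (elim UnE; clarsimp; (drule subsetD[OF keys_diff])+; auto simp: M.smult_closed dest!: subsetD[OF keys_diff])

lemma K_subgroup: "subgroup K (tensor_free U M)" unfolding tensor_kernel_def using relations_keys by (intro group.generate_is_subgroup) auto

lemma K_keys: "c \<in> K ==> keys c \<subseteq> C" using subgroup.subset[OF K_subgroup] by (auto simp: free_Abelian_group_def)

lemma K_zero: "0 \<in> K" and K_add: "a \<in> K ==> b \<in> K ==> a + b \<in> K" and K_minus: "a \<in> K ==> - a \<in> K"
 using subgroup.one_closed[OF K_subgroup] subgroup.m_closed[OF K_subgroup, of a b] subgroup.m_inv_closed[OF K_subgroup, of a]
  K_keys[of a] by simp_all

lemma K_diff: "a \<in> K ==> b \<in> K ==> a - b \<in> K" using K_add[of a "- b"] K_minus[of b] by simp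

text \<open>Closure under differences replaces the two rules for inverses and sums, so that each
  later induction has a single composite case.\<close>

lemma K_induct [consumes 1, case_names zero rel diff]:
 assumes "c \<in> K" "P 0" "\<And>z. z \<in> tensor_relations R U \<phi> M ==> P z"
  and diff: "\<And>a b. a \<in> K ==> b \<in> K ==> P a ==> P b ==> P (a - b)" shows "P c" using assms(1) unfolding tensor_kernel_def
proof (induction rule: generate.induct)
 have gen: "generate (tensor_free U M) (tensor_relations R U \<phi> M) = K" by (simp add: tensor_kernel_def)
 {
  case (inv h)
  then have "h \<in> K" using generate.incl[OF inv, of "tensor_free U M"] by (simp add: gen)
  then show ?case using diff[OF K_zero \<open>h \<in> K\<close>] assms(2) assms(3)[OF inv] K_keys[of h] by simp
 next
  case (eng a b)
  then have ab: "a \<in> K" "b \<in> K" by (simp_all add: gen)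
  have "P (- b)" using diff[OF K_zero ab(2) assms(2) eng(4)] by simp
  from diff[OF ab(1) K_minus[OF ab(2)] eng(3) this] show ?case by simp
 }
qed (use assms in auto)

lemma in_coset_iff: "d \<in> coset c \<longleftrightarrow> d - c \<in> K" by (auto simp: coset_def r_coset_def intro!: bexI[of _ "d - c"])

lemma coset_eq_iff: "coset c = coset d \<longleftrightarrow> c - d \<in> K"
proof
 assume "coset c = coset d"
 moreover have "c \<in> coset c" by (simp add: in_coset_iff K_zero)
 ultimately show "c - d \<in> K" by (simp add: in_coset_iff)
next
 assume cd: "c - d \<in> K"
 have "x - c \<in> K \<longleftrightarrow> x - d \<in> K" for x using K_add[OF _ cd, of "x - c"] K_diff[OF _ cd, of "x - d"] by auto
 then show "coset c = coset d" by (auto simp: in_coset_iff)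
qed

lemma BC_carrier: "carrier T = coset ` {c. keys c \<subseteq> C}"
 by (auto simp: base_change_def RCOSETS_def coset_def free_Abelian_group_def)

lemma BC_zero: "\<zero>\<^bsub>T\<^esub> = coset 0" by (auto simp: base_change_def in_coset_iff)

lemma BC_add: "coset c \<oplus>\<^bsub>T\<^esub> coset d = coset (c + d)"
proof -
 have "coset c \<oplus>\<^bsub>T\<^esub> coset d = {x + y | x y. x \<in> coset c \<and> y \<in> coset d}" by (auto simp: base_change_def set_mult_def)
 also have "\<dots> = coset (c + d)"
 proof (intro equalityI subsetI)
  fix z assume "z \<in> {x + y | x y. x \<in> coset c \<and> y \<in> coset d}"
  then obtain x y where "z = x + y" "x - c \<in> K" "y - d \<in> K" by (auto simp: in_coset_iff)
  then show "z \<in> coset (c + d)" using K_add[of "x - c" "y - d"] by (simp add: in_coset_iff algebra_simps)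
 next
  fix z assume "z \<in> coset (c + d)"
  then have "z - d \<in> coset c" "d \<in> coset d" "z = (z - d) + d" by (simp_all add: in_coset_iff K_zero algebra_simps)
  then show "z \<in> {x + y | x y. x \<in> coset c \<and> y \<in> coset d}" by blast
 qed
 finally show ?thesis .
qed

lemma left_act_diff: "left_act s (c - d) = left_act s c - left_act s d" and left_act_add: "left_act s (c + d) = left_act s c + left_act s d"
 and left_act_zero: "left_act s 0 = 0" and left_act_of: "left_act s (frag_of (t, x)) = frag_of (s \<star> t, x)"
 by (simp_all add: left_act_def frag_extend_diff frag_extend_add)

lemma left_act_keys:
 assumes "s \<in> carrier U" "keys c \<subseteq> C" shows "keys (left_act s c) \<subseteq> C"
 unfolding left_act_def using assms by (intro order.trans[OF keys_frag_extend]) auto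

lemma relations:
 assumes "s \<in> carrier U" "x \<in> carrier M"
 shows "t \<in> carrier U ==> frag_of (s \<oplus>\<^sub>U t, x) - frag_of (s, x) - frag_of (t, x) \<in> K"
  and "y \<in> carrier M ==> frag_of (s, x \<oplus>\<^bsub>M\<^esub> y) - frag_of (s, x) - frag_of (s, y) \<in> K"
  and "r \<in> carrier R ==> frag_of (s \<star> \<phi> r, x) - frag_of (s, r \<odot>\<^bsub>M\<^esub> x) \<in> K"
 unfolding tensor_kernel_def using assms by (intro generate.incl; unfold tensor_relations_def; blast)+

lemma left_act_K:
 assumes s: "s \<in> carrier U" and c: "c \<in> K" shows "left_act s c \<in> K" using c
proof (induction rule: K_induct)
 case (rel z)
 then show ?case unfolding tensor_relations_def
  using s relations by (elim UnE; clarsimp simp: left_act_diff left_act_of U.r_distr U.m_assoc[symmetric])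
qed (simp_all add: left_act_zero left_act_diff K_zero K_diff)

lemma BC_smult: "s \<in> carrier U ==> s \<odot>\<^bsub>T\<^esub> coset c = coset (left_act s c)"
proof -
 assume s: "s \<in> carrier U"
 have "s \<odot>\<^bsub>T\<^esub> coset c = (\<Union>d\<in>coset c. coset (left_act s d))" by (simp add: base_change_def coset_def left_act_def)
 also have "\<dots> = coset (left_act s c)"
 proof (rule SUP_eq_const)
  show "coset c \<noteq> {}" using K_zero in_coset_iff[of c c] by auto
  show "coset (left_act s d) = coset (left_act s c)" if "d \<in> coset c" for d
   using left_act_K[OF s, of "d - c"] that by (simp add: coset_eq_iff in_coset_iff left_act_diff)
 qed
 finally show ?thesis .
qed

lemma BC_lm: "lmod U T"
proof -
 have sm: "coset (left_act (r \<oplus>\<^sub>U s) c) = coset (left_act r c + left_act s c)"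
  "coset (left_act (r \<star> s) c) = coset (left_act r (left_act s c))" "coset (left_act \<one>\<^sub>U c) = coset c"
  if r: "r \<in> carrier U" "s \<in> carrier U" and c: "keys c \<subseteq> C" for r s c
 proof -
  from c have "left_act (r \<oplus>\<^sub>U s) c - (left_act r c + left_act s c) \<in> K"
  proof (induction c rule: frag_induction)
   case (one p)
   then show ?case using relations(1)[of "r \<star> fst p" "snd p" "s \<star> fst p"] r
    by (cases p) (auto simp: left_act_of U.l_distr diff_diff_eq)
  next
   case (diff a b)
   show ?case using K_diff[OF diff] by (simp add: left_act_diff algebra_simps)
  qed (simp add: left_act_zero K_zero)
  then show "coset (left_act (r \<oplus>\<^sub>U s) c) = coset (left_act r c + left_act s c)" by (simp add: coset_eq_iff)
  from c have "left_act (r \<star> s) c = left_act r (left_act s c)"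
  proof (induction c rule: frag_induction)
   case (one p)
   then show ?case using r by (cases p) (auto simp: left_act_of U.m_assoc)
  qed (simp_all add: left_act_zero left_act_diff)
  then show "coset (left_act (r \<star> s) c) = coset (left_act r (left_act s c))" by simp
  from c have "left_act \<one>\<^sub>U c = c"
  proof (induction c rule: frag_induction)
   case (one p)
   then show ?case by (cases p) (auto simp: left_act_of)
  qed (simp_all add: left_act_zero left_act_diff)
  then show "coset (left_act \<one>\<^sub>U c) = coset c" by simp
 qed
 show ?thesis
 proof (rule left_moduleI)
  fix x assume "x \<in> carrier T"
  then obtain c where "keys c \<subseteq> C" "x = coset c" by (auto simp: BC_carrier)
  then show "\<exists>y\<in>carrier T. y \<oplus>\<^bsub>T\<^esub> x = \<zero>\<^bsub>T\<^esub>"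
   by (intro bexI[of _ "coset (- c)"]) (auto simp: BC_carrier BC_add BC_zero)
 next
  fix x y assume "x \<in> carrier T" "y \<in> carrier T"
  then show "x \<oplus>\<^bsub>T\<^esub> y \<in> carrier T" using keys_add by (fastforce simp: BC_carrier BC_add)
 next
  fix x assume "x \<in> carrier T"
  then show "\<one>\<^sub>U \<odot>\<^bsub>T\<^esub> x = x"
   using sm(3)[of "\<one>\<^sub>U" "\<one>\<^sub>U"] by (clarsimp simp: BC_carrier BC_smult)
 qed (auto simp: BC_carrier BC_add BC_zero BC_smult sm U.ring_axioms
   left_act_add left_act_keys add_ac intro!: imageI)
qed

sublocale T: left_module U T by (rule BC_lm)

lemma tens_closed [simp]: "s \<in> carrier U ==> x \<in> carrier M ==> tens s x \<in> carrier T" by (auto simp: tens_def BC_carrier)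

lemma tens_smult: "s \<in> carrier U ==> s \<odot>\<^bsub>T\<^esub> tens t x = tens (s \<star> t) x"
 by (simp add: tens_def BC_smult left_act_of)

lemma tens_add_right:
 "s \<in> carrier U ==> x \<in> carrier M ==> y \<in> carrier M ==> tens s (x \<oplus>\<^bsub>M\<^esub> y) = tens s x \<oplus>\<^bsub>T\<^esub> tens s y"
 and tens_balanced:
 "s \<in> carrier U ==> r \<in> carrier R ==> x \<in> carrier M ==> tens (s \<star> \<phi> r) x = tens s (r \<odot>\<^bsub>M\<^esub> x)"
 by (simp_all add: tens_def BC_add coset_eq_iff relations diff_diff_eq[symmetric])

lemma BC_induct [consumes 1, case_names zero tens diff]:
 assumes "X \<in> carrier T" and "P \<zero>\<^bsub>T\<^esub>" and "\<And>s x. s \<in> carrier U ==> x \<in> carrier M ==> P (tens s x)"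
  and d: "\<And>X Y. X \<in> carrier T ==> Y \<in> carrier T ==> P X ==> P Y ==> P (X \<ominus>\<^bsub>T\<^esub> Y)" shows "P X"
proof -
 obtain c where c: "keys c \<subseteq> C" "X = coset c" using assms(1) by (auto simp: BC_carrier)
 from c(1) have "P (coset c)"
 proof (induction c rule: free_Abelian_group_induct[consumes 1])
  case 1
  then show ?case using assms(2) by (simp add: BC_zero)
 next
  case (2 a b)
  then have ab: "coset a \<in> carrier T" "coset b \<in> carrier T" "coset (a - b) \<in> carrier T"
   using keys_diff[of a b] by (auto simp: BC_carrier intro!: imageI)
  have "(coset (a - b) \<oplus>\<^bsub>T\<^esub> coset b) \<ominus>\<^bsub>T\<^esub> coset b = coset (a - b)"
   using ab by (simp add: a_minus_def T.M.a_assoc T.M.r_neg)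
  then have "coset (a - b) = coset a \<ominus>\<^bsub>T\<^esub> coset b" by (simp add: BC_add)
  then show ?case using d ab 2 by simp
 next
  case (3 p)
  then show ?case using assms(3)[of "fst p" "snd p"] by (cases p) (auto simp: tens_def)
 qed
 then show ?thesis using c by simp
qed

text \<open>The map \<open>s \<otimes> x \<mapsto> s j(x)\<close> of the universal property. It has
  the shape of \<open>tensor_to_ring\<close>, which is the case of the regular module with
  \<open>j = \<phi>\<close>; \<open>the_elem\<close> is meaningful because the sum is constant on
  cosets of the kernel.\<close>

definition tensor_lift :: "('s, 'v, 'd) module_scheme => ('m => 'v) => ('s \<times> 'm \<Rightarrow>\<^sub>0 int) set => 'v" where
 "tensor_lift V j X = the_elem (free_sum V (\<lambda>(s, x). s \<odot>\<^bsub>V\<^esub> j x) ` X)"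

lemma
 assumes V: "lmod U V" and j: "j \<in> Hom R M (RS \<phi> V)" shows tensor_lift_hom: "tensor_lift V j \<in> Hom U T V"
  and tensor_lift_tens: "s \<in> carrier U ==> x \<in> carrier M ==> tensor_lift V j (tens s x) = s \<odot>\<^bsub>V\<^esub> j x"
proof -
 interpret V: left_module U V by (rule V)
 let ?g = "\<lambda>(s, x). s \<odot>\<^bsub>V\<^esub> j x"
 have jc: "j x \<in> carrier V" if "x \<in> carrier M" for x using hom_closed[OF j that] by simp
 have g: "?g \<in> C \<rightarrow> carrier V" using jc by (auto intro: V.smult_closed)
 note fz = V.M.free_sum_zero and fd = V.M.free_sum_diff[OF g] and fc = V.M.free_sum_closed[OF g]
 have fo: "free_sum V ?g (frag_of (s, x)) = s \<odot>\<^bsub>V\<^esub> j x" if "s \<in> carrier U" "x \<in> carrier M" for s x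
  using that jc by (subst V.M.free_sum_frag_of) (auto simp: V.smult_closed)
 have three: "free_sum V ?g (frag_of p - frag_of q - frag_of r) = \<zero>\<^bsub>V\<^esub>"
  if p: "p \<in> C" "q \<in> C" "r \<in> C" and e: "?g p = ?g q \<oplus>\<^bsub>V\<^esub> ?g r" for p q r
 proof -
  have "keys (frag_of p - frag_of q) \<subseteq> C" using p keys_diff[of "frag_of p" "frag_of q"] by auto
  moreover have gc: "?g p \<in> carrier V" "?g q \<in> carrier V" "?g r \<in> carrier V" using p g by blast+
  ultimately have "free_sum V ?g (frag_of p - frag_of q - frag_of r) = ?g p \<ominus>\<^bsub>V\<^esub> ?g q \<ominus>\<^bsub>V\<^esub> ?g r"
   using p by (simp add: fd V.M.free_sum_frag_of)
  moreover have "(?g q \<oplus>\<^bsub>V\<^esub> ?g r) \<ominus>\<^bsub>V\<^esub> ?g q = ?g r"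
   using gc by (simp add: a_minus_def V.M.a_comm[of "?g q"] V.M.a_assoc V.M.r_neg)
  ultimately show ?thesis unfolding e using gc by (simp add: a_minus_def V.M.r_neg)
 qed
 have "free_sum V ?g c = \<zero>\<^bsub>V\<^esub>" if "c \<in> K" for c using that
 proof (induction rule: K_induct)
  case (diff a b)
  then show ?case using fd[of a b] K_keys by (simp add: a_minus_def)
 next
  case (rel z)
  then show ?case unfolding tensor_relations_def
  proof (elim UnE)
   assume "z \<in> {frag_of (s \<star> \<phi> r, x) - frag_of (s, r \<odot>\<^bsub>M\<^esub> x) | s r x. s \<in> carrier U \<and> r \<in> carrier R \<and> x \<in> carrier M}"
   then obtain s r x where z: "z = frag_of (s \<star> \<phi> r, x) - frag_of (s, r \<odot>\<^bsub>M\<^esub> x)" and m: "s \<in> carrier U" "r \<in> carrier R" "x \<in> carrier M"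
    by blast
   show ?thesis unfolding z using m hom_smult[OF j m(2,3)]
    by (subst fd) (auto simp: fo M.smult_closed V.smult_assoc V.smult_closed jc a_minus_def V.M.r_neg)
  qed (use jc hom_add[OF j] in \<open>clarsimp; intro three; auto simp: V.smult_l_distr V.smult_r_distr\<close>)+
 qed (rule fz)
 note fK = this
 have eq: "free_sum V ?g d = free_sum V ?g c" if c: "keys c \<subseteq> C" and d: "d - c \<in> K" for c d
 proof -
  have "free_sum V ?g ((d - c) + c) = free_sum V ?g (d - c) \<oplus>\<^bsub>V\<^esub> free_sum V ?g c" by (rule V.M.free_sum_add[OF g K_keys[OF d] c])
  then show ?thesis using fK[OF d] fc[OF c] by simp
 qed
 have lift: "tensor_lift V j (coset c) = free_sum V ?g c" if c: "keys c \<subseteq> C" for c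
 proof -
  have "free_sum V ?g ` coset c = (\<lambda>_. free_sum V ?g c) ` coset c" by (rule image_cong[OF refl], rule eq[OF c]) (simp add: in_coset_iff)
  also have "\<dots> = {free_sum V ?g c}" by (rule image_constant[of c]) (simp add: in_coset_iff K_zero)
  finally have "free_sum V ?g ` coset c = {free_sum V ?g c}" .
  then show ?thesis by (simp add: tensor_lift_def)
 qed
 show "tensor_lift V j (tens s x) = s \<odot>\<^bsub>V\<^esub> j x" if "s \<in> carrier U" "x \<in> carrier M" for s x
  unfolding tens_def using that by (subst lift) (auto simp: fo)
 show "tensor_lift V j \<in> Hom U T V"
 proof (rule HomI)
  fix X Y assume "X \<in> carrier T" "Y \<in> carrier T"
  then obtain c d where c: "keys c \<subseteq> C" "X = coset c" and d: "keys d \<subseteq> C" "Y = coset d"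
   by (auto simp: BC_carrier)
  have "keys (c + d) \<subseteq> C" using keys_add[of c d] c(1) d(1) by blast
  then show "tensor_lift V j (X \<oplus>\<^bsub>T\<^esub> Y) = tensor_lift V j X \<oplus>\<^bsub>V\<^esub> tensor_lift V j Y"
   using c d by (simp add: BC_add lift V.M.free_sum_add[OF g])
 next
  fix s X assume s: "s \<in> carrier U" and "X \<in> carrier T"
  then obtain c where c: "keys c \<subseteq> C" "X = coset c" by (auto simp: BC_carrier)
  from c(1) have "keys c \<subseteq> C \<and> free_sum V ?g (left_act s c) = s \<odot>\<^bsub>V\<^esub> free_sum V ?g c"
  proof (induction c rule: free_Abelian_group_induct[consumes 1])
   case 1
   show ?case by (simp add: left_act_zero fz V.smult_zero_right s)
  next
   case (2 a b)
   have "keys (a - b) \<subseteq> C" using 2 keys_diff[of a b] by auto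
   moreover have "s \<odot>\<^bsub>V\<^esub> (free_sum V ?g a \<ominus>\<^bsub>V\<^esub> free_sum V ?g b) = s \<odot>\<^bsub>V\<^esub> free_sum V ?g a \<ominus>\<^bsub>V\<^esub> s \<odot>\<^bsub>V\<^esub> free_sum V ?g b"
   proof -
    have "s \<odot>\<^bsub>V\<^esub> free_sum V ?g a = s \<odot>\<^bsub>V\<^esub> (free_sum V ?g a \<ominus>\<^bsub>V\<^esub> free_sum V ?g b) \<oplus>\<^bsub>V\<^esub> s \<odot>\<^bsub>V\<^esub> free_sum V ?g b"
     using fc 2 s by (subst V.smult_r_distr[symmetric]) (auto simp: a_minus_def V.M.a_assoc V.M.l_neg)
    then show ?thesis using fc 2 s by (auto simp: a_minus_def V.M.a_assoc V.M.r_neg V.smult_closed)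
   qed
   ultimately show ?case using 2 s by (simp add: left_act_diff fd left_act_keys)
  next
   case (3 p)
   then show ?case using s by (cases p) (auto simp: left_act_of fo V.smult_assoc jc)
  qed
  then show "tensor_lift V j (s \<odot>\<^bsub>T\<^esub> X) = s \<odot>\<^bsub>V\<^esub> tensor_lift V j X"
   using s c by (simp add: BC_smult lift left_act_keys)
 qed (auto simp: BC_carrier lift fc)
qed

end

lemma free_sum_Reg: "free_sum (Reg U) = free_sum U"
proof -
 have "m_inv (add_monoid (Reg U)) = m_inv (add_monoid U)" by (simp add: m_inv_def fun_eq_iff)
 then have "add_pow (Reg U) k x = add_pow U k x" for k :: int and x
  by (cases "k < 0") (simp_all add: add_pow_def int_pow_def nat_pow_def Let_def)
 then show ?thesis by (intro ext) (simp add: free_sum_def finsum_def finprod_def regular_module_def)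
qed

section \<open>Rings of fractions\<close>

lemma (in left_module) smult_Units_cancel:
 assumes s: "s \<in> Units R" and x: "x \<in> carrier M" and y: "y \<in> carrier M" and eq: "s \<odot>\<^sub>M x = s \<odot>\<^sub>M y"
 shows "x = y"
proof -
 have "inv\<^bsub>R\<^esub> s \<odot>\<^sub>M (s \<odot>\<^sub>M z) = z" if "z \<in> carrier M" for z
  using s that by (simp add: smult_assoc[symmetric] R.Units_closed smult_one)
 from this[OF x] this[OF y] show ?thesis unfolding eq by simp
qed

lemma hom_RS: "\<phi> \<in> ring_hom R U ==> f \<in> Hom U V W ==>
  f \<in> Hom R (RS \<phi> V) (RS \<phi> W)" by (rule HomI) (simp_all add: hom_closed hom_add hom_smult ring_hom_closed)

lemma submodule_RS:
 assumes \<phi>: "\<phi> \<in> ring_hom R U" "ring R" and V: "lmod U V" and L: "submodule L U V" shows "submodule L R (RS \<phi> V)"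
 using sub_subset[OF L] sub_zero[OF L] sub_add[OF L] sub_smult[OF L] ring_hom_closed[OF \<phi>(1)]
 by (intro left_module.submoduleI[OF RS_lm[OF \<phi>(2,1) V]]) auto

text \<open>What the algebra takes from the analysis: \<open>U\<close> consists of left and of right
  fractions over \<open>R\<close>, finitely generated left ideals are principal, and
  \<open>polar\<close> attaches to \<open>a\<close> the idempotents \<open>v w\<close> and
  \<open>w v\<close> with the left and the right annihilator of \<open>a\<close>, respectively.
  These are the range and the support projection.\<close>

locale ring_extension = scalar_extension R U \<phi>
 for R :: "('r, 'a) ring_scheme" (structure) and U :: "('s, 'b) ring_scheme" and \<phi> :: "'r => 's" +
 assumes inj: "inj_on \<phi> (carrier R)"
  and left_fraction: "u \<in> carrier U ==> \<exists>s\<in>carrier R. \<exists>a\<in>carrier R. \<phi> s \<in> Units U \<and> \<phi> s \<star> u = \<phi> a"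
  and right_fraction: "u \<in> carrier U ==> \<exists>s\<in>carrier R. \<exists>a\<in>carrier R. \<phi> s \<in> Units U \<and> u \<star> \<phi> s = \<phi> a"
  and Bezout: "a \<in> carrier R ==> b \<in> carrier R ==>
   \<exists>c\<in>carrier R. \<exists>v1\<in>carrier R. \<exists>v2\<in>carrier R. \<exists>w1\<in>carrier R. \<exists>w2\<in>carrier R.
    a = v1 \<otimes> c \<and> b = v2 \<otimes> c \<and> c = w1 \<otimes> a \<oplus> w2 \<otimes> b"
  and polar: "a \<in> carrier R ==> \<exists>v\<in>carrier R. \<exists>w\<in>carrier R.
    v \<otimes> w \<otimes> v = v \<and> w \<otimes> v \<otimes> w = w \<and>
    (\<forall>x\<in>carrier R. x \<otimes> a = \<zero> \<longleftrightarrow> x \<otimes> (v \<otimes> w) = \<zero>) \<and>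
    (\<forall>x\<in>carrier R. a \<otimes> x = \<zero> \<longleftrightarrow> w \<otimes> v \<otimes> x = \<zero>)"
begin

abbreviation R_mult (infixl "\<cdot>" 70) where "x \<cdot> y \<equiv> x \<otimes> y"
abbreviation "RU \<equiv> RS \<phi> (Reg U)"

definition den :: "'r => bool" where "den s \<longleftrightarrow> s \<in> carrier R \<and> \<phi> s \<in> Units U"

lemma den_one: "den \<one>" by (simp add: den_def)

lemma den_mult: "den s ==> den t ==> den (s \<cdot> t)" by (simp add: den_def \<phi>_mult)

lemma den_closed [simp]: "den s ==> s \<in> carrier R" and den_Units [simp]: "den s ==> \<phi> s \<in> Units U" by (simp_all add: den_def)

lemma \<phi>_eq_iff: "a \<in> carrier R ==> b \<in> carrier R ==> \<phi> a = \<phi> b \<longleftrightarrow> a = b" using inj by (auto dest: inj_onD)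

lemma \<phi>_zero [simp]: "\<phi> \<zero> = \<zero>\<^sub>U"
proof -
 have "\<phi> \<zero> \<oplus>\<^sub>U \<phi> \<zero> = \<phi> \<zero>" using \<phi>_add[of "\<zero>" "\<zero>"] by simp
 then show ?thesis by simp
qed

lemma \<phi>_eq_zero_iff: "a \<in> carrier R ==> \<phi> a = \<zero>\<^sub>U \<longleftrightarrow> a = \<zero>"
 using \<phi>_eq_iff[of a "\<zero>"] by simp

lemma left_fractionE:
 assumes "u \<in> carrier U" obtains s a where "den s" "a \<in> carrier R" "\<phi> s \<star> u = \<phi> a"
 using left_fraction[OF assms] that unfolding den_def by blast

lemma right_fractionE:
 assumes "u \<in> carrier U" obtains s a where "den s" "a \<in> carrier R" "u \<star> \<phi> s = \<phi> a"
 using right_fraction[OF assms] that unfolding den_def by blast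

lemma den_cancel_left: "den s ==> x \<in> carrier U ==> y \<in> carrier U ==> \<phi> s \<star> x = \<phi> s \<star> y ==> x = y"
 by simp

lemma den_cancel_right:
 assumes "den s" "x \<in> carrier U" "x \<star> \<phi> s = \<zero>\<^sub>U" shows "x = \<zero>\<^sub>U"
proof -
 have "x \<star> (\<phi> s \<star> inv\<^bsub>U\<^esub> (\<phi> s)) = x \<star> \<phi> s \<star> inv\<^bsub>U\<^esub> (\<phi> s)"
  by (rule U.m_assoc[symmetric]) (use assms in auto)
 then show ?thesis using assms by simp
qed

lemma den_zero_left: "den s ==> x \<in> carrier U ==> \<phi> s \<star> x = \<zero>\<^sub>U ==> x = \<zero>\<^sub>U"
 using den_cancel_left[of s x "\<zero>\<^sub>U"] by simp

text \<open>The Ore condition, from rewriting the right fraction \<open>s t^(-1)\<close> as a left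
  fraction.\<close>

lemma common_left_multiple:
 assumes s: "den s" and t: "den t"
 obtains s' t' where "s' \<in> carrier R" "t' \<in> carrier R" "s' \<cdot> s = t' \<cdot> t" "den (s' \<cdot> s)"
proof -
 obtain z a where z: "den z" "a \<in> carrier R" "\<phi> z \<star> (\<phi> s \<star> inv\<^bsub>U\<^esub> (\<phi> t)) = \<phi> a"
  by (rule left_fractionE[of "\<phi> s \<star> inv\<^bsub>U\<^esub> (\<phi> t)"]) (use s t in auto)
 have "\<phi> z \<star> (\<phi> s \<star> inv\<^bsub>U\<^esub> (\<phi> t)) \<star> \<phi> t = \<phi> (z \<cdot> s)"
  using z(1) s t by (simp add: \<phi>_mult U.m_assoc)
 then have "\<phi> (a \<cdot> t) = \<phi> (z \<cdot> s)" unfolding z(3) using z(2) t by (simp add: \<phi>_mult)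
 then have "z \<cdot> s = a \<cdot> t" using z(1,2) s t by (simp add: \<phi>_eq_iff)
 then show ?thesis using that[of z a] z den_mult[OF z(1) s] by simp
qed

lemma common_right_denominator:
 assumes c: "c \<in> carrier U" and u: "u \<in> carrier U"
 obtains s a b where "den s" "a \<in> carrier R" "b \<in> carrier R" "c \<star> \<phi> s = \<phi> a" "u \<star> \<phi> s = \<phi> b"
proof -
 obtain s a where s: "den s" "a \<in> carrier R" "c \<star> \<phi> s = \<phi> a" by (rule right_fractionE[OF c])
 obtain t b where t: "den t" "b \<in> carrier R" "u \<star> \<phi> t = \<phi> b" by (rule right_fractionE[OF u])
 obtain z d where z: "den z" "d \<in> carrier R" "(inv\<^bsub>U\<^esub> (\<phi> s) \<star> \<phi> t) \<star> \<phi> z = \<phi> d"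
  by (rule right_fractionE[of "inv\<^bsub>U\<^esub> (\<phi> s) \<star> \<phi> t"]) (use s t in auto)
 have "\<phi> s \<star> \<phi> d = \<phi> s \<star> inv\<^bsub>U\<^esub> (\<phi> s) \<star> (\<phi> t \<star> \<phi> z)"
  unfolding z(3)[symmetric] using s(1) t(1) z(1) by (simp only: U.m_assoc den_closed \<phi>_closed U.Units_inv_closed den_Units U.m_closed)
 then have e: "\<phi> t \<star> \<phi> z = \<phi> s \<star> \<phi> d" using s(1) t(1) z(1) by simp
 show ?thesis
 proof (rule that)
  show "den (t \<cdot> z)" by (rule den_mult[OF t(1) z(1)])
  show "a \<cdot> d \<in> carrier R" "b \<cdot> z \<in> carrier R" using s t z by auto
  have "c \<star> \<phi> (t \<cdot> z) = c \<star> (\<phi> s \<star> \<phi> d)" using t z by (simp add: \<phi>_mult e)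
  also have "\<dots> = c \<star> \<phi> s \<star> \<phi> d" by (rule U.m_assoc[symmetric]) (use c s z in auto)
  finally show "c \<star> \<phi> (t \<cdot> z) = \<phi> (a \<cdot> d)" using s z by (simp add: \<phi>_mult)
  have "u \<star> (\<phi> t \<star> \<phi> z) = u \<star> \<phi> t \<star> \<phi> z" by (rule U.m_assoc[symmetric]) (use u t z in auto)
  then show "u \<star> \<phi> (t \<cdot> z) = \<phi> (b \<cdot> z)" using t z by (simp add: \<phi>_mult)
 qed
qed

text \<open>A common right denominator reduces two elements of \<open>U\<close> to two of
  \<open>R\<close>, and left coefficients are unaffected by dividing on the right.\<close>

lemma Bezout_fractions:
 assumes c: "c \<in> carrier U" and u: "u \<in> carrier U"
 obtains d v1 v2 w1 w2 where "d \<in> carrier U" "v1 \<in> carrier R" "v2 \<in> carrier R" "w1 \<in> carrier R" "w2 \<in> carrier R"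
  "c = \<phi> v1 \<star> d" "u = \<phi> v2 \<star> d" "d = \<phi> w1 \<star> c \<oplus>\<^sub>U \<phi> w2 \<star> u"
proof -
 obtain s a b where s: "den s" "a \<in> carrier R" "b \<in> carrier R" "c \<star> \<phi> s = \<phi> a" "u \<star> \<phi> s = \<phi> b"
  by (rule common_right_denominator[OF c u])
 obtain d v1 v2 w1 w2 where d: "d \<in> carrier R" "v1 \<in> carrier R" "v2 \<in> carrier R" "w1 \<in> carrier R" "w2 \<in> carrier R"
  "a = v1 \<cdot> d" "b = v2 \<cdot> d" "d = w1 \<cdot> a \<oplus> w2 \<cdot> b" using Bezout[OF s(2,3)] by blast
 let ?i = "inv\<^bsub>U\<^esub> (\<phi> s)"
 have i: "?i \<in> carrier U" using s(1) by simp
 have solve: "x = \<phi> y \<star> ?i" if "x \<in> carrier U" "x \<star> \<phi> s = \<phi> y" for x y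
  unfolding that(2)[symmetric] using that(1) s(1) by (simp add: U.m_assoc)
 show ?thesis
 proof (rule that[of "\<phi> d \<star> ?i" v1 v2 w1 w2])
  show "c = \<phi> v1 \<star> (\<phi> d \<star> ?i)" using solve[OF c s(4)] d(1-5) i by (subst (asm) d(6)) (simp add: \<phi>_mult U.m_assoc)
  show "u = \<phi> v2 \<star> (\<phi> d \<star> ?i)" using solve[OF u s(5)] d(1-5) i by (subst (asm) d(7)) (simp add: \<phi>_mult U.m_assoc)
  have "\<phi> w1 \<star> c \<oplus>\<^sub>U \<phi> w2 \<star> u = \<phi> w1 \<star> (\<phi> a \<star> ?i) \<oplus>\<^sub>U \<phi> w2 \<star> (\<phi> b \<star> ?i)"
   using solve[OF c s(4)] solve[OF u s(5)] by simp
  also have "\<dots> = \<phi> (w1 \<cdot> a \<oplus> w2 \<cdot> b) \<star> ?i"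
   using d(1-5) s by (simp add: \<phi>_mult \<phi>_add U.m_assoc U.l_distr)
  finally show "\<phi> d \<star> ?i = \<phi> w1 \<star> c \<oplus>\<^sub>U \<phi> w2 \<star> u" using d(8) by simp
 qed (use d(1-5) i in auto)
qed

lemma RU_lm: "lmod R RU" by (rule RS_lm[OF R.ring_axioms hom U.Reg_lm])

text \<open>Finitely generated R-submodules of \<open>U\<close> are cyclic, by induction with
  \<open>Bezout_fractions\<close>; the last conclusion says that the generator lies in the submodule
  spanned by \<open>X\<close>.\<close>

lemma finite_cyclic:
 assumes "finite X" "X \<subseteq> carrier U"
 obtains c where "c \<in> carrier U" "\<And>x. x \<in> X ==> \<exists>r\<in>carrier R. x = \<phi> r \<star> c"
  "\<And>N. submodule N R RU ==> X \<subseteq> N ==> c \<in> N"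
proof -
 have "\<exists>c\<in>carrier U. (\<forall>x\<in>X. \<exists>r\<in>carrier R. x = \<phi> r \<star> c) \<and> (\<forall>N. submodule N R RU \<and> X \<subseteq> N \<longrightarrow> c \<in> N)"
  using assms
 proof (induction X)
  case empty
  show ?case using sub_zero[of _ R RU] by (intro bexI[of _ "\<zero>\<^sub>U"]) auto
 next
  case (insert u X)
  then obtain c where c: "c \<in> carrier U" "\<forall>x\<in>X. \<exists>r\<in>carrier R. x = \<phi> r \<star> c"
   "\<And>N. submodule N R RU ==> X \<subseteq> N ==> c \<in> N" by auto
  have u: "u \<in> carrier U" using insert by simp
  obtain d v1 v2 w1 w2 where d: "d \<in> carrier U" "v1 \<in> carrier R" "v2 \<in> carrier R" "w1 \<in> carrier R" "w2 \<in> carrier R"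
   "c = \<phi> v1 \<star> d" "u = \<phi> v2 \<star> d" "d = \<phi> w1 \<star> c \<oplus>\<^sub>U \<phi> w2 \<star> u"
   by (rule Bezout_fractions[OF c(1) u])
  show ?case
  proof (intro bexI[of _ d] conjI ballI allI impI)
   fix x assume "x \<in> insert u X"
   then consider "x = u" | r where "r \<in> carrier R" "x = \<phi> r \<star> c" using c(2) by auto
   then show "\<exists>r\<in>carrier R. x = \<phi> r \<star> d"
   proof cases
    case 2
    have "x = \<phi> (r \<cdot> v1) \<star> d" unfolding 2(2) using 2(1) d(1,2) by (subst d(6)) (simp add: \<phi>_mult U.m_assoc)
    then show ?thesis using 2(1) d(2) by blast
   qed (use d(3,7) in blast)
  next
   fix N assume N: "submodule N R RU \<and> insert u X \<subseteq> N"
   then have "c \<in> N" "u \<in> N" using c(3) by auto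
   then have "\<phi> w1 \<star> c \<oplus>\<^sub>U \<phi> w2 \<star> u \<in> N"
    using N sub_add[of N R RU] sub_smult[of N R RU] d(4,5) by simp
   then show "d \<in> N" using d(8) by simp
  qed (rule d(1))
 qed
 then show ?thesis using that by blast
qed

lemma polarE:
 assumes "a \<in> carrier R"
 obtains v w where "v \<in> carrier R" "w \<in> carrier R" "v \<cdot> w \<cdot> v = v" "w \<cdot> v \<cdot> w = w"
  "\<And>x. x \<in> carrier R ==> x \<cdot> a = \<zero> \<longleftrightarrow> x \<cdot> (v \<cdot> w) = \<zero>"
  "\<And>x. x \<in> carrier R ==> a \<cdot> x = \<zero> \<longleftrightarrow> w \<cdot> v \<cdot> x = \<zero>"
 using polar[OF assms] by metis

definition idem :: "'r => bool" where "idem e \<longleftrightarrow> e \<in> carrier R \<and> e \<cdot> e = e"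
text \<open>For an idempotent this is the principal left ideal \<open>R e\<close>, described by an
  equation so that membership can be tested by right multiplication.\<close>

definition lid :: "'r => 'r set" where "lid e = {x \<in> carrier R. x \<cdot> e = x}"

lemma idem_closed: "idem e ==> e \<in> carrier R" and idem_idem: "idem e ==> e \<cdot> e = e" by (simp_all add: idem_def)

lemma idem_complement: "idem e ==> idem (\<one> \<ominus> e)"
 by (auto simp: idem_def a_minus_def R.l_distr R.r_distr R.l_minus R.r_minus R.r_neg)

lemma idem_polar: 
 assumes "v \<in> carrier R" "w \<in> carrier R" "v \<cdot> w \<cdot> v = v" shows "idem (v \<cdot> w)" "idem (w \<cdot> v)"
proof -
 have "(v \<cdot> w) \<cdot> (v \<cdot> w) = (v \<cdot> w \<cdot> v) \<cdot> w" "(w \<cdot> v) \<cdot> (w \<cdot> v) = w \<cdot> (v \<cdot> w \<cdot> v)"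
  using assms(1,2) by (simp_all add: R.m_assoc)
 then show "idem (v \<cdot> w)" "idem (w \<cdot> v)" using assms by (simp_all add: idem_def)
qed

declare idem_closed [simp]

lemma lid_submodule: "e \<in> carrier R ==> left_ideal R (lid e)"
 by (rule left_module.submoduleI[OF R.Reg_lm]) (auto simp: lid_def R.l_distr R.m_assoc)

lemma lid_projective:
 assumes e: "idem e" shows "fgp R (restr (Reg R) (lid e))"
proof (rule fgp_retract[OF R.fgp_regular])
 show "lmod R (restr (Reg R) (lid e))" by (rule left_module.restr_lm[OF R.Reg_lm lid_submodule]) (use e in simp)
 show "(\<lambda>x. x) \<in> Hom R (restr (Reg R) (lid e)) (Reg R)" by (rule HomI) (auto simp: lid_def)
 show "(\<lambda>x. x \<cdot> e) \<in> Hom R (Reg R) (restr (Reg R) (lid e))"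
  by (rule HomI) (use e in \<open>auto simp: lid_def R.m_assoc idem_idem R.l_distr\<close>)
qed (simp add: lid_def)

end

context ring_extension
begin

section \<open>Finitely generated submodules of free modules over the ring of fractions\<close>

text \<open>For an R-submodule \<open>P\<close> this says that \<open>Q\<close> is contained in the
  U-submodule generated by \<open>P\<close>, denominators having been cleared.\<close>

definition covers :: "('s, 'v) module => 'v set => 'v set => bool" where
 "covers V P Q \<longleftrightarrow> (\<forall>x\<in>Q. \<exists>s. den s \<and> \<phi> s \<odot>\<^bsub>V\<^esub> x \<in> P)"

definition fg_submodule :: "('s, 'v) module => 'v set => bool" where
 "fg_submodule V P \<longleftrightarrow> submodule P R (RS \<phi> V) \<and> fin_gen R (restr (RS \<phi> V) P)"

text \<open>Up to isomorphism, a finitely generated R-submodule is determined by the U-submodule that it generates.\<close>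

definition span_rigid :: "('s, 'v) module => bool" where
 "span_rigid V \<longleftrightarrow> (\<forall>P Q. fg_submodule V P \<and> fg_submodule V Q \<and> covers V P Q \<and> covers V Q P \<longrightarrow>
  fgp R (restr (RS \<phi> V) P) \<and>
  Isom R (restr (RS \<phi> V) P) (restr (RS \<phi> V) Q))"

lemma span_rigidD:
 assumes "span_rigid V" "fg_submodule V P" "fg_submodule V Q" "covers V P Q" "covers V Q P" shows "fgp R (restr (RS \<phi> V) P)"
  and "Isom R (restr (RS \<phi> V) P) (restr (RS \<phi> V) Q)" using assms unfolding span_rigid_def by blast+

lemma rs_lm: "lmod U V ==> lmod R (RS \<phi> V)" by (rule RS_lm[OF R.ring_axioms hom])

lemma fg_submodule_image:
 assumes V: "lmod U V" and W: "lmod U W" and j: "j \<in> Hom U V W" and P: "fg_submodule V P" shows "fg_submodule W (j ` P)"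
proof -
 have j': "j \<in> Hom R (RS \<phi> V) (RS \<phi> W)" by (rule hom_RS[OF hom j])
 have sP: "submodule P R (RS \<phi> V)" and fgP: "fin_gen R (restr (RS \<phi> V) P)" using P by (auto simp: fg_submodule_def)
 have s: "submodule (j ` P) R (RS \<phi> W)" by (rule image_submodule[OF rs_lm[OF V] rs_lm[OF W] j' sP])
 have "fin_gen R (restr (RS \<phi> W) (j ` P))"
 proof (rule fg_image[OF _ _ _ _ fgP])
  show "lmod R (restr (RS \<phi> V) P)" "lmod R (restr (RS \<phi> W) (j ` P))" by (rule left_module.restr_lm[OF rs_lm] V W sP s)+
  show "j \<in> Hom R (restr (RS \<phi> V) P) (restr (RS \<phi> W) (j ` P))"
   by (rule Hom_into_restr[OF Hom_restr[OF j' sub_subset[OF sP]]]) simp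
 qed simp
 then show ?thesis using s by (simp add: fg_submodule_def)
qed

lemma span_rigid_pullback:
 assumes V: "lmod U V" and W: "lmod U W" and j: "j \<in> Hom U V W" and i: "inj_on j (carrier V)" and rigid: "span_rigid W"
 shows "span_rigid V" unfolding span_rigid_def
proof (intro allI impI, elim conjE)
 fix P Q assume P: "fg_submodule V P" and Q: "fg_submodule V Q" and PQ: "covers V P Q" "covers V Q P"
 have sub: "P' \<subseteq> carrier V" if "fg_submodule V P'" for P' using that sub_subset[of P' R "RS \<phi> V"] by (simp add: fg_submodule_def)
 have iso: "Isom R (restr (RS \<phi> V) P') (restr (RS \<phi> W) (j ` P'))" if "fg_submodule V P'" for P'
  using Isom_image[of j R "restr (RS \<phi> V) P'" "RS \<phi> W"]
   Hom_restr[OF hom_RS[OF hom j]] sub[OF that] inj_on_subset[OF i] by auto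
 have c: "covers W (j ` P') (j ` Q')" if cov: "covers V P' Q'" and Q': "fg_submodule V Q'" for P' Q' unfolding covers_def
 proof
  fix y assume "y \<in> j ` Q'"
  then obtain x where x: "x \<in> Q'" "y = j x" by auto
  then obtain s where "den s" "\<phi> s \<odot>\<^bsub>V\<^esub> x \<in> P'" using cov x(1) unfolding covers_def by blast
  then show "\<exists>s. den s \<and> \<phi> s \<odot>\<^bsub>W\<^esub> y \<in> j ` P'"
   using x sub[OF Q'] hom_smult[OF j, of "\<phi> s" x] by (metis U.Units_closed den_Units imageI subsetD)
 qed
 note r = span_rigidD[OF rigid fg_submodule_image[OF V W j P] fg_submodule_image[OF V W j Q] c[OF PQ(1) Q] c[OF PQ(2) P]]
 have l: "lmod R (restr (RS \<phi> V) P')" if "fg_submodule V P'" for P'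
  using that left_module.restr_lm[OF rs_lm[OF V]] by (auto simp: fg_submodule_def)
 have l': "lmod R (restr (RS \<phi> W) (j ` P))"
  using fg_submodule_image[OF V W j P] left_module.restr_lm[OF rs_lm[OF W]] by (auto simp: fg_submodule_def)
 show "fgp R (restr (RS \<phi> V) P) \<and>
  Isom R (restr (RS \<phi> V) P) (restr (RS \<phi> V) Q)" using fgp_isomorphic[OF r(1) l[OF P] Isom_sym[OF iso[OF P] l[OF P]]]
   Isom_trans[OF iso[OF P] Isom_trans[OF r(2) Isom_sym[OF iso[OF Q] l[OF Q]]]] by blast
qed

section \<open>Cyclic submodules and induction on the rank\<close>

definition cyc :: "'s => 's set" where "cyc c = {\<phi> r \<star> c | r. r \<in> carrier R}"

text \<open>As \<open>s\<close> is a denominator, \<open>c\<close> has the same left annihilator as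
  \<open>a\<close>, that of the idempotent \<open>v w\<close>. So \<open>R c\<close> is isomorphic
  to \<open>R v w\<close>, and through \<open>v\<close> and \<open>w\<close> to
  \<open>R w v\<close>. The last form is preferred because the right annihilator of \<open>a\<close>
  determines \<open>lid (w v)\<close>, and right annihilators can be compared for different
  generators.\<close>

lemma cyc_isomorphic:
 assumes c: "c \<in> carrier U" and s: "den s" and a: "a \<in> carrier R" "c \<star> \<phi> s = \<phi> a" and v: "v \<in> carrier R" and w: "w \<in> carrier R"
  and vwv: "v \<cdot> w \<cdot> v = v" and ann: "\<And>x. x \<in> carrier R ==> x \<cdot> a = \<zero> \<longleftrightarrow> x \<cdot> (v \<cdot> w) = \<zero>"
 shows "Isom R (restr (Reg R) (lid (w \<cdot> v))) (restr RU (cyc c))"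
proof -
 let ?N = "restr (Reg R) (lid (w \<cdot> v))" and ?f = "\<lambda>x. \<phi> (x \<cdot> w) \<star> c"
 interpret left_module R RU by (rule RU_lm)
 have lN: "lmod R ?N" by (rule left_module.restr_lm[OF R.Reg_lm lid_submodule]) (use v w in simp)
 have kill: "\<phi> r \<star> c = \<zero>\<^sub>U \<longleftrightarrow> r \<cdot> (v \<cdot> w) = \<zero>" if r: "r \<in> carrier R" for r
 proof -
  have "\<phi> r \<star> c = \<zero>\<^sub>U \<longleftrightarrow> \<phi> r \<star> c \<star> \<phi> s = \<zero>\<^sub>U"
   using den_cancel_right[OF s, of "\<phi> r \<star> c"] r c s by auto
  also have "\<phi> r \<star> c \<star> \<phi> s = \<phi> (r \<cdot> a)" using r a s c by (simp add: U.m_assoc \<phi>_mult)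
  finally show ?thesis using r a ann by (simp add: \<phi>_eq_zero_iff)
 qed
 have f: "?f \<in> Hom R ?N RU" using w c by (intro HomI) (auto simp: lid_def \<phi>_add \<phi>_mult U.l_distr U.m_assoc)
 have "inj_on ?f (carrier ?N)"
 proof (rule hom_inj_on[OF lN left_module_axioms f])
  fix x assume "x \<in> carrier ?N" "?f x = \<zero>\<^bsub>RU\<^esub>"
  then have x: "x \<in> carrier R" "x \<cdot> (w \<cdot> v) = x" "x \<cdot> w \<cdot> (v \<cdot> w) = \<zero>" using kill[of "x \<cdot> w"] w by (auto simp: lid_def)
  have "x \<cdot> (w \<cdot> v) \<cdot> (w \<cdot> v) = x \<cdot> w \<cdot> (v \<cdot> w) \<cdot> v" using x(1) v w by (simp add: R.m_assoc)
  then show "x = \<zero>\<^bsub>?N\<^esub>" using x v by simp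
 qed
 moreover have "?f ` carrier ?N = cyc c"
 proof (intro equalityI subsetI)
  fix y assume "y \<in> cyc c"
  then obtain r where r: "r \<in> carrier R" "y = \<phi> r \<star> c" by (auto simp: cyc_def)
  have rv: "r \<cdot> v \<in> carrier ?N" using r v w vwv by (simp add: lid_def R.m_assoc)
  have "r \<cdot> (v \<cdot> w \<cdot> v \<cdot> w) = r \<cdot> (v \<cdot> w)" by (simp only: vwv)
  then have "(r \<ominus> r \<cdot> v \<cdot> w) \<cdot> (v \<cdot> w) = \<zero>"
   using r v w by (simp add: a_minus_def R.l_distr R.l_minus R.m_assoc R.r_neg)
  then have "\<phi> (r \<ominus> r \<cdot> v \<cdot> w) \<star> c = \<zero>\<^sub>U" using kill r v w by simp
  moreover have "\<phi> (r \<ominus> r \<cdot> v \<cdot> w) \<star> c \<oplus>\<^sub>U ?f (r \<cdot> v) = y"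
   using r v w c by (simp add: U.l_distr[symmetric] \<phi>_add[symmetric] a_minus_def R.a_assoc R.l_neg)
  ultimately show "y \<in> ?f ` carrier ?N" using r v w c by (intro image_eqI[OF _ rv]) simp
 qed (use w in \<open>auto simp: cyc_def lid_def\<close>)
 ultimately show ?thesis using Isom_image[OF f] by simp
qed

lemma cyc_submodule: "c \<in> carrier U ==> submodule (cyc c) R RU"
proof (rule left_module.submoduleI[OF RU_lm])
 assume c: "c \<in> carrier U"
 then show "cyc c \<subseteq> carrier RU" "\<zero>\<^bsub>RU\<^esub> \<in> cyc c" by (auto simp: cyc_def intro!: exI[of _ "\<zero>"])
 show "x \<oplus>\<^bsub>RU\<^esub> y \<in> cyc c" if "x \<in> cyc c" "y \<in> cyc c" for x y
  using that c by (auto simp: cyc_def \<phi>_add[symmetric] U.l_distr[symmetric])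
 show "r \<odot>\<^bsub>RU\<^esub> x \<in> cyc c" if "r \<in> carrier R" "x \<in> cyc c" for r x
  using that c by (auto simp: cyc_def \<phi>_mult[symmetric] U.m_assoc[symmetric])
qed

text \<open>The image in the last coordinate is finitely generated, hence cyclic, hence projective
  by \<open>cyc_isomorphic\<close>. So the projection splits, and its kernel is finitely generated
  as a quotient of \<open>P\<close>.\<close>

lemma split_last_coordinate:
 assumes V: "lmod U V" and P: "fg_submodule (DSum V (Reg U)) P"
 defines "K \<equiv> {x \<in> carrier V. (x, \<zero>\<^sub>U) \<in> P}"
 obtains c where "c \<in> carrier U" "snd ` P = cyc c" "fg_submodule V K" "Isom R (restr (RS \<phi> (DSum V (Reg U))) P)
   (DSum (restr (RS \<phi> V) K) (restr RU (cyc c)))"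
proof -
 let ?D = "RS \<phi> (DSum V (Reg U))"
 let ?P = "restr ?D P" and ?K = "restr (RS \<phi> V) K"
 note lD = rs_lm[OF DSum_lm[OF V U.Reg_lm]] and lV = rs_lm[OF V]
 have sP: "submodule P R ?D" and fgP: "fin_gen R ?P" using P by (auto simp: fg_submodule_def)
 note lP = left_module.restr_lm[OF lD sP]
 have inl: "(\<lambda>x. (x, \<zero>\<^sub>U)) \<in> Hom R (RS \<phi> V) ?D" using hom_RS[OF hom DSum_hom_inl[OF U.Reg_lm, of V]] by simp
 have sK: "submodule K R (RS \<phi> V)" using vimage_submodule[OF lV lD inl sP] by (simp add: K_def)
 note lK = left_module.restr_lm[OF lV sK]
 have hs: "snd \<in> Hom R ?P RU" using Hom_restr[OF hom_RS[OF hom DSum_hom_snd] sub_subset[OF sP]] .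
 obtain X where X: "finite X" "X \<subseteq> P" "\<And>N. submodule N R ?P ==> X \<subseteq> N ==> N = P" by (rule fgE[OF fgP]) (use that in auto)
 have XU: "snd ` X \<subseteq> carrier U" using X(2) sub_subset[OF sP] by auto
 obtain c where c: "c \<in> carrier U" "\<And>x. x \<in> snd ` X ==> \<exists>r\<in>carrier R. x = \<phi> r \<star> c"
  "\<And>N. submodule N R RU ==> snd ` X \<subseteq> N ==> c \<in> N" by (rule finite_cyclic[of "snd ` X"]) (use X(1) XU in auto)
 have "{y \<in> carrier ?P. snd y \<in> cyc c} = P"
  by (rule X(3)[OF vimage_submodule[OF lP RU_lm hs cyc_submodule[OF c(1)]]]) (use X(2) c(2) in \<open>force simp: cyc_def\<close>)
 moreover have sI: "submodule (snd ` P) R RU" using image_submodule[OF lP RU_lm hs left_module.sub_carrier[OF lP]] by simp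
 then have "c \<in> snd ` P" by (rule c(3)) (use X(2) in auto)
 then have "cyc c \<subseteq> snd ` P" using sub_smult[OF sI, of _ c] by (auto simp: cyc_def)
 ultimately have img: "snd ` P = cyc c" by blast
 note lC = left_module.restr_lm[OF RU_lm cyc_submodule[OF c(1)]]
 obtain s a where s: "den s" "a \<in> carrier R" "c \<star> \<phi> s = \<phi> a" by (rule right_fractionE[OF c(1)])
 obtain v w where v: "v \<in> carrier R" "w \<in> carrier R" "v \<cdot> w \<cdot> v = v"
  and ann: "\<And>x. x \<in> carrier R ==> x \<cdot> a = \<zero> \<longleftrightarrow> x \<cdot> (v \<cdot> w) = \<zero>"
  by (rule polarE[OF s(2)]) (rule that)
 have pC: "fgp R (restr RU (cyc c))" by (rule fgp_isomorphic[OF lid_projective[OF idem_polar(2)[OF v]] lC cyc_isomorphic[OF c(1) s v ann]])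
 have hC: "snd \<in> Hom R ?P (restr RU (cyc c))" by (rule Hom_into_restr[OF hs]) (simp add: img)
 let ?Z = "restr ?P {y \<in> carrier ?P. snd y = \<zero>\<^bsub>restr RU (cyc c)\<^esub>}"
 have split: "Isom R ?P (DSum ?Z (restr RU (cyc c)))" by (rule R.fgp_split[OF lP fgP pC hC]) (simp add: img)
 have "Isom R ?Z ?K"
 proof (rule IsomI[where f=fst and g="\<lambda>x. (x, \<zero>\<^sub>U)"])
  show "fst \<in> Hom R ?Z ?K" using sub_subset[OF sP] by (intro HomI) (auto simp: K_def)
  show "(\<lambda>x. (x, \<zero>\<^sub>U)) \<in> Hom R ?K ?Z" by (intro HomI) (auto simp: K_def)
 qed auto
 then have iso: "Isom R ?P (DSum ?K (restr RU (cyc c)))" by (intro Isom_trans[OF split] DSum_isomorphic lC Isom_refl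
    left_module.restr_lm[OF lP hom_kernel_submodule[OF lP lC hC]])
 obtain \<alpha> \<beta> where \<alpha>: "\<alpha> \<in> Hom R ?P (DSum ?K (restr RU (cyc c)))" "\<beta> \<in> Hom R (DSum ?K (restr RU (cyc c))) ?P"
  "\<And>y. y \<in> carrier (DSum ?K (restr RU (cyc c))) ==> \<alpha> (\<beta> y) = y" by (rule IsomE[OF iso lP]) (rule that)
 note h = Hom_comp[OF \<alpha>(1) DSum_hom_fst]
 have "x \<in> (\<lambda>x. fst (\<alpha> x)) ` carrier ?P" if "x \<in> carrier ?K" for x
 proof -
  have z: "(x, \<zero>\<^sub>U) \<in> carrier (DSum ?K (restr RU (cyc c)))" using that sub_zero[OF cyc_submodule[OF c(1)]] by simp
  show ?thesis using \<alpha>(3)[OF z] hom_closed[OF \<alpha>(2) z] by (intro image_eqI[of _ _ "\<beta> (x, \<zero>\<^sub>U)"]) auto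
 qed
 then have "(\<lambda>x. fst (\<alpha> x)) ` carrier ?P = carrier ?K" using hom_closed[OF h] by blast
 then have "fg_submodule V K" using fg_image[OF lP lK h _ fgP] sK by (simp add: fg_submodule_def)
 then show ?thesis by (rule that[OF c(1) img _ iso])
qed

text \<open>The kernels of the last projection again cover each other, which is the hypothesis on
  \<open>V\<close>. The cyclic images generate the same U-submodule of \<open>U\<close>, so with a
  common right denominator their numerators \<open>a\<close> and \<open>b\<close> have equal right
  annihilators, and the corresponding idempotents generate the same left ideal.\<close>

lemma span_rigid_DSum:
 assumes V: "lmod U V" and rigid: "span_rigid V" shows "span_rigid (DSum V (Reg U))" unfolding span_rigid_def
proof (intro allI impI, elim conjE)
 interpret V: left_module U V by (rule V)
 let ?D = "DSum V (Reg U)"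
 fix P Q assume P: "fg_submodule ?D P" and Q: "fg_submodule ?D Q" and PQ: "covers ?D P Q" "covers ?D Q P"
 let ?K = "\<lambda>P. {x \<in> carrier V. (x, \<zero>\<^sub>U) \<in> P}"
 obtain c where c: "c \<in> carrier U" "snd ` P = cyc c" and KP: "fg_submodule V (?K P)"
  and iP: "Isom R (restr (RS \<phi> ?D) P) (DSum (restr (RS \<phi> V) (?K P)) (restr RU (cyc c)))" by (rule split_last_coordinate[OF V P])
 obtain d where d: "d \<in> carrier U" "snd ` Q = cyc d" and KQ: "fg_submodule V (?K Q)"
  and iQ: "Isom R (restr (RS \<phi> ?D) Q) (DSum (restr (RS \<phi> V) (?K Q)) (restr RU (cyc d)))" by (rule split_last_coordinate[OF V Q])
 obtain s a b where s: "den s" "a \<in> carrier R" "b \<in> carrier R" "c \<star> \<phi> s = \<phi> a" "d \<star> \<phi> s = \<phi> b"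
  by (rule common_right_denominator[OF c(1) d(1)])
 \<comment> \<open>Some denominator \<open>t\<close> brings \<open>c\<close> into the other module,
   \<open>t c = r d\<close>; multiplying by \<open>s\<close> and then \<open>x\<close> gives
   \<open>t a x = r b x = 0\<close>, and \<open>t\<close> cancels. The variables are generalized so
   that the claim can be used in both directions.\<close>
 have ann: "a \<cdot> x = \<zero>" if PQ: "covers ?D Q P" "snd ` P = cyc c" "snd ` Q = cyc d"
   and m: "c \<in> carrier U" "d \<in> carrier U" "a \<in> carrier R" "b \<in> carrier R" "c \<star> \<phi> s = \<phi> a" "d \<star> \<phi> s = \<phi> b"
   and x: "x \<in> carrier R" "b \<cdot> x = \<zero>" for P Q c d a b x
 proof -
  have "\<phi> \<one> \<star> c \<in> snd ` P" unfolding PQ(2) cyc_def by blast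
  then obtain y where y: "y \<in> P" "snd y = c" using m(1) by auto
  then obtain t where t: "den t" "\<phi> t \<odot>\<^bsub>?D\<^esub> y \<in> Q" using PQ(1) unfolding covers_def by blast
  then have "\<phi> t \<star> c \<in> snd ` Q" using y by (cases y) force
  then obtain r where r: "r \<in> carrier R" "\<phi> t \<star> c = \<phi> r \<star> d" unfolding PQ(3) by (auto simp: cyc_def)
  have "\<phi> t \<star> \<phi> (a \<cdot> x) = \<phi> t \<star> c \<star> \<phi> s \<star> \<phi> x" using t(1) m x s(1) by (simp add: \<phi>_mult U.m_assoc)
  also have "\<dots> = \<phi> r \<star> \<phi> (b \<cdot> x)" unfolding r(2) using r(1) m x(1) s(1) by (simp add: \<phi>_mult U.m_assoc)
  also have "\<dots> = \<zero>\<^sub>U" using r x by simp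
  finally have "\<phi> (a \<cdot> x) = \<zero>\<^sub>U" using den_zero_left[OF t(1)] m x by simp
  then show ?thesis using m x by (simp add: \<phi>_eq_zero_iff)
 qed
 obtain v w where v: "v \<in> carrier R" "w \<in> carrier R" "v \<cdot> w \<cdot> v = v"
  and a1: "\<And>x. x \<in> carrier R ==> x \<cdot> a = \<zero> \<longleftrightarrow> x \<cdot> (v \<cdot> w) = \<zero>"
  and a2: "\<And>x. x \<in> carrier R ==> a \<cdot> x = \<zero> \<longleftrightarrow> w \<cdot> v \<cdot> x = \<zero>"
  by (rule polarE[OF s(2)]) (rule that)
 obtain v' w' where v': "v' \<in> carrier R" "w' \<in> carrier R" "v' \<cdot> w' \<cdot> v' = v'"
  and b1: "\<And>x. x \<in> carrier R ==> x \<cdot> b = \<zero> \<longleftrightarrow> x \<cdot> (v' \<cdot> w') = \<zero>"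
  and b2: "\<And>x. x \<in> carrier R ==> b \<cdot> x = \<zero> \<longleftrightarrow> w' \<cdot> v' \<cdot> x = \<zero>"
  by (rule polarE[OF s(3)]) (rule that)
 have p: "idem (w \<cdot> v)" "idem (w' \<cdot> v')" using idem_polar(2) v v' by auto
 \<comment> \<open>If \<open>p\<close> kills whatever \<open>q\<close> kills on the right, it kills
   \<open>1 - q\<close>; thus \<open>p = p q\<close>.\<close>
 have absorb: "lid p \<subseteq> lid q" if pq: "idem p" "idem q" "\<And>x. x \<in> carrier R ==> q \<cdot> x = \<zero> ==> p \<cdot> x = \<zero>" for p q
 proof
  fix x assume x: "x \<in> lid p"
  have "q \<cdot> (\<one> \<ominus> q) = \<zero>" using pq(2) by (simp add: a_minus_def R.r_distr R.r_minus idem_idem R.r_neg)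
  then have "p \<cdot> (\<one> \<ominus> q) = \<zero>" using pq by simp
  then have "p \<oplus> \<ominus> (p \<cdot> q) = \<zero>" using pq by (simp add: a_minus_def R.r_distr R.r_minus)
  then have "p = p \<cdot> q" using pq R.minus_equality[of p "\<ominus> (p \<cdot> q)"] by simp
  moreover have "x \<cdot> p \<cdot> q = x \<cdot> (p \<cdot> q)" by (rule R.m_assoc) (use x pq in \<open>auto simp: lid_def\<close>)
  ultimately show "x \<in> lid q" using x by (simp add: lid_def)
 qed
 have lid: "lid (w \<cdot> v) = lid (w' \<cdot> v')"
 proof (rule equalityI; rule absorb)
  show "w \<cdot> v \<cdot> x = \<zero>" if "x \<in> carrier R" "w' \<cdot> v' \<cdot> x = \<zero>" for x
   using ann[OF PQ(2) c(2) d(2) c(1) d(1) s(2,3,4,5)] that a2 b2 by simp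
  show "w' \<cdot> v' \<cdot> x = \<zero>" if "x \<in> carrier R" "w \<cdot> v \<cdot> x = \<zero>" for x
   using ann[OF PQ(1) d(2) c(2) d(1) c(1) s(3,2,5,4)] that a2 b2 by simp
 qed (use p in auto)
 have cov: "covers V (?K P) (?K Q)" if "covers ?D P Q" for P Q unfolding covers_def
 proof
  fix x assume x: "x \<in> ?K Q"
  then obtain s where s: "den s" "\<phi> s \<odot>\<^bsub>?D\<^esub> (x, \<zero>\<^sub>U) \<in> P" using \<open>covers ?D P Q\<close> unfolding covers_def by blast
  then show "\<exists>s. den s \<and> \<phi> s \<odot>\<^bsub>V\<^esub> x \<in> ?K P" using x by (intro exI[of _ s]) (simp add: V.smult_closed)
 qed
 note rK = span_rigidD[OF rigid KP KQ cov[OF PQ(1)] cov[OF PQ(2)]]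
 have l: "lmod R (restr (RS \<phi> W) P')" if "fg_submodule W P'" "lmod U W" for P' and W :: "('s, 'v) module"
  using that left_module.restr_lm[OF rs_lm[OF that(2)]] by (auto simp: fg_submodule_def)
 have lD: "lmod U ?D" by (rule DSum_lm[OF V U.Reg_lm])
 note pN = lid_projective[OF p(1)] and cP = cyc_isomorphic[OF c(1) s(1,2,4) v a1] and cQ = cyc_isomorphic[OF d(1) s(1,3,5) v' b1, folded lid]
 note lN = fgp_lm[OF pN] and lC = left_module.restr_lm[OF RU_lm cyc_submodule[OF c(1)]]
 have "fgp R (restr (RS \<phi> ?D) P)" by (rule fgp_isomorphic[OF fgp_DSum[OF rK(1) fgp_isomorphic[OF pN lC cP]]
    l[OF P lD] Isom_sym[OF iP l[OF P lD]]])
 moreover have "Isom R (restr (RS \<phi> ?D) P) (restr (RS \<phi> ?D) Q)" by (rule Isom_trans[OF iP Isom_trans[OF DSum_isomorphic[OF l[OF KP V] rK(2)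
   lC Isom_trans[OF Isom_sym[OF cP lN] cQ]] Isom_sym[OF iQ l[OF Q lD]]]])
 ultimately show "fgp R (restr (RS \<phi> ?D) P) \<and>
  Isom R (restr (RS \<phi> ?D) P) (restr (RS \<phi> ?D) Q)" by blast
qed

lemma span_rigid_free: "span_rigid (Free U n)"
proof (induction n)
 case 0
 show ?case unfolding span_rigid_def
 proof (intro allI impI, elim conjE)
  fix P Q :: "(nat => 's) set"
  have eq: "P' = {\<zero>\<^bsub>Free U 0\<^esub>}" if "fg_submodule (Free U 0) P'" for P' using that sub_subset[of P' R "RS \<phi> (Free U 0)"]
    sub_zero[of P' R "RS \<phi> (Free U 0)"] U.Free_0 by (auto simp: fg_submodule_def)
  assume P: "fg_submodule (Free U 0) P" and Q: "fg_submodule (Free U 0) Q"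
  have "lmod R (restr (RS \<phi> (Free U 0)) P)" using P left_module.restr_lm[OF rs_lm[OF U.free_lm]] by (auto simp: fg_submodule_def)
  then have "fgp R (restr (RS \<phi> (Free U 0)) P)" by (rule fgp_trivial) (simp add: eq[OF P] del: Free_simps)
  then show "fgp R (restr (RS \<phi> (Free U 0)) P) \<and>
   Isom R (restr (RS \<phi> (Free U 0)) P) (restr (RS \<phi> (Free U 0)) Q)" using Isom_refl unfolding eq[OF P] eq[OF Q] by blast
 qed
next
 case (Suc n)
 obtain \<alpha> \<beta> where \<alpha>: "\<alpha> \<in> Hom U (Free U (Suc n)) (DSum (Free U n) (Reg U))"
  "\<And>x. x \<in> carrier (Free U (Suc n)) ==> \<beta> (\<alpha> x) = x" by (rule IsomE[OF U.Free_Suc U.free_lm]) (rule that)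
 show ?case by (rule span_rigid_pullback[OF U.free_lm DSum_lm[OF U.free_lm U.Reg_lm] \<alpha>(1)
     inj_on_inverseI[of _ \<beta>] span_rigid_DSum[OF U.free_lm Suc]]) (rule \<alpha>(2))
qed

end

section \<open>Base change to the ring of fractions\<close>

lemma RS_minus [simp]:
 "\<ominus>\<^bsub>RS \<phi> M\<^esub> x = \<ominus>\<^bsub>M\<^esub> x" "x \<ominus>\<^bsub>RS \<phi> M\<^esub> y = x \<ominus>\<^bsub>M\<^esub> y"
 by (simp_all add: a_minus_def a_inv_def m_inv_def)

lemma (in mod_ext) tens_one_hom: "tens \<one>\<^sub>U \<in> Hom R M (RS \<phi> T)"
 by (rule HomI) (simp_all add: tens_add_right tens_smult tens_balanced[symmetric])

context scalar_extension
begin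

lemma mod_ext: "lmod R M ==> mod_ext R U \<phi> M" by (intro mod_ext.intro scalar_extension_axioms)

lemma BC_hom_eq:
 assumes M: "lmod R M" and V: "lmod U V" and F: "F \<in> Hom U (BC R U \<phi> M) V" and G: "G \<in> Hom U (BC R U \<phi> M) V"
  and eq: "\<And>s x. s \<in> carrier U ==> x \<in> carrier M ==>
   F (mod_ext.tens R U \<phi> M s x) = G (mod_ext.tens R U \<phi> M s x)" and X: "X \<in> carrier (BC R U \<phi> M)"
 shows "F X = G X"
proof -
 interpret M: mod_ext R U \<phi> M by (rule mod_ext[OF M])
 note l = M.BC_lm
 from X show ?thesis by (induction rule: M.BC_induct) (simp_all add: eq hom_zero[OF l V F] hom_zero[OF l V G] hom_diff[OF l V F] hom_diff[OF l V G])
qed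

text \<open>The last conclusion is conditional so that the same lemma handles retractions, which
  know only one composite, and isomorphisms.\<close>

lemma BC_functor:
 assumes M: "lmod R M" and N: "lmod R N" and f: "f \<in> Hom R M N" and g: "g \<in> Hom R N M"
  and gf: "\<And>x. x \<in> carrier M ==> g (f x) = x"
 obtains F G where "F \<in> Hom U (BC R U \<phi> M) (BC R U \<phi> N)" "G \<in> Hom U (BC R U \<phi> N) (BC R U \<phi> M)"
  "\<And>X. X \<in> carrier (BC R U \<phi> M) ==> G (F X) = X"
  "(\<And>y. y \<in> carrier N ==> f (g y) = y) ==> (\<And>Y. Y \<in> carrier (BC R U \<phi> N) ==> F (G Y) = Y)"
proof -
 interpret M: mod_ext R U \<phi> M by (rule mod_ext[OF M])
 interpret N: mod_ext R U \<phi> N by (rule mod_ext[OF N])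
 note lM = M.BC_lm and lN = N.BC_lm
 note j1 = M.tens_one_hom and j2 = N.tens_one_hom
 note h1 = Hom_comp[OF f j2] and h2 = Hom_comp[OF g j1]
 let ?F = "M.tensor_lift N.T (\<lambda>x. N.tens \<one>\<^sub>U (f x))" and ?G = "N.tensor_lift M.T (\<lambda>x. M.tens \<one>\<^sub>U (g x))"
 note F = M.tensor_lift_hom[OF lN h1] and G = N.tensor_lift_hom[OF lM h2]
 have Ft: "?F (M.tens s x) = N.tens s (f x)" if "s \<in> carrier U" "x \<in> carrier M" for s x
  using that by (simp add: M.tensor_lift_tens[OF lN h1] N.tens_smult)
 have Gt: "?G (N.tens s x) = M.tens s (g x)" if "s \<in> carrier U" "x \<in> carrier N" for s x
  using that by (simp add: N.tensor_lift_tens[OF lM h2] M.tens_smult)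
 show ?thesis
 proof (rule that[OF F G])
  show "?G (?F X) = X" if "X \<in> carrier M.T" for X by (rule BC_hom_eq[OF M lM Hom_comp[OF F G] Hom_id _ that])
    (simp add: Ft Gt gf hom_closed[OF f])
  show "?F (?G Y) = Y" if "\<And>y. y \<in> carrier N ==> f (g y) = y" "Y \<in> carrier N.T" for Y
   by (rule BC_hom_eq[OF N lN Hom_comp[OF G F] Hom_id _ that(2)]) (simp add: Ft Gt that(1) hom_closed[OF g])
 qed
qed

lemma BC_isomorphic:
 assumes M: "lmod R M" and N: "lmod R N" and iso: "Isom R M N" shows "Isom U (BC R U \<phi> M) (BC R U \<phi> N)"
proof -
 obtain f g where fg: "f \<in> Hom R M N" "g \<in> Hom R N M"
  "\<And>x. x \<in> carrier M ==> g (f x) = x" "\<And>y. y \<in> carrier N ==> f (g y) = y" by (rule IsomE[OF iso M]) (rule that)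
 show ?thesis
 proof (rule BC_functor[where f=f and g=g, OF M N fg(1,2)])
  fix F G assume "F \<in> Hom U (BC R U \<phi> M) (BC R U \<phi> N)" "G \<in> Hom U (BC R U \<phi> N) (BC R U \<phi> M)"
   "\<And>X. X \<in> carrier (BC R U \<phi> M) ==> G (F X) = X"
   "(\<And>y. y \<in> carrier N ==> f (g y) = y) ==> (\<And>Y. Y \<in> carrier (BC R U \<phi> N) ==> F (G Y) = Y)"
  then show ?thesis using fg(4) by (intro IsomI) blast+
 qed (rule fg(3))
qed

lemma tensor_to_ring_lift:
 assumes I: "mod_ext R U \<phi> (restr (Reg R) I)" shows "tensor_to_ring U \<phi> = mod_ext.tensor_lift (Reg U) \<phi>"
proof -
 interpret mod_ext R U \<phi> "restr (Reg R) I" by (rule I)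
 show ?thesis by (intro ext) (simp add: tensor_to_ring_def tensor_lift_def free_sum_Reg free_sum_def case_prod_beta')
qed

end

context ring_extension
begin

text \<open>For a pure tensor a left denominator of the scalar moves its numerator to the right
  factor; two tensors are combined over a common left multiple of their denominators.\<close>

lemma clear_denominator:
 assumes M: "lmod R M" and X: "X \<in> carrier (BC R U \<phi> M)"
 obtains s x where "den s" "x \<in> carrier M" "\<phi> s \<odot>\<^bsub>BC R U \<phi> M\<^esub> X = mod_ext.tens R U \<phi> M \<one>\<^sub>U x"
proof -
 interpret M: mod_ext R U \<phi> M by (rule mod_ext[OF M])
 note j = M.tens_one_hom
 from X have "\<exists>s x. den s \<and> x \<in> carrier M \<and> \<phi> s \<odot>\<^bsub>M.T\<^esub> X = M.tens \<one>\<^sub>U x"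
 proof (induction rule: M.BC_induct)
  case zero
  have "M.tens \<one>\<^sub>U \<zero>\<^bsub>M\<^esub> = \<zero>\<^bsub>M.T\<^esub>" using hom_zero[OF M rs_lm[OF M.BC_lm] j] by simp
  then show ?case by (intro exI[of _ "\<one>"] exI[of _ "\<zero>\<^bsub>M\<^esub>"]) (simp add: den_one M.T.smult_zero_right)
 next
  case (tens u x)
  obtain s a where "den s" "a \<in> carrier R" "\<phi> s \<star> u = \<phi> a" by (rule left_fractionE[OF tens(1)])
  then show ?case using M.tens_balanced[of "\<one>\<^sub>U" a x] tens
   by (intro exI[of _ s] exI[of _ "a \<odot>\<^bsub>M\<^esub> x"]) (simp add: M.tens_smult M.M.smult_closed)
 next
  case (diff X Y)
  obtain s x where s: "den s" "x \<in> carrier M" "\<phi> s \<odot>\<^bsub>M.T\<^esub> X = M.tens \<one>\<^sub>U x" using diff by blast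
  obtain t y where t: "den t" "y \<in> carrier M" "\<phi> t \<odot>\<^bsub>M.T\<^esub> Y = M.tens \<one>\<^sub>U y" using diff by blast
  obtain s' t' where z: "s' \<in> carrier R" "t' \<in> carrier R" "s' \<cdot> s = t' \<cdot> t" "den (s' \<cdot> s)"
   by (rule common_left_multiple[OF s(1) t(1)])
  have X: "\<phi> (s' \<cdot> s) \<odot>\<^bsub>M.T\<^esub> X = M.tens \<one>\<^sub>U (s' \<odot>\<^bsub>M\<^esub> x)"
   using z(1) s diff(1) hom_smult[OF j z(1) s(2)] by (simp add: \<phi>_mult M.T.smult_assoc)
  have Y: "\<phi> (s' \<cdot> s) \<odot>\<^bsub>M.T\<^esub> Y = M.tens \<one>\<^sub>U (t' \<odot>\<^bsub>M\<^esub> y)"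
   unfolding z(3) using z(2) t diff(2) hom_smult[OF j z(2) t(2)] by (simp add: \<phi>_mult M.T.smult_assoc)
  have c: "s' \<odot>\<^bsub>M\<^esub> x \<in> carrier M" "t' \<odot>\<^bsub>M\<^esub> y \<in> carrier M" using z s t by (simp_all add: M.M.smult_closed)
  have "\<phi> (s' \<cdot> s) \<odot>\<^bsub>M.T\<^esub> (X \<ominus>\<^bsub>M.T\<^esub> Y) = M.tens \<one>\<^sub>U (s' \<odot>\<^bsub>M\<^esub> x \<ominus>\<^bsub>M\<^esub> t' \<odot>\<^bsub>M\<^esub> y)"
   using z(4) diff(1,2) hom_diff[OF M rs_lm[OF M.BC_lm] j c] by (simp add: M.T.smult_diff X Y)
  then show ?case using z(4) c by (intro exI[of _ "s' \<cdot> s"] exI[of _ "s' \<odot>\<^bsub>M\<^esub> x \<ominus>\<^bsub>M\<^esub> t' \<odot>\<^bsub>M\<^esub> y"]) simp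
 qed
 then show ?thesis using that by blast
qed

text \<open>Every tensor has the form \<open>s\<^sup>-\<^sup>1 \<otimes> x\<close>, so base change along an Ore localization needs no flatness argument.\<close>

lemma
 assumes M: "lmod R M" and V: "lmod U V" and j: "j \<in> Hom R M (RS \<phi> V)" and inj_j: "inj_on j (carrier M)"
 shows tensor_lift_inj: "inj_on (mod_ext.tensor_lift V j) (carrier (BC R U \<phi> M))"
  and tensor_lift_image: "mod_ext.tensor_lift V j ` carrier (BC R U \<phi> M) =
   {v \<in> carrier V. \<exists>s. den s \<and> \<phi> s \<odot>\<^bsub>V\<^esub> v \<in> j ` carrier M}"
proof -
 interpret M: mod_ext R U \<phi> M by (rule mod_ext[OF M])
 interpret V: left_module U V by (rule V)
 note lT = M.BC_lm
 note J = M.tensor_lift_hom[OF V j]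
 have Jt: "M.tensor_lift V j (M.tens \<one>\<^sub>U x) = j x" if "x \<in> carrier M" for x
  using that hom_closed[OF j that] by (simp add: M.tensor_lift_tens[OF V j] V.smult_one)
 show "inj_on (M.tensor_lift V j) (carrier M.T)"
 proof (rule hom_inj_on[OF lT V J])
  fix X assume X: "X \<in> carrier M.T" "M.tensor_lift V j X = \<zero>\<^bsub>V\<^esub>"
  obtain s x where s: "den s" "x \<in> carrier M" "\<phi> s \<odot>\<^bsub>M.T\<^esub> X = M.tens \<one>\<^sub>U x" by (rule clear_denominator[OF M X(1)])
  have "j x = M.tensor_lift V j (\<phi> s \<odot>\<^bsub>M.T\<^esub> X)" using s by (simp add: Jt)
  also have "\<dots> = \<zero>\<^bsub>V\<^esub>" using s X hom_smult[OF J, of "\<phi> s" X] by (simp add: V.smult_zero_right)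
  also have "\<dots> = j \<zero>\<^bsub>M\<^esub>" using hom_zero[OF M rs_lm[OF V] j] by simp
  finally have "x = \<zero>\<^bsub>M\<^esub>" using inj_j s(2) by (auto dest: inj_onD)
  then have "\<phi> s \<odot>\<^bsub>M.T\<^esub> X = \<zero>\<^bsub>M.T\<^esub>" using s(3) hom_zero[OF M rs_lm[OF lT] M.tens_one_hom] by simp
  then show "X = \<zero>\<^bsub>M.T\<^esub>"
   using M.T.smult_Units_cancel[of "\<phi> s" X "\<zero>\<^bsub>M.T\<^esub>"] s(1) X(1) by (simp add: M.T.smult_zero_right)
 qed
 show "M.tensor_lift V j ` carrier M.T = {v \<in> carrier V. \<exists>s. den s \<and> \<phi> s \<odot>\<^bsub>V\<^esub> v \<in> j ` carrier M}"
 proof (intro equalityI subsetI)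
  fix v assume "v \<in> M.tensor_lift V j ` carrier M.T"
  then obtain X where X: "X \<in> carrier M.T" "v = M.tensor_lift V j X" by auto
  obtain s x where s: "den s" "x \<in> carrier M" "\<phi> s \<odot>\<^bsub>M.T\<^esub> X = M.tens \<one>\<^sub>U x" by (rule clear_denominator[OF M X(1)])
  have "\<phi> s \<odot>\<^bsub>V\<^esub> v = j x" using hom_smult[OF J, of "\<phi> s" X] s X Jt by simp
  then show "v \<in> {v \<in> carrier V. \<exists>s. den s \<and> \<phi> s \<odot>\<^bsub>V\<^esub> v \<in> j ` carrier M}"
   using s hom_closed[OF J X(1)] X(2) by auto
 next
  fix v assume "v \<in> {v \<in> carrier V. \<exists>s. den s \<and> \<phi> s \<odot>\<^bsub>V\<^esub> v \<in> j ` carrier M}"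
  then obtain s x where s: "v \<in> carrier V" "den s" "x \<in> carrier M" "\<phi> s \<odot>\<^bsub>V\<^esub> v = j x" by auto
  let ?X = "M.tens (inv\<^bsub>U\<^esub> (\<phi> s)) x"
  have X: "?X \<in> carrier M.T" using s by simp
  have "M.tensor_lift V j ?X = inv\<^bsub>U\<^esub> (\<phi> s) \<odot>\<^bsub>V\<^esub> (\<phi> s \<odot>\<^bsub>V\<^esub> v)" using s by (simp add: M.tensor_lift_tens[OF V j])
  also have "\<dots> = v" using s by (subst V.smult_assoc[symmetric]) (auto simp: V.smult_one)
  finally show "v \<in> M.tensor_lift V j ` carrier M.T" using X by (metis imageI)
 qed
qed

lemma BC_isomorphicI:
 assumes M: "lmod R M" and V: "lmod U V" and j: "j \<in> Hom R M (RS \<phi> V)" and inj_j: "inj_on j (carrier M)"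
  and dense: "\<And>v. v \<in> carrier V ==> \<exists>s. den s \<and> \<phi> s \<odot>\<^bsub>V\<^esub> v \<in> j ` carrier M"
 shows "Isom U (BC R U \<phi> M) V" unfolding module_isomorphic_def bij_betw_def
 using mod_ext.tensor_lift_hom[OF mod_ext[OF M] V j] tensor_lift_inj[OF M V j inj_j]
  tensor_lift_image[OF M V j inj_j] dense by (intro bexI conjI) auto

section \<open>Base change and contraction of projective modules\<close>

definition emb :: "nat => (nat => 'r) => nat => 's" where
 "emb n v = (\<lambda>i\<in>{..<n}. \<phi> (v i))"

lemma emb_hom: "emb n \<in> Hom R (Free R n) (RS \<phi> (Free U n))"
 by (rule HomI) (auto simp: emb_def PiE_def Pi_def \<phi>_add \<phi>_mult)

lemma emb_inj: "inj_on (emb n) (carrier (Free R n))"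
proof (rule inj_onI)
 fix v w assume v: "v \<in> carrier (Free R n)" and w: "w \<in> carrier (Free R n)" and e: "emb n v = emb n w"
 have "v i = w i" if "i < n" for i using fun_cong[OF e, of i] that v w by (auto simp: emb_def PiE_def Pi_def \<phi>_eq_iff)
 then show "v = w" using v w by (intro PiE_ext[of v "{..<n}" "\<lambda>_. carrier R"]) auto
qed

lemma emb_dense:
 assumes v: "v \<in> carrier (Free U n)" shows "\<exists>s. den s \<and> \<phi> s \<odot>\<^bsub>Free U n\<^esub> v \<in> emb n ` carrier (Free R n)"
proof -
 have vc: "v i \<in> carrier U" if "i < n" for i using v that by auto
 have "k \<le> n ==> \<exists>s. den s \<and> (\<forall>i<k. \<phi> s \<star> v i \<in> \<phi> ` carrier R)" for k
 proof (induction k)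
  case 0
  then show ?case using den_one by blast
 next
  case (Suc k)
  then obtain s where s: "den s" "\<forall>i<k. \<phi> s \<star> v i \<in> \<phi> ` carrier R" by auto
  obtain t a where t: "den t" "a \<in> carrier R" "\<phi> t \<star> v k = \<phi> a" by (rule left_fractionE[OF vc]) (use Suc in auto)
  obtain s' t' where z: "s' \<in> carrier R" "t' \<in> carrier R" "s' \<cdot> s = t' \<cdot> t" "den (s' \<cdot> s)"
   by (rule common_left_multiple[OF s(1) t(1)])
  have "\<phi> (s' \<cdot> s) \<star> v i \<in> \<phi> ` carrier R" if i: "i < Suc k" for i
  proof (cases "i = k")
   case True
   have "\<phi> (t' \<cdot> t) \<star> v k = \<phi> (t' \<cdot> a)" using z(2) t vc[of k] Suc.prems by (simp add: \<phi>_mult U.m_assoc)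
   then show ?thesis using z t True by simp
  next
   case False
   then have "\<phi> s \<star> v i \<in> \<phi> ` carrier R" using s(2) i by simp
   then obtain b where b: "b \<in> carrier R" "\<phi> s \<star> v i = \<phi> b" by auto
   have "\<phi> (s' \<cdot> s) \<star> v i = \<phi> (s' \<cdot> b)" using z(1) s(1) b vc[of i] Suc.prems i by (simp add: \<phi>_mult U.m_assoc)
   then show ?thesis using z b by simp
  qed
  then show ?case using z(4) by blast
 qed
 then obtain s where s: "den s" "\<forall>i<n. \<phi> s \<star> v i \<in> \<phi> ` carrier R" by blast
 then obtain a where a: "\<forall>i<n. a i \<in> carrier R \<and> \<phi> s \<star> v i = \<phi> (a i)" unfolding image_iff by metis
 have "\<phi> s \<odot>\<^bsub>Free U n\<^esub> v = emb n (\<lambda>i\<in>{..<n}. a i)" using a by (auto simp: emb_def)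
 moreover have "(\<lambda>i\<in>{..<n}. a i) \<in> carrier (Free R n)" using a by auto
 ultimately show ?thesis using s(1) by (metis imageI)
qed

lemma BC_free: "Isom U (BC R U \<phi> (Free R n)) (Free U n)" by (rule BC_isomorphicI[OF R.free_lm U.free_lm emb_hom emb_inj emb_dense])

lemma BC_lm: "lmod R M ==> lmod U (BC R U \<phi> M)" by (rule mod_ext.BC_lm[OF mod_ext])

lemma fgp_BC:
 assumes P: "fgp R P" shows "fgp U (BC R U \<phi> P)"
proof -
 note lP = fgp_lm[OF P]
 obtain n i r where i: "i \<in> Hom R P (Free R n)" "r \<in> Hom R (Free R n) P" "\<And>x. x \<in> carrier P ==> r (i x) = x"
  by (rule R.fgp_free_retract[OF P]) (rule that)
 note lT = BC_lm[OF lP] and lF = BC_lm[OF R.free_lm]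
 have pF: "fgp U (BC R U \<phi> (Free R n))" by (rule fgp_isomorphic[OF U.fgp_free lF Isom_sym[OF BC_free lF]])
 show ?thesis
 proof (rule BC_functor[where f=i and g=r, OF lP R.free_lm i(1,2)])
  fix F G assume "F \<in> Hom U (BC R U \<phi> P) (BC R U \<phi> (Free R n))" "G \<in> Hom U (BC R U \<phi> (Free R n)) (BC R U \<phi> P)"
   "\<And>X. X \<in> carrier (BC R U \<phi> P) ==> G (F X) = X"
  then show ?thesis by (rule fgp_retract[OF pF lT])
 qed (rule i(3))
qed

text \<open>\<open>P\<close> embeds in some \<open>R\<^sup>n\<close> and so in
  \<open>U\<^sup>n\<close>; this embedding factors through the map into the tensor product.\<close>

lemma tens_one_inj:
 assumes P: "fgp R P" shows "inj_on (mod_ext.tens R U \<phi> P \<one>\<^sub>U) (carrier P)"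
proof -
 note lP = fgp_lm[OF P]
 interpret P: mod_ext R U \<phi> P by (rule mod_ext[OF lP])
 obtain n i r where i: "i \<in> Hom R P (Free R n)" "r \<in> Hom R (Free R n) P" "\<And>x. x \<in> carrier P ==> r (i x) = x"
  by (rule R.fgp_free_retract[OF P]) (rule that)
 note j = Hom_comp[OF i(1) emb_hom]
 show ?thesis
 proof (rule inj_onI)
  fix x y assume x: "x \<in> carrier P" and y: "y \<in> carrier P" and eq: "P.tens \<one>\<^sub>U x = P.tens \<one>\<^sub>U y"
  have lift: "P.tensor_lift (Free U n) (\<lambda>x. emb n (i x)) (P.tens \<one>\<^sub>U z) = emb n (i z)" if "z \<in> carrier P" for z
   using that hom_closed[OF j that] left_module.smult_one[OF U.free_lm, of "emb n (i z)"]
   by (simp add: P.tensor_lift_tens[OF U.free_lm j] del: Free_simps)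
  have "emb n (i x) = emb n (i y)" using lift[OF x] lift[OF y] eq by simp
  then have "i x = i y" using hom_closed[OF i(1) x] hom_closed[OF i(1) y] by (rule inj_onD[OF emb_inj])
  then show "x = y" using i(3) x y by metis
 qed
qed

lemma BC_DSum:
 assumes P: "fgp R P" and Q: "fgp R Q" shows "Isom U (BC R U \<phi> (DSum P Q)) (DSum (BC R U \<phi> P) (BC R U \<phi> Q))"
proof -
 note lP = fgp_lm[OF P] and lQ = fgp_lm[OF Q]
 interpret P: mod_ext R U \<phi> P by (rule mod_ext[OF lP])
 interpret Q: mod_ext R U \<phi> Q by (rule mod_ext[OF lQ])
 let ?j = "\<lambda>z. (P.tens \<one>\<^sub>U (fst z), Q.tens \<one>\<^sub>U (snd z))"
 show ?thesis
 proof (rule BC_isomorphicI[where j="?j"])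
  show "lmod R (DSum P Q)" "lmod U (DSum P.T Q.T)" by (intro DSum_lm lP lQ P.BC_lm Q.BC_lm)+
  show "?j \<in> Hom R (DSum P Q) (RS \<phi> (DSum P.T Q.T))" using hom_smult[OF P.tens_one_hom] hom_smult[OF Q.tens_one_hom]
   by (intro HomI) (auto simp: P.tens_add_right Q.tens_add_right)
  show "inj_on ?j (carrier (DSum P Q))" using tens_one_inj[OF P] tens_one_inj[OF Q] by (auto simp: inj_on_def)
  fix V assume "V \<in> carrier (DSum P.T Q.T)"
  then obtain X Y where V: "X \<in> carrier P.T" "Y \<in> carrier Q.T" "V = (X, Y)" by auto
  obtain s x where s: "den s" "x \<in> carrier P" "\<phi> s \<odot>\<^bsub>P.T\<^esub> X = P.tens \<one>\<^sub>U x" by (rule clear_denominator[OF lP V(1)])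
  obtain t y where t: "den t" "y \<in> carrier Q" "\<phi> t \<odot>\<^bsub>Q.T\<^esub> Y = Q.tens \<one>\<^sub>U y" by (rule clear_denominator[OF lQ V(2)])
  obtain s' t' where z: "s' \<in> carrier R" "t' \<in> carrier R" "s' \<cdot> s = t' \<cdot> t" "den (s' \<cdot> s)"
   by (rule common_left_multiple[OF s(1) t(1)])
  have "\<phi> (s' \<cdot> s) \<odot>\<^bsub>P.T\<^esub> X = P.tens \<one>\<^sub>U (s' \<odot>\<^bsub>P\<^esub> x)"
   using z(1) s V(1) hom_smult[OF P.tens_one_hom z(1) s(2)] by (simp add: \<phi>_mult P.T.smult_assoc)
  moreover have "\<phi> (s' \<cdot> s) \<odot>\<^bsub>Q.T\<^esub> Y = Q.tens \<one>\<^sub>U (t' \<odot>\<^bsub>Q\<^esub> y)"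
   unfolding z(3) using z(2) t V(2) hom_smult[OF Q.tens_one_hom z(2) t(2)] by (simp add: \<phi>_mult Q.T.smult_assoc)
  ultimately have "\<phi> (s' \<cdot> s) \<odot>\<^bsub>DSum P.T Q.T\<^esub> V = ?j (s' \<odot>\<^bsub>P\<^esub> x, t' \<odot>\<^bsub>Q\<^esub> y)" by (simp add: V(3))
  moreover have "(s' \<odot>\<^bsub>P\<^esub> x, t' \<odot>\<^bsub>Q\<^esub> y) \<in> carrier (DSum P Q)" using z s t by (simp add: P.M.smult_closed Q.M.smult_closed)
  ultimately show "\<exists>s. den s \<and> \<phi> s \<odot>\<^bsub>DSum P.T Q.T\<^esub> V \<in> ?j ` carrier (DSum P Q)"
   using z(4) by (metis (lifting) imageI)
 qed
qed

text \<open>The images of P and Q in \<open>U\<^sup>n \<supseteq> U \<otimes> P \<cong> U \<otimes> Q\<close> generate the same U-submodule.\<close>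

lemma BC_reflects_isomorphic:
 assumes P: "fgp R P" and Q: "fgp R Q" and iso: "Isom U (BC R U \<phi> P) (BC R U \<phi> Q)" shows "Isom R P Q"
proof -
 note lP = fgp_lm[OF P] and lQ = fgp_lm[OF Q]
 interpret P: mod_ext R U \<phi> P by (rule mod_ext[OF lP])
 interpret Q: mod_ext R U \<phi> Q by (rule mod_ext[OF lQ])
 obtain \<theta> \<eta> where \<theta>: "\<theta> \<in> Hom U P.T Q.T" "\<eta> \<in> Hom U Q.T P.T"
  "\<And>x. x \<in> carrier P.T ==> \<eta> (\<theta> x) = x" "\<And>y. y \<in> carrier Q.T ==> \<theta> (\<eta> y) = y"
  by (rule IsomE[OF iso P.BC_lm]) (rule that)
 obtain n h k where h: "h \<in> Hom U P.T (Free U n)" "k \<in> Hom U (Free U n) P.T" "\<And>X. X \<in> carrier P.T ==> k (h X) = X"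
  by (rule U.fgp_free_retract[OF fgp_BC[OF P]]) (rule that)
 let ?V = "Free U n"
 let ?p = "\<lambda>x. h (P.tens \<one>\<^sub>U x)" and ?q = "\<lambda>y. h (\<eta> (Q.tens \<one>\<^sub>U y))"
 note hr = hom_RS[OF hom]
 have hp: "?p \<in> Hom R P (RS \<phi> ?V)" by (rule Hom_comp[OF P.tens_one_hom hr[OF h(1)]])
 have hq: "?q \<in> Hom R Q (RS \<phi> ?V)" by (rule Hom_comp[OF Hom_comp[OF Q.tens_one_hom hr[OF \<theta>(2)]] hr[OF h(1)]])
 have ip: "inj_on ?p (carrier P)"
 proof (rule inj_onI)
  fix x y assume x: "x \<in> carrier P" "y \<in> carrier P" and e: "?p x = ?p y"
  have "P.tens \<one>\<^sub>U x = P.tens \<one>\<^sub>U y" using arg_cong[OF e, of k] x by (simp add: h(3))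
  then show "x = y" using tens_one_inj[OF P] x by (auto dest: inj_onD)
 qed
 have iq: "inj_on ?q (carrier Q)"
 proof (rule inj_onI)
  fix x y assume x: "x \<in> carrier Q" "y \<in> carrier Q" and e: "?q x = ?q y"
  have "Q.tens \<one>\<^sub>U x = Q.tens \<one>\<^sub>U y"
   using arg_cong[OF e, of "\<lambda>v. \<theta> (k v)"] x by (simp add: h(3) \<theta>(4) hom_closed[OF \<theta>(2)])
  then show "x = y" using tens_one_inj[OF Q] x by (auto dest: inj_onD)
 qed
 have fgs: "fg_submodule ?V (f ` carrier M)" if f: "f \<in> Hom R M (RS \<phi> ?V)" and M: "fgp R M" for f M
 proof -
  note lM = fgp_lm[OF M]
  have s: "submodule (f ` carrier M) R (RS \<phi> ?V)" by (rule image_submodule[OF lM rs_lm[OF U.free_lm] f left_module.sub_carrier[OF lM]])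
  have "fin_gen R (restr (RS \<phi> ?V) (f ` carrier M))" by (rule fg_image[OF lM left_module.restr_lm[OF rs_lm[OF U.free_lm] s]
     Hom_into_restr[OF f] _ fgp_fg[OF M]]) auto
  then show ?thesis using s by (simp add: fg_submodule_def)
 qed
 \<comment> \<open>Clearing the denominator of the tensor that corresponds to an element of
   \<open>Q\<close> brings it into the image of \<open>P\<close>; the other inclusion is symmetric,
   through the inverse isomorphism.\<close>
 have c1: "covers ?V (?p ` carrier P) (?q ` carrier Q)" unfolding covers_def
 proof
  fix v assume "v \<in> ?q ` carrier Q"
  then obtain y where y: "y \<in> carrier Q" "v = ?q y" by auto
  have Y: "\<eta> (Q.tens \<one>\<^sub>U y) \<in> carrier P.T" using y by (simp add: hom_closed[OF \<theta>(2)])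
  obtain s x where s: "den s" "x \<in> carrier P" "\<phi> s \<odot>\<^bsub>P.T\<^esub> \<eta> (Q.tens \<one>\<^sub>U y) = P.tens \<one>\<^sub>U x"
   by (rule clear_denominator[OF lP Y])
  have "\<phi> s \<odot>\<^bsub>?V\<^esub> v = ?p x" unfolding y(2) s(3)[symmetric] by (rule hom_smult[OF h(1) _ Y, symmetric]) (use s in simp)
  then show "\<exists>s. den s \<and> \<phi> s \<odot>\<^bsub>?V\<^esub> v \<in> ?p ` carrier P" using s by (metis imageI)
 qed
 have c2: "covers ?V (?q ` carrier Q) (?p ` carrier P)" unfolding covers_def
 proof
  fix v assume "v \<in> ?p ` carrier P"
  then obtain x where x: "x \<in> carrier P" "v = ?p x" by auto
  have X: "P.tens \<one>\<^sub>U x \<in> carrier P.T" using x by simp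
  have Y: "\<theta> (P.tens \<one>\<^sub>U x) \<in> carrier Q.T" by (rule hom_closed[OF \<theta>(1) X])
  obtain s y where s: "den s" "y \<in> carrier Q" "\<phi> s \<odot>\<^bsub>Q.T\<^esub> \<theta> (P.tens \<one>\<^sub>U x) = Q.tens \<one>\<^sub>U y"
   by (rule clear_denominator[OF lQ Y])
  have "\<eta> (Q.tens \<one>\<^sub>U y) = \<phi> s \<odot>\<^bsub>P.T\<^esub> P.tens \<one>\<^sub>U x"
   unfolding s(3)[symmetric] using hom_smult[OF \<theta>(2), of "\<phi> s" "\<theta> (P.tens \<one>\<^sub>U x)"] s Y X by (simp add: \<theta>(3))
  then have "\<phi> s \<odot>\<^bsub>?V\<^esub> v = ?q y" unfolding x(2) by (simp only:) (rule hom_smult[OF h(1) _ X, symmetric], use s in simp)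
  then show "\<exists>s. den s \<and> \<phi> s \<odot>\<^bsub>?V\<^esub> v \<in> ?q ` carrier Q" using s by (metis imageI)
 qed
 note r = span_rigidD(2)[OF span_rigid_free fgs[OF hp P] fgs[OF hq Q] c1 c2]
 show ?thesis by (rule Isom_trans[OF Isom_image[OF hp ip] Isom_trans[OF r
   Isom_sym[OF Isom_image[OF hq iq] lQ]]])
qed

text \<open>A vector of \<open>R\<^sup>n\<close> lies in \<open>Q\<close> exactly when the
  complementary projection \<open>\<kappa>\<close> kills its image. So the contraction is the kernel
  of a map from \<open>R\<^sup>n\<close> onto a finitely generated R-submodule of
  \<open>U\<^sup>n\<close>; such submodules are projective by \<open>span_rigid_free\<close>, and
  the map splits. The base change is then identified by clearing denominators inside
  \<open>Q\<close>.\<close>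

lemma
 assumes Q: "summand U (Free U n) Q" shows contract_projective: "fgp R (contract R \<phi> n Q)"
  and BC_contract: "Isom U (BC R U \<phi> (contract R \<phi> n Q)) (restr (Free U n) Q)"
proof -
 let ?V = "Free U n" and ?F = "Free R n"
 interpret V: left_module U ?V by (rule U.free_lm)
 interpret F: left_module R ?F by (rule R.free_lm)
 note lV = U.free_lm[of n] and lF = R.free_lm[of n]
 let ?Q = "{v \<in> carrier ?F. emb n v \<in> Q}"
 have sQ: "submodule Q U ?V" using Q by (simp add: direct_summand_def)
 have contract: "contract R \<phi> n Q = restr ?F ?Q" by (simp add: contract_def emb_def del: Free_simps)
 obtain \<pi> where \<pi>: "\<pi> \<in> Hom U ?V ?V" "\<And>x. x \<in> carrier ?V ==> \<pi> x \<in> Q" "\<And>x. x \<in> Q ==> \<pi> x = x"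
  by (rule U.summand_projection[OF lV Q]) (rule that)
 define \<kappa> where "\<kappa> x = x \<ominus>\<^bsub>?V\<^esub> \<pi> x" for x
 have \<pi>c: "\<pi> x \<in> carrier ?V" if "x \<in> carrier ?V" for x by (rule hom_closed[OF \<pi>(1) that])
 have \<kappa>hom: "\<kappa> \<in> Hom U ?V ?V" unfolding \<kappa>_def by (rule V.Hom_id_diff[OF \<pi>(1)])
 have \<kappa>zero: "\<kappa> x = \<zero>\<^bsub>?V\<^esub> \<longleftrightarrow> x \<in> Q" if x: "x \<in> carrier ?V" for x
  unfolding \<kappa>_def using V.diff_eq_zero[OF x \<pi>c[OF x]] \<pi>(2)[OF x] \<pi>(3)[of x] by metis
 let ?f = "\<lambda>v. \<kappa> (emb n v)" and ?rV = "RS \<phi> ?V"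
 note lrV = rs_lm[OF lV]
 note f = Hom_comp[OF emb_hom hom_RS[OF hom \<kappa>hom]]
 let ?W = "?f ` carrier ?F"
 have sW: "submodule ?W R ?rV" by (rule image_submodule[OF lF lrV f F.sub_carrier])
 note lW = left_module.restr_lm[OF lrV sW]
 have fW: "?f \<in> Hom R ?F (restr ?rV ?W)" by (rule Hom_into_restr[OF f]) simp
 have "fin_gen R (restr ?rV ?W)" by (rule fg_image[OF lF lW fW _ fgp_fg[OF R.fgp_free]]) simp
 then have "fg_submodule ?V ?W" using sW by (simp add: fg_submodule_def)
 \<comment> \<open>Comparing the submodule with itself extracts from \<open>span_rigid\<close> its
   statement of projectivity.\<close>
 moreover have "covers ?V ?W ?W"
  unfolding covers_def using V.smult_one sub_subset[OF sW] by (intro ballI exI[of _ "\<one>"]) (auto simp: den_one)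
 ultimately have W: "fgp R (restr ?rV ?W)" using span_rigidD(1)[OF span_rigid_free] by blast
 obtain \<sigma> where \<sigma>: "\<sigma> \<in> Hom R (restr ?rV ?W) ?F" "\<And>x. x \<in> carrier (restr ?rV ?W) ==> ?f (\<sigma> x) = x"
  by (rule R.fgp_section[OF W fW]) (use that in auto)
 note \<sigma>f = Hom_comp[OF fW \<sigma>(1)]
 have sQ': "submodule ?Q R ?F" using vimage_submodule[OF lF lrV emb_hom submodule_RS[OF hom R.ring_axioms lV sQ]] .
 have "summand R ?F ?Q"
 proof (rule R.summandI[OF lF sQ' F.Hom_id_diff[OF \<sigma>f]])
  fix v assume v: "v \<in> carrier ?F"
  have \<sigma>v: "\<sigma> (?f v) \<in> carrier ?F" by (rule hom_closed[OF \<sigma>f v])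
  have c: "v \<ominus>\<^bsub>?F\<^esub> \<sigma> (?f v) \<in> carrier ?F" using v \<sigma>v by (rule F.M.minus_closed)
  have "?f (\<sigma> (?f v)) = ?f v" by (rule \<sigma>(2)) (use v in simp)
  then have "?f (v \<ominus>\<^bsub>?F\<^esub> \<sigma> (?f v)) = \<zero>\<^bsub>?rV\<^esub>"
   using hom_diff[OF lF lrV f v \<sigma>v] left_module.diff_eq_zero[OF lrV hom_closed[OF f v] hom_closed[OF f v]] by simp
  then show "v \<ominus>\<^bsub>?F\<^esub> \<sigma> (?f v) \<in> ?Q"
   using c \<kappa>zero[of "emb n (v \<ominus>\<^bsub>?F\<^esub> \<sigma> (?f v))"] hom_closed[OF emb_hom c] by simp
 next
  fix v assume v: "v \<in> ?Q"
  then have "?f v = \<zero>\<^bsub>restr ?rV ?W\<^esub>" using \<kappa>zero[of "emb n v"] hom_closed[OF emb_hom, of v n] by simp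
  then have "\<sigma> (?f v) = \<zero>\<^bsub>?F\<^esub>" using hom_zero[OF lW lF \<sigma>(1)] by simp
  then show "v \<ominus>\<^bsub>?F\<^esub> \<sigma> (?f v) = v" using v by (simp add: a_minus_def del: Free_simps)
 qed
 then show "fgp R (contract R \<phi> n Q)" unfolding contract by (rule R.fgp_summand)
 show "Isom U (BC R U \<phi> (contract R \<phi> n Q)) (restr ?V Q)" unfolding contract
 proof (rule BC_isomorphicI[where j="emb n"])
  show "lmod R (restr ?F ?Q)" by (rule F.restr_lm[OF sQ'])
  show "lmod U (restr ?V Q)" by (rule V.restr_lm[OF sQ])
  show "emb n \<in> Hom R (restr ?F ?Q) (RS \<phi> (restr ?V Q))" using hom_add[OF emb_hom[of n]] hom_smult[OF emb_hom[of n]]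
   by (intro HomI) (auto simp del: Free_simps)
  show "inj_on (emb n) (carrier (restr ?F ?Q))" by (rule inj_on_subset[OF emb_inj]) auto
  fix v assume "v \<in> carrier (restr ?V Q)"
  then have v: "v \<in> Q" by simp
  then obtain s x where s: "den s" "x \<in> carrier ?F" "\<phi> s \<odot>\<^bsub>?V\<^esub> v = emb n x"
   using emb_dense[of v n] sub_subset[OF sQ] by blast
  then have "emb n x \<in> Q" using sub_smult[OF sQ _ v, of "\<phi> s"] by simp
  then show "\<exists>s. den s \<and> \<phi> s \<odot>\<^bsub>restr ?V Q\<^esub> v \<in> emb n ` carrier (restr ?F ?Q)"
   using s by (intro exI[of _ s]) (auto)
 qed
qed

section \<open>The maps on isomorphism classes and on Grothendieck groups\<close>

lemma Proj_map_class:
 assumes P: "fgp R P" shows "Proj_map R U \<phi> (iso_class R P) = iso_class U (BC R U \<phi> P)" unfolding Proj_map_def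
proof (rule R.iso_class_UN[OF P])
 fix P' :: "('r, nat => 'r) module" assume P': "fgp R P'" "Isom R P P'"
 note l = fgp_lm
 show "iso_class U (BC R U \<phi> P') = iso_class U (BC R U \<phi> P)"
  by (rule iso_class_cong[symmetric, OF BC_lm[OF l[OF P]] BC_isomorphic[OF l[OF P] l[OF P'(1)] P'(2)]])
qed

lemma Proj_map_one: "Proj_map R U \<phi> \<one>\<^bsub>Proj R\<^esub> = \<one>\<^bsub>Proj U\<^esub>" unfolding Proj_one Proj_map_class[OF R.fgp_free]
 by (rule iso_class_cong[OF BC_lm[OF R.free_lm] BC_free])

lemma Proj_map_contract:
 assumes Q: "summand U (Free U n) Q" shows "Proj_map R U \<phi> (iso_class R (contract R \<phi> n Q)) = iso_class U (restr (Free U n) Q)"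
 unfolding Proj_map_class[OF contract_projective[OF Q]] by (rule iso_class_cong[OF BC_lm[OF fgp_lm[OF contract_projective[OF Q]]] BC_contract[OF Q]])

lemma Proj_map_iso: "Proj_map R U \<phi> \<in> iso (Proj R) (Proj U)" unfolding iso_def bij_betw_def
proof (intro CollectI conjI)
 note T = fgp_BC and l = fgp_lm
 have closed: "Proj_map R U \<phi> X \<in> carrier (Proj U)" if "X \<in> carrier (Proj R)" for X
  using that by (elim R.Proj_carrierE) (simp add: Proj_map_class U.iso_class_Proj T)
 show "Proj_map R U \<phi> \<in> hom (Proj R) (Proj U)"
 proof (rule homI[OF closed])
  fix X Y assume "X \<in> carrier (Proj R)" "Y \<in> carrier (Proj R)"
  then obtain P Q :: "('r, nat => 'r) module" where PQ: "fgp R P" "X = iso_class R P" "fgp R Q" "Y = iso_class R Q"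
   by (meson R.Proj_carrierE)
  have "iso_class U (BC R U \<phi> (DSum P Q)) =
    iso_class U (DSum (BC R U \<phi> P) (BC R U \<phi> Q))" by (rule iso_class_cong[OF BC_lm[OF DSum_lm] BC_DSum]) (use PQ l in auto)
  then show "Proj_map R U \<phi> (X \<otimes>\<^bsub>Proj R\<^esub> Y) = Proj_map R U \<phi> X \<otimes>\<^bsub>Proj U\<^esub> Proj_map R U \<phi> Y"
   using PQ by (simp add: R.Proj_mult U.Proj_mult Proj_map_class fgp_DSum T)
 qed
 show "inj_on (Proj_map R U \<phi>) (carrier (Proj R))"
 proof (rule inj_onI)
  fix X Y assume "X \<in> carrier (Proj R)" "Y \<in> carrier (Proj R)" and eq: "Proj_map R U \<phi> X = Proj_map R U \<phi> Y"
  then obtain P Q :: "('r, nat => 'r) module" where PQ: "fgp R P" "X = iso_class R P" "fgp R Q" "Y = iso_class R Q"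
   by (meson R.Proj_carrierE)
  have "Isom U (BC R U \<phi> P) (BC R U \<phi> Q)" using eq PQ by (intro U.iso_class_eqD T BC_lm l) (simp_all add: Proj_map_class)
  then show "X = Y" unfolding PQ(2,4) by (intro iso_class_cong l BC_reflects_isomorphic PQ)
 qed
 show "Proj_map R U \<phi> ` carrier (Proj R) = carrier (Proj U)"
 proof (intro equalityI subsetI)
  fix Z assume "Z \<in> carrier (Proj U)"
  then obtain P :: "('s, nat => 's) module" where P: "fgp U P" "Z = iso_class U P" by (rule U.Proj_carrierE)
  obtain n i L where L: "summand U (Free U n) L" "i \<in> Hom U P (Free U n)" "inj_on i (carrier P)" "i ` carrier P = L"
   by (rule U.fgp_summand_exists[OF P(1)])
  have "Z = iso_class U (restr (Free U n) L)" unfolding P(2) using Isom_image[OF L(2,3)] L(4) by (intro iso_class_cong l[OF P(1)]) simp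
  then show "Z \<in> Proj_map R U \<phi> ` carrier (Proj R)"
   using Proj_map_contract[OF L(1)] R.iso_class_Proj[OF contract_projective[OF L(1)]] by (metis imageI)
 qed (use closed in auto)
qed

lemma Proj_map_inverse:
 assumes Q: "summand U (Free U n) Q"
 shows "inv_into (carrier (Proj R)) (Proj_map R U \<phi>) (iso_class U (restr (Free U n) Q)) = iso_class R (contract R \<phi> n Q)"
 unfolding Proj_map_contract[OF Q, symmetric] using Proj_map_iso
 by (intro inv_into_f_f R.iso_class_Proj contract_projective[OF Q]) (simp add: iso_def bij_betw_def)

lemma K0_map_iso: "K0_map R U \<phi> \<in> iso (K0 R) (K0 U)"
 unfolding K0_map_def K0_def by (rule comm_monoid.groth_map_iso[OF R.Proj_comm_monoid U.Proj_comm_monoid Proj_map_iso])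

lemma K0_map_class':
 assumes P: "fgp R P" and Q: "Proj_map R U \<phi> (iso_class R P) = iso_class U Q" shows "K0_map R U \<phi> (K0_class R P) = K0_class U Q"
 unfolding K0_map_def K0_class_def Q[symmetric] Proj_map_one[symmetric]
 by (rule comm_monoid.groth_map_class[OF R.Proj_comm_monoid U.Proj_comm_monoid Proj_map_iso R.iso_class_Proj[OF P]])
  (simp add: Proj_one R.iso_class_Proj R.fgp_free)

lemma K0_map_class: "fgp R P ==> K0_map R U \<phi> (K0_class R P) = K0_class U (BC R U \<phi> P)" by (rule K0_map_class'[OF _ Proj_map_class])

lemma K0_map_inverse:
 assumes Q: "summand U (Free U n) Q"
 shows "inv_into (carrier (K0 R)) (K0_map R U \<phi>) (K0_class U (restr (Free U n) Q)) = K0_class R (contract R \<phi> n Q)"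
proof -
 have "K0_class R (contract R \<phi> n Q) \<in> carrier (K0 R)" unfolding K0_class_def K0_def
  by (intro comm_monoid.groth_class_in R.Proj_comm_monoid R.iso_class_Proj contract_projective[OF Q]) (simp add: Proj_one R.iso_class_Proj R.fgp_free)
 then show ?thesis unfolding K0_map_class'[OF contract_projective[OF Q] Proj_map_contract[OF Q], symmetric] using K0_map_iso
  by (intro inv_into_f_f) (simp_all add: iso_def bij_betw_def)
qed

end

section \<open>Goldie closed ideals and direct summands\<close>

lemma nonsingular_module_inj:
 assumes M: "lmod R M" and N: "nonsingular_module R N" and f: "f \<in> Hom R M N" and i: "inj_on f (carrier M)" shows "nonsingular_module R M"
proof -
 have lN: "lmod R N" and sN: "singular_submodule R N = {\<zero>\<^bsub>N\<^esub>}" using N by (auto simp: nonsingular_module_def)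
 interpret M: left_module R M by (rule M)
 interpret N: left_module R N by (rule lN)
 have f0: "f x = \<zero>\<^bsub>N\<^esub> \<longleftrightarrow> x = \<zero>\<^bsub>M\<^esub>" if "x \<in> carrier M" for x
  using hom_zero[OF M lN f] i that by (metis M.M.zero_closed inj_onD)
 have ann: "annihilator R M x = annihilator R N (f x)" if "x \<in> carrier M" for x
  using that f0 hom_smult[OF f, of _ x, symmetric] M.smult_closed by (auto simp: annihilator_def)
 have mem: "x \<in> singular_submodule R M \<longleftrightarrow> f x \<in> singular_submodule R N" if "x \<in> carrier M" for x
  using that hom_closed[OF f that] by (simp add: singular_submodule_def ann)
 have "singular_submodule R M \<subseteq> carrier M" by (auto simp: singular_submodule_def)
 then have "singular_submodule R M = {\<zero>\<^bsub>M\<^esub>}" using mem f0 sN by auto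
 then show ?thesis using M by (simp add: nonsingular_module_def)
qed

lemma (in left_module) quotient_hom_factor:
 assumes N: "submodule N R M" and L: "lmod R L" and h: "h \<in> Hom R M L" and hN: "\<And>x. x \<in> N ==> h x = \<zero>\<^bsub>L\<^esub>"
 obtains g where "g \<in> Hom R (quotient_module M N) L" "\<And>x. x \<in> carrier M ==> g (N +>\<^bsub>M\<^esub> x) = h x"
proof -
 interpret L: left_module R L by (rule L)
 define g where "g X = h (SOME x. x \<in> carrier M \<and> N +>\<^bsub>M\<^esub> x = X)" for X
 have g: "g (N +>\<^bsub>M\<^esub> x) = h x" if x: "x \<in> carrier M" for x
 proof -
  let ?y = "SOME y. y \<in> carrier M \<and> N +>\<^bsub>M\<^esub> y = N +>\<^bsub>M\<^esub> x"
  have y: "?y \<in> carrier M" "N +>\<^bsub>M\<^esub> ?y = N +>\<^bsub>M\<^esub> x"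
   using someI[of "\<lambda>y. y \<in> carrier M \<and> N +>\<^bsub>M\<^esub> y = N +>\<^bsub>M\<^esub> x" x] x by auto
  then have "h (?y \<ominus>\<^sub>M x) = \<zero>\<^bsub>L\<^esub>" using hN coset_eq_iff[OF N y(1) x] by simp
  then have "h ?y = h x" using hom_diff[OF left_module_axioms L h y(1) x] L.diff_eq_zero[OF hom_closed[OF h y(1)] hom_closed[OF h x]] by simp
  then show ?thesis by (simp add: g_def)
 qed
 have "g \<in> Hom R (quotient_module M N) L" using hom_closed[OF h] hom_add[OF h] hom_smult[OF h]
  by (intro HomI) (auto simp: quotient_carrier quotient_add[OF N] quotient_smult[OF N] g smult_closed)
 then show ?thesis using that g by blast
qed

text \<open>\<open>support\<close> says that \<open>I\<close> lies in \<open>R e\<close> for an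
  idempotent \<open>e\<close> and is dense there, in a form that makes \<open>R e / I\<close> a
  torsion module. \<open>Baer_condition\<close> is the input of \<open>Baer_criterion\<close> for
  \<open>U\<close>, as a module over \<open>R\<close>.\<close>

locale maximal_extension = ring_extension R U \<phi>
 for R :: "('r, 'a) ring_scheme" (structure) and U :: "('s, 'b) ring_scheme" and \<phi> :: "'r => 's" +
 assumes support: "left_ideal R I ==> \<exists>e\<in>carrier R. e \<otimes> e = e \<and> (\<forall>a\<in>I. a \<otimes> e = a) \<and>
   (\<forall>x\<in>carrier R. \<forall>y\<in>carrier R. x \<otimes> e = x \<longrightarrow> y \<noteq> \<zero> \<longrightarrow>
    (\<exists>r\<in>carrier R. r \<otimes> y \<noteq> \<zero> \<and> r \<otimes> x \<in> I))"
  and Baer_condition: "left_ideal R I ==>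
   f \<in> Hom R (restr (Reg R) I) (RS \<phi> (Reg U)) ==>
   \<exists>u\<in>carrier U. \<forall>a\<in>I. f a = \<phi> a \<star> u"
begin

text \<open>The left annihilator of \<open>a\<close> is that of the idempotent \<open>v w\<close>,
  so it meets \<open>lid (v \<cdot> w)\<close> only in zero; if it is essential, then
  \<open>v w = 0\<close> and hence \<open>a = 0\<close>.\<close>

lemma nonsingular_regular: "nonsingular_module R (Reg R)" unfolding nonsingular_module_def
proof (intro conjI R.Reg_lm equalityI subsetI)
 interpret left_module R "Reg R" by (rule R.Reg_lm)
 fix a assume "a \<in> singular_submodule R (Reg R)"
 then have a: "a \<in> carrier R" and ess: "essential_submodule R (Reg R) (annihilator R (Reg R) a)" by (auto simp: singular_submodule_def)
 obtain v w where v: "v \<in> carrier R" "w \<in> carrier R" "v \<cdot> w \<cdot> v = v"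
  and ann: "\<And>x. x \<in> carrier R ==> x \<cdot> a = \<zero> \<longleftrightarrow> x \<cdot> (v \<cdot> w) = \<zero>"
  by (rule polarE[OF a]) (rule that)
 have q: "idem (v \<cdot> w)" by (rule idem_polar(1)[OF v])
 have "annihilator R (Reg R) a \<inter> lid (v \<cdot> w) = {\<zero>}" using v ann by (auto simp: annihilator_def lid_def)
 then have "lid (v \<cdot> w) = {\<zero>}" using ess lid_submodule[of "v \<cdot> w"] q unfolding essential_submodule_def by auto
 moreover have "v \<cdot> w \<in> lid (v \<cdot> w)" using q by (simp add: lid_def idem_idem)
 ultimately have "v \<cdot> w = \<zero>" by auto
 then show "a \<in> {\<zero>\<^bsub>Reg R\<^esub>}" using ann[of "\<one>"] a by simp
next
 interpret left_module R "Reg R" by (rule R.Reg_lm)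
 have "annihilator R (Reg R) \<zero> = carrier R" by (auto simp: annihilator_def)
 moreover fix a assume "a \<in> {\<zero>\<^bsub>Reg R\<^esub>}"
 ultimately show "a \<in> singular_submodule R (Reg R)" using sub_carrier sub_subset[of _ R "Reg R"]
  by (auto simp: singular_submodule_def essential_submodule_def)
qed

text \<open>Right multiplication by \<open>1 - e\<close> has kernel \<open>R e\<close>, so it embeds
  the quotient in the nonsingular regular module and must kill every torsion submodule.\<close>

lemma lid_goldie_closed:
 assumes e: "idem e" shows "lid e \<in> goldie_closed_ideals R"
proof -
 let ?M = "Reg R" and ?e' = "\<one> \<ominus> e"
 let ?Q = "quotient_module ?M (lid e)"
 interpret left_module R ?M by (rule R.Reg_lm)
 have I: "left_ideal R (lid e)" using e by (intro lid_submodule) simp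
 interpret Q: left_module R ?Q by (rule quotient_lm[OF I])
 have e': "?e' \<in> carrier R" using e by simp
 have ker: "x \<cdot> ?e' = \<zero> \<longleftrightarrow> x \<in> lid e" if x: "x \<in> carrier R" for x
 proof -
  have "x \<cdot> ?e' = x \<ominus> x \<cdot> e" using x e by (simp add: a_minus_def R.r_distr R.r_minus)
  then show ?thesis using diff_eq_zero[of x "x \<cdot> e"] x e by (auto simp: lid_def a_minus_def a_inv_def m_inv_def)
 qed
 \<comment> \<open>Torsion of submodules of the quotient is tested on modules whose elements are
   sets of cosets; double singletons copy the regular module to that type.\<close>
 let ?\<sigma> = "\<lambda>x :: 'r. {{x}}"
 have \<sigma>: "inj_on ?\<sigma> (carrier ?M)" by (simp add: inj_on_def)
 let ?F = "transport ?\<sigma> ?M"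
 note lF = transport_left_module[OF R.Reg_lm \<sigma>] and h\<sigma> = transport_hom[OF R.Reg_lm \<sigma>]
 obtain \<alpha> \<beta> where \<alpha>: "\<alpha> \<in> Hom R ?M ?F" "\<beta> \<in> Hom R ?F ?M" "\<And>y. y \<in> carrier ?F ==> \<alpha> (\<beta> y) = y"
  by (rule IsomE[OF transport_isomorphic[OF R.Reg_lm \<sigma>] R.Reg_lm]) (rule that)
 have nF: "nonsingular_module R ?F"
  by (rule nonsingular_module_inj[OF lF nonsingular_regular \<alpha>(2) inj_on_inverseI[of _ \<alpha>]]) (rule \<alpha>(3))
 have he: "(\<lambda>x. x \<cdot> ?e') \<in> Hom R ?M ?M" by (rule HomI) (use e' in \<open>auto simp: R.l_distr R.m_assoc\<close>)
 obtain g where g: "g \<in> Hom R ?Q ?M" "\<And>x. x \<in> carrier ?M ==> g (lid e +>\<^bsub>?M\<^esub> x) = x \<cdot> ?e'"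
  by (rule quotient_hom_factor[OF I R.Reg_lm he]) (use ker in \<open>auto simp: lid_def\<close>)
 have zero: "\<zero>\<^bsub>?Q\<^esub> \<in> goldie_torsion_submodule R ?Q" unfolding goldie_torsion_submodule_def
 proof (rule UnionI[of "{\<zero>\<^bsub>?Q\<^esub>}"], rule CollectI, intro conjI)
  show s: "submodule {\<zero>\<^bsub>?Q\<^esub>} R ?Q" by (rule Q.submodule_zero_set)
  show "goldie_torsion R (restr ?Q {\<zero>\<^bsub>?Q\<^esub>})" unfolding goldie_torsion_def
  proof (intro conjI allI impI ballI)
   show l: "lmod R (restr ?Q {\<zero>\<^bsub>?Q\<^esub>})" by (rule Q.restr_lm[OF s])
   fix F :: "('r, 'r set set) module" and f x
   assume "nonsingular_module R F" "f \<in> Hom R (restr ?Q {\<zero>\<^bsub>?Q\<^esub>}) F" "x \<in> carrier (restr ?Q {\<zero>\<^bsub>?Q\<^esub>})"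
   then show "f x = \<zero>\<^bsub>F\<^esub>" using hom_zero[OF l, of F f] by (simp add: nonsingular_module_def)
  qed
 qed simp
 have "goldie_closure R ?M (lid e) = lid e"
 proof (intro equalityI subsetI)
  fix x assume "x \<in> goldie_closure R ?M (lid e)"
  then obtain T where x: "x \<in> carrier R" and T: "lid e +>\<^bsub>?M\<^esub> x \<in> T" "submodule T R ?Q" "goldie_torsion R (restr ?Q T)"
   by (auto simp: goldie_closure_def goldie_torsion_submodule_def)
  have "(\<lambda>X. ?\<sigma> (g X)) \<in> Hom R (restr ?Q T) ?F" by (rule Hom_restr[OF Hom_comp[OF g(1) h\<sigma>] sub_subset[OF T(2)]])
  then have "?\<sigma> (g (lid e +>\<^bsub>?M\<^esub> x)) = \<zero>\<^bsub>?F\<^esub>" using T(1,3) nF unfolding goldie_torsion_def by auto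
  then show "x \<in> lid e" using g(2)[of x] x ker by (simp add: transport_def)
 next
  fix x assume x: "x \<in> lid e"
  then have "lid e +>\<^bsub>?M\<^esub> x = lid e +>\<^bsub>?M\<^esub> \<zero>\<^bsub>?M\<^esub>"
   using submodule_diff[OF I x sub_zero[OF I]] by (subst coset_eq_iff[OF I]) (auto simp: lid_def)
  then show "x \<in> goldie_closure R ?M (lid e)" using x zero quotient_zero[OF I] by (simp add: goldie_closure_def lid_def)
 qed
 then show ?thesis using I by (simp add: goldie_closed_ideals_def)
qed

text \<open>For the idempotent \<open>e\<close> supplied by \<open>support\<close>, the quotient of
  \<open>R e\<close> by \<open>I\<close> is torsion: images of its elements in a nonsingular module
  have essential annihilators. Hence the closure of \<open>I\<close> contains \<open>R e\<close>,
  and a closed \<open>I\<close> equals it.\<close>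

lemma goldie_closed_lid:
 assumes I: "I \<in> goldie_closed_ideals R"
 obtains e where "idem e" "I = lid e"
proof -
 let ?M = "Reg R"
 let ?Q = "quotient_module ?M I"
 have sI: "left_ideal R I" and cl: "goldie_closure R ?M I = I" using I by (auto simp: goldie_closed_ideals_def)
 interpret left_module R ?M by (rule R.Reg_lm)
 interpret Q: left_module R ?Q by (rule quotient_lm[OF sI])
 obtain e where e: "e \<in> carrier R" "e \<cdot> e = e" "\<And>a. a \<in> I ==> a \<cdot> e = a"
  and dense: "\<And>x y. x \<in> carrier R ==> y \<in> carrier R ==> x \<cdot> e = x ==> y \<noteq> \<zero> ==> \<exists>r\<in>carrier R. r \<cdot> y \<noteq> \<zero> \<and> r \<cdot> x \<in> I"
  using support[OF sI] by blast
 let ?q = "\<lambda>x. I +>\<^bsub>?M\<^esub> x"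
 let ?T = "?q ` lid e"
 have sT: "submodule ?T R ?Q" by (rule image_submodule[OF R.Reg_lm Q.left_module_axioms quotient_hom[OF sI] lid_submodule[OF e(1)]])
 have "goldie_torsion R (restr ?Q ?T)" unfolding goldie_torsion_def
 proof (intro conjI allI impI ballI)
  show lT: "lmod R (restr ?Q ?T)" by (rule Q.restr_lm[OF sT])
  fix F :: "('r, 'r set set) module" and f X
  assume F: "nonsingular_module R F" and f: "f \<in> Hom R (restr ?Q ?T) F" and "X \<in> carrier (restr ?Q ?T)"
  then obtain x where x: "x \<in> lid e" "X = ?q x" by auto
  have lF: "lmod R F" using F by (simp add: nonsingular_module_def)
  interpret F: left_module R F by (rule lF)
  have xR: "x \<in> carrier R" "x \<cdot> e = x" using x by (auto simp: lid_def)
  have X: "X \<in> carrier (restr ?Q ?T)" using x by simp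
  have fX: "f X \<in> carrier F" by (rule hom_closed[OF f X])
  have kill: "r \<in> annihilator R F (f X)" if r: "r \<in> carrier R" "r \<cdot> x \<in> I" for r
  proof -
   have "r \<odot>\<^bsub>?Q\<^esub> X = ?q (r \<cdot> x)" using quotient_smult[OF sI, of r x] r xR x by simp
   also have "\<dots> = ?q \<zero>\<^bsub>?M\<^esub>" using submodule_diff[OF sI r(2) sub_zero[OF sI]] r xR by (subst coset_eq_iff[OF sI]) auto
   finally have "r \<odot>\<^bsub>restr ?Q ?T\<^esub> X = \<zero>\<^bsub>restr ?Q ?T\<^esub>" using quotient_zero[OF sI] by simp
   then have "r \<odot>\<^bsub>F\<^esub> f X = \<zero>\<^bsub>F\<^esub>" using hom_smult[OF f r(1) X] hom_zero[OF lT lF f] by simp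
   then show ?thesis using r by (simp add: annihilator_def)
  qed
  have "essential_submodule R ?M (annihilator R F (f X))" unfolding essential_submodule_def
  proof (intro conjI allI impI)
   have "(\<lambda>r. r \<odot>\<^bsub>F\<^esub> f X) \<in> Hom R ?M F"
    by (rule HomI) (use fX in \<open>auto simp: F.smult_closed F.smult_l_distr F.smult_assoc\<close>)
   then show "left_ideal R (annihilator R F (f X))" using hom_kernel_submodule[OF R.Reg_lm lF] by (simp add: annihilator_def)
   fix K assume K: "left_ideal R K \<and> K \<noteq> {\<zero>\<^bsub>?M\<^esub>}"
   then obtain y where y: "y \<in> K" "y \<noteq> \<zero>" using sub_zero[of K R ?M] by auto
   have yR: "y \<in> carrier R" using sub_subset[of K R ?M] K y by auto
   \<comment> \<open>Density is applied to \<open>y x\<close> rather than to \<open>x\<close>: it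
     gives \<open>r\<close> with \<open>r y\<close> nonzero in \<open>K\<close> and
     \<open>r y x\<close> in \<open>I\<close>, so that \<open>r y\<close> annihilates the class of
     \<open>x\<close>.\<close>
   have "(y \<cdot> x) \<cdot> e = y \<cdot> x" using yR xR e by (simp add: R.m_assoc)
   then obtain r where r: "r \<in> carrier R" "r \<cdot> y \<noteq> \<zero>" "r \<cdot> (y \<cdot> x) \<in> I"
    using dense[of "y \<cdot> x" y] yR xR y by auto
   have "r \<cdot> y \<in> K" using sub_smult[of K R ?M r y] K r y by simp
   moreover have "r \<cdot> y \<in> annihilator R F (f X)" using r yR xR by (intro kill) (simp_all add: R.m_assoc)
   ultimately show "annihilator R F (f X) \<inter> K \<noteq> {\<zero>\<^bsub>?M\<^esub>}" using r(2) by auto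
  qed
  then have "f X \<in> singular_submodule R F" using fX by (simp add: singular_submodule_def)
  then show "f X = \<zero>\<^bsub>F\<^esub>" using F by (simp add: nonsingular_module_def)
 qed
 then have "?q x \<in> goldie_torsion_submodule R ?Q" if "x \<in> lid e" for x using sT that unfolding goldie_torsion_submodule_def by blast
 then have "lid e \<subseteq> goldie_closure R ?M I" by (auto simp: goldie_closure_def lid_def)
 moreover have "I \<subseteq> lid e" using e sub_subset[OF sI] by (auto simp: lid_def)
 ultimately have "I = lid e" using cl by auto
 then show ?thesis using that[of e] e by (simp add: idem_def)
qed

section \<open>Direct summands of the ring of fractions\<close>

definition Ulid :: "'r => 's set" where "Ulid e = {u \<in> carrier U. u \<star> \<phi> e = u}"

lemma \<phi>_lid_iff: "e \<in> carrier R ==> a \<in> carrier R ==> \<phi> a \<in> Ulid e \<longleftrightarrow> a \<in> lid e"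
 by (simp add: Ulid_def lid_def \<phi>_mult[symmetric] \<phi>_eq_iff)

lemma Ulid_submodule: "e \<in> carrier R ==> left_ideal U (Ulid e)"
 by (rule left_module.submoduleI[OF U.Reg_lm]) (auto simp: Ulid_def U.l_distr U.m_assoc)

lemma Ulid_summand:
 assumes e: "idem e" shows "summand U (Reg U) (Ulid e)"
proof (rule U.summandI[OF U.Reg_lm Ulid_submodule])
 have ee: "\<phi> e \<star> \<phi> e = \<phi> e" using e by (simp add: \<phi>_mult[symmetric] idem_idem)
 show "(\<lambda>u. u \<star> \<phi> e) \<in> Hom U (Reg U) (Reg U)" by (rule HomI) (use e in \<open>auto simp: U.l_distr U.m_assoc\<close>)
 show "u \<star> \<phi> e \<in> Ulid e" if "u \<in> carrier (Reg U)" for u using that e ee by (simp add: Ulid_def U.m_assoc)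
qed (use e in \<open>auto simp: Ulid_def\<close>)

text \<open>A summand of U is the left annihilator of an element of U, whose polar decomposition yields the idempotent of R.\<close>

lemma summand_Ulid:
 assumes L: "summand U (Reg U) L"
 obtains e where "idem e" "L = Ulid e"
proof -
 interpret left_module U "Reg U" by (rule U.Reg_lm)
 have sL: "left_ideal U L" using L by (simp add: direct_summand_def)
 obtain \<pi> where \<pi>: "\<pi> \<in> Hom U (Reg U) (Reg U)"
  "\<And>x. x \<in> carrier (Reg U) ==> \<pi> x \<in> L" "\<And>x. x \<in> L ==> \<pi> x = x"
  by (rule U.summand_projection[OF U.Reg_lm L]) (rule that)
 define f where "f = \<one>\<^sub>U \<ominus>\<^sub>U \<pi> \<one>\<^sub>U"
 have p1: "\<pi> \<one>\<^sub>U \<in> carrier U" using hom_closed[OF \<pi>(1)] by simp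
 then have f: "f \<in> carrier U" by (simp add: f_def)
 have LU: "L \<subseteq> carrier U" using sub_subset[OF sL] by simp
 have Lf: "u \<in> L \<longleftrightarrow> u \<star> f = \<zero>\<^sub>U" if u: "u \<in> carrier U" for u
 proof -
  have "\<pi> u = u \<star> \<pi> \<one>\<^sub>U" using hom_smult[OF \<pi>(1), of u "\<one>\<^sub>U"] u by simp
  then have "u \<star> f = u \<ominus>\<^sub>U \<pi> u" using u p1 by (simp add: f_def a_minus_def U.r_distr U.r_minus)
  moreover have "u \<ominus>\<^sub>U \<pi> u = \<zero>\<^sub>U \<longleftrightarrow> u = \<pi> u"
   using diff_eq_zero[of u "\<pi> u"] u hom_closed[OF \<pi>(1), of u] by (simp add: a_minus_def a_inv_def m_inv_def)
  ultimately show ?thesis using \<pi>(2)[of u] \<pi>(3)[of u] u by auto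
 qed
 obtain s a where s: "den s" "a \<in> carrier R" "f \<star> \<phi> s = \<phi> a" by (rule right_fractionE[OF f])
 obtain v w where v: "v \<in> carrier R" "w \<in> carrier R" "v \<cdot> w \<cdot> v = v"
  and ann: "\<And>x. x \<in> carrier R ==> x \<cdot> a = \<zero> \<longleftrightarrow> x \<cdot> (v \<cdot> w) = \<zero>"
  by (rule polarE[OF s(2)]) (rule that)
 let ?q = "v \<cdot> w"
 let ?e = "\<one> \<ominus> ?q"
 have q: "idem ?q" by (rule idem_polar(1)[OF v])
 \<comment> \<open>\<open>polarE\<close> speaks of elements of \<open>R\<close> only. A left
   denominator of \<open>u\<close> and the right denominator of \<open>f\<close> bring the equation
   into \<open>R\<close>, and both can be cancelled.\<close>
 have "u \<star> f = \<zero>\<^sub>U \<longleftrightarrow> u \<star> \<phi> ?q = \<zero>\<^sub>U" if u: "u \<in> carrier U" for u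
 proof -
  obtain t b where t: "den t" "b \<in> carrier R" "\<phi> t \<star> u = \<phi> b" by (rule left_fractionE[OF u])
  have "u \<star> f = \<zero>\<^sub>U \<longleftrightarrow> u \<star> f \<star> \<phi> s = \<zero>\<^sub>U" using den_cancel_right[OF s(1), of "u \<star> f"] u f s(1) by auto
  also have "\<dots> \<longleftrightarrow> \<phi> t \<star> (u \<star> f \<star> \<phi> s) = \<zero>\<^sub>U"
   using den_zero_left[OF t(1), of "u \<star> f \<star> \<phi> s"] u f s(1) t(1) by auto
  also have "\<phi> t \<star> (u \<star> f \<star> \<phi> s) = \<phi> t \<star> (u \<star> (f \<star> \<phi> s))" using u f s(1) by (simp add: U.m_assoc)
  also have "\<dots> = \<phi> t \<star> u \<star> (f \<star> \<phi> s)" by (rule U.m_assoc[symmetric]) (use u f s(1) t(1) in auto)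
  also have "\<dots> = \<phi> (b \<cdot> a)" unfolding t(3) s(3) using t s by (simp add: \<phi>_mult)
  also have "\<phi> (b \<cdot> a) = \<zero>\<^sub>U \<longleftrightarrow> \<phi> (b \<cdot> ?q) = \<zero>\<^sub>U" using t s ann q by (simp add: \<phi>_eq_zero_iff)
  also have "\<phi> (b \<cdot> ?q) = \<phi> t \<star> u \<star> \<phi> ?q" unfolding t(3) using t q by (simp add: \<phi>_mult)
  also have "\<dots> = \<phi> t \<star> (u \<star> \<phi> ?q)" by (rule U.m_assoc) (use u t q in auto)
  also have "\<dots> = \<zero>\<^sub>U \<longleftrightarrow> u \<star> \<phi> ?q = \<zero>\<^sub>U"
   using den_zero_left[OF t(1), of "u \<star> \<phi> ?q"] u t(1) q by auto
  finally show ?thesis .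
 qed
 moreover have "u \<star> \<phi> ?q = \<zero>\<^sub>U \<longleftrightarrow> u \<in> Ulid ?e" if u: "u \<in> carrier U" for u
 proof -
  have "\<phi> ?e \<oplus>\<^sub>U \<phi> ?q = \<one>\<^sub>U"
   using q by (simp add: \<phi>_add[symmetric] a_minus_def R.a_assoc R.l_neg)
  then have "u \<star> \<phi> ?e \<oplus>\<^sub>U u \<star> \<phi> ?q = u" using u q U.r_distr[of "\<phi> ?e" "\<phi> ?q" u] by simp
  moreover have c: "u \<star> \<phi> ?e \<in> carrier U" "u \<star> \<phi> ?q \<in> carrier U" using u q by auto
  ultimately have "u \<star> \<phi> ?q = \<zero>\<^sub>U \<longleftrightarrow> u \<star> \<phi> ?e = u"
   using u U.r_zero[OF c(1)] by auto
  then show ?thesis using u by (simp add: Ulid_def)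
 qed
 ultimately have "L = Ulid ?e" using Lf LU by (auto simp: Ulid_def)
 then show ?thesis using that idem_complement[OF q] by blast
qed

text \<open>Denominators act invertibly on U-modules, so linearity over \<open>U\<close> follows
  from linearity over \<open>R\<close> by multiplying with a left denominator and cancelling
  it.\<close>

lemma R_hom_U_hom:
 assumes V: "lmod U V" and W: "lmod U W" and f: "f \<in> Hom R (RS \<phi> V) (RS \<phi> W)" shows "f \<in> Hom U V W"
proof (rule HomI)
 interpret V: left_module U V by (rule V)
 interpret W: left_module U W by (rule W)
 note c = hom_closed[OF f, simplified] and a = hom_add[OF f, simplified] and m = hom_smult[OF f, simplified]
 show "x \<in> carrier V ==> f x \<in> carrier W" "x \<in> carrier V ==> y \<in> carrier V ==> f (x \<oplus>\<^bsub>V\<^esub> y) = f x \<oplus>\<^bsub>W\<^esub> f y" for x y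
  using c a by auto
 fix u x assume u: "u \<in> carrier U" and x: "x \<in> carrier V"
 obtain s b where s: "den s" "b \<in> carrier R" "\<phi> s \<star> u = \<phi> b" by (rule left_fractionE[OF u])
 have "\<phi> s \<odot>\<^bsub>W\<^esub> f (u \<odot>\<^bsub>V\<^esub> x) = f ((\<phi> s \<star> u) \<odot>\<^bsub>V\<^esub> x)" using s(1) u x m by (simp add: V.smult_assoc V.smult_closed)
 also have "\<dots> = \<phi> b \<odot>\<^bsub>W\<^esub> f x" using s(2) x m by (simp add: s(3))
 also have "\<dots> = \<phi> s \<odot>\<^bsub>W\<^esub> (u \<odot>\<^bsub>W\<^esub> f x)" using s(1) u x c by (simp add: s(3)[symmetric] W.smult_assoc)
 finally show "f (u \<odot>\<^bsub>V\<^esub> x) = u \<odot>\<^bsub>W\<^esub> f x"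
  by (rule W.smult_Units_cancel[rotated 3]) (use s(1) u x c in \<open>auto simp: V.smult_closed W.smult_closed\<close>)
qed

text \<open>The projection onto an R-summand is U-linear by \<open>R_hom_U_hom\<close>, so its image
  is a U-submodule.\<close>

lemma summand_RS: "summand R RU L \<longleftrightarrow> summand U (Reg U) L"
proof
 assume L: "summand R RU L"
 obtain \<pi> where \<pi>: "\<pi> \<in> Hom R RU RU" "\<And>x. x \<in> carrier RU ==> \<pi> x \<in> L" "\<And>x. x \<in> L ==> \<pi> x = x"
  by (rule R.summand_projection[OF RU_lm L]) (rule that)
 have \<pi>U: "\<pi> \<in> Hom U (Reg U) (Reg U)" by (rule R_hom_U_hom[OF U.Reg_lm U.Reg_lm \<pi>(1)])
 have "L \<subseteq> carrier U" using L sub_subset[of L R RU] by (simp add: direct_summand_def)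
 then have "\<pi> ` carrier (Reg U) = L" using \<pi>(2,3) by force
 then have "left_ideal U L" using image_submodule[OF U.Reg_lm U.Reg_lm \<pi>U
    left_module.sub_carrier[OF U.Reg_lm]] by simp
 then show "summand U (Reg U) L" by (rule U.summandI[OF U.Reg_lm _ \<pi>U]) (use \<pi> in auto)
next
 assume L: "summand U (Reg U) L"
 have sL: "left_ideal U L" using L by (simp add: direct_summand_def)
 obtain \<pi> where \<pi>: "\<pi> \<in> Hom U (Reg U) (Reg U)"
  "\<And>x. x \<in> carrier (Reg U) ==> \<pi> x \<in> L" "\<And>x. x \<in> L ==> \<pi> x = x"
  by (rule U.summand_projection[OF U.Reg_lm L]) (rule that)
 show "summand R RU L" by (rule R.summandI[OF RU_lm submodule_RS[OF hom R.ring_axioms U.Reg_lm sL]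
    hom_RS[OF hom \<pi>(1)]]) (use \<pi> in auto)
qed

lemma lid_lm: "e \<in> carrier R ==> lmod R (restr (Reg R) (lid e))" by (rule left_module.restr_lm[OF R.Reg_lm lid_submodule])

lemma \<phi>_hom: "I \<subseteq> carrier R ==> \<phi> \<in> Hom R (restr (Reg R) I) RU" by (rule HomI) (auto simp: \<phi>_add \<phi>_mult subset_iff)

text \<open>By \<open>tensor_lift_image\<close> the image consists of the \<open>u\<close> that some
  denominator brings into \<open>\<phi>\<close> of \<open>R e\<close>. As denominators cancel, this
  amounts to \<open>u \<phi>(e) = u\<close>.\<close>

lemma
 assumes e: "idem e" shows tensor_to_ring_hom: "tensor_to_ring U \<phi> \<in> Hom U (ideal_tensor R U \<phi> (lid e)) (Reg U)"
  and tensor_to_ring_inj: "inj_on (tensor_to_ring U \<phi>) (carrier (ideal_tensor R U \<phi> (lid e)))"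
  and extended_ideal_lid: "extended_ideal R U \<phi> (lid e) = Ulid e"
proof -
 have eR: "e \<in> carrier R" using e by simp
 note l = lid_lm[OF eR]
 have s: "lid e \<subseteq> carrier R" by (auto simp: lid_def)
 note j = \<phi>_hom[OF s]
 have i: "inj_on \<phi> (carrier (restr (Reg R) (lid e)))" using inj_on_subset[OF inj s] by simp
 note eq = tensor_to_ring_lift[OF mod_ext[OF l]]
 show "tensor_to_ring U \<phi> \<in> Hom U (ideal_tensor R U \<phi> (lid e)) (Reg U)"
  unfolding eq by (rule mod_ext.tensor_lift_hom[OF mod_ext[OF l] U.Reg_lm j])
 show "inj_on (tensor_to_ring U \<phi>) (carrier (ideal_tensor R U \<phi> (lid e)))" unfolding eq by (rule tensor_lift_inj[OF l U.Reg_lm j i])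
 have "extended_ideal R U \<phi> (lid e) = {u \<in> carrier U. \<exists>s. den s \<and> \<phi> s \<star> u \<in> \<phi> ` lid e}"
  unfolding extended_ideal_def eq tensor_lift_image[OF l U.Reg_lm j i] by simp
 also have "\<dots> = Ulid e"
 proof (intro equalityI subsetI)
  fix u assume "u \<in> {u \<in> carrier U. \<exists>s. den s \<and> \<phi> s \<star> u \<in> \<phi> ` lid e}"
  then obtain s x where s: "u \<in> carrier U" "den s" "x \<in> lid e" "\<phi> s \<star> u = \<phi> x" by auto
  have "\<phi> s \<star> (u \<star> \<phi> e) = \<phi> s \<star> u \<star> \<phi> e" by (rule U.m_assoc[symmetric]) (use s eR in auto)
  also have "\<dots> = \<phi> s \<star> u" unfolding s(4) using s(3) eR by (auto simp: lid_def \<phi>_mult[symmetric])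
  finally have "u \<star> \<phi> e = u" by (rule den_cancel_left[OF s(2), rotated 2]) (use s eR in auto)
  then show "u \<in> Ulid e" using s by (simp add: Ulid_def)
 next
  fix u assume "u \<in> Ulid e"
  then have u: "u \<in> carrier U" "u \<star> \<phi> e = u" by (auto simp: Ulid_def)
  obtain s a where s: "den s" "a \<in> carrier R" "\<phi> s \<star> u = \<phi> a" by (rule left_fractionE[OF u(1)])
  have "\<phi> s \<star> u \<star> \<phi> e = \<phi> s \<star> (u \<star> \<phi> e)" by (rule U.m_assoc) (use s eR u in auto)
  then have "\<phi> a \<in> Ulid e" using s u(2) by (simp add: Ulid_def)
  then show "u \<in> {u \<in> carrier U. \<exists>s. den s \<and> \<phi> s \<star> u \<in> \<phi> ` lid e}" using s u eR by (auto simp: \<phi>_lid_iff)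
 qed
 finally show "extended_ideal R U \<phi> (lid e) = Ulid e" .
qed

text \<open>A homomorphism into \<open>U e\<close> extends as right multiplication by some
  \<open>u\<close> in \<open>U\<close>, and replacing \<open>u\<close> by \<open>u e\<close> keeps
  the extension inside \<open>U e\<close>. Essentiality follows by clearing the denominator of a
  nonzero element.\<close>

lemma Ulid_injective_envelope:
 assumes e: "idem e" shows "injective_envelope TYPE('q) R (restr (Reg R) (lid e)) \<phi> (restr RU (Ulid e))" unfolding injective_envelope_def
proof (intro conjI)
 let ?E = "restr RU (Ulid e)"
 have eR: "e \<in> carrier R" using e by simp
 have ee: "\<phi> e \<star> \<phi> e = \<phi> e" using e by (simp add: \<phi>_mult[symmetric] idem_idem)
 have sE: "submodule (Ulid e) R RU" by (rule submodule_RS[OF hom R.ring_axioms U.Reg_lm Ulid_submodule[OF eR]])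
 note lE = left_module.restr_lm[OF RU_lm sE]
 show lI: "lmod R (restr (Reg R) (lid e))" by (rule lid_lm[OF eR])
 show "injective_module TYPE('q) R ?E"
 proof (rule Baer_criterion[OF lE])
  fix I f assume I: "left_ideal R I" and f: "f \<in> Hom R (restr (Reg R) I) ?E"
  obtain u where u: "u \<in> carrier U" "\<forall>a\<in>I. f a = \<phi> a \<star> u"
   using Baer_condition[OF I Hom_from_restr[OF f sub_subset[OF sE]]] by blast
  have "f a = a \<odot>\<^bsub>?E\<^esub> (u \<star> \<phi> e)" if a: "a \<in> I" for a
  proof -
   have "f a \<in> Ulid e" using hom_closed[OF f, of a] a by simp
   then have "f a = \<phi> a \<star> u \<star> \<phi> e" using u(2) a by (simp add: Ulid_def)
   also have "\<dots> = \<phi> a \<star> (u \<star> \<phi> e)" by (rule U.m_assoc) (use u(1) eR a sub_subset[OF I] in auto)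
   finally show ?thesis by simp
  qed
  moreover have "u \<star> \<phi> e \<in> carrier ?E" using u(1) eR ee by (simp add: Ulid_def U.m_assoc)
  ultimately show "\<exists>x\<in>carrier ?E. \<forall>a\<in>I. f a = a \<odot>\<^bsub>?E\<^esub> x" by blast
 qed
 have s: "lid e \<subseteq> carrier R" by (auto simp: lid_def)
 show h: "\<phi> \<in> Hom R (restr (Reg R) (lid e)) ?E"
  by (rule Hom_into_restr[OF \<phi>_hom[OF s]]) (use s eR in \<open>auto simp: \<phi>_lid_iff\<close>)
 show "inj_on \<phi> (carrier (restr (Reg R) (lid e)))" using inj_on_subset[OF inj s] by simp
 show "essential_submodule R ?E (\<phi> ` carrier (restr (Reg R) (lid e)))" unfolding essential_submodule_def
 proof (intro conjI allI impI)
  show "submodule (\<phi> ` carrier (restr (Reg R) (lid e))) R ?E" by (rule image_submodule[OF lI lE h left_module.sub_carrier[OF lI]])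
  fix K assume K: "submodule K R ?E \<and> K \<noteq> {\<zero>\<^bsub>?E\<^esub>}"
  then obtain y where y: "y \<in> K" "y \<noteq> \<zero>\<^sub>U" using sub_zero[of K R ?E] by auto
  have yE: "y \<in> Ulid e" "y \<in> carrier U" using sub_subset[of K R ?E] K y by (auto simp: Ulid_def)
  obtain t a where t: "den t" "a \<in> carrier R" "\<phi> t \<star> y = \<phi> a" by (rule left_fractionE[OF yE(2)])
  have "\<phi> a \<in> K" using sub_smult[of K R ?E t y] K y t by simp
  moreover have "\<phi> a \<in> Ulid e" using sub_subset[of K R ?E] K calculation by auto
  moreover have "\<phi> a \<noteq> \<zero>\<^sub>U" using den_zero_left[OF t(1) yE(2)] y(2) t(3) by auto
  ultimately show "\<phi> ` carrier (restr (Reg R) (lid e)) \<inter> K \<noteq> {\<zero>\<^bsub>?E\<^esub>}"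
   using t(2) eR by (auto simp: \<phi>_lid_iff)
 qed
qed

lemma contract_Ulid: "e \<in> carrier R ==> {a \<in> carrier R. \<phi> a \<in> Ulid e} = lid e" using \<phi>_lid_iff by (auto simp: lid_def)

lemma extended_ideal_bij: "bij_betw (extended_ideal R U \<phi>) (goldie_closed_ideals R) {L. summand U (Reg U) L}"
proof (rule bij_betw_byWitness[where f'="\<lambda>L. {a \<in> carrier R. \<phi> a \<in> L}"])
 show "\<forall>I\<in>goldie_closed_ideals R. {a \<in> carrier R. \<phi> a \<in> extended_ideal R U \<phi> I} = I"
 proof
  fix I assume "I \<in> goldie_closed_ideals R"
  then obtain e where "idem e" "I = lid e" by (rule goldie_closed_lid)
  then show "{a \<in> carrier R. \<phi> a \<in> extended_ideal R U \<phi> I} = I" by (simp add: extended_ideal_lid contract_Ulid)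
 qed
 show "\<forall>L\<in>{L. summand U (Reg U) L}. extended_ideal R U \<phi> {a \<in> carrier R. \<phi> a \<in> L} = L"
 proof
  fix L assume "L \<in> {L. summand U (Reg U) L}"
  then obtain e where "idem e" "L = Ulid e" using summand_Ulid by blast
  then show "extended_ideal R U \<phi> {a \<in> carrier R. \<phi> a \<in> L} = L" by (simp add: extended_ideal_lid contract_Ulid)
 qed
 show "extended_ideal R U \<phi> ` goldie_closed_ideals R \<subseteq> {L. summand U (Reg U) L}"
  by (auto elim!: goldie_closed_lid simp: extended_ideal_lid Ulid_summand)
 show "(\<lambda>L. {a \<in> carrier R. \<phi> a \<in> L}) ` {L. summand U (Reg U) L} \<subseteq> goldie_closed_ideals R"
  by (auto elim!: summand_Ulid simp: contract_Ulid lid_goldie_closed)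
qed

lemma extended_ideal_inverse:
 assumes L: "summand U (Reg U) L"
 shows "inv_into (goldie_closed_ideals R) (extended_ideal R U \<phi>) L = {a \<in> carrier R. \<phi> a \<in> L}"
proof -
 obtain e where e: "idem e" "L = Ulid e" by (rule summand_Ulid[OF L])
 have "inv_into (goldie_closed_ideals R) (extended_ideal R U \<phi>) (extended_ideal R U \<phi> (lid e)) = lid e"
  by (rule inv_into_f_f[OF bij_betw_imp_inj_on[OF extended_ideal_bij] lid_goldie_closed[OF e(1)]])
 then show ?thesis using e by (simp add: extended_ideal_lid contract_Ulid)
qed

end

section \<open>The algebra of affiliated operators\<close>

lemma vn_ring_simps [simp]: "carrier (vn_ring A) = A" "a \<otimes>\<^bsub>vn_ring A\<^esub> b = a \<circ> b" "\<one>\<^bsub>vn_ring A\<^esub> = id"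
 "\<zero>\<^bsub>vn_ring A\<^esub> = (\<lambda>_. 0)" "a \<oplus>\<^bsub>vn_ring A\<^esub> b = (\<lambda>x. a x + b x)" by (simp_all add: vn_ring_def)

lemma (in vna) ring_vn_ring: "ring (vn_ring N)"
proof (rule ringI)
 show "abelian_group (vn_ring N)"
 proof (rule abelian_groupI)
  fix a assume "a \<in> carrier (vn_ring N)"
  then show "\<exists>b\<in>carrier (vn_ring N). b \<oplus>\<^bsub>vn_ring N\<^esub> a = \<zero>\<^bsub>vn_ring N\<^esub>"
   by (intro bexI[of _ "\<lambda>x. - a x"]) (auto simp: N_minus)
 qed (auto simp: N_add N_zero add_ac)
 show "monoid (vn_ring N)" by (rule monoidI) (auto simp: N_comp N_id)
qed (auto simp: fun_eq_iff bclin_simps[OF N_bc])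

context regular_representation
begin

lemma affiliated_ring_eq: "affiliated_ring A \<Lambda> = M.aring"
 unfolding affiliated_ring_def M.aring_def affiliated_def M.Aff_def M.atimes_def[abs_def] M.aplus_def[abs_def] unfolding M_def L_def ..

lemma vn_incl_eq: "vn_incl A \<Lambda> a = gr (L a)" by (simp add: vn_incl_def L_def)

lemma gr_L_inj: "a \<in> A ==> b \<in> A ==> gr (L a) = gr (L b) ==> a = b" by (rule L_inj, assumption+) (metis M.gr_iff ext)

lemma L_M: "a \<in> A ==> L a \<in> M" and M_D: "S \<in> M ==> \<exists>a\<in>A. S = L a" by (auto simp: M_def)

text \<open>The Bezout, polar and support conditions concern \<open>A\<close> alone and are taken
  from its given space. Fractions and the extension of homomorphisms involve affiliated operators
  and come from the image algebra on the completion; for the latter a homomorphism on a left ideal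
  of \<open>A\<close> is composed with the inverse of \<open>L\<close>.\<close>

lemma maximal_extension_affiliated: "maximal_extension (vn_ring A) (affiliated_ring A \<Lambda>) (vn_incl A \<Lambda>)"
proof -
 let ?R = "vn_ring A" and ?U = "M.aring" and ?i = "\<lambda>a. gr (L a)"
 have i: "vn_incl A \<Lambda> = ?i" by (rule ext) (rule vn_incl_eq)
 interpret R: ring ?R by (rule ring_vn_ring)
 interpret U: ring ?U by (rule M.ring_aring)
 have h: "?i \<in> ring_hom ?R ?U" by (rule ring_hom_memI) (auto simp: M.gr_Aff L_M L_comp L_add L_id M.atimes_op_graph M.aplus_op_graph)
 have lid: "lideal I" if I: "left_ideal ?R I" for I
  using sub_subset[OF I] sub_zero[OF I] sub_add[OF I] sub_smult[OF I] by (simp add: lideal_def)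
 have "maximal_extension ?R ?U ?i"
 proof (intro maximal_extension.intro ring_extension.intro scalar_extension.intro ring_extension_axioms.intro
   maximal_extension_axioms.intro scalar_extension_axioms.intro R.ring_axioms U.ring_axioms h, goal_cases)
  case 1 show ?case by (rule inj_onI) (simp add: gr_L_inj)
 next
  case (2 T)
  then have T: "T \<in> M.Aff" by simp
  obtain s a where "s \<in> M" "a \<in> M" "gr s \<in> Units ?U" "M.atimes (gr s) T = gr a" by (rule M.aring_left_fraction[OF T])
  then show ?case by (auto dest!: M_D)
 next
  case (3 T)
  then have T: "T \<in> M.Aff" by simp
  obtain s a where "s \<in> M" "a \<in> M" "gr s \<in> Units ?U" "M.atimes T (gr s) = gr a" by (rule M.aring_right_fraction[OF T])
  then show ?case by (auto dest!: M_D)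
 next
  case (4 a b)
  then have ab: "a \<in> A" "b \<in> A" by auto
  obtain c v1 v2 w1 w2 where "c \<in> A" "v1 \<in> A" "v2 \<in> A" "w1 \<in> A" "w2 \<in> A"
   "\<And>x. v1 (c x) = a x" "\<And>x. v2 (c x) = b x" "\<And>x. c x = w1 (a x) + w2 (b x)" by (rule Bezout[OF ab]) (rule that)
  then show ?case
   by (intro bexI[of _ c] bexI[of _ v1] bexI[of _ v2] bexI[of _ w1] bexI[of _ w2]) (auto)
 next
  case (5 a)
  then have a: "a \<in> A" by simp
  note K = aff_ker[OF a] and C = aff_clran[OF a]
  obtain v where v: "v \<in> A" "\<And>x. adj v (v x) = pr (ortho (ker a)) x" "\<And>x. v (adj v x) = pr (clran a) x"
   "\<And>x. v (adj v (v x)) = v x" "\<And>x. adj v (v (adj v x)) = adj v x" by (rule polar_equivalence[OF a]) (rule that)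
  let ?w = "adj v"
  have vw: "v \<circ> ?w = pr (clran a)" "?w \<circ> v = pr (ortho (ker a))" using v(2,3) by auto
  have l: "x \<circ> a = (\<lambda>_. 0) \<longleftrightarrow> x \<circ> (v \<circ> ?w) = (\<lambda>_. 0)" if x: "x \<in> A" for x
  proof -
   have "x \<circ> a = (\<lambda>_. 0) \<longleftrightarrow> range a \<subseteq> ker x" by (auto simp: fun_eq_iff ker_def)
   also have "\<dots> \<longleftrightarrow> clran a \<subseteq> ker x"
    using closure_minimal[of "range a" "ker x"] closure_subset[of "range a"] aff_cs[OF aff_ker[OF x]] by auto
   also have "\<dots> \<longleftrightarrow> x \<circ> pr (clran a) = (\<lambda>_. 0)"
    using pr_in[OF aff_cs[OF C]] pr_id[OF aff_cs[OF C]] by (auto simp: fun_eq_iff ker_def subset_iff) metis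
   finally show ?thesis by (simp add: vw)
  qed
  have r: "a \<circ> x = (\<lambda>_. 0) \<longleftrightarrow> (?w \<circ> v) \<circ> x = (\<lambda>_. 0)" for x
   unfolding vw using pr_ortho_zero_iff[OF aff_cs[OF K]] by (auto simp: fun_eq_iff ker_def)
  have "v \<circ> ?w \<circ> v = v" "?w \<circ> v \<circ> ?w = ?w" using v(4,5) by auto
  then show ?case using v(1) N_adj[OF v(1)] l r by (intro bexI[of _ v] bexI[of _ ?w]) auto
 next
  case (6 I)
  obtain E where E: "aff E" "\<And>a x. a \<in> I ==> a (pr E x) = a x"
   "\<And>a y. a \<in> A ==> (\<And>x. a (pr E x) = a x) ==> y \<in> A ==> y \<noteq> (\<lambda>_. 0) ==>
   \<exists>r\<in>A. r \<circ> y \<noteq> (\<lambda>_. 0) \<and> r \<circ> a \<in> I"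
  proof (rule lideal_support[OF lid[OF 6]], goal_cases)
   case (1 E) show ?case by (rule 1(1)[OF 1(2-4)])
  qed
  show ?case
  proof (rule bexI[of _ "pr E"]; (intro conjI ballI impI)?)
   show "pr E \<otimes>\<^bsub>?R\<^esub> pr E = pr E" by (auto simp: pr_pr aff_cs[OF E(1)])
   show "pr E \<in> carrier ?R" using pr_N[OF E(1)] by simp
   show "a \<otimes>\<^bsub>?R\<^esub> pr E = a" if "a \<in> I" for a using E(2)[OF that] by auto
   fix x y assume "x \<in> carrier ?R" "y \<in> carrier ?R" "x \<otimes>\<^bsub>?R\<^esub> pr E = x" "y \<noteq> \<zero>\<^bsub>?R\<^esub>"
   then show "\<exists>r\<in>carrier ?R. r \<otimes>\<^bsub>?R\<^esub> y \<noteq> \<zero>\<^bsub>?R\<^esub> \<and> r \<otimes>\<^bsub>?R\<^esub> x \<in> I"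
    using E(3)[of x y] by (simp add: fun_eq_iff)
  qed
 next
  case (7 I f)
  note I = 7(1) and f = 7(2)
  have IA: "I \<subseteq> A" using sub_subset[OF I] by simp
  have inv: "inv_into A L (L a) = a" if "a \<in> A" for a using L_inj that by (intro inv_into_f_f inj_onI)
  have add: "L (inv_into A L S) = S" "inv_into A L S \<in> A" if "S \<in> M" for S using that by (auto simp: M_def inv)
  have LI: "M.lideal (L ` I)" unfolding M.lideal_def
  proof (intro conjI ballI)
   show "L ` I \<subseteq> M" using IA by (auto simp: M_def)
   show "(\<lambda>_. 0) \<in> L ` I" using sub_zero[OF I] L_zero by force
   show "(\<lambda>x. S x + T x) \<in> L ` I" if "S \<in> L ` I" "T \<in> L ` I" for S T
    using that IA sub_add[OF I] by (force simp: L_add[symmetric] subset_iff)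
   show "S \<circ> T \<in> L ` I" if "S \<in> M" "T \<in> L ` I" for S T
    using that IA sub_smult[OF I] by (force simp: M_def L_comp[symmetric] subset_iff)
  qed
  obtain u where u: "u \<in> M.Aff" "\<And>S. S \<in> L ` I ==> f (inv_into A L S) = M.atimes (gr S) u"
  proof (rule M.hom_extends[OF LI, where f="\<lambda>S. f (inv_into A L S)"], goal_cases)
   case (1 S)
   then show ?case using hom_closed[OF f] IA by (auto simp: inv subset_iff)
  next
   case (2 S T)
   then obtain a b where ab: "a \<in> I" "S = L a" "b \<in> I" "T = L b" by auto
   then show ?case using hom_add[OF f, of a b] IA by (simp add: L_add[symmetric] inv N_add subset_iff)
  next
   case (3 S T)
   then obtain a b where ab: "a \<in> A" "S = L a" "b \<in> I" "T = L b" by (auto simp: M_def)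
   then show ?case using hom_smult[OF f, of a b] IA by (simp add: L_comp[symmetric] inv N_comp subset_iff)
  qed (rule that)
  have "f a = ?i a \<otimes>\<^bsub>?U\<^esub> u" if "a \<in> I" for a using u(2)[of "L a"] that IA by (auto simp: inv subset_iff)
  then show ?case using u(1) by auto
 qed
 then show ?thesis by (simp add: i affiliated_ring_eq)
qed

end

theorem theorem5p2:
  fixes A :: "('h::complex_hilbert_space \<Rightarrow> 'h) set"
    and tr :: "('h \<Rightarrow> 'h) \<Rightarrow> complex"
    and \<Lambda> :: "('h \<Rightarrow> 'h) \<Rightarrow> 'k::complex_hilbert_space"
  defines "R \<equiv> vn_ring A"
    and "U \<equiv> affiliated_ring A \<Lambda>"
    and "\<iota> \<equiv> vn_incl A \<Lambda>"
  assumes finite_vn: "finite_von_neumann_algebra A tr"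
    and completion: "l2_completion A tr \<Lambda>"
  shows
    "(\<forall>I\<in>goldie_closed_ideals R.
        tensor_to_ring U \<iota> \<in> left_module_hom U (ideal_tensor R U \<iota> I) (regular_module U) \<and>
        inj_on (tensor_to_ring U \<iota>) (carrier (ideal_tensor R U \<iota> I)) \<and>
        injective_envelope TYPE('q) R (restr (regular_module R) I) \<iota>
          (restr (restrict_scalars \<iota> (regular_module U)) (extended_ideal R U \<iota> I))) \<and>
     bij_betw (extended_ideal R U \<iota>) (goldie_closed_ideals R)
       {L. direct_summand U (regular_module U) L} \<and>
     (\<forall>L. direct_summand U (regular_module U) L \<longrightarrow>
        inv_into (goldie_closed_ideals R) (extended_ideal R U \<iota>) L = {a \<in> carrier R. \<iota> a \<in> L}) \<and>
     (\<forall>L. direct_summand R (restrict_scalars \<iota> (regular_module U)) L \<longleftrightarrow>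
        direct_summand U (regular_module U) L) \<and>

     comm_monoid (Proj R) \<and> comm_monoid (Proj U) \<and>
     Proj_map R U \<iota> \<in> iso (Proj R) (Proj U) \<and>
     Proj_map R U \<iota> \<one>\<^bsub>Proj R\<^esub> = \<one>\<^bsub>Proj U\<^esub> \<and>
     (\<forall>P :: ('h \<Rightarrow> 'h, 'p) module. fg_projective R P \<longrightarrow>
        fg_projective U (base_change R U \<iota> P) \<and>
        Proj_map R U \<iota> (iso_class R P) = iso_class U (base_change R U \<iota> P)) \<and>
     (\<forall>n Q. direct_summand U (free_module U n) Q \<longrightarrow>
        fg_projective U (restr (free_module U n) Q) \<and>
        fg_projective R (contract R \<iota> n Q) \<and>
        inv_into (carrier (Proj R)) (Proj_map R U \<iota>) (iso_class U (restr (free_module U n) Q)) =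
          iso_class R (contract R \<iota> n Q)) \<and>

     comm_group (K0 R) \<and> comm_group (K0 U) \<and>
     K0_map R U \<iota> \<in> iso (K0 R) (K0 U) \<and>
     (\<forall>P :: ('h \<Rightarrow> 'h, 'p) module. fg_projective R P \<longrightarrow>
        K0_map R U \<iota> (K0_class R P) = K0_class U (base_change R U \<iota> P)) \<and>
     (\<forall>n Q. direct_summand U (free_module U n) Q \<longrightarrow>
        inv_into (carrier (K0 R)) (K0_map R U \<iota>) (K0_class U (restr (free_module U n) Q)) =
          K0_class R (contract R \<iota> n Q))"
proof -
 interpret regular_representation A tr \<Lambda> by unfold_locales (rule finite_vn completion)+
 interpret X: maximal_extension R U \<iota> unfolding R_def U_def \<iota>_def by (rule maximal_extension_affiliated)
 have "tensor_to_ring U \<iota> \<in> Hom U (ideal_tensor R U \<iota> I) (Reg U)"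
  "inj_on (tensor_to_ring U \<iota>) (carrier (ideal_tensor R U \<iota> I))" "injective_envelope TYPE('q) R (restr (Reg R) I) \<iota>
   (restr (RS \<iota> (Reg U)) (extended_ideal R U \<iota> I))" if I: "I \<in> goldie_closed_ideals R" for I
 proof -
  obtain e where e: "X.idem e" "I = X.lid e" by (rule X.goldie_closed_lid[OF I])
  show "tensor_to_ring U \<iota> \<in> Hom U (ideal_tensor R U \<iota> I) (Reg U)"
   "inj_on (tensor_to_ring U \<iota>) (carrier (ideal_tensor R U \<iota> I))"
   unfolding e(2) by (rule X.tensor_to_ring_hom[OF e(1)] X.tensor_to_ring_inj[OF e(1)])+
  show "injective_envelope TYPE('q) R (restr (Reg R) I) \<iota> (restr (RS \<iota> (Reg U)) (extended_ideal R U \<iota> I))"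
   unfolding e(2) X.extended_ideal_lid[OF e(1)] by (rule X.Ulid_injective_envelope[OF e(1)])
 qed
 note I = this
 show ?thesis by (intro conjI allI impI ballI; (rule I; assumption)?;
   (rule X.extended_ideal_bij X.extended_ideal_inverse X.summand_RS X.R.Proj_comm_monoid
    X.U.Proj_comm_monoid X.Proj_map_iso X.Proj_map_one X.fgp_BC X.Proj_map_class
    X.U.fgp_summand X.contract_projective X.Proj_map_inverse
    comm_monoid.grothendieck_comm_group[OF X.R.Proj_comm_monoid, folded K0_def]
    comm_monoid.grothendieck_comm_group[OF X.U.Proj_comm_monoid, folded K0_def]
    X.K0_map_iso X.K0_map_class X.K0_map_inverse; assumption?))
qed

end
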